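(* Let $M$ be a closed three-dimensional manifold, $r\ge 2$, and let $f\in\mathrm{Diff}^r(M)$ have a non-transverse heterodimensional cycle associated with saddles $P$ and $Q$, with heteroclinic orbits of $X$ (quasi-transverse point) and $Y$ (tangency point). Assume that $f$ satisfies conditions (Lin), (Eig) and (Tr) described in the context (linearizability near $P,Q$, eigenvalue conditions, and transition conditions). Then there is a six-parameter family $\{f_{\mu,\nu}\}_{\mu,\nu\in[-\epsilon,\epsilon]^3}\subset\mathrm{Diff}^r(M)$ (for some $\epsilon>0$) with $f_{\mathbf{0},\mathbf{0}}=f$ satisfying the following. For any real number $\xi>0$ there are: - a sequence of coordinate changes $\Psi_k:K\to M$ defined near the tangency point $\tilde Y=f^{N_2}(Y)$, where $K$ is a compact neighborhood of the origin of $\mathbb{R}^3$ that can be taken arbitrarily large; - reparametrizations $\mu_k:I\to\mathbb{R}^3$, where $I$ is a compact neighborhood of $0$ in $\mathbb{R}$ that can be taken arbitrarily large; - parameter values $\nu_k\in\mathbb{R}^3$; - a sequence of pairs of natural numbers $(m_k,n_k)_k$ with $m_k,n_k\to\infty$, and natural numbers $N_1$ and $N_2$ independent of $k$ and $\xi$; such that the map $$F_{\mu_k(\bar\mu),\nu_k}(\bar{\mathbf{x}})=(\Psi_k^{-1}|_{\Psi_k(K)})\circ f^{N_2+m_k+N_1+n_k}_{\mu_k(\bar\mu),\nu_k}\circ\Psi_k(\bar{\mathbf{x}})$$ satisfies the following properties. (1) If $(\bar\mu,\bar{\mathbf{x}})$ is contained in a (fixed) compact set of $\mathbb{R}\times\mathbb{R}^3$,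 then the sequence $\{(\mu_k(\bar\mu),\nu_k)\}$ converges to $(\mathbf{0},\mathbf{0})\in\mathbb{R}^6$ and the sequence $\{\Psi_k(\bar{\mathbf{x}})\}$ converges to the tangency point $\tilde Y$ as $k\to+\infty$. (2) The sequence of maps $\{F_{\mu_k(\bar\mu),\nu_k}\}$ converges in the $C^r$ topology to a one-parameter family conjugate to $$G_\mu(x,y,z)=(\xi x+y,\ \mu+y^2+\kappa_1x^2+\kappa_2xy,\ y),$$ where $\kappa_1,\kappa_2$ are constants depending only on $f$.
   Context: Non-transverse heterodimensional cycle. The index of a hyperbolic periodic point is the dimension of its unstable bundle. $f$ has a non-transverse heterodimensional cycle associated with the saddle periodic points $P$ (index $2$) and $Q$ (index $1$) if: there is $X\in W^s(P)\cap W^u(Q)$ at which the intersection of these one-dimensional manifolds is quasi-transverse, i.e. $\dim(T_XW^s(P)+T_XW^u(Q))=\dim E^s(P)+\dim E^u(Q)$; and the two-dimensional manifolds $W^u(P)$ and $W^s(Q)$ have a non-transverse intersection (a tangency) along the orbit of a point $Y$. Write $\tilde\lambda,\tilde\zeta,\tilde\sigma$ for the (real) eigenvalues of $Df^{\mathrm{per}(P)}(P)$ and $\lambda,\zeta,\sigma$ for those of $Df^{\mathrm{per}(Q)}(Q)$, where $\mathrm{per}(\cdot)$ denotes the period. (Lin) There are $C^r$ coordinates $(x,y,z)$ on neighborhoods $U_P$ of $P$ and $U_Q$ of $Q$ (with $P$, resp. $Q$, at the origin) in which $f^{\mathrm{per}(P)}(x,y,z)=(\tilde\lambda x,\tilde\sigma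 y,\tilde\zeta z)$ on $U_P$ and $f^{\mathrm{per}(Q)}(x,y,z)=(\lambda x,\sigma y,\zeta z)$ on $U_Q$. (Eig) $|\tilde\lambda|<1<|\tilde\sigma|<|\tilde\zeta|$, $|\lambda|<|\zeta|<1<|\sigma|$, and, with $k=\log|\lambda|^{-1}/\log|\tilde\zeta|$ (this $k$ is unrelated to the sequence index $k$), $$\big||\tilde\sigma\tilde\zeta|^k\sigma\zeta^2\big|<1,\quad \big||\tilde\sigma^{-3}\tilde\zeta|^k\sigma^{-1}\big|<1,\quad \big||\tilde\lambda\tilde\sigma|^k\sigma\big|<1.$$ (Tr) The coordinates in (Lin) are normalized so that $X=(0,1,0)\in U_Q$, $f^{N_1}(X)=(1,0,0)\in U_P$ (a point of $W^s_{\mathrm{loc}}(P)$), $Y=(0,1,1)\in U_P$ and $\tilde Y=f^{N_2}(Y)=(1,0,1)\in U_Q$ (a point of $W^s_{\mathrm{loc}}(Q)$) for some positive integers $N_1,N_2$. Near $X$, $$f^{N_1}(x,1+y,z)=\big(1+\alpha_1x+\alpha_2y+\alpha_3z+\tilde H_1,\ \beta_1x+\beta_2y+\beta_3z+\tilde H_2,\ \gamma_1x+\gamma_2y+\gamma_3z+\tilde H_3\big),$$ and near $Y$, $$f^{N_2}(x,1+y,1+z)=\big(1+a_1x+a_2y+a_3z+H_1,\ b_1x+b_2y^2+b_3z^2+b_4yz+H_2,\ 1+c_1x+c_2y+c_3z+H_3\big),$$ where $H_i=H_i(x,y,z)$, $\tilde H_i=\tilde H_i(x,y,z)$ vanish at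 $\mathbf{0}$ together with all their first order partial derivatives. It is assumed that $\beta_3=\gamma_2=\gamma_3=0$; that $\partial_y^2H_2(\mathbf{0})=\partial_z^2H_2(\mathbf{0})=\partial_y\partial_zH_2(\mathbf{0})=0$ and $c_3=0$; and that $b_2b_3\ne0$ and $\gamma_1a_3>0$. (Since $f$ is a diffeomorphism, $\beta_2\gamma_1\neq0$.) In (2), convergence is on compact domains, and "conjugate" is understood for one-parameter families: up to a change of coordinates in the variables $(\bar x,\bar y,\bar z)$ and in the parameter $\bar\mu$. *)

theory Defs
  imports "HOL-Analysis.Analysis"
begin

type_synonym R3 = "real \<times> real \<times> real"

text \<open>Meant for open \<open>S\<close>; \<open>frechet_derivative f (at x) i\<close> with \<open>i \<in> Basis\<close> is the
  partial derivative of \<open>f\<close> in the direction of the coordinate vector \<open>i\<close>.\<close>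

fun Ck_on :: "nat \<Rightarrow> ('a::euclidean_space \<Rightarrow> 'b::real_normed_vector) \<Rightarrow> 'a set \<Rightarrow> bool" where
  "Ck_on 0 f S \<longleftrightarrow> continuous_on S f"
| "Ck_on (Suc k) f S \<longleftrightarrow>
     (\<forall>x\<in>S. f differentiable (at x)) \<and>
     (\<forall>i\<in>Basis. Ck_on k (\<lambda>x. frechet_derivative f (at x) i) S)"

fun partials :: "'a::euclidean_space list \<Rightarrow> ('a \<Rightarrow> 'b::real_normed_vector) \<Rightarrow> 'a \<Rightarrow> 'b" where
  "partials [] f = f"
| "partials (v # vs) f = (\<lambda>x. frechet_derivative (partials vs f) (at x) v)"

text \<open>Uniform convergence on \<open>C\<close> of all partial derivatives of order at most \<open>r\<close>; the
  \<open>F k\<close> are only required to be of class \<open>C\<^sup>r\<close> around \<open>C\<close> for large \<open>k\<close>.\<close>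

definition Cr_converges_on ::
    "nat \<Rightarrow> (nat \<Rightarrow> 'a::euclidean_space \<Rightarrow> 'b::real_normed_vector) \<Rightarrow> ('a \<Rightarrow> 'b) \<Rightarrow> 'a set \<Rightarrow> bool" where
  "Cr_converges_on r F \<Phi> C \<longleftrightarrow>
     (\<forall>\<^sub>F k in sequentially. \<exists>U. open U \<and> C \<subseteq> U \<and> Ck_on r (F k) U) \<and>
     (\<forall>vs. set vs \<subseteq> Basis \<and> length vs \<le> r \<longrightarrow>
        uniform_limit C (\<lambda>k. partials vs (F k)) (partials vs \<Phi>) sequentially)"

definition Cr_diffeo :: "nat \<Rightarrow> ('a::euclidean_space \<Rightarrow> 'a) \<Rightarrow> bool" where
  "Cr_diffeo r h \<longleftrightarrow> bij h \<and> Ck_on r h UNIV \<and> Ck_on r (inv h) UNIV"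

text \<open>The manifold \<open>M\<close> is the whole of a Hausdorff type \<open>'m\<close>, with a smooth atlas \<open>\<A>\<close>.
  A chart is a pair of its domain and its coordinate map.\<close>

type_synonym 'm chart = "'m set \<times> ('m \<Rightarrow> R3)"

definition chart_inv :: "'m chart \<Rightarrow> R3 \<Rightarrow> 'm" where
  "chart_inv c = inv_into (fst c) (snd c)"

definition is_chart :: "'m::topological_space chart \<Rightarrow> bool" where
  "is_chart c \<longleftrightarrow> open (fst c) \<and> open (snd c ` fst c) \<and>
     homeomorphism (fst c) (snd c ` fst c) (snd c) (chart_inv c)"

definition compatible :: "nat \<Rightarrow> 'm::topological_space chart \<Rightarrow> 'm chart \<Rightarrow> bool" where
  "compatible k c d \<longleftrightarrow>
     Ck_on k (snd d \<circ> chart_inv c) (snd c ` (fst c \<inter> fst d)) \<and>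
     Ck_on k (snd c \<circ> chart_inv d) (snd d ` (fst c \<inter> fst d))"

definition closed_3_manifold :: "'m::t2_space chart set \<Rightarrow> bool" where
  "closed_3_manifold \<A> \<longleftrightarrow> compact (UNIV :: 'm set) \<and>
     (\<forall>c\<in>\<A>. is_chart c) \<and> (\<Union>c\<in>\<A>. fst c) = UNIV \<and>
     (\<forall>c\<in>\<A>. \<forall>d\<in>\<A>. \<forall>k. compatible k c d)"

definition Cr_chart :: "nat \<Rightarrow> 'm::t2_space chart set \<Rightarrow> 'm chart \<Rightarrow> bool" where
  "Cr_chart r \<A> c \<longleftrightarrow> is_chart c \<and> (\<forall>d\<in>\<A>. compatible r c d)"

definition Cr_map :: "nat \<Rightarrow> 'm::t2_space chart set \<Rightarrow> ('m \<Rightarrow> 'm) \<Rightarrow> bool" where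
  "Cr_map r \<A> g \<longleftrightarrow> continuous_on UNIV g \<and>
     (\<forall>c\<in>\<A>. \<forall>d\<in>\<A>. Ck_on r (snd d \<circ> g \<circ> chart_inv c) (snd c ` (fst c \<inter> g -` fst d)))"

definition Diff :: "nat \<Rightarrow> 'm::t2_space chart set \<Rightarrow> ('m \<Rightarrow> 'm) set" where
  "Diff r \<A> = {g. bij g \<and> Cr_map r \<A> g \<and> Cr_map r \<A> (inv g)}"

text \<open>Families \<open>p \<mapsto> g p\<close> of maps of \<open>M\<close> that are of class \<open>C\<^sup>r\<close> jointly in the
  parameter \<open>p \<in> W\<close> and the point of \<open>M\<close>, for \<open>W\<close> open.\<close>

definition Cr_family ::
    "nat \<Rightarrow> 'm::t2_space chart set \<Rightarrow> 'p::euclidean_space set \<Rightarrow> ('p \<Rightarrow> 'm \<Rightarrow> 'm) \<Rightarrow> bool" where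
  "Cr_family r \<A> W g \<longleftrightarrow> continuous_on (W \<times> UNIV) (\<lambda>(p, x). g p x) \<and>
     (\<forall>c\<in>\<A>. \<forall>d\<in>\<A>. Ck_on r (\<lambda>(p, u). snd d (g p (chart_inv c u)))
        {(p, u). p \<in> W \<and> u \<in> snd c ` fst c \<and> g p (chart_inv c u) \<in> fst d})"

text \<open>\<open>\<Psi>\<close> restricted to the open set \<open>\<Omega>\<close> is a \<open>C\<^sup>r\<close> diffeomorphism onto an open
  subset of \<open>M\<close>, that is, the inverse of a \<open>C\<^sup>r\<close> chart.\<close>

definition Cr_parametrization :: "nat \<Rightarrow> 'm::t2_space chart set \<Rightarrow> (R3 \<Rightarrow> 'm) \<Rightarrow> R3 set \<Rightarrow> bool" where
  "Cr_parametrization r \<A> \<Psi> \<Omega> \<longleftrightarrow> open \<Omega> \<and> inj_on \<Psi> \<Omega> \<and>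
     Cr_chart r \<A> (\<Psi> ` \<Omega>, inv_into \<Omega> \<Psi>)"

text \<open>The tangent space at \<open>x\<close> is identified with \<open>\<real>\<^sup>3\<close> through one fixed chart of
  the atlas around \<open>x\<close>.\<close>

definition chart_at :: "'m chart set \<Rightarrow> 'm \<Rightarrow> 'm chart" where
  "chart_at \<A> x = (SOME c. c \<in> \<A> \<and> x \<in> fst c)"

definition tangent_map :: "'m chart set \<Rightarrow> ('m \<Rightarrow> 'm) \<Rightarrow> 'm \<Rightarrow> R3 \<Rightarrow> R3" where
  "tangent_map \<A> g x =
     frechet_derivative (snd (chart_at \<A> (g x)) \<circ> g \<circ> chart_inv (chart_at \<A> x))
       (at (snd (chart_at \<A> x) x))"

text \<open>\<open>T\<^sub>x W\<close> for an injectively immersed submanifold \<open>W\<close>: velocities of \<open>C\<^sup>1\<close>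
  curves of \<open>M\<close> that run inside \<open>W\<close>.\<close>

definition tangent_vectors :: "'m chart set \<Rightarrow> 'm set \<Rightarrow> 'm \<Rightarrow> R3 set" where
  "tangent_vectors \<A> W x = {v. \<exists>(\<gamma> :: real \<Rightarrow> 'm) e. 0 < e \<and> \<gamma> 0 = x \<and>
     \<gamma> ` {-e<..<e} \<subseteq> W \<inter> fst (chart_at \<A> x) \<and>
     Ck_on 1 (snd (chart_at \<A> x) \<circ> \<gamma>) {-e<..<e} \<and>
     ((snd (chart_at \<A> x) \<circ> \<gamma>) has_vector_derivative v) (at 0)}"

definition periodic_point :: "('m \<Rightarrow> 'm) \<Rightarrow> 'm \<Rightarrow> bool" where
  "periodic_point f x \<longleftrightarrow> (\<exists>n>0. (f ^^ n) x = x)"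

definition period :: "('m \<Rightarrow> 'm) \<Rightarrow> 'm \<Rightarrow> nat" where
  "period f x = (LEAST n. 0 < n \<and> (f ^^ n) x = x)"

definition period_deriv :: "'m chart set \<Rightarrow> ('m \<Rightarrow> 'm) \<Rightarrow> 'm \<Rightarrow> R3 \<Rightarrow> R3" where
  "period_deriv \<A> f x = tangent_map \<A> (f ^^ period f x) x"

definition real_eigenvalues :: "('a::real_vector \<Rightarrow> 'a) \<Rightarrow> real set" where
  "real_eigenvalues A = {l. \<exists>v. v \<noteq> 0 \<and> A v = l *\<^sub>R v}"

definition set_sum :: "'a::plus set \<Rightarrow> 'a set \<Rightarrow> 'a set" where
  "set_sum A B = {u + v |u v. u \<in> A \<and> v \<in> B}"

definition hyperbolic_splitting :: "('a::euclidean_space \<Rightarrow> 'a) \<Rightarrow> 'a set \<Rightarrow> 'a set \<Rightarrow> bool" where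
  "hyperbolic_splitting A Es Eu \<longleftrightarrow>
     subspace Es \<and> subspace Eu \<and> Es \<inter> Eu = {0} \<and> set_sum Es Eu = UNIV \<and>
     A ` Es = Es \<and> A ` Eu = Eu \<and>
     (\<exists>C>0. \<exists>\<theta>. 0 < \<theta> \<and> \<theta> < 1 \<and>
        (\<forall>n. \<forall>v\<in>Es. norm ((A ^^ n) v) \<le> C * \<theta> ^ n * norm v) \<and>
        (\<forall>n. \<forall>v\<in>Eu. norm v \<le> C * \<theta> ^ n * norm ((A ^^ n) v)))"

text \<open>Invariant manifolds are those of the whole periodic orbit of \<open>x\<close>.  As \<open>M\<close> is
  compact, convergence of \<open>n \<mapsto> f\<^sup>p\<^sup>n(y)\<close> (where \<open>p\<close> is the period of \<open>x\<close>) to a point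
  of the orbit is the same as the iterates of \<open>y\<close> being asymptotic to that orbit.\<close>

definition stable_manifold :: "('m::topological_space \<Rightarrow> 'm) \<Rightarrow> 'm \<Rightarrow> 'm set" where
  "stable_manifold f x = {y. \<exists>i. (\<lambda>n. (f ^^ (period f x * n)) y) \<longlonglongrightarrow> (f ^^ i) x}"

definition unstable_manifold :: "('m::topological_space \<Rightarrow> 'm) \<Rightarrow> 'm \<Rightarrow> 'm set" where
  "unstable_manifold f x = stable_manifold (inv f) x"

definition local_stable_manifold :: "('m::topological_space \<Rightarrow> 'm) \<Rightarrow> 'm \<Rightarrow> 'm set \<Rightarrow> 'm set" where
  "local_stable_manifold f x U = {y. (\<forall>n. (f ^^ (period f x * n)) y \<in> U) \<and>
     (\<lambda>n. (f ^^ (period f x * n)) y) \<longlonglongrightarrow> x}"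

definition local_unstable_manifold :: "('m::topological_space \<Rightarrow> 'm) \<Rightarrow> 'm \<Rightarrow> 'm set \<Rightarrow> 'm set" where
  "local_unstable_manifold f x U = local_stable_manifold (inv f) x U"

definition nontransverse_heterodimensional_cycle ::
    "'m::t2_space chart set \<Rightarrow> ('m \<Rightarrow> 'm) \<Rightarrow> 'm \<Rightarrow> 'm \<Rightarrow> 'm \<Rightarrow> 'm \<Rightarrow> bool" where
  "nontransverse_heterodimensional_cycle \<A> f P Q X Y \<longleftrightarrow>
     periodic_point f P \<and> periodic_point f Q \<and>
     (\<exists>EsP EuP EsQ EuQ.
        hyperbolic_splitting (period_deriv \<A> f P) EsP EuP \<and> dim EuP = 2 \<and>
        hyperbolic_splitting (period_deriv \<A> f Q) EsQ EuQ \<and> dim EuQ = 1 \<and>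
        X \<in> stable_manifold f P \<inter> unstable_manifold f Q \<and>
        dim (set_sum (tangent_vectors \<A> (stable_manifold f P) X)
                     (tangent_vectors \<A> (unstable_manifold f Q) X)) = dim EsP + dim EuQ) \<and>
     Y \<in> unstable_manifold f P \<inter> stable_manifold f Q \<and>
     set_sum (tangent_vectors \<A> (unstable_manifold f P) Y)
             (tangent_vectors \<A> (stable_manifold f Q) Y) \<noteq> UNIV"

text \<open>The coordinate expression of \<open>f\<^sup>p\<^sup>e\<^sup>r\<close> has as its domain the points of the chart that are
  mapped back into the chart; only there is it required to be linear.\<close>

definition linearizing_chart ::
    "nat \<Rightarrow> 'm::t2_space chart set \<Rightarrow> ('m \<Rightarrow> 'm) \<Rightarrow> 'm \<Rightarrow> 'm chart \<Rightarrow> real \<Rightarrow> real \<Rightarrow> real \<Rightarrow> bool" where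
  "linearizing_chart r \<A> f x c l s t \<longleftrightarrow>
     Cr_chart r \<A> c \<and> x \<in> fst c \<and> snd c x = (0, 0, 0) \<and>
     (\<forall>p\<in>fst c. (f ^^ period f x) p \<in> fst c \<longrightarrow>
        snd c ((f ^^ period f x) p) =
          (case snd c p of (u, v, w) \<Rightarrow> (l * u, s * v, t * w)))"

text \<open>The eigenvalues with suffix \<open>P\<close> are those at \<open>P\<close>, the others those at \<open>Q\<close>; \<open>l\<close>, \<open>s\<close>, \<open>z\<close>
  stand for \<open>\<lambda>\<close>, \<open>\<sigma>\<close>, \<open>\<zeta>\<close>.\<close>

definition eigenvalue_conditions ::
    "real \<Rightarrow> real \<Rightarrow> real \<Rightarrow> real \<Rightarrow> real \<Rightarrow> real \<Rightarrow> bool" where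
  "eigenvalue_conditions lP sP zP l s z \<longleftrightarrow>
     \<bar>lP\<bar> < 1 \<and> 1 < \<bar>sP\<bar> \<and> \<bar>sP\<bar> < \<bar>zP\<bar> \<and>
     \<bar>l\<bar> < \<bar>z\<bar> \<and> \<bar>z\<bar> < 1 \<and> 1 < \<bar>s\<bar> \<and>
     (let \<kappa> = ln (inverse \<bar>l\<bar>) / ln \<bar>zP\<bar> in
        \<bar>\<bar>sP * zP\<bar> powr \<kappa> * s * z ^ 2\<bar> < 1 \<and>
        \<bar>\<bar>inverse (sP ^ 3) * zP\<bar> powr \<kappa> * inverse s\<bar> < 1 \<and>
        \<bar>\<bar>lP * sP\<bar> powr \<kappa> * s\<bar> < 1)"

definition vanishes_to_first_order :: "(R3 \<Rightarrow> real) \<Rightarrow> bool" where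
  "vanishes_to_first_order H \<longleftrightarrow> H 0 = 0 \<and> (H has_derivative (\<lambda>_. 0)) (at 0)"

definition G_family :: "real \<Rightarrow> real \<Rightarrow> real \<Rightarrow> real \<Rightarrow> R3 \<Rightarrow> R3" where
  "G_family \<xi> \<kappa>\<^sub>1 \<kappa>\<^sub>2 \<mu> =
     (\<lambda>(x, y, z). (\<xi> * x + y, \<mu> + y ^ 2 + \<kappa>\<^sub>1 * x ^ 2 + \<kappa>\<^sub>2 * x * y, y))"

definition conjugate_families :: "nat \<Rightarrow> (real \<times> R3 \<Rightarrow> R3) \<Rightarrow> (real \<Rightarrow> R3 \<Rightarrow> R3) \<Rightarrow> bool" where
  "conjugate_families r \<Phi> G \<longleftrightarrow>
     (\<exists>h \<theta>. Cr_diffeo r h \<and> Cr_diffeo r \<theta> \<and> (\<forall>\<mu> x. h (\<Phi> (\<mu>, x)) = G (\<theta> \<mu>) (h x)))"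

text \<open>\<open>F\<^sub>k(\<mu>, x) = (\<Psi>\<^sub>k|\<^sub>K)\<^sup>-\<^sup>1 (g\<^sup>N (\<Psi>\<^sub>k(x)))\<close> with \<open>g\<close> the member of the family \<open>fam\<close> at
  \<open>(\<mu>\<^sub>k(\<mu>), \<nu>\<^sub>k)\<close>; its value is meaningful only if \<open>g\<^sup>N (\<Psi>\<^sub>k(x)) \<in> \<Psi>\<^sub>k(K)\<close>.\<close>

definition renormalized ::
    "(R3 \<times> R3 \<Rightarrow> 'm \<Rightarrow> 'm) \<Rightarrow> R3 set \<Rightarrow> (R3 \<Rightarrow> 'm) \<Rightarrow> (real \<Rightarrow> R3) \<Rightarrow> R3 \<Rightarrow> nat \<Rightarrow> real \<times> R3 \<Rightarrow> R3" where
  "renormalized fam K \<Psi> \<mu>k \<nu>k N =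
     (\<lambda>(\<mu>, x). inv_into K \<Psi> ((fam (\<mu>k \<mu>, \<nu>k) ^^ N) (\<Psi> x)))"

end

theory Submission
  imports Defs
begin

text \<open>A point near \<open>f\<^bsup>N2\<^esup> Y\<close> that returns along the cycle follows \<open>Q\<close> for \<open>n\<close> turns to a
  neighbourhood of \<open>X\<close>, crosses by \<open>f\<^bsup>N1\<^esup>\<close>, follows \<open>P\<close> for \<open>m\<close> turns to a neighbourhood of \<open>Y\<close> and
  crosses back by \<open>f\<^bsup>N2\<^esup>\<close>.  The two passages are diagonal linear maps and the two crossings have given
  second order expansions, so the return map is explicit.  It stays explicit under perturbations
  that act only near \<open>f\<^bsup>N1\<^esup> X\<close> and \<open>f\<^bsup>N2\<^esup> Y\<close>, since no other point of the cycle comes near these two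
  (\<open>unfolding_family\<close>).  The six parameters are those of displacements there that are affine in the
  coordinates which the point had before the crossing.

  The form of the limit is decided by linear algebra and by the tangency.  Let \<open>(Y, Z)\<close> be the
  deviation from the tangency point in the two unstable directions at \<open>P\<close>.  The crossing turns it into
  \<open>x' = a2 Y + a3 Z\<close> and \<open>z' = c2 Y + c3 Z\<close> at \<open>Q\<close>, where \<open>c3\<close> is one of the parameters.  The next
  turn returns \<open>C x' + N z'\<close> as new deviation in the third direction.  Here \<open>C\<close> is bounded, because \<open>m\<close>
  is the integer part of \<open>k n\<close>, with \<open>k\<close> the exponent of the eigenvalue conditions; the coefficient
  \<open>N = n\<close> is another parameter in rescaled form.  In the rescaled coordinates \<open>u = C x' + N z'\<close> and
  \<open>y\<close>, one has \<open>Y = y\<close> and \<open>Z = u + e y\<close>, with a shear \<open>e\<close> that is again a parameter in rescaled form.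
  Thus \<open>c3\<close> can be chosen to give \<open>u\<close> the coefficient \<open>\<xi>\<close> in the new \<open>u\<close>, and \<open>e\<close> to give \<open>y\<close> the
  coefficient \<open>1\<close>.  The combination of \<open>x'\<close> and \<open>z'\<close> that does not see \<open>Z\<close> becomes the third
  coordinate \<open>w\<close>, and its new value is \<open>y\<close>.  The remaining three parameters keep the
  orbit in place, and one of them carries \<open>\<mu>\<close>.

  The new \<open>y\<close> is the quadratic form \<open>b2 Y\<^sup>2 + b4 Y Z + b3 Z\<^sup>2\<close>, normalized by its value at \<open>(1, e)\<close>.
  The choice of \<open>e\<close> makes it grow like \<open>n\<close>, because \<open>c2 \<noteq> 0\<close>.  Hence \<open>e y\<close> dominates \<open>u\<close> in \<open>Z\<close>, the
  term \<open>b3 Z\<^sup>2\<close> dominates the others, and the normalized form tends to \<open>y\<^sup>2\<close>.  The limit is the family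
  with \<open>\<kappa>\<^sub>1 = \<kappa>\<^sub>2 = 0\<close> itself, and the conjugacy is the identity.

  What remains is to see that the nonlinear terms of the crossings disappear in the limit
  (\<open>F_tends\<close>).  Relative to the scale of the rescaling they are bounded by powers of \<open>n\<close> times
  expressions that decay exponentially in \<open>n\<close> by the eigenvalue conditions
  (\<open>renormalization_exponents\<close>).  Their derivatives up to order \<open>r\<close> are controlled by blowing up:
  \<open>\<rho>\<^sup>-\<^sup>2 H(\<rho> R)\<close> tends to zero in the \<open>C\<^sup>r\<close> topology as \<open>\<rho>\<close> does if \<open>H\<close> vanishes to first order and its
  second derivative vanishes along the limit of \<open>R\<close> (\<open>Cr_tends_rescale2\<close>).\<close>

section \<open>Calculus of maps of class \<open>C\<^sup>k\<close>\<close>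

lemma frechet_derivative_eqI:
  "(f has_derivative f') (at x) \<Longrightarrow> frechet_derivative f (at x) = f'"
  by (metis frechet_derivative_at)

lemma has_frechet_derivative:
  "f differentiable (at x) \<Longrightarrow> (f has_derivative frechet_derivative f (at x)) (at x)"
  by (simp add: frechet_derivative_works[symmetric])

lemma frechet_derivative_cong_open:
  assumes "open S" "x \<in> S" "\<And>y. y \<in> S \<Longrightarrow> f y = g y"
  shows "frechet_derivative f (at x) = frechet_derivative g (at x)"
proof -
  have "(f has_derivative f') (at x) = (g has_derivative f') (at x)" for f'
    using has_derivative_transform_within_open[of f f' x UNIV S g]
      has_derivative_transform_within_open[of g f' x UNIV S f] assms by auto
  then show ?thesis by (simp add: frechet_derivative_def)
qed

lemma differentiable_cong_open:
  assumes "open S" "x \<in> S" "\<And>y. y \<in> S \<Longrightarrow> f y = g y" "f differentiable (at x)"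
  shows "g differentiable (at x)"
  using assms has_derivative_transform_within_open[of f _ x UNIV S g]
  unfolding differentiable_def by (metis)

lemma frechet_derivative_expand:
  fixes f :: "'a::euclidean_space \<Rightarrow> 'b::real_normed_vector"
  assumes "f differentiable (at x)"
  shows "frechet_derivative f (at x) v = (\<Sum>j\<in>Basis. (v \<bullet> j) *\<^sub>R frechet_derivative f (at x) j)"
proof -
  have l: "linear (frechet_derivative f (at x))" by (rule linear_frechet_derivative[OF assms])
  have "frechet_derivative f (at x) v = frechet_derivative f (at x) (\<Sum>j\<in>Basis. (v \<bullet> j) *\<^sub>R j)"
    by (simp add: euclidean_representation)
  also have "\<dots> = (\<Sum>j\<in>Basis. (v \<bullet> j) *\<^sub>R frechet_derivative f (at x) j)"
    by (simp add: linear_sum[OF l] linear_scale[OF l])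
  finally show ?thesis .
qed

lemma Ck_on_subset: "Ck_on k f S \<Longrightarrow> T \<subseteq> S \<Longrightarrow> Ck_on k f T"
proof (induction k arbitrary: f)
  case 0
  then show ?case using continuous_on_subset[of S f T] by simp
next
  case (Suc k)
  have "Ck_on k (\<lambda>x. frechet_derivative f (at x) i) T" if "i \<in> Basis" for i
    using Suc.prems that by (intro Suc.IH) auto
  moreover have "f differentiable (at x)" if "x \<in> T" for x
    using Suc.prems that by auto
  ultimately show ?case by simp
qed

lemma Ck_on_cong:
  assumes "open S" "\<And>x. x \<in> S \<Longrightarrow> f x = g x" "Ck_on k f S"
  shows "Ck_on k g S"
  using assms(2,3)
proof (induction k arbitrary: f g)
  case 0
  then show ?case using continuous_on_cong[of S S f g] by simp
next
  case (Suc k)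
  have "Ck_on k (\<lambda>x. frechet_derivative g (at x) i) S" if "i \<in> Basis" for i
  proof (rule Suc.IH)
    show "Ck_on k (\<lambda>x. frechet_derivative f (at x) i) S" using Suc.prems(2) that by auto
    show "frechet_derivative f (at x) i = frechet_derivative g (at x) i" if "x \<in> S" for x
      using frechet_derivative_cong_open[OF assms(1) that Suc.prems(1)] by simp
  qed
  moreover have "g differentiable (at x)" if "x \<in> S" for x
    using differentiable_cong_open[OF assms(1) that Suc.prems(1)] Suc.prems(2) that by auto
  ultimately show ?case by auto
qed

lemma Ck_on_imp_continuous_on: "Ck_on k f S \<Longrightarrow> continuous_on S f"
  by (cases k) (auto intro: differentiable_imp_continuous_on differentiable_at_imp_differentiable_on)

lemma Ck_on_Suc_D: "Ck_on (Suc k) f S \<Longrightarrow> Ck_on k f S"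
proof (induction k arbitrary: f)
  case 0
  then show ?case using Ck_on_imp_continuous_on[OF 0] by simp
next
  case (Suc k)
  then show ?case by (metis Ck_on.simps(2))
qed

lemma Ck_on_le: "Ck_on k f S \<Longrightarrow> j \<le> k \<Longrightarrow> Ck_on j f S"
proof (induction k)
  case (Suc k)
  then show ?case using Ck_on_Suc_D by (cases "j = Suc k") auto
qed simp

lemma Ck_on_local:
  assumes "\<And>x. x \<in> S \<Longrightarrow> \<exists>U. open U \<and> x \<in> U \<and> Ck_on k f U"
  shows "Ck_on k f S"
  using assms
proof (induction k arbitrary: f)
  case 0
  have "isCont f x" if x: "x \<in> S" for x
  proof -
    obtain U where "open U" "x \<in> U" "Ck_on 0 f U" using 0 x by blast
    then show ?thesis by (simp add: continuous_on_eq_continuous_at)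
  qed
  then show ?case by (simp add: continuous_at_imp_continuous_on)
next
  case (Suc k)
  have "Ck_on k (\<lambda>x. frechet_derivative f (at x) i) S" if i: "i \<in> Basis" for i
  proof (rule Suc.IH)
    fix x assume "x \<in> S"
    then obtain U where "open U" "x \<in> U" "Ck_on (Suc k) f U" using Suc.prems by blast
    then show "\<exists>U. open U \<and> x \<in> U \<and> Ck_on k (\<lambda>x. frechet_derivative f (at x) i) U"
      using i by auto
  qed
  moreover have "f differentiable (at x)" if "x \<in> S" for x
    using Suc.prems[OF that] by auto
  ultimately show ?case by auto
qed

lemma Ck_on_const [simp]: "Ck_on k (\<lambda>x. c) S"
  by (induction k arbitrary: c) auto

lemma Ck_on_bounded_linear: "bounded_linear L \<Longrightarrow> Ck_on k L S"
proof (cases k)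
  case 0
  then show "bounded_linear L \<Longrightarrow> ?thesis" by (auto simp: linear_continuous_on)
next
  case (Suc n)
  assume L: "bounded_linear L"
  have "frechet_derivative L (at x) = L" for x
    by (rule frechet_derivative_eqI) (rule bounded_linear_imp_has_derivative[OF L])
  then show ?thesis using Suc L by (auto intro: bounded_linear_imp_differentiable)
qed

text \<open>Every closure property below has the same shape: a derivative of the combined map is an
  expression of the same kind in the maps and their partial derivatives, so that induction on the
  order applies once this expression is known.\<close>

lemma Ck_on_SucI:
  assumes S: "open S"
    and d: "\<And>x. x \<in> S \<Longrightarrow> (f has_derivative D x) (at x)"
    and k: "\<And>i. i \<in> Basis \<Longrightarrow> Ck_on k (\<lambda>x. D x i) S"
  shows "Ck_on (Suc k) f S"
proof -
  have "Ck_on k (\<lambda>x. frechet_derivative f (at x) i) S" if "i \<in> Basis" for i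
    by (rule Ck_on_cong[OF S _ k[OF that]]) (simp add: frechet_derivative_eqI[OF d])
  then show ?thesis using d by (auto simp: differentiable_def)
qed

lemma Ck_on_has_derivative:
  "Ck_on (Suc k) f S \<Longrightarrow> x \<in> S \<Longrightarrow> (f has_derivative frechet_derivative f (at x)) (at x)"
  by (auto intro: has_frechet_derivative)

lemma Ck_on_compose_linear:
  assumes L: "bounded_linear L" and S: "open S" and f: "Ck_on k f S"
  shows "Ck_on k (\<lambda>x. L (f x)) S"
  using f
proof (induction k arbitrary: f)
  case 0
  then show ?case by (auto intro: bounded_linear.continuous_on[OF L])
next
  case (Suc k)
  show ?case
    by (rule Ck_on_SucI[OF S bounded_linear.has_derivative[OF L Ck_on_has_derivative[OF Suc.prems]]])
       (use Suc in auto)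
qed

lemma Ck_on_add:
  assumes S: "open S" and "Ck_on k f S" "Ck_on k g S"
  shows "Ck_on k (\<lambda>x. f x + g x) S"
  using assms(2,3)
proof (induction k arbitrary: f g)
  case 0
  then show ?case by (auto intro: continuous_intros)
next
  case (Suc k)
  show ?case
    by (rule Ck_on_SucI[OF S has_derivative_add[OF Ck_on_has_derivative[OF Suc.prems(1)]
              Ck_on_has_derivative[OF Suc.prems(2)]]])
       (use Suc in auto)
qed

lemma Ck_on_sum:
  assumes S: "open S" and "finite A" "\<And>a. a \<in> A \<Longrightarrow> Ck_on k (f a) S"
  shows "Ck_on k (\<lambda>x. \<Sum>a\<in>A. f a x) S"
  using assms(2,3) by (induction A rule: finite_induct) (auto intro: Ck_on_add[OF S])

lemma Ck_on_scaleR: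
  assumes S: "open S" and "Ck_on k f S" "Ck_on k g S"
  shows "Ck_on k (\<lambda>x. f x *\<^sub>R g x) S"
  using assms(2,3)
proof (induction k arbitrary: f g)
  case 0
  then show ?case by (auto intro: continuous_intros)
next
  case (Suc k)
  note f = Suc.prems(1) and g = Suc.prems(2)
  show ?case
    by (rule Ck_on_SucI[OF S has_derivative_scaleR[OF Ck_on_has_derivative[OF f] Ck_on_has_derivative[OF g]]])
       (use f g in \<open>auto intro!: Ck_on_add[OF S] Suc.IH simp: Ck_on_Suc_D[OF f] Ck_on_Suc_D[OF g]\<close>)
qed

lemma Ck_on_mult:
  fixes f g :: "'a::euclidean_space \<Rightarrow> real"
  shows "open S \<Longrightarrow> Ck_on k f S \<Longrightarrow> Ck_on k g S \<Longrightarrow> Ck_on k (\<lambda>x. f x * g x) S"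
  using Ck_on_scaleR[of S k f g] by simp

lemma Ck_on_minus:
  "open S \<Longrightarrow> Ck_on k f S \<Longrightarrow> Ck_on k (\<lambda>x. - f x) S"
  using Ck_on_compose_linear[of uminus S k f] by (simp add: bounded_linear_minus[OF bounded_linear_ident])

lemma Ck_on_diff:
  "open S \<Longrightarrow> Ck_on k f S \<Longrightarrow> Ck_on k g S \<Longrightarrow> Ck_on k (\<lambda>x. f x - g x) S"
  using Ck_on_add[of S k f "\<lambda>x. - g x"] by (simp add: Ck_on_minus)

lemma Ck_on_Pair:
  assumes S: "open S" and "Ck_on k f S" "Ck_on k g S"
  shows "Ck_on k (\<lambda>x. (f x, g x)) S"
proof -
  have "bounded_linear (\<lambda>a. (a, 0))" "bounded_linear (\<lambda>b. (0, b))"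
    by (auto intro: bounded_linear_Pair bounded_linear_ident bounded_linear_zero)
  then have "Ck_on k (\<lambda>x. (f x, 0) + (0, g x)) S"
    using assms by (intro Ck_on_add Ck_on_compose_linear[where L="\<lambda>a. (a, 0)"]
        Ck_on_compose_linear[where L="\<lambda>b. (0, b)"])
  then show ?thesis by simp
qed

lemma Ck_on_fst: "open S \<Longrightarrow> Ck_on k f S \<Longrightarrow> Ck_on k (\<lambda>x. fst (f x)) S"
  by (rule Ck_on_compose_linear[OF bounded_linear_fst])

lemma Ck_on_snd: "open S \<Longrightarrow> Ck_on k f S \<Longrightarrow> Ck_on k (\<lambda>x. snd (f x)) S"
  by (rule Ck_on_compose_linear[OF bounded_linear_snd])

lemma Ck_on_ident [simp]: "Ck_on k (\<lambda>x. x) S"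
  by (rule Ck_on_bounded_linear) (rule bounded_linear_ident)

lemma Ck_on_inverse:
  fixes f :: "'a::euclidean_space \<Rightarrow> real"
  assumes S: "open S" and "Ck_on k f S" and nz: "\<And>x. x \<in> S \<Longrightarrow> f x \<noteq> 0"
  shows "Ck_on k (\<lambda>x. inverse (f x)) S"
  using assms(2)
proof (induction k)
  case 0
  then show ?case using nz by (auto intro: continuous_intros)
next
  case (Suc k)
  note f = Suc.prems
  have "Ck_on k (\<lambda>x. inverse (f x)) S" by (rule Suc.IH[OF Ck_on_Suc_D[OF f]])
  then show ?case
    by (intro Ck_on_SucI[OF S Deriv.has_derivative_inverse[OF nz Ck_on_has_derivative[OF f]]])
       (use f in \<open>auto intro!: Ck_on_minus[OF S] Ck_on_mult[OF S]\<close>)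
qed

text \<open>The chain rule in coordinates.  The partial derivatives of \<open>g\<close> are evaluated at \<open>f x\<close> in it, so they
  are compositions of one order less, to which the induction hypothesis applies.\<close>

lemma Ck_on_compose:
  fixes f :: "'a::euclidean_space \<Rightarrow> 'b::euclidean_space"
  assumes S: "open S" and T: "open T" and "Ck_on k f S" "Ck_on k g T" "f ` S \<subseteq> T"
  shows "Ck_on k (\<lambda>x. g (f x)) S"
  using assms(3-5)
proof (induction k arbitrary: g)
  case 0
  then show ?case by (auto intro: continuous_on_compose2)
next
  case (Suc k)
  note f = Suc.prems(1) and g = Suc.prems(2)
  have d: "((\<lambda>x. g (f x)) has_derivative
      (\<lambda>h. \<Sum>j\<in>Basis. (frechet_derivative f (at x) h \<bullet> j) *\<^sub>R frechet_derivative g (at (f x)) j)) (at x)"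
    if x: "x \<in> S" for x
  proof -
    have "f x \<in> T" using x Suc.prems(3) by auto
    then have "((\<lambda>x. g (f x)) has_derivative
        (\<lambda>h. frechet_derivative g (at (f x)) (frechet_derivative f (at x) h))) (at x)"
      by (intro has_derivative_compose[OF Ck_on_has_derivative[OF f x] Ck_on_has_derivative[OF g]])
    moreover have "g differentiable (at (f x))" using g \<open>f x \<in> T\<close> by auto
    ultimately show ?thesis by (subst frechet_derivative_expand[symmetric]) auto
  qed
  show ?case
  proof (rule Ck_on_SucI[OF S d])
    fix i :: 'a assume i: "i \<in> Basis"
    have "Ck_on k (\<lambda>x. frechet_derivative f (at x) i) S" using f i by auto
    moreover have "Ck_on k (\<lambda>x. frechet_derivative g (at (f x)) j) S" if "j \<in> Basis" for j
      by (rule Suc.IH[OF Ck_on_Suc_D[OF f]]) (use g that Suc.prems(3) in auto)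
    ultimately show "Ck_on k (\<lambda>x. \<Sum>j\<in>Basis. (frechet_derivative f (at x) i \<bullet> j) *\<^sub>R
        frechet_derivative g (at (f x)) j) S"
      by (auto intro!: Ck_on_sum[OF S] Ck_on_scaleR[OF S]
          Ck_on_compose_linear[OF bounded_linear_inner_left S])
  qed auto
qed

lemma continuous_on_open_preimage_of:
  "open S \<Longrightarrow> Ck_on k f S \<Longrightarrow> open T \<Longrightarrow> open (S \<inter> f -` T)"
  by (metis Ck_on_imp_continuous_on continuous_on_open_vimage Int_commute)

text \<open>The maps of interest are defined by charts and are smooth near certain points only; the local
  form of smoothness avoids all bookkeeping of domains.\<close>

definition Ck_at :: "nat \<Rightarrow> ('a::euclidean_space \<Rightarrow> 'b::real_normed_vector) \<Rightarrow> 'a \<Rightarrow> bool" where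
  "Ck_at k f x \<longleftrightarrow> (\<exists>U. open U \<and> x \<in> U \<and> Ck_on k f U)"

lemma Ck_atI: "open U \<Longrightarrow> x \<in> U \<Longrightarrow> Ck_on k f U \<Longrightarrow> Ck_at k f x"
  by (auto simp: Ck_at_def)

lemma Ck_on_imp_at: "open S \<Longrightarrow> Ck_on k f S \<Longrightarrow> x \<in> S \<Longrightarrow> Ck_at k f x"
  by (rule Ck_atI)

lemma Ck_on_atI: "(\<And>x. x \<in> S \<Longrightarrow> Ck_at k f x) \<Longrightarrow> Ck_on k f S"
  unfolding Ck_at_def by (rule Ck_on_local) auto

lemma Ck_at_le: "Ck_at k f x \<Longrightarrow> j \<le> k \<Longrightarrow> Ck_at j f x"
  unfolding Ck_at_def using Ck_on_le by blast

lemma Ck_at_cong: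
  assumes "Ck_at k f x" "\<forall>\<^sub>F y in nhds x. f y = g y"
  shows "Ck_at k g x"
proof -
  obtain U where U: "open U" "x \<in> U" "Ck_on k f U" using assms by (auto simp: Ck_at_def)
  obtain V where V: "open V" "x \<in> V" "\<And>y. y \<in> V \<Longrightarrow> f y = g y"
    using assms(2) by (auto simp: eventually_nhds)
  have "Ck_on k g (U \<inter> V)"
    by (rule Ck_on_cong[where f=f]) (use U V in \<open>auto intro: Ck_on_subset\<close>)
  then show ?thesis using U V by (intro Ck_atI[of "U \<inter> V"]) auto
qed

lemma Ck_at_isCont: "Ck_at k f x \<Longrightarrow> isCont f x"
  unfolding Ck_at_def by (metis Ck_on_imp_continuous_on continuous_on_eq_continuous_at)

lemma Ck_at_differentiable: "Ck_at (Suc k) f x \<Longrightarrow> f differentiable (at x)"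
  unfolding Ck_at_def by auto

lemma Ck_at_compose:
  fixes f :: "'a::euclidean_space \<Rightarrow> 'b::euclidean_space"
  assumes "Ck_at k f x" "Ck_at k g (f x)"
  shows "Ck_at k (\<lambda>x. g (f x)) x"
proof -
  obtain U where U: "open U" "x \<in> U" "Ck_on k f U" using assms by (auto simp: Ck_at_def)
  obtain V where V: "open V" "f x \<in> V" "Ck_on k g V" using assms by (auto simp: Ck_at_def)
  have o: "open (U \<inter> f -` V)" by (rule continuous_on_open_preimage_of) (use U V in auto)
  have "Ck_on k (\<lambda>x. g (f x)) (U \<inter> f -` V)"
    by (rule Ck_on_compose[OF o V(1)]) (use U V in \<open>auto intro: Ck_on_subset\<close>)
  then show ?thesis using o U V by (intro Ck_atI[OF o]) auto
qed

lemma Ck_at_binop: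
  assumes "Ck_at k f x" "Ck_at k g x"
    and op: "\<And>S. open S \<Longrightarrow> Ck_on k f S \<Longrightarrow> Ck_on k g S \<Longrightarrow> Ck_on k h S"
  shows "Ck_at k h x"
proof -
  obtain U where U: "open U" "x \<in> U" "Ck_on k f U" using assms by (auto simp: Ck_at_def)
  obtain V where V: "open V" "x \<in> V" "Ck_on k g V" using assms by (auto simp: Ck_at_def)
  have "Ck_on k h (U \<inter> V)" by (rule op) (use U V in \<open>auto intro: Ck_on_subset\<close>)
  then show ?thesis using U V by (intro Ck_atI[of "U \<inter> V"]) auto
qed

lemma Ck_at_add: "Ck_at k f x \<Longrightarrow> Ck_at k g x \<Longrightarrow> Ck_at k (\<lambda>x. f x + g x) x"
  by (rule Ck_at_binop[of k f x g]) (auto intro: Ck_on_add)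

lemma Ck_at_diff: "Ck_at k f x \<Longrightarrow> Ck_at k g x \<Longrightarrow> Ck_at k (\<lambda>x. f x - g x) x"
  by (rule Ck_at_binop[of k f x g]) (auto intro: Ck_on_diff)

lemma Ck_at_scaleR: "Ck_at k f x \<Longrightarrow> Ck_at k g x \<Longrightarrow> Ck_at k (\<lambda>x. f x *\<^sub>R g x) x"
  by (rule Ck_at_binop[of k f x g]) (auto intro: Ck_on_scaleR)

lemma Ck_at_mult:
  fixes f g :: "'a::euclidean_space \<Rightarrow> real"
  shows "Ck_at k f x \<Longrightarrow> Ck_at k g x \<Longrightarrow> Ck_at k (\<lambda>x. f x * g x) x"
  by (rule Ck_at_binop[of k f x g]) (auto intro: Ck_on_mult)

lemma Ck_at_Pair: "Ck_at k f x \<Longrightarrow> Ck_at k g x \<Longrightarrow> Ck_at k (\<lambda>x. (f x, g x)) x"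
  by (rule Ck_at_binop[of k f x g]) (auto intro: Ck_on_Pair)

lemma Ck_at_compose_linear: "bounded_linear L \<Longrightarrow> Ck_at k f x \<Longrightarrow> Ck_at k (\<lambda>x. L (f x)) x"
  by (rule Ck_at_binop[of k f x f]) (auto intro: Ck_on_compose_linear)

lemma Ck_at_fst: "Ck_at k f x \<Longrightarrow> Ck_at k (\<lambda>x. fst (f x)) x"
  by (rule Ck_at_compose_linear[OF bounded_linear_fst])

lemma Ck_at_snd: "Ck_at k f x \<Longrightarrow> Ck_at k (\<lambda>x. snd (f x)) x"
  by (rule Ck_at_compose_linear[OF bounded_linear_snd])

lemma Ck_at_const [simp]: "Ck_at k (\<lambda>x. c) x"
  by (rule Ck_atI[of UNIV]) auto

lemma Ck_at_ident [simp]: "Ck_at k (\<lambda>x. x) x"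
  by (rule Ck_atI[of UNIV]) auto

lemma Ck_at_bounded_linear: "bounded_linear L \<Longrightarrow> Ck_at k L x"
  by (rule Ck_atI[of UNIV]) (auto intro: Ck_on_bounded_linear)

lemma Ck_at_sum:
  "finite A \<Longrightarrow> (\<And>a. a \<in> A \<Longrightarrow> Ck_at k (f a) x) \<Longrightarrow> Ck_at k (\<lambda>x. \<Sum>a\<in>A. f a x) x"
  by (induction A rule: finite_induct) (auto intro: Ck_at_add)

lemma Ck_at_power:
  fixes f :: "'a::euclidean_space \<Rightarrow> real"
  shows "Ck_at k f x \<Longrightarrow> Ck_at k (\<lambda>x. f x ^ n) x"
  by (induction n) (auto intro: Ck_at_mult)

lemmas Ck_at_intros = Ck_at_add Ck_at_diff Ck_at_mult Ck_at_scaleR Ck_at_Pair Ck_at_fst Ck_at_snd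
  Ck_at_power Ck_at_const Ck_at_ident

section \<open>Convergence in the \<open>C\<^sup>r\<close> topology on bounded sets\<close>

text \<open>The rescaled maps are smooth on balls that grow with \<open>k\<close> but not on the whole space; regularity is
  therefore only asked for eventually on each ball.\<close>

definition loc_unif ::
    "(nat \<Rightarrow> 'a::real_normed_vector \<Rightarrow> 'b::real_normed_vector) \<Rightarrow> ('a \<Rightarrow> 'b) \<Rightarrow> bool" where
  "loc_unif F f \<longleftrightarrow> (\<forall>R. (\<forall>\<^sub>F k in sequentially. continuous_on (ball 0 R) (F k)) \<and>
     uniform_limit (ball 0 R) F f sequentially)"

fun Cr_tends :: "nat \<Rightarrow> (nat \<Rightarrow> 'a::euclidean_space \<Rightarrow> 'b::real_normed_vector) \<Rightarrow> ('a \<Rightarrow> 'b) \<Rightarrow> bool" where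
  "Cr_tends 0 F f \<longleftrightarrow> loc_unif F f"
| "Cr_tends (Suc r) F f \<longleftrightarrow> loc_unif F f \<and>
     (\<forall>R. \<forall>\<^sub>F k in sequentially. \<forall>x\<in>ball 0 R. F k differentiable (at x)) \<and>
     (\<forall>x. f differentiable (at x)) \<and>
     (\<forall>i\<in>Basis. Cr_tends r (\<lambda>k x. frechet_derivative (F k) (at x) i)
        (\<lambda>x. frechet_derivative f (at x) i))"

lemma Cr_tends_loc_unif: "Cr_tends r F f \<Longrightarrow> loc_unif F f"
  by (cases r) auto

lemma loc_unif_limit: "loc_unif F f \<Longrightarrow> uniform_limit (ball 0 R) F f sequentially"
  by (simp add: loc_unif_def)

lemma loc_unif_continuous:
  assumes "loc_unif F f" shows "continuous_on S f"
proof -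
  have "isCont f x" for x
  proof -
    have "continuous_on (ball 0 (norm x + 1)) f"
      using assms by (intro uniform_limit_theorem[of _ F]) (auto simp: loc_unif_def)
    then show ?thesis by (simp add: continuous_on_eq_continuous_at)
  qed
  then show ?thesis by (simp add: continuous_at_imp_continuous_on)
qed

lemma loc_unif_bounded:
  fixes f :: "'a::euclidean_space \<Rightarrow> 'b::real_normed_vector"
  assumes "loc_unif F f" shows "bounded (f ` ball 0 R)"
proof -
  have "compact (f ` cball 0 R)"
    by (intro compact_continuous_image loc_unif_continuous[OF assms]) auto
  then show ?thesis by (rule bounded_subset[OF compact_imp_bounded]) auto
qed

lemma loc_unif_cong:
  assumes "loc_unif F f" "\<And>R. \<forall>\<^sub>F k in sequentially. \<forall>x\<in>ball 0 R. F k x = G k x"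
  shows "loc_unif G f"
  unfolding loc_unif_def
proof (intro allI conjI)
  fix R :: real
  note e = assms(2)[of R]
  have "\<forall>\<^sub>F k in sequentially. continuous_on (ball 0 R) (F k)"
    using assms(1) by (simp add: loc_unif_def)
  then show "\<forall>\<^sub>F k in sequentially. continuous_on (ball 0 R) (G k)"
    using e by eventually_elim (metis continuous_on_cong)
  show "uniform_limit (ball 0 R) G f sequentially"
    using loc_unif_limit[OF assms(1)] e
      uniform_limit_cong[of "ball 0 R" F G sequentially f f] by auto
qed

lemma Cr_tends_cong:
  assumes "Cr_tends r F f" "\<And>R. \<forall>\<^sub>F k in sequentially. \<forall>x\<in>ball 0 R. F k x = G k x"
  shows "Cr_tends r G f"
  using assms
proof (induction r arbitrary: F G f)
  case 0
  then show ?case using loc_unif_cong by auto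
next
  case (Suc r)
  have "Cr_tends r (\<lambda>k x. frechet_derivative (G k) (at x) i) (\<lambda>x. frechet_derivative f (at x) i)"
    if i: "i \<in> Basis" for i
  proof (rule Suc.IH)
    show "Cr_tends r (\<lambda>k x. frechet_derivative (F k) (at x) i) (\<lambda>x. frechet_derivative f (at x) i)"
      using Suc.prems i by auto
    show "\<forall>\<^sub>F k in sequentially. \<forall>x\<in>ball 0 R. frechet_derivative (F k) (at x) i = frechet_derivative (G k) (at x) i"
      for R
      using Suc.prems(2)[of R]
      by eventually_elim (metis frechet_derivative_cong_open[OF open_ball])
  qed
  moreover have "\<forall>\<^sub>F k in sequentially. \<forall>x\<in>ball 0 R. G k differentiable (at x)" for R
  proof -
    have "\<forall>\<^sub>F k in sequentially. \<forall>x\<in>ball 0 R. F k differentiable (at x)" using Suc.prems(1) by simp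
    then show ?thesis using Suc.prems(2)[of R]
      by eventually_elim (metis differentiable_cong_open[OF open_ball])
  qed
  moreover have "loc_unif G f"
    using loc_unif_cong[OF _ Suc.prems(2)] Suc.prems(1) by simp
  ultimately show ?case using Suc.prems(1) by simp
qed

lemma Cr_tends_SucI:
  assumes u: "loc_unif F f"
    and F: "\<And>R. \<forall>\<^sub>F k in sequentially. \<forall>x\<in>ball 0 R. (F k has_derivative D k x) (at x)"
    and f: "\<And>x. (f has_derivative D' x) (at x)"
    and r: "\<And>i. i \<in> Basis \<Longrightarrow> Cr_tends r (\<lambda>k x. D k x i) (\<lambda>x. D' x i)"
  shows "Cr_tends (Suc r) F f"
proof -
  have "\<forall>\<^sub>F k in sequentially. \<forall>x\<in>ball 0 R. F k differentiable (at x)" for R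
    using F[of R] by eventually_elim (auto simp: differentiable_def)
  moreover have "Cr_tends r (\<lambda>k x. frechet_derivative (F k) (at x) i) (\<lambda>x. frechet_derivative f (at x) i)"
    if i: "i \<in> Basis" for i
  proof -
    have "(\<lambda>x. frechet_derivative f (at x) i) = (\<lambda>x. D' x i)"
      by (simp add: frechet_derivative_eqI[OF f])
    moreover have "\<forall>\<^sub>F k in sequentially. \<forall>x\<in>ball 0 R. D k x i = frechet_derivative (F k) (at x) i" for R
      using F[of R] by eventually_elim (metis frechet_derivative_eqI)
    ultimately show ?thesis using Cr_tends_cong[OF r[OF i]] by simp
  qed
  ultimately show ?thesis using u f by (auto simp: differentiable_def)
qed

text \<open>Convergence of the derivatives on balls, together with convergence at one point, already
  gives convergence of the functions, by the mean value inequality.\<close>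

lemma loc_unif_of_derivative:
  fixes F :: "nat \<Rightarrow> 'a::euclidean_space \<Rightarrow> 'b::real_normed_vector"
  assumes z: "(\<lambda>k. F k 0) \<longlonglongrightarrow> f 0"
    and F: "\<And>R. \<forall>\<^sub>F k in sequentially. \<forall>x\<in>ball 0 R. (F k has_derivative D k x) (at x)"
    and f: "\<And>x. (f has_derivative D' x) (at x)"
    and r: "\<And>i. i \<in> Basis \<Longrightarrow> loc_unif (\<lambda>k x. D k x i) (\<lambda>x. D' x i)"
  shows "loc_unif F f"
  unfolding loc_unif_def
proof (intro allI conjI)
  fix R :: real
  show "\<forall>\<^sub>F k in sequentially. continuous_on (ball 0 R) (F k)"
    using F[of R]
    by eventually_elim (auto intro!: continuous_at_imp_continuous_on has_derivative_continuous)
  show "uniform_limit (ball 0 R) F f sequentially"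
  proof (cases "R > 0")
    case False
    then have b: "ball 0 R = ({} :: 'a set)" by simp
    show ?thesis unfolding b by (simp add: uniform_limit_iff)
  next
    case R: True
    show ?thesis
    proof (rule uniform_limitI)
      fix e :: real assume e: "e > 0"
      define d where "d = e / (2 * (R * DIM('a) + 1))"
      have d: "d > 0" using e R unfolding d_def by (intro divide_pos_pos) (auto intro: add_nonneg_pos)
      have "\<forall>\<^sub>F k in sequentially. \<forall>i\<in>Basis. \<forall>x\<in>ball 0 R. dist (D k x i) (D' x i) < d"
        by (intro eventually_ball_finite) (auto intro!: uniform_limitD[OF loc_unif_limit[OF r]] d)
      moreover have "\<forall>\<^sub>F k in sequentially. dist (F k 0) (f 0) < e / 2"
        using z e by (intro tendstoD) auto
      ultimately show "\<forall>\<^sub>F k in sequentially. \<forall>x\<in>ball 0 R. dist (F k x) (f x) < e"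
        using F[of R]
      proof eventually_elim
        case (elim k)
        show ?case
        proof
          fix x :: 'a assume x: "x \<in> ball 0 R"
          have bd: "onorm (\<lambda>h. D k y h - D' y h) \<le> DIM('a) * d" if y: "y \<in> ball 0 R" for y
          proof -
            have "bounded_linear (\<lambda>h. D k y h - D' y h)"
              using elim(3) f y by (intro bounded_linear_sub) (auto intro: has_derivative_bounded_linear)
            then have "onorm (\<lambda>h. D k y h - D' y h) \<le> (\<Sum>i\<in>Basis. norm (D k y i - D' y i))"
              by (rule onorm_componentwise)
            also have "\<dots> \<le> (\<Sum>i\<in>(Basis::'a set). d)"
              using elim(1) y by (intro sum_mono) (auto simp: dist_norm intro: less_imp_le)
            finally show ?thesis by simp
          qed
          have "norm ((F k x - f x) - (F k 0 - f 0)) \<le> DIM('a) * d * norm (x - 0)"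
          proof (rule differentiable_bound[of "ball 0 R" "\<lambda>x. F k x - f x" "\<lambda>y h. D k y h - D' y h"])
            show "((\<lambda>x. F k x - f x) has_derivative (\<lambda>h. D k y h - D' y h)) (at y within ball 0 R)"
              if "y \<in> ball 0 R" for y
              using elim(3) f that by (auto intro: has_derivative_diff has_derivative_at_withinI)
          qed (use bd x R in auto)
          also have "\<dots> \<le> DIM('a) * d * R" using x d by (intro mult_left_mono) auto
          also have "\<dots> < e / 2"
          proof -
            have "2 * (R * DIM('a)) < 2 * (R * DIM('a) + 1)" by simp
            moreover have "0 < R * DIM('a) + 1" using R by (intro add_nonneg_pos) auto
            ultimately show ?thesis using e unfolding d_def by (simp add: field_simps)
          qed
          finally have "norm ((F k x - f x) - (F k 0 - f 0)) < e / 2" .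
          moreover have "norm (F k 0 - f 0) < e / 2" using elim(2) by (simp add: dist_norm)
          ultimately have "norm (F k x - f x) < e"
            using norm_triangle_ineq[of "(F k x - f x) - (F k 0 - f 0)" "F k 0 - f 0"] by simp
          then show "dist (F k x) (f x) < e" by (simp add: dist_norm)
        qed
      qed
    qed
  qed
qed

lemma Cr_tends_of_derivative:
  assumes "(\<lambda>k. F k 0) \<longlonglongrightarrow> f 0"
    and "\<And>R. \<forall>\<^sub>F k in sequentially. \<forall>x\<in>ball 0 R. (F k has_derivative D k x) (at x)"
    and "\<And>x. (f has_derivative D' x) (at x)"
    and "\<And>i. i \<in> Basis \<Longrightarrow> Cr_tends r (\<lambda>k x. D k x i) (\<lambda>x. D' x i)"
  shows "Cr_tends (Suc r) F f"
proof (rule Cr_tends_SucI[OF _ assms(2-4)])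
  show "loc_unif F f"
    by (rule loc_unif_of_derivative[OF assms(1-3) Cr_tends_loc_unif[OF assms(4)]])
qed

lemma Cr_tends_Suc_D: "Cr_tends (Suc r) F f \<Longrightarrow> Cr_tends r F f"
proof (induction r arbitrary: F f)
  case (Suc r)
  note * = Suc.prems[unfolded Cr_tends.simps(2)[of "Suc r"]]
  have "Cr_tends r (\<lambda>k x. frechet_derivative (F k) (at x) i) (\<lambda>x. frechet_derivative f (at x) i)"
    if "i \<in> Basis" for i
    by (rule Suc.IH) (use * that in blast)
  then show ?case using * by simp
qed simp

lemma Cr_tends_SucE:
  assumes "Cr_tends (Suc r) F f"
  shows "\<And>R. \<forall>\<^sub>F k in sequentially. \<forall>x\<in>ball 0 R. (F k has_derivative frechet_derivative (F k) (at x)) (at x)"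
    and "\<And>x. (f has_derivative frechet_derivative f (at x)) (at x)"
    and "\<And>i. i \<in> Basis \<Longrightarrow> Cr_tends r (\<lambda>k x. frechet_derivative (F k) (at x) i) (\<lambda>x. frechet_derivative f (at x) i)"
proof -
  fix R
  have "\<forall>\<^sub>F k in sequentially. \<forall>x\<in>ball 0 R. F k differentiable (at x)" using assms by simp
  then show "\<forall>\<^sub>F k in sequentially. \<forall>x\<in>ball 0 R. (F k has_derivative frechet_derivative (F k) (at x)) (at x)"
    by eventually_elim (auto intro: has_frechet_derivative)
qed (use assms in \<open>auto intro: has_frechet_derivative\<close>)

lemma Cr_tends_const:
  fixes d :: "'b::real_normed_vector"
  shows "c \<longlonglongrightarrow> d \<Longrightarrow> Cr_tends r (\<lambda>k (x::'a::euclidean_space). c k) (\<lambda>x. d)"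
proof (induction r arbitrary: c d)
  case 0
  then have "uniform_limit (ball (0::'a) R) (\<lambda>k x. c k) (\<lambda>x. d) sequentially" for R :: real
    by (auto simp: uniform_limit_iff tendsto_iff elim!: eventually_mono)
  then show ?case by (simp add: loc_unif_def)
next
  case (Suc r)
  have "Cr_tends r (\<lambda>k (x::'a). 0::'b) (\<lambda>x. 0)" by (rule Suc.IH) simp
  moreover have "loc_unif (\<lambda>k (x::'a). c k) (\<lambda>x. d)"
    using Suc.prems by (auto simp: loc_unif_def uniform_limit_iff tendsto_iff elim!: eventually_mono)
  ultimately show ?case by (intro Cr_tends_SucI[where D="\<lambda>_ _ _. 0" and D'="\<lambda>_ _. 0"]) auto
qed

lemma Cr_tends_const' [simp]: "Cr_tends r (\<lambda>k x. c) (\<lambda>x. c)"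
  by (rule Cr_tends_const) simp

lemma Cr_tends_compose_linear:
  assumes L: "bounded_linear L" and "Cr_tends r F f"
  shows "Cr_tends r (\<lambda>k x. L (F k x)) (\<lambda>x. L (f x))"
  using assms(2)
proof (induction r arbitrary: F f)
  case 0
  have "\<forall>\<^sub>F k in sequentially. continuous_on (ball 0 R) (\<lambda>x. L (F k x))" for R
  proof -
    have "\<forall>\<^sub>F k in sequentially. continuous_on (ball 0 R) (F k)" using 0 by (simp add: loc_unif_def)
    then show ?thesis by eventually_elim (rule bounded_linear.continuous_on[OF L])
  qed
  then show ?case using 0 by (auto simp: loc_unif_def intro: bounded_linear.uniform_limit[OF L])
next
  case (Suc r)
  show ?case
  proof (rule Cr_tends_SucI[where D="\<lambda>k x h. L (frechet_derivative (F k) (at x) h)"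
        and D'="\<lambda>x h. L (frechet_derivative f (at x) h)"])
    show "loc_unif (\<lambda>k x. L (F k x)) (\<lambda>x. L (f x))"
      by (rule Cr_tends_loc_unif) (rule Suc.IH[OF Cr_tends_Suc_D[OF Suc.prems]])
    show "\<forall>\<^sub>F k in sequentially. \<forall>x\<in>ball 0 R.
        ((\<lambda>x. L (F k x)) has_derivative (\<lambda>h. L (frechet_derivative (F k) (at x) h))) (at x)" for R
      using Cr_tends_SucE(1)[OF Suc.prems, of R]
      by eventually_elim (auto intro: bounded_linear.has_derivative[OF L])
  qed (auto intro: bounded_linear.has_derivative[OF L] Suc.IH Cr_tends_SucE[OF Suc.prems])
qed

lemma Cr_tends_linear: "bounded_linear L \<Longrightarrow> Cr_tends r (\<lambda>k. L) L"
proof (induction r)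
  case 0
  then show ?case by (auto simp: loc_unif_def linear_continuous_on uniform_limit_iff)
next
  case (Suc r)
  show ?case
    by (rule Cr_tends_SucI[where D="\<lambda>k x. L" and D'="\<lambda>x. L"])
      (use Suc in \<open>auto intro: bounded_linear_imp_has_derivative Cr_tends_loc_unif\<close>)
qed

lemma Cr_tends_add:
  assumes "Cr_tends r F f" "Cr_tends r G g"
  shows "Cr_tends r (\<lambda>k x. F k x + G k x) (\<lambda>x. f x + g x)"
  using assms
proof (induction r arbitrary: F f G g)
  case 0
  have "\<forall>\<^sub>F k in sequentially. continuous_on (ball 0 R) (\<lambda>x. F k x + G k x)" for R
  proof -
    have "\<forall>\<^sub>F k in sequentially. continuous_on (ball 0 R) (F k)"
      "\<forall>\<^sub>F k in sequentially. continuous_on (ball 0 R) (G k)" using 0 by (auto simp: loc_unif_def)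
    then show ?thesis by eventually_elim (rule continuous_on_add)
  qed
  then show ?case using 0 by (auto simp: loc_unif_def intro: uniform_limit_add)
next
  case (Suc r)
  note F = Suc.prems(1) and G = Suc.prems(2)
  show ?case
  proof (rule Cr_tends_SucI[where D="\<lambda>k x h. frechet_derivative (F k) (at x) h + frechet_derivative (G k) (at x) h"
        and D'="\<lambda>x h. frechet_derivative f (at x) h + frechet_derivative g (at x) h"])
    show "loc_unif (\<lambda>k x. F k x + G k x) (\<lambda>x. f x + g x)"
      by (rule Cr_tends_loc_unif) (rule Suc.IH[OF Cr_tends_Suc_D[OF F] Cr_tends_Suc_D[OF G]])
    show "\<forall>\<^sub>F k in sequentially. \<forall>x\<in>ball 0 R. ((\<lambda>x. F k x + G k x) has_derivative
        (\<lambda>h. frechet_derivative (F k) (at x) h + frechet_derivative (G k) (at x) h)) (at x)" for R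
      using Cr_tends_SucE(1)[OF F, of R] Cr_tends_SucE(1)[OF G, of R]
      by eventually_elim (auto intro: has_derivative_add)
  qed (auto intro: has_derivative_add Suc.IH Cr_tends_SucE[OF F] Cr_tends_SucE[OF G])
qed

lemma Cr_tends_sum:
  assumes "finite A" "\<And>a. a \<in> A \<Longrightarrow> Cr_tends r (F a) (f a)"
  shows "Cr_tends r (\<lambda>k x. \<Sum>a\<in>A. F a k x) (\<lambda>x. \<Sum>a\<in>A. f a x)"
  using assms by (induction A rule: finite_induct) (auto intro: Cr_tends_add)

lemma Cr_tends_scaleR:
  fixes G :: "nat \<Rightarrow> 'a::euclidean_space \<Rightarrow> 'b::real_normed_vector"
  assumes "Cr_tends r F f" "Cr_tends r G g"
  shows "Cr_tends r (\<lambda>k x. F k x *\<^sub>R G k x) (\<lambda>x. f x *\<^sub>R g x)"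
  using assms
proof (induction r arbitrary: F f G g)
  case 0
  have "\<forall>\<^sub>F k in sequentially. continuous_on (ball 0 R) (\<lambda>x. F k x *\<^sub>R G k x)" for R
  proof -
    have "\<forall>\<^sub>F k in sequentially. continuous_on (ball 0 R) (F k)"
      "\<forall>\<^sub>F k in sequentially. continuous_on (ball 0 R) (G k)" using 0 by (auto simp: loc_unif_def)
    then show ?thesis by eventually_elim (rule continuous_on_scaleR)
  qed
  moreover have "uniform_limit (ball 0 R) (\<lambda>k x. F k x *\<^sub>R G k x) (\<lambda>x. f x *\<^sub>R g x) sequentially" for R
    using 0 by (intro bounded_bilinear.bounded_uniform_limit[OF bounded_bilinear_scaleR])
      (auto intro: loc_unif_limit loc_unif_bounded)
  ultimately show ?case by (simp add: loc_unif_def)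
next
  case (Suc r)
  note F = Suc.prems(1) and G = Suc.prems(2)
  show ?case
  proof (rule Cr_tends_SucI[where D="\<lambda>k x h. F k x *\<^sub>R frechet_derivative (G k) (at x) h + frechet_derivative (F k) (at x) h *\<^sub>R G k x"
        and D'="\<lambda>x h. f x *\<^sub>R frechet_derivative g (at x) h + frechet_derivative f (at x) h *\<^sub>R g x"])
    show "loc_unif (\<lambda>k x. F k x *\<^sub>R G k x) (\<lambda>x. f x *\<^sub>R g x)"
      by (rule Cr_tends_loc_unif) (rule Suc.IH[OF Cr_tends_Suc_D[OF F] Cr_tends_Suc_D[OF G]])
    show "\<forall>\<^sub>F k in sequentially. \<forall>x\<in>ball 0 R. ((\<lambda>x. F k x *\<^sub>R G k x) has_derivative
        (\<lambda>h. F k x *\<^sub>R frechet_derivative (G k) (at x) h + frechet_derivative (F k) (at x) h *\<^sub>R G k x)) (at x)" for R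
      using Cr_tends_SucE(1)[OF F, of R] Cr_tends_SucE(1)[OF G, of R]
      by eventually_elim (auto intro: has_derivative_scaleR)
    show "((\<lambda>x. f x *\<^sub>R g x) has_derivative
        (\<lambda>h. f x *\<^sub>R frechet_derivative g (at x) h + frechet_derivative f (at x) h *\<^sub>R g x)) (at x)" for x
      by (rule has_derivative_scaleR[OF Cr_tends_SucE(2)[OF F] Cr_tends_SucE(2)[OF G]])
    show "Cr_tends r
        (\<lambda>k x. F k x *\<^sub>R frechet_derivative (G k) (at x) i + frechet_derivative (F k) (at x) i *\<^sub>R G k x)
        (\<lambda>x. f x *\<^sub>R frechet_derivative g (at x) i + frechet_derivative f (at x) i *\<^sub>R g x)"
      if i: "i \<in> Basis" for i
      by (intro Cr_tends_add Suc.IH Cr_tends_Suc_D[OF F] Cr_tends_Suc_D[OF G]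
          Cr_tends_SucE(3)[OF F i] Cr_tends_SucE(3)[OF G i])
  qed
qed

lemma Cr_tends_mult:
  fixes F G :: "nat \<Rightarrow> 'a::euclidean_space \<Rightarrow> real"
  shows "Cr_tends r F f \<Longrightarrow> Cr_tends r G g \<Longrightarrow> Cr_tends r (\<lambda>k x. F k x * G k x) (\<lambda>x. f x * g x)"
  using Cr_tends_scaleR[of r F f G g] by simp

lemma Cr_tends_power2:
  fixes F :: "nat \<Rightarrow> 'a::euclidean_space \<Rightarrow> real"
  shows "Cr_tends r F f \<Longrightarrow> Cr_tends r (\<lambda>k x. (F k x)^2) (\<lambda>x. (f x)^2)"
  unfolding power2_eq_square by (rule Cr_tends_mult)

lemma Cr_tends_Pair:
  assumes "Cr_tends r F f" "Cr_tends r G g"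
  shows "Cr_tends r (\<lambda>k x. (F k x, G k x)) (\<lambda>x. (f x, g x))"
proof -
  have "bounded_linear (\<lambda>a. (a, 0))" "bounded_linear (\<lambda>b. (0, b))"
    by (auto intro: bounded_linear_Pair bounded_linear_ident bounded_linear_zero)
  then have "Cr_tends r (\<lambda>k x. (F k x, 0) + (0, G k x)) (\<lambda>x. (f x, 0) + (0, g x))"
    using assms by (intro Cr_tends_add Cr_tends_compose_linear[where L="\<lambda>a. (a, 0)"]
        Cr_tends_compose_linear[where L="\<lambda>b. (0, b)"])
  then show ?thesis by simp
qed

lemma Cr_tends_imp_Ck_on:
  assumes "Cr_tends r F f"
  shows "\<forall>\<^sub>F k in sequentially. Ck_on r (F k) (ball 0 R)"
  using assms
proof (induction r arbitrary: F f)
  case 0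
  then show ?case by (auto simp: loc_unif_def)
next
  case (Suc r)
  have "\<forall>\<^sub>F k in sequentially. \<forall>i\<in>Basis. Ck_on r (\<lambda>x. frechet_derivative (F k) (at x) i) (ball 0 R)"
    using Suc.prems by (intro eventually_ball_finite) (auto intro: Suc.IH)
  moreover have "\<forall>\<^sub>F k in sequentially. \<forall>x\<in>ball 0 R. F k differentiable (at x)" using Suc.prems by simp
  ultimately show ?case by eventually_elim auto
qed

lemma partials_snoc: "partials (vs @ [v]) f = partials vs (\<lambda>x. frechet_derivative f (at x) v)"
  by (induction vs) auto

lemma partials_cong_open:
  assumes "open S" "\<And>y. y \<in> S \<Longrightarrow> f y = g y" "x \<in> S"
  shows "partials vs f x = partials vs g x"
  using assms(3)
proof (induction vs arbitrary: x)
  case (Cons v vs)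
  show ?case using frechet_derivative_cong_open[OF assms(1) Cons.prems Cons.IH] by simp
qed (use assms in auto)

lemma Cr_tends_partials:
  assumes "Cr_tends r F f" "set vs \<subseteq> Basis" "length vs \<le> r"
  shows "uniform_limit (ball 0 R) (\<lambda>k. partials vs (F k)) (partials vs f) sequentially"
  using assms
proof (induction vs arbitrary: r F f rule: rev_induct)
  case Nil
  then show ?case using loc_unif_limit[OF Cr_tends_loc_unif] by simp
next
  case (snoc v vs)
  then obtain r' where r: "r = Suc r'" by (cases r) auto
  show ?case unfolding partials_snoc
    by (rule snoc.IH[of r']) (use snoc.prems r in auto)
qed

text \<open>On a fixed ball \<open>P k\<close> eventually takes values in \<open>U\<close>.  In the chain rule every term contains a
  derivative of \<open>P k\<close>, which tends to zero.\<close>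

lemma Cr_tends_compose_near_0:
  fixes P :: "nat \<Rightarrow> 'a::euclidean_space \<Rightarrow> 'c::euclidean_space"
  assumes "Cr_tends r P (\<lambda>x. 0)" and U: "open U" "0 \<in> U" and "Ck_on r K U"
  shows "Cr_tends r (\<lambda>k x. K (P k x)) (\<lambda>x. K 0)"
proof -
  have inU: "\<forall>\<^sub>F k in sequentially. \<forall>x\<in>ball 0 R. P k x \<in> U" for R
  proof -
    obtain e where e: "e > 0" "ball 0 e \<subseteq> U" using U openE by blast
    have "\<forall>\<^sub>F k in sequentially. \<forall>x\<in>ball 0 R. dist (P k x) 0 < e"
      by (rule uniform_limitD[OF loc_unif_limit[OF Cr_tends_loc_unif[OF assms(1)]] e(1)])
    then show ?thesis by eventually_elim (use e in \<open>auto simp: dist_commute\<close>)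
  qed
  have u: "loc_unif (\<lambda>k x. K (P k x)) (\<lambda>x. K 0)" if c: "continuous_on U K" for K :: "'c \<Rightarrow> 'd::real_normed_vector"
    unfolding loc_unif_def
  proof (intro allI conjI)
    fix R
    have "\<forall>\<^sub>F k in sequentially. continuous_on (ball 0 R) (P k)"
      using Cr_tends_loc_unif[OF assms(1)] by (simp add: loc_unif_def)
    then show "\<forall>\<^sub>F k in sequentially. continuous_on (ball 0 R) (\<lambda>x. K (P k x))"
      using inU[of R] by eventually_elim (auto intro!: continuous_on_compose2[OF c])
    show "uniform_limit (ball 0 R) (\<lambda>k x. K (P k x)) (\<lambda>x. K 0) sequentially"
    proof (rule uniform_limitI)
      fix e :: real assume "e > 0"
      then obtain d where d: "d > 0" "\<And>y. dist y 0 < d \<Longrightarrow> dist (K y) (K 0) < e"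
        using c U unfolding continuous_on_eq_continuous_at[OF U(1)] continuous_at_eps_delta by metis
      have "\<forall>\<^sub>F k in sequentially. \<forall>x\<in>ball 0 R. dist (P k x) 0 < d"
        by (rule uniform_limitD[OF loc_unif_limit[OF Cr_tends_loc_unif[OF assms(1)]] d(1)])
      then show "\<forall>\<^sub>F k in sequentially. \<forall>x\<in>ball 0 R. dist (K (P k x)) (K 0) < e"
        by eventually_elim (use d in auto)
    qed
  qed
  show ?thesis using assms(1,4)
  proof (induction r arbitrary: K)
    case 0
    then show ?case using u by simp
  next
    case (Suc r)
    note P = Suc.prems(1) and K = Suc.prems(2)
    let ?D = "\<lambda>k x h. \<Sum>j\<in>Basis. (frechet_derivative (P k) (at x) h \<bullet> j) *\<^sub>R frechet_derivative K (at (P k x)) j"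
    show ?case
    proof (rule Cr_tends_SucI[where D="?D" and D'="\<lambda>x h. 0"])
      show "loc_unif (\<lambda>k x. K (P k x)) (\<lambda>x. K 0)" by (rule u) (rule Ck_on_imp_continuous_on[OF K])
      show "\<forall>\<^sub>F k in sequentially. \<forall>x\<in>ball 0 R. ((\<lambda>x. K (P k x)) has_derivative ?D k x) (at x)" for R
        using Cr_tends_SucE(1)[OF P, of R] inU[of R]
      proof eventually_elim
        case (elim k)
        show ?case
        proof
          fix x :: 'a assume x: "x \<in> ball 0 R"
          then have i: "P k x \<in> U" using elim by auto
          have "(P k has_derivative frechet_derivative (P k) (at x)) (at x)" using elim x by auto
          note has_derivative_compose[OF this Ck_on_has_derivative[OF K i]]
          moreover have "K differentiable (at (P k x))" using K i by auto
          ultimately show "((\<lambda>x. K (P k x)) has_derivative ?D k x) (at x)"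
            by (subst frechet_derivative_expand[symmetric]) auto
        qed
      qed
      show "Cr_tends r (\<lambda>k x. ?D k x i) (\<lambda>x. 0)" if i: "i \<in> Basis" for i
      proof -
        have "Cr_tends r (\<lambda>k x. ?D k x i) (\<lambda>x. \<Sum>j\<in>(Basis::'c set). ((0::'c) \<bullet> j) *\<^sub>R frechet_derivative K (at 0) j)"
        proof (intro Cr_tends_sum Cr_tends_scaleR)
          fix j :: 'c assume j: "j \<in> Basis"
          have "Cr_tends r (\<lambda>k x. frechet_derivative (P k) (at x) i) (\<lambda>x. 0)"
            using Cr_tends_SucE(3)[OF P i] by simp
          then show "Cr_tends r (\<lambda>k x. frechet_derivative (P k) (at x) i \<bullet> j) (\<lambda>x. 0 \<bullet> j)"
            by (rule Cr_tends_compose_linear[OF bounded_linear_inner_left])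
          show "Cr_tends r (\<lambda>k x. frechet_derivative K (at (P k x)) j) (\<lambda>x. frechet_derivative K (at 0) j)"
            by (rule Suc.IH[OF Cr_tends_Suc_D[OF P]]) (use K j in auto)
        qed auto
        then show ?thesis by simp
      qed
    qed auto
  qed
qed

lemma differentiable_imp_linear_bound:
  fixes K :: "'c::real_normed_vector \<Rightarrow> 'b::real_normed_vector"
  assumes "K differentiable (at 0)" "K 0 = 0"
  obtains C d where "C \<ge> 0" "d > 0" "\<And>w. norm w < d \<Longrightarrow> norm (K w) \<le> C * norm w"
proof -
  obtain K' where K': "(K has_derivative K') (at 0)" using assms(1) by (auto simp: differentiable_def)
  then have bl: "bounded_linear K'" by (rule has_derivative_bounded_linear)
  obtain d where d: "d > 0" "\<And>y. norm y < d \<Longrightarrow> norm (K y - K' y) \<le> norm y"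
    using K' assms(2) unfolding has_derivative_at_alt by (metis diff_zero mult_1 zero_less_one)
  show ?thesis
  proof (rule that[of "1 + onorm K'" d])
    show "norm (K w) \<le> (1 + onorm K') * norm w" if "norm w < d" for w
    proof -
      have "norm (K w) \<le> norm (K w - K' w) + norm (K' w)"
        using norm_triangle_ineq[of "K w - K' w" "K' w"] by simp
      also have "\<dots> \<le> norm w + onorm K' * norm w"
        by (intro add_mono d(2)[OF that] onorm[OF bl])
      finally show ?thesis by (simp add: algebra_simps)
    qed
  qed (use d onorm_pos_le[OF bl] in auto)
qed

text \<open>Blowing up a map at a zero.  The rescaled maps \<open>\<rho>\<^sup>-\<^sup>1 K(\<rho> R)\<close> tend to the linear part.\<close>

lemma Cr_tends_rescale:
  fixes P :: "nat \<Rightarrow> 'a::euclidean_space \<Rightarrow> 'c::euclidean_space"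
    and K :: "'c \<Rightarrow> 'b::real_normed_vector"
  assumes P: "Cr_tends (Suc r) P p" and p0: "p 0 = 0" and U: "open U" "0 \<in> U"
    and K: "Ck_on (Suc r) K U" and K0: "K 0 = 0"
    and rho: "rho \<longlonglongrightarrow> 0" "\<And>k. rho k \<noteq> (0::real)"
  shows "Cr_tends (Suc r) (\<lambda>k x. (1 / rho k) *\<^sub>R K (rho k *\<^sub>R P k x)) (\<lambda>x. frechet_derivative K (at 0) (p x))"
proof -
  have rP: "Cr_tends (Suc r) (\<lambda>k x. rho k *\<^sub>R P k x) (\<lambda>x. 0)"
    using Cr_tends_scaleR[OF Cr_tends_const[OF rho(1)] P] by simp
  have inU: "\<forall>\<^sub>F k in sequentially. \<forall>x\<in>ball 0 R. rho k *\<^sub>R P k x \<in> U" for R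
  proof -
    obtain e where e: "e > 0" "ball 0 e \<subseteq> U" using U openE by blast
    have "\<forall>\<^sub>F k in sequentially. \<forall>x\<in>ball 0 R. dist (rho k *\<^sub>R P k x) 0 < e"
      by (rule uniform_limitD[OF loc_unif_limit[OF Cr_tends_loc_unif[OF rP]] e(1)])
    then show ?thesis by eventually_elim (use e in \<open>auto simp: dist_commute\<close>)
  qed
  have dK: "K differentiable (at w)" if "w \<in> U" for w using K that by auto
  let ?D = "\<lambda>k x h. \<Sum>j\<in>Basis. (frechet_derivative (P k) (at x) h \<bullet> j) *\<^sub>R
    frechet_derivative K (at (rho k *\<^sub>R P k x)) j"
  let ?D' = "\<lambda>x h. \<Sum>j\<in>Basis. (frechet_derivative p (at x) h \<bullet> j) *\<^sub>R frechet_derivative K (at 0) j"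
  show ?thesis
  proof (rule Cr_tends_of_derivative[where D="?D" and D'="?D'"])
    show "((\<lambda>x. frechet_derivative K (at 0) (p x)) has_derivative ?D' x) (at x)" for x
    proof -
      have "bounded_linear (frechet_derivative K (at 0))"
        using has_frechet_derivative[OF dK[OF U(2)]] by (rule has_derivative_bounded_linear)
      then have "((\<lambda>x. frechet_derivative K (at 0) (p x)) has_derivative
          (\<lambda>h. frechet_derivative K (at 0) (frechet_derivative p (at x) h))) (at x)"
        by (rule bounded_linear.has_derivative) (rule Cr_tends_SucE(2)[OF P])
      then show ?thesis using dK[OF U(2)] by (subst frechet_derivative_expand[symmetric]) auto
    qed
    show "\<forall>\<^sub>F k in sequentially. \<forall>x\<in>ball 0 R.
        ((\<lambda>x. (1 / rho k) *\<^sub>R K (rho k *\<^sub>R P k x)) has_derivative ?D k x) (at x)" for R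
      using Cr_tends_SucE(1)[OF P, of R] inU[of R]
    proof eventually_elim
      case (elim k)
      show ?case
      proof
        fix x :: 'a assume x: "x \<in> ball 0 R"
        then have i: "rho k *\<^sub>R P k x \<in> U" using elim by auto
        note d = dK[OF i]
        have "((\<lambda>x. rho k *\<^sub>R P k x) has_derivative (\<lambda>h. rho k *\<^sub>R frechet_derivative (P k) (at x) h)) (at x)"
          using elim x by (intro has_derivative_scaleR_right) auto
        then have "((\<lambda>x. K (rho k *\<^sub>R P k x)) has_derivative
            (\<lambda>h. frechet_derivative K (at (rho k *\<^sub>R P k x)) (rho k *\<^sub>R frechet_derivative (P k) (at x) h))) (at x)"
          by (rule has_derivative_compose) (rule has_frechet_derivative[OF d])
        then have "((\<lambda>x. (1 / rho k) *\<^sub>R K (rho k *\<^sub>R P k x)) has_derivative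
            (\<lambda>h. (1 / rho k) *\<^sub>R frechet_derivative K (at (rho k *\<^sub>R P k x)) (rho k *\<^sub>R frechet_derivative (P k) (at x) h))) (at x)"
          by (rule has_derivative_scaleR_right)
        moreover have "(\<lambda>h. (1 / rho k) *\<^sub>R frechet_derivative K (at (rho k *\<^sub>R P k x)) (rho k *\<^sub>R frechet_derivative (P k) (at x) h))
            = ?D k x"
          using rho(2)[of k] linear_scale[OF linear_frechet_derivative[OF d]]
          by (subst frechet_derivative_expand[OF d, symmetric]) auto
        ultimately show "((\<lambda>x. (1 / rho k) *\<^sub>R K (rho k *\<^sub>R P k x)) has_derivative ?D k x) (at x)" by simp
      qed
    qed
    show "Cr_tends r (\<lambda>k x. ?D k x i) (\<lambda>x. ?D' x i)" if i: "i \<in> Basis" for i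
    proof (intro Cr_tends_sum Cr_tends_scaleR)
      fix j :: 'c assume j: "j \<in> Basis"
      show "Cr_tends r (\<lambda>k x. frechet_derivative (P k) (at x) i \<bullet> j) (\<lambda>x. frechet_derivative p (at x) i \<bullet> j)"
        by (rule Cr_tends_compose_linear[OF bounded_linear_inner_left Cr_tends_SucE(3)[OF P i]])
      show "Cr_tends r (\<lambda>k x. frechet_derivative K (at (rho k *\<^sub>R P k x)) j) (\<lambda>x. frechet_derivative K (at 0) j)"
        by (rule Cr_tends_compose_near_0[OF Cr_tends_Suc_D[OF rP] U]) (use K j in auto)
    qed auto
    obtain C d where C: "C \<ge> 0" "d > 0" "\<And>w. norm w < d \<Longrightarrow> norm (K w) \<le> C * norm w"
      using differentiable_imp_linear_bound[OF dK[OF U(2)] K0] by blast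
    have P0: "(\<lambda>k. P k 0) \<longlonglongrightarrow> 0"
      using tendsto_uniform_limitI[OF loc_unif_limit[OF Cr_tends_loc_unif[OF P], of 1], of 0] p0 by simp
    have "(\<lambda>k. rho k *\<^sub>R P k 0) \<longlonglongrightarrow> 0" using tendsto_scaleR[OF rho(1) P0] by simp
    then have "\<forall>\<^sub>F k in sequentially. norm (rho k *\<^sub>R P k 0) < d"
      using C(2) by (simp add: tendsto_iff dist_norm)
    then have "\<forall>\<^sub>F k in sequentially. norm ((1 / rho k) *\<^sub>R K (rho k *\<^sub>R P k 0)) \<le> C * norm (P k 0)"
    proof eventually_elim
      case (elim k)
      have "norm ((1 / rho k) *\<^sub>R K (rho k *\<^sub>R P k 0)) = norm (K (rho k *\<^sub>R P k 0)) / \<bar>rho k\<bar>" by simp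
      also have "\<dots> \<le> (C * norm (rho k *\<^sub>R P k 0)) / \<bar>rho k\<bar>"
        by (intro divide_right_mono C(3) elim) auto
      also have "\<dots> = C * norm (P k 0)" using rho(2)[of k] by simp
      finally show ?case .
    qed
    moreover have "(\<lambda>k. C * norm (P k 0)) \<longlonglongrightarrow> 0"
      using tendsto_mult[OF tendsto_const tendsto_norm[OF P0], of C] by simp
    ultimately have "(\<lambda>k. (1 / rho k) *\<^sub>R K (rho k *\<^sub>R P k 0)) \<longlonglongrightarrow> 0" by (rule Lim_null_comparison)
    moreover have "frechet_derivative K (at 0) (p 0) = 0"
      using linear_0[OF linear_frechet_derivative[OF dK[OF U(2)]]] p0 by simp
    ultimately show "(\<lambda>k. (1 / rho k) *\<^sub>R K (rho k *\<^sub>R P k 0)) \<longlonglongrightarrow> frechet_derivative K (at 0) (p 0)" by simp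
  qed
qed

text \<open>The partial derivatives of \<open>H\<close> vanish at the origin and are differentiable there, hence bounded by
  a multiple of the norm; the mean value inequality then gains one order.\<close>

lemma second_order_bound:
  fixes H :: "'c::euclidean_space \<Rightarrow> 'b::real_normed_vector"
  assumes U: "open U" "0 \<in> U" and H: "Ck_on (Suc (Suc 0)) H U" and H0: "H 0 = 0"
    and dH0: "\<And>j. j \<in> Basis \<Longrightarrow> frechet_derivative H (at 0) j = 0"
  obtains C d where "C \<ge> 0" "d > 0" "\<And>w. norm w < d \<Longrightarrow> norm (H w) \<le> C * norm w ^ 2"
proof -
  have "\<forall>j\<in>Basis. \<exists>C d. C \<ge> 0 \<and> d > 0 \<and> (\<forall>w. norm w < d \<longrightarrow> norm (frechet_derivative H (at w) j) \<le> C * norm w)"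
  proof
    fix j :: 'c assume j: "j \<in> Basis"
    then have "(\<lambda>w. frechet_derivative H (at w) j) differentiable (at 0)" using H U by auto
    from differentiable_imp_linear_bound[OF this dH0[OF j]]
    show "\<exists>C d. C \<ge> 0 \<and> d > 0 \<and> (\<forall>w. norm w < d \<longrightarrow> norm (frechet_derivative H (at w) j) \<le> C * norm w)"
      by metis
  qed
  then obtain C d where C: "\<And>j. j \<in> Basis \<Longrightarrow> C j \<ge> 0" and d: "\<And>j. j \<in> Basis \<Longrightarrow> d j > 0"
    and Cd: "\<And>j w. j \<in> Basis \<Longrightarrow> norm w < d j \<Longrightarrow> norm (frechet_derivative H (at w) j) \<le> C j * norm w"
    by metis
  obtain e where e: "e > 0" "ball 0 e \<subseteq> U" using U openE by blast
  define D where "D = Min (insert e (d ` Basis))"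
  have D: "D > 0" "D \<le> e" using e d by (auto simp: D_def)
  have Dd: "D \<le> d j" if "j \<in> Basis" for j unfolding D_def by (rule Min_le) (use that in auto)
  define B where "B = (\<Sum>j\<in>Basis. C j)"
  have B: "B \<ge> 0" using C by (auto simp: B_def intro: sum_nonneg)
  show ?thesis
  proof (rule that[OF B D(1)])
    fix w :: 'c assume w: "norm w < D"
    have "norm (H w - H 0) \<le> (B * norm w) * norm (w - 0)"
    proof (rule differentiable_bound[of "cball 0 (norm w)" H "\<lambda>x. frechet_derivative H (at x)"])
      fix x :: 'c assume x: "x \<in> cball 0 (norm w)"
      then have xU: "x \<in> U" using w D(2) e(2) by auto
      have hd: "(H has_derivative frechet_derivative H (at x)) (at x)" by (rule Ck_on_has_derivative[OF H xU])
      then show "(H has_derivative frechet_derivative H (at x)) (at x within cball 0 (norm w))"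
        by (rule has_derivative_at_withinI)
      have "onorm (frechet_derivative H (at x)) \<le> (\<Sum>j\<in>Basis. norm (frechet_derivative H (at x) j))"
        by (rule onorm_componentwise) (rule has_derivative_bounded_linear[OF hd])
      also have "\<dots> \<le> (\<Sum>j\<in>Basis. C j * norm w)"
      proof (rule sum_mono)
        fix j :: 'c assume j: "j \<in> Basis"
        have "norm x < d j" using x w Dd[OF j] by auto
        then have "norm (frechet_derivative H (at x) j) \<le> C j * norm x" by (rule Cd[OF j])
        also have "\<dots> \<le> C j * norm w" using x C[OF j] by (intro mult_left_mono) auto
        finally show "norm (frechet_derivative H (at x) j) \<le> C j * norm w" .
      qed
      finally show "onorm (frechet_derivative H (at x)) \<le> B * norm w" by (simp add: B_def sum_distrib_right)
    qed auto
    then show "norm (H w) \<le> B * norm w ^ 2" by (simp add: H0 power2_eq_square mult.assoc)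
  qed
qed

text \<open>The second blow-up.  The derivative of \<open>\<rho>\<^sup>-\<^sup>2 H(\<rho> P)\<close> is a combination of the
  first blow-ups of the partial derivatives of \<open>H\<close>; it tends to zero as soon as the second
  derivative of \<open>H\<close> vanishes along the limit \<open>p\<close> of the \<open>P\<close>.\<close>

lemma Cr_tends_rescale2:
  fixes P :: "nat \<Rightarrow> 'a::euclidean_space \<Rightarrow> 'c::euclidean_space"
    and H :: "'c \<Rightarrow> 'b::real_normed_vector"
  assumes P: "Cr_tends (Suc (Suc r)) P p" and p0: "p 0 = 0" and U: "open U" "0 \<in> U"
    and H: "Ck_on (Suc (Suc r)) H U" and H0: "H 0 = 0"
    and dH0: "\<And>j. j \<in> Basis \<Longrightarrow> frechet_derivative H (at 0) j = 0"
    and ddH0: "\<And>x i. i \<in> Basis \<Longrightarrow> (\<Sum>j\<in>Basis. (frechet_derivative p (at x) i \<bullet> j) *\<^sub>R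
        frechet_derivative (\<lambda>w. frechet_derivative H (at w) j) (at 0) (p x)) = 0"
    and rho: "rho \<longlonglongrightarrow> 0" "\<And>k. rho k \<noteq> (0::real)"
  shows "Cr_tends (Suc (Suc r)) (\<lambda>k x. (1 / rho k ^ 2) *\<^sub>R H (rho k *\<^sub>R P k x)) (\<lambda>x. 0)"
proof -
  have rP: "Cr_tends (Suc r) (\<lambda>k x. rho k *\<^sub>R P k x) (\<lambda>x. 0)"
    using Cr_tends_scaleR[OF Cr_tends_const[OF rho(1)] Cr_tends_Suc_D[OF P]] by simp
  have inU: "\<forall>\<^sub>F k in sequentially. \<forall>x\<in>ball 0 R. rho k *\<^sub>R P k x \<in> U" for R
  proof -
    obtain e where e: "e > 0" "ball 0 e \<subseteq> U" using U openE by blast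
    have "\<forall>\<^sub>F k in sequentially. \<forall>x\<in>ball 0 R. dist (rho k *\<^sub>R P k x) 0 < e"
      by (rule uniform_limitD[OF loc_unif_limit[OF Cr_tends_loc_unif[OF rP]] e(1)])
    then show ?thesis by eventually_elim (use e in \<open>auto simp: dist_commute\<close>)
  qed
  have dH: "H differentiable (at w)" if "w \<in> U" for w using H that by auto
  let ?D = "\<lambda>k x h. \<Sum>j\<in>Basis. (frechet_derivative (P k) (at x) h \<bullet> j) *\<^sub>R
    ((1 / rho k) *\<^sub>R frechet_derivative H (at (rho k *\<^sub>R P k x)) j)"
  show ?thesis
  proof (rule Cr_tends_of_derivative[where D="?D" and D'="\<lambda>x h. 0"])
    show "\<forall>\<^sub>F k in sequentially. \<forall>x\<in>ball 0 R.
        ((\<lambda>x. (1 / rho k ^ 2) *\<^sub>R H (rho k *\<^sub>R P k x)) has_derivative ?D k x) (at x)" for R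
      using Cr_tends_SucE(1)[OF P, of R] inU[of R]
    proof eventually_elim
      case (elim k)
      show ?case
      proof
        fix x :: 'a assume x: "x \<in> ball 0 R"
        then have i: "rho k *\<^sub>R P k x \<in> U" using elim by auto
        note d = dH[OF i]
        have "((\<lambda>x. rho k *\<^sub>R P k x) has_derivative (\<lambda>h. rho k *\<^sub>R frechet_derivative (P k) (at x) h)) (at x)"
          using elim x by (intro has_derivative_scaleR_right) auto
        then have "((\<lambda>x. H (rho k *\<^sub>R P k x)) has_derivative
            (\<lambda>h. frechet_derivative H (at (rho k *\<^sub>R P k x)) (rho k *\<^sub>R frechet_derivative (P k) (at x) h))) (at x)"
          by (rule has_derivative_compose) (rule has_frechet_derivative[OF d])
        then have "((\<lambda>x. (1 / rho k ^ 2) *\<^sub>R H (rho k *\<^sub>R P k x)) has_derivative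
            (\<lambda>h. (1 / rho k ^ 2) *\<^sub>R frechet_derivative H (at (rho k *\<^sub>R P k x)) (rho k *\<^sub>R frechet_derivative (P k) (at x) h))) (at x)"
          by (rule has_derivative_scaleR_right)
        moreover have "(1 / rho k ^ 2) *\<^sub>R frechet_derivative H (at (rho k *\<^sub>R P k x)) (rho k *\<^sub>R frechet_derivative (P k) (at x) h)
            = ?D k x h" for h
        proof -
          have "?D k x h = (1 / rho k) *\<^sub>R frechet_derivative H (at (rho k *\<^sub>R P k x)) (frechet_derivative (P k) (at x) h)"
            by (subst frechet_derivative_expand[OF d]) (simp add: scaleR_sum_right mult.commute)
          then show ?thesis using rho(2)[of k] linear_scale[OF linear_frechet_derivative[OF d]]
            by (simp add: power2_eq_square)
        qed
        ultimately show "((\<lambda>x. (1 / rho k ^ 2) *\<^sub>R H (rho k *\<^sub>R P k x)) has_derivative ?D k x) (at x)" by simp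
      qed
    qed
    show "Cr_tends (Suc r) (\<lambda>k x. ?D k x i) (\<lambda>x. 0)" if i: "i \<in> Basis" for i
    proof -
      have "Cr_tends (Suc r) (\<lambda>k x. ?D k x i) (\<lambda>x. \<Sum>j\<in>Basis. (frechet_derivative p (at x) i \<bullet> j) *\<^sub>R
        frechet_derivative (\<lambda>w. frechet_derivative H (at w) j) (at 0) (p x))"
      proof (intro Cr_tends_sum Cr_tends_scaleR[where F="\<lambda>k x. frechet_derivative (P k) (at x) i \<bullet> j" for j])
        fix j :: 'c assume j: "j \<in> Basis"
        show "Cr_tends (Suc r) (\<lambda>k x. frechet_derivative (P k) (at x) i \<bullet> j) (\<lambda>x. frechet_derivative p (at x) i \<bullet> j)"
          by (rule Cr_tends_compose_linear[OF bounded_linear_inner_left Cr_tends_SucE(3)[OF P i]])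
        show "Cr_tends (Suc r) (\<lambda>k x. (1 / rho k) *\<^sub>R frechet_derivative H (at (rho k *\<^sub>R P k x)) j)
           (\<lambda>x. frechet_derivative (\<lambda>w. frechet_derivative H (at w) j) (at 0) (p x))"
          by (rule Cr_tends_rescale[where K="\<lambda>w. frechet_derivative H (at w) j",
                OF Cr_tends_Suc_D[OF P] p0 U _ dH0[OF j] rho]) (use H j in auto)
      qed auto
      then show ?thesis by (simp only: ddH0[OF i])
    qed
    obtain C d where C: "C \<ge> 0" "d > 0" "\<And>w. norm w < d \<Longrightarrow> norm (H w) \<le> C * norm w ^ 2"
      using second_order_bound[OF U Ck_on_le[OF H] H0 dH0] by auto
    have P0: "(\<lambda>k. P k 0) \<longlonglongrightarrow> 0"
      using tendsto_uniform_limitI[OF loc_unif_limit[OF Cr_tends_loc_unif[OF P], of 1], of 0] p0 by simp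
    have "(\<lambda>k. rho k *\<^sub>R P k 0) \<longlonglongrightarrow> 0" using tendsto_scaleR[OF rho(1) P0] by simp
    then have "\<forall>\<^sub>F k in sequentially. norm (rho k *\<^sub>R P k 0) < d"
      using C(2) by (simp add: tendsto_iff dist_norm)
    then have "\<forall>\<^sub>F k in sequentially. norm ((1 / rho k ^ 2) *\<^sub>R H (rho k *\<^sub>R P k 0)) \<le> C * norm (P k 0) ^ 2"
    proof eventually_elim
      case (elim k)
      have "norm ((1 / rho k ^ 2) *\<^sub>R H (rho k *\<^sub>R P k 0)) = norm (H (rho k *\<^sub>R P k 0)) / rho k ^ 2" by simp
      also have "\<dots> \<le> (C * norm (rho k *\<^sub>R P k 0) ^ 2) / rho k ^ 2"
        by (intro divide_right_mono C(3) elim) auto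
      also have "\<dots> = C * norm (P k 0) ^ 2" using rho(2)[of k] by (simp add: power_mult_distrib)
      finally show ?case .
    qed
    moreover have "(\<lambda>k. C * norm (P k 0) ^ 2) \<longlonglongrightarrow> 0"
      using tendsto_mult[OF tendsto_const tendsto_power[OF tendsto_norm[OF P0], of 2], of C] by simp
    ultimately show "(\<lambda>k. (1 / rho k ^ 2) *\<^sub>R H (rho k *\<^sub>R P k 0)) \<longlonglongrightarrow> 0" by (rule Lim_null_comparison)
  qed auto
qed

corollary Cr_tends_rescale2_0:
  fixes P :: "nat \<Rightarrow> 'a::euclidean_space \<Rightarrow> 'c::euclidean_space"
    and H :: "'c \<Rightarrow> 'b::real_normed_vector"
  assumes P: "Cr_tends (Suc (Suc r)) P (\<lambda>x. 0)" and U: "open U" "0 \<in> U"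
    and H: "Ck_on (Suc (Suc r)) H U" and H0: "H 0 = 0"
    and dH0: "\<And>j. j \<in> Basis \<Longrightarrow> frechet_derivative H (at 0) j = 0"
    and rho: "rho \<longlonglongrightarrow> 0" "\<And>k. rho k \<noteq> (0::real)"
  shows "Cr_tends (Suc (Suc r)) (\<lambda>k x. (1 / rho k ^ 2) *\<^sub>R H (rho k *\<^sub>R P k x)) (\<lambda>x. 0)"
  by (rule Cr_tends_rescale2[OF P _ U H H0 dH0 _ rho]) auto

section \<open>Smooth maps and families on the manifold\<close>

lemma is_chartD:
  assumes "is_chart c"
  shows "open (fst c)" "open (snd c ` fst c)"
    "x \<in> fst c \<Longrightarrow> chart_inv c (snd c x) = x"
    "u \<in> snd c ` fst c \<Longrightarrow> snd c (chart_inv c u) = u"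
    "u \<in> snd c ` fst c \<Longrightarrow> chart_inv c u \<in> fst c"
    "continuous_on (fst c) (snd c)" "continuous_on (snd c ` fst c) (chart_inv c)"
  using assms unfolding is_chart_def homeomorphism_def by auto

lemma is_chart_isCont:
  assumes "is_chart c"
  shows "x \<in> fst c \<Longrightarrow> isCont (snd c) x" "u \<in> snd c ` fst c \<Longrightarrow> isCont (chart_inv c) u"
  using is_chartD[OF assms] by (metis continuous_on_eq_continuous_at)+

lemma is_chart_open_image:
  assumes c: "is_chart c" and "open V" "V \<subseteq> fst c" shows "open (snd c ` V)"
proof -
  have "snd c ` V = snd c ` fst c \<inter> chart_inv c -` V"
    using is_chartD[OF c] assms(3) by (force simp: image_iff)
  then show ?thesis
    using continuous_on_open_vimage[OF is_chartD(2)[OF c]] is_chartD(7)[OF c] assms(2)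
    by (metis Int_commute)
qed

lemma is_chart_open_inv_image:
  assumes c: "is_chart c" and "open V" "V \<subseteq> snd c ` fst c" shows "open (chart_inv c ` V)"
proof -
  have "chart_inv c ` V = fst c \<inter> snd c -` V"
    using is_chartD[OF c] assms(3) by (force simp: image_iff)
  then show ?thesis
    using continuous_on_open_vimage[OF is_chartD(1)[OF c]] is_chartD(6)[OF c] assms(2)
    by (metis Int_commute)
qed

lemma isCont_eventually_in:
  assumes "isCont F y" "open V" "F y \<in> V"
  shows "\<forall>\<^sub>F z in nhds y. F z \<in> V"
  using topological_tendstoD[of F "F y" "nhds y" V] assms
  by (simp add: isCont_def tendsto_at_iff_tendsto_nhds)

text \<open>Smoothness jointly in the parameter and the point, near a given pair.  The separate requirement of
  continuity ensures that nearby pairs are seen in the same two charts.\<close>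

definition smooth_family_at ::
    "nat \<Rightarrow> 'm::t2_space chart set \<Rightarrow> ('p::euclidean_space \<Rightarrow> 'm \<Rightarrow> 'm) \<Rightarrow> 'p \<Rightarrow> 'm \<Rightarrow> bool" where
  "smooth_family_at r \<A> G p x \<longleftrightarrow>
     (\<exists>N. open N \<and> (p, x) \<in> N \<and> continuous_on N (\<lambda>z. G (fst z) (snd z))) \<and>
     (\<forall>c d. Cr_chart r \<A> c \<and> Cr_chart r \<A> d \<and> x \<in> fst c \<and> G p x \<in> fst d \<longrightarrow>
        Ck_at r (\<lambda>z. snd d (G (fst z) (chart_inv c (snd z)))) (p, snd c x))"

lemma smooth_family_at_isCont:
  "smooth_family_at r \<A> G p x \<Longrightarrow> isCont (\<lambda>z. G (fst z) (snd z)) (p, x)"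
  unfolding smooth_family_at_def by (metis continuous_on_eq_continuous_at)

lemma smooth_family_at_joint_expression:
  assumes "smooth_family_at r \<A> G p x" "Cr_chart r \<A> c" "Cr_chart r \<A> d" "x \<in> fst c" "G p x \<in> fst d"
  shows "Ck_at r (\<lambda>z. snd d (G (fst z) (chart_inv c (snd z)))) (p, snd c x)"
  using assms unfolding smooth_family_at_def by blast

lemma Cr_chart_is_chart: "Cr_chart r \<A> c \<Longrightarrow> is_chart c"
  by (simp add: Cr_chart_def)

text \<open>A map of \<open>\<real>\<^sup>3\<close> that is the identity off a compact part of a chart is transported
  to the manifold.\<close>

definition lift :: "'m chart \<Rightarrow> (R3 \<Rightarrow> R3) \<Rightarrow> 'm \<Rightarrow> 'm" where
  "lift c g q = (if q \<in> fst c then chart_inv c (g (snd c q)) else q)"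

context
  fixes \<A> :: "'m::t2_space chart set"
  assumes \<A>: "closed_3_manifold \<A>"
begin

lemma atlas_is_chart: "c \<in> \<A> \<Longrightarrow> is_chart c"
  using \<A> by (auto simp: closed_3_manifold_def)

lemma atlas_Cr_chart: "c \<in> \<A> \<Longrightarrow> Cr_chart r \<A> c"
  using \<A> by (auto simp: closed_3_manifold_def Cr_chart_def)

lemma atlas_covers: obtains c where "c \<in> \<A>" "x \<in> fst c"
  using \<A> unfolding closed_3_manifold_def by blast

lemma chart_change:
  assumes c: "Cr_chart r \<A> c" and d: "Cr_chart r \<A> d" and x: "x \<in> fst c" "x \<in> fst d"
  shows "Ck_at r (\<lambda>u. snd d (chart_inv c u)) (snd c x)"
proof -
  obtain e where e: "e \<in> \<A>" "x \<in> fst e" by (rule atlas_covers)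
  note ic = Cr_chart_is_chart[OF c] and id = Cr_chart_is_chart[OF d] and ie = atlas_is_chart[OF e(1)]
  have 1: "Ck_on r (snd e \<circ> chart_inv c) (snd c ` (fst c \<inter> fst e))"
    and 2: "Ck_on r (snd d \<circ> chart_inv e) (snd e ` (fst d \<inter> fst e))"
    using c d e by (auto simp: Cr_chart_def compatible_def)
  have o1: "open (snd c ` (fst c \<inter> fst e))"
    by (rule is_chart_open_image[OF ic open_Int[OF is_chartD(1)[OF ic] is_chartD(1)[OF ie]]]) simp
  have o2: "open (snd e ` (fst d \<inter> fst e))"
    by (rule is_chart_open_image[OF ie open_Int[OF is_chartD(1)[OF id] is_chartD(1)[OF ie]]]) simp
  have "Ck_at r (\<lambda>u. snd e (chart_inv c u)) (snd c x)"
    using Ck_on_imp_at[OF o1 1 imageI, of x] x e by (simp add: o_def)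
  moreover have "Ck_at r (\<lambda>u. snd d (chart_inv e u)) (snd e x)"
    using Ck_on_imp_at[OF o2 2 imageI, of x] x e by (simp add: o_def)
  ultimately have "Ck_at r (\<lambda>u. snd d (chart_inv e (snd e (chart_inv c u)))) (snd c x)"
    using x is_chartD(3)[OF ic] Ck_at_compose[of r "\<lambda>u. snd e (chart_inv c u)" "snd c x" "\<lambda>u. snd d (chart_inv e u)"]
    by simp
  moreover have "\<forall>\<^sub>F u in nhds (snd c x). snd d (chart_inv e (snd e (chart_inv c u))) = snd d (chart_inv c u)"
    unfolding eventually_nhds
    by (rule exI[of _ "snd c ` (fst c \<inter> fst e)"]) (use o1 x e is_chartD[OF ic] is_chartD[OF ie] in auto)
  ultimately show ?thesis by (rule Ck_at_cong)
qed

text \<open>One pair of charts suffices: any other pair gives an expression that differs by smooth changes of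
  coordinates on both sides.\<close>

lemma smooth_family_atI:
  assumes N: "open N" "(p, x) \<in> N" "continuous_on N (\<lambda>z. G (fst z) (snd z))"
    and c: "Cr_chart r \<A> c" "x \<in> fst c" and d: "Cr_chart r \<A> d" "G p x \<in> fst d"
    and k: "Ck_at r (\<lambda>z. snd d (G (fst z) (chart_inv c (snd z)))) (p, snd c x)"
  shows "smooth_family_at r \<A> G p x"
  unfolding smooth_family_at_def
proof (intro conjI allI impI)
  show "\<exists>N. open N \<and> (p, x) \<in> N \<and> continuous_on N (\<lambda>z. G (fst z) (snd z))" using N by blast
  fix c' d' :: "'m chart"
  assume "Cr_chart r \<A> c' \<and> Cr_chart r \<A> d' \<and> x \<in> fst c' \<and> G p x \<in> fst d'"
  then have c': "Cr_chart r \<A> c'" "x \<in> fst c'" and d': "Cr_chart r \<A> d'" "G p x \<in> fst d'" by auto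
  note ic = Cr_chart_is_chart[OF c(1)] and id = Cr_chart_is_chart[OF d(1)]
    and ic' = Cr_chart_is_chart[OF c'(1)] and id' = Cr_chart_is_chart[OF d'(1)]
  let ?E = "\<lambda>z. snd d (G (fst z) (chart_inv c (snd z)))"
  let ?g = "\<lambda>z. (fst z, snd c (chart_inv c' (snd z)))"
  have "Ck_at r (\<lambda>z. snd c (chart_inv c' (snd z))) (p, snd c' x)"
    by (rule Ck_at_compose[where f=snd]) (use chart_change[OF c'(1) c(1) c'(2) c(2)] in
        \<open>auto intro: Ck_at_bounded_linear bounded_linear_snd\<close>)
  then have g: "Ck_at r ?g (p, snd c' x)"
    by (intro Ck_at_Pair) (auto intro: Ck_at_bounded_linear bounded_linear_fst)
  have gx: "?g (p, snd c' x) = (p, snd c x)" using is_chartD[OF ic'] c' by simp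
  have Eg: "Ck_at r (\<lambda>z. ?E (?g z)) (p, snd c' x)"
    by (rule Ck_at_compose[OF g]) (use k gx in simp)
  have "Ck_at r (\<lambda>u. snd d' (chart_inv d u)) (?E (?g (p, snd c' x)))"
    using chart_change[OF d(1) d'(1) d(2) d'(2)] gx is_chartD[OF ic] c by simp
  from Ck_at_compose[OF Eg this]
  have A: "Ck_at r (\<lambda>z. snd d' (chart_inv d (?E (?g z)))) (p, snd c' x)" .
  show "Ck_at r (\<lambda>z. snd d' (G (fst z) (chart_inv c' (snd z)))) (p, snd c' x)"
  proof (rule Ck_at_cong[OF A])
    have cc: "isCont (\<lambda>z. chart_inv c' (snd z)) (p, snd c' x)"
      by (rule isCont_o2[where f=snd]) (use is_chart_isCont[OF ic'] c' in auto)
    have i: "chart_inv c' (snd c' x) = x" using is_chartD[OF ic'] c' by simp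
    have "isCont (\<lambda>z. (fst z, chart_inv c' (snd z))) (p, snd c' x)"
      by (intro continuous_intros cc)
    moreover have "isCont (\<lambda>z. G (fst z) (snd z)) (fst (p, snd c' x), chart_inv c' (snd (p, snd c' x)))"
      using N i by (simp add: continuous_on_eq_continuous_at)
    ultimately have "isCont (\<lambda>z. G (fst z) (chart_inv c' (snd z))) (p, snd c' x)"
      using isCont_o2[of "(p, snd c' x)" "\<lambda>z. (fst z, chart_inv c' (snd z))" "\<lambda>z. G (fst z) (snd z)"] by simp
    from isCont_eventually_in[OF this is_chartD(1)[OF id]]
    have e1: "\<forall>\<^sub>F z in nhds (p, snd c' x). G (fst z) (chart_inv c' (snd z)) \<in> fst d" using d i by simp
    have e2: "\<forall>\<^sub>F z in nhds (p, snd c' x). chart_inv c' (snd z) \<in> fst c"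
      using isCont_eventually_in[OF cc is_chartD(1)[OF ic]] c i by simp
    show "\<forall>\<^sub>F z in nhds (p, snd c' x). snd d' (chart_inv d (?E (?g z))) = snd d' (G (fst z) (chart_inv c' (snd z)))"
      using e1 e2 by eventually_elim (simp add: is_chartD[OF ic] is_chartD[OF id])
  qed
qed

text \<open>The parameter is carried along as an additional coordinate, which turns a composition of families
  into a composition of maps.\<close>

lemma smooth_family_at_compose:
  assumes G: "smooth_family_at r \<A> G p x" and H: "smooth_family_at r \<A> H p (G p x)"
  shows "smooth_family_at r \<A> (\<lambda>p x. H p (G p x)) p x"
proof -
  obtain N where N: "open N" "(p, x) \<in> N" "continuous_on N (\<lambda>z. G (fst z) (snd z))"
    using G unfolding smooth_family_at_def by blast
  obtain N' where N': "open N'" "(p, G p x) \<in> N'" "continuous_on N' (\<lambda>z. H (fst z) (snd z))"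
    using H unfolding smooth_family_at_def by blast
  have cg: "continuous_on N (\<lambda>z. (fst z, G (fst z) (snd z)))" by (intro continuous_intros N)
  define N2 where "N2 = (\<lambda>z. (fst z, G (fst z) (snd z))) -` N' \<inter> N"
  have o2: "open N2" unfolding N2_def using continuous_on_open_vimage[OF N(1)] cg N'(1) by blast
  have c2: "continuous_on N2 (\<lambda>z. H (fst z) (G (fst z) (snd z)))"
    using continuous_on_compose2[OF N'(3) continuous_on_subset[OF cg, of N2]] by (auto simp: N2_def)
  obtain c where c: "c \<in> \<A>" "x \<in> fst c" by (rule atlas_covers)
  obtain d where d: "d \<in> \<A>" "G p x \<in> fst d" by (rule atlas_covers)
  obtain e where e: "e \<in> \<A>" "H p (G p x) \<in> fst e" by (rule atlas_covers)
  note ic = atlas_is_chart[OF c(1)] and id = atlas_is_chart[OF d(1)]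
  have kG: "Ck_at r (\<lambda>z. snd d (G (fst z) (chart_inv c (snd z)))) (p, snd c x)"
    by (rule smooth_family_at_joint_expression[OF G atlas_Cr_chart[OF c(1)] atlas_Cr_chart[OF d(1)] c(2) d(2)])
  have kH: "Ck_at r (\<lambda>z. snd e (H (fst z) (chart_inv d (snd z)))) (p, snd d (G p x))"
    by (rule smooth_family_at_joint_expression[OF H atlas_Cr_chart[OF d(1)] atlas_Cr_chart[OF e(1)] d(2) e(2)])
  let ?g = "\<lambda>z. (fst z, snd d (G (fst z) (chart_inv c (snd z))))"
  have g: "Ck_at r ?g (p, snd c x)"
    by (intro Ck_at_Pair kG) (auto intro: Ck_at_bounded_linear bounded_linear_fst)
  have A: "Ck_at r (\<lambda>z. snd e (H (fst (?g z)) (chart_inv d (snd (?g z))))) (p, snd c x)"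
    by (rule Ck_at_compose[OF g]) (use kH is_chartD[OF ic] c in simp)
  show ?thesis
  proof (rule smooth_family_atI[OF o2 _ c2 atlas_Cr_chart[OF c(1)] c(2) atlas_Cr_chart[OF e(1)] e(2)])
    show "(p, x) \<in> N2" using N N' by (simp add: N2_def)
    show "Ck_at r (\<lambda>z. snd e (H (fst z) (G (fst z) (chart_inv c (snd z))))) (p, snd c x)"
    proof (rule Ck_at_cong[OF A])
      have cc: "isCont (\<lambda>z. chart_inv c (snd z)) (p, snd c x)"
        by (rule isCont_o2[where f=snd]) (use is_chart_isCont[OF ic] c in auto)
      have i: "chart_inv c (snd c x) = x" using is_chartD[OF ic] c by simp
      have "isCont (\<lambda>z. (fst z, chart_inv c (snd z))) (p, snd c x)"
        by (intro continuous_intros cc)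
      moreover have "isCont (\<lambda>z. G (fst z) (snd z)) (fst (p, snd c x), chart_inv c (snd (p, snd c x)))"
        using N i by (simp add: continuous_on_eq_continuous_at)
      ultimately have "isCont (\<lambda>z. G (fst z) (chart_inv c (snd z))) (p, snd c x)"
        using isCont_o2[of "(p, snd c x)" "\<lambda>z. (fst z, chart_inv c (snd z))" "\<lambda>z. G (fst z) (snd z)"] by simp
      from isCont_eventually_in[OF this is_chartD(1)[OF id]]
      have "\<forall>\<^sub>F z in nhds (p, snd c x). G (fst z) (chart_inv c (snd z)) \<in> fst d" using d i by simp
      then show "\<forall>\<^sub>F z in nhds (p, snd c x). snd e (H (fst (?g z)) (chart_inv d (snd (?g z))))
          = snd e (H (fst z) (G (fst z) (chart_inv c (snd z))))"
        by eventually_elim (simp add: is_chartD[OF id])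
    qed
  qed
qed

lemma smooth_family_at_of_map:
  assumes "Cr_map r \<A> f"
  shows "smooth_family_at r \<A> (\<lambda>_. f) p x"
proof -
  obtain c where c: "c \<in> \<A>" "x \<in> fst c" by (rule atlas_covers)
  obtain d where d: "d \<in> \<A>" "f x \<in> fst d" by (rule atlas_covers)
  note ic = atlas_is_chart[OF c(1)] and id = atlas_is_chart[OF d(1)]
  have cf: "continuous_on UNIV f" using assms by (simp add: Cr_map_def)
  have "open (f -` fst d)"
    using continuous_on_open_vimage[of UNIV f] cf is_chartD(1)[OF id] by auto
  then have o: "open (snd c ` (fst c \<inter> f -` fst d))"
    by (intro is_chart_open_image[OF ic open_Int[OF is_chartD(1)[OF ic]]]) auto
  have "Ck_on r (snd d \<circ> f \<circ> chart_inv c) (snd c ` (fst c \<inter> f -` fst d))"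
    using assms c d by (auto simp: Cr_map_def)
  from Ck_on_imp_at[OF o this imageI, of x] have k: "Ck_at r (\<lambda>u. snd d (f (chart_inv c u))) (snd c x)"
    using c d by (simp add: o_def)
  show ?thesis
  proof (rule smooth_family_atI[where G="\<lambda>_. f" and p=p and x=x, OF open_UNIV _ _ atlas_Cr_chart[OF c(1)] c(2) atlas_Cr_chart[OF d(1)] d(2)])
    show "continuous_on UNIV (\<lambda>z. f (snd z))"
      by (rule continuous_on_compose2[OF cf]) (auto intro: continuous_intros)
    show "Ck_at r (\<lambda>z. snd d (f (chart_inv c (snd z)))) (p, snd c x)"
      by (rule Ck_at_compose[where f=snd]) (use k in \<open>auto intro: Ck_at_bounded_linear bounded_linear_snd\<close>)
  qed auto
qed

lemma smooth_family_at_chart_expression: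
  assumes "smooth_family_at r \<A> G p x" "Cr_chart r \<A> c" "Cr_chart r \<A> d" "x \<in> fst c" "G p x \<in> fst d"
  shows "Ck_at r (\<lambda>u. snd d (G p (chart_inv c u))) (snd c x)"
proof -
  have k: "Ck_at r (\<lambda>z. snd d (G (fst z) (chart_inv c (snd z)))) (p, snd c x)"
    by (rule smooth_family_at_joint_expression[OF assms])
  have "Ck_at r (\<lambda>u. (p, u)) (snd c x)" by (intro Ck_at_intros)
  from Ck_at_compose[OF this k] show ?thesis by simp
qed

lemma Cr_map_chart_expression:
  assumes "Cr_map r \<A> f" "Cr_chart r \<A> c" "Cr_chart r \<A> d" "x \<in> fst c" "f x \<in> fst d"
  shows "Ck_at r (\<lambda>u. snd d (f (chart_inv c u))) (snd c x)"
  using smooth_family_at_chart_expression[OF smooth_family_at_of_map[OF assms(1)] assms(2-5)] .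

lemma smooth_family_imp_Cr_map:
  assumes "\<And>x. smooth_family_at r \<A> G p x"
  shows "Cr_map r \<A> (G p)"
  unfolding Cr_map_def
proof (intro conjI ballI)
  have "isCont (G p) x" for x
  proof -
    have "isCont (\<lambda>x. (p, x)) x" by (intro continuous_intros)
    from isCont_o2[OF this smooth_family_at_isCont[OF assms]] show ?thesis by simp
  qed
  then show "continuous_on UNIV (G p)" by (simp add: continuous_at_imp_continuous_on)
  fix c d assume cd: "c \<in> \<A>" "d \<in> \<A>"
  show "Ck_on r (snd d \<circ> G p \<circ> chart_inv c) (snd c ` (fst c \<inter> G p -` fst d))"
  proof (rule Ck_on_atI)
    fix u assume "u \<in> snd c ` (fst c \<inter> G p -` fst d)"
    then obtain x where x: "u = snd c x" "x \<in> fst c" "G p x \<in> fst d" by blast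
    show "Ck_at r (snd d \<circ> G p \<circ> chart_inv c) u"
      using smooth_family_at_chart_expression[OF assms atlas_Cr_chart[OF cd(1)] atlas_Cr_chart[OF cd(2)] x(2,3)]
      by (simp add: o_def x(1))
  qed
qed

lemma smooth_family_imp_Cr_family:
  assumes W: "open W" and s: "\<And>p x. p \<in> W \<Longrightarrow> smooth_family_at r \<A> G p x"
  shows "Cr_family r \<A> W G"
  unfolding Cr_family_def
proof (intro conjI ballI)
  have "isCont (\<lambda>z. G (fst z) (snd z)) z" if "z \<in> W \<times> UNIV" for z
    using smooth_family_at_isCont[OF s[of "fst z" "snd z"]] that by auto
  then show "continuous_on (W \<times> UNIV) (\<lambda>(p, x). G p x)"
    by (simp add: continuous_at_imp_continuous_on split_beta)
  fix c d assume cd: "c \<in> \<A>" "d \<in> \<A>"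
  show "Ck_on r (\<lambda>(p, u). snd d (G p (chart_inv c u)))
     {(p, u). p \<in> W \<and> u \<in> snd c ` fst c \<and> G p (chart_inv c u) \<in> fst d}"
  proof (rule Ck_on_atI)
    fix z assume "z \<in> {(p, u). p \<in> W \<and> u \<in> snd c ` fst c \<and> G p (chart_inv c u) \<in> fst d}"
    then obtain p x where z: "z = (p, snd c x)" "p \<in> W" "x \<in> fst c" "G p x \<in> fst d"
      using is_chartD(3)[OF atlas_is_chart[OF cd(1)]] by auto
    show "Ck_at r (\<lambda>(p, u). snd d (G p (chart_inv c u))) z"
      unfolding split_beta z(1)
      by (rule smooth_family_at_joint_expression[OF s[OF z(2)] atlas_Cr_chart[OF cd(1)] atlas_Cr_chart[OF cd(2)] z(3,4)])
  qed
qed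

lemma Cr_map_id: "Cr_map r \<A> id"
  unfolding Cr_map_def
proof (intro conjI ballI)
  fix c d assume cd: "c \<in> \<A>" "d \<in> \<A>"
  show "Ck_on r (snd d \<circ> id \<circ> chart_inv c) (snd c ` (fst c \<inter> id -` fst d))"
  proof (rule Ck_on_atI)
    fix u assume "u \<in> snd c ` (fst c \<inter> id -` fst d)"
    then obtain x where x: "u = snd c x" "x \<in> fst c" "x \<in> fst d" by auto
    show "Ck_at r (snd d \<circ> id \<circ> chart_inv c) u"
      using chart_change[OF atlas_Cr_chart[OF cd(1)] atlas_Cr_chart[OF cd(2)] x(2,3)]
      by (simp add: o_def x(1))
  qed
qed (auto intro: continuous_on_id)

lemma Cr_map_compose:
  assumes "Cr_map r \<A> f" "Cr_map r \<A> g" shows "Cr_map r \<A> (g \<circ> f)"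
proof -
  have "smooth_family_at r \<A> (\<lambda>p x. g (f x)) (0::real) x" for x
    by (rule smooth_family_at_compose[OF smooth_family_at_of_map[OF assms(1)] smooth_family_at_of_map[OF assms(2)]])
  from smooth_family_imp_Cr_map[OF this] show ?thesis by (simp add: o_def)
qed

lemma Diff_compose: "f \<in> Diff r \<A> \<Longrightarrow> g \<in> Diff r \<A> \<Longrightarrow> g \<circ> f \<in> Diff r \<A>"
  by (auto simp: Diff_def bij_comp o_inv_distrib Cr_map_compose)

text \<open>A point lies in the chart, where the expression is \<open>g\<close>, or off the compact set \<open>chart_inv c ` C\<close>,
  which is closed because the manifold is a Hausdorff space; there the lift is the identity.\<close>

lemma smooth_family_at_lift:
  fixes g :: "'p::euclidean_space \<Rightarrow> R3 \<Rightarrow> R3"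
  assumes c: "Cr_chart r \<A> c" and C: "compact C" "C \<subseteq> snd c ` fst c" and W: "open W" "p \<in> W"
    and off: "\<And>q w. q \<in> W \<Longrightarrow> w \<notin> C \<Longrightarrow> g q w = w"
    and on: "\<And>q w. q \<in> W \<Longrightarrow> w \<in> C \<Longrightarrow> g q w \<in> C"
    and k: "\<And>q w. q \<in> W \<Longrightarrow> Ck_at r (\<lambda>z. g (fst z) (snd z)) (q, w)"
  shows "smooth_family_at r \<A> (\<lambda>p. lift c (g p)) p x"
proof (cases "x \<in> fst c")
  case True
  note ic = Cr_chart_is_chart[OF c]
  have g_im: "g q w \<in> snd c ` fst c" if "q \<in> W" "w \<in> snd c ` fst c" for q w
    using on[OF that(1), of w] off[OF that(1), of w] that C(2) by (cases "w \<in> C") auto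
  have "continuous_on (W \<times> UNIV) (\<lambda>z. g (fst z) (snd z))"
    using Ck_at_isCont[OF k] by (intro continuous_at_imp_continuous_on) auto
  then have "continuous_on (W \<times> fst c) (\<lambda>z. (\<lambda>z. g (fst z) (snd z)) (fst z, snd c (snd z)))"
    by (rule continuous_on_compose2)
       (auto intro!: continuous_intros continuous_on_compose2[OF is_chartD(6)[OF ic]])
  then have "continuous_on (W \<times> fst c) (\<lambda>z. chart_inv c (g (fst z) (snd c (snd z))))"
    by (intro continuous_on_compose2[OF is_chartD(7)[OF ic]]) (auto intro!: g_im)
  then have cont: "continuous_on (W \<times> fst c) (\<lambda>z. lift c (g (fst z)) (snd z))"
    by (rule continuous_on_eq) (auto simp: lift_def)
  have lx: "lift c (g p) x \<in> fst c"
    using is_chartD(5)[OF ic g_im[OF W(2) imageI[OF True]]] True by (simp add: lift_def)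
  show ?thesis
  proof (rule smooth_family_atI[OF _ _ cont c True c lx])
    show "open (W \<times> fst c)" using W is_chartD[OF ic] by (auto intro: open_Times)
    show "(p, x) \<in> W \<times> fst c" using W True by auto
    show "Ck_at r (\<lambda>z. snd c (lift c (g (fst z)) (chart_inv c (snd z)))) (p, snd c x)"
    proof (rule Ck_at_cong[OF k[OF W(2)]])
      show "\<forall>\<^sub>F z in nhds (p, snd c x). g (fst z) (snd z) = snd c (lift c (g (fst z)) (chart_inv c (snd z)))"
        unfolding eventually_nhds
      proof (intro exI[of _ "W \<times> snd c ` fst c"] conjI ballI)
        fix z assume z: "z \<in> W \<times> snd c ` fst c"
        then have "chart_inv c (snd z) \<in> fst c" "snd c (chart_inv c (snd z)) = snd z"
          using is_chartD[OF ic] by auto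
        then have "lift c (g (fst z)) (chart_inv c (snd z)) = chart_inv c (g (fst z) (snd z))"
          by (simp add: lift_def)
        then show "g (fst z) (snd z) = snd c (lift c (g (fst z)) (chart_inv c (snd z)))"
          using is_chartD(4)[OF ic g_im[of "fst z" "snd z"]] z by auto
      qed (use W True is_chartD[OF ic] in \<open>auto intro: open_Times\<close>)
    qed
  qed
next
  case False
  note ic = Cr_chart_is_chart[OF c]
  have cl: "closed (chart_inv c ` C)"
    by (intro compact_imp_closed compact_continuous_image C continuous_on_subset[OF is_chartD(7)[OF ic]])
  define N where "N = W \<times> (- chart_inv c ` C)"
  have N: "open N" using W cl by (auto simp: N_def intro: open_Times)
  have ci: "chart_inv c ` C \<subseteq> fst c" using C is_chartD[OF ic] by auto
  have lid: "lift c (g q) y = y" if "(q, y) \<in> N" for q y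
  proof (cases "y \<in> fst c")
    case True
    have "snd c y \<notin> C" using that True is_chartD(3)[OF ic True] by (force simp: N_def)
    then show ?thesis using off[of q "snd c y"] that True is_chartD[OF ic] by (auto simp: lift_def N_def)
  qed (simp add: lift_def)
  have px: "(p, x) \<in> N" using W False ci by (auto simp: N_def)
  obtain d where d: "d \<in> \<A>" "x \<in> fst d" by (rule atlas_covers)
  note id = atlas_is_chart[OF d(1)]
  show ?thesis
  proof (rule smooth_family_atI[OF N px _ atlas_Cr_chart[OF d(1)] d(2) atlas_Cr_chart[OF d(1)]])
    have "continuous_on N (\<lambda>z. snd z)" by (intro continuous_intros)
    then show "continuous_on N (\<lambda>z. lift c (g (fst z)) (snd z))"
      by (rule continuous_on_eq) (metis lid prod.collapse)
    show "lift c (g p) x \<in> fst d" using lid[OF px] d by simp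
    have "Ck_at r (\<lambda>z. snd z) (p, snd d x)" by (intro Ck_at_bounded_linear bounded_linear_snd)
    then show "Ck_at r (\<lambda>z. snd d (lift c (g (fst z)) (chart_inv d (snd z)))) (p, snd d x)"
    proof (rule Ck_at_cong)
      have "isCont (\<lambda>z. chart_inv d (snd z)) (p, snd d x)"
        by (rule isCont_o2[where f=snd]) (use is_chart_isCont[OF id] d in auto)
      then have "isCont (\<lambda>z. (fst z, chart_inv d (snd z))) (p, snd d x)" by (intro continuous_intros)
      from isCont_eventually_in[OF this N]
      have 1: "\<forall>\<^sub>F z in nhds (p, snd d x). (fst z, chart_inv d (snd z)) \<in> N"
        using px is_chartD[OF id] d by simp
      have "isCont snd (p, snd d x)" by (intro continuous_intros)
      from isCont_eventually_in[OF this is_chartD(2)[OF id]]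
      have 2: "\<forall>\<^sub>F z in nhds (p, snd d x). snd z \<in> snd d ` fst d" using d by simp
      show "\<forall>\<^sub>F z in nhds (p, snd d x). snd z = snd d (lift c (g (fst z)) (chart_inv d (snd z)))"
        using 1 2 by eventually_elim (simp add: lid is_chartD[OF id])
    qed
  qed
qed

lemma lift_inverse:
  assumes c: "is_chart c" and C: "C \<subseteq> snd c ` fst c"
    and off: "\<And>w. w \<notin> C \<Longrightarrow> g w = w" and on: "\<And>w. w \<in> C \<Longrightarrow> g w \<in> C"
    and inv: "\<And>w. h (g w) = w"
  shows "lift c h (lift c g q) = q"
proof (cases "q \<in> fst c")
  case True
  then have "g (snd c q) \<in> snd c ` fst c"
    using on[of "snd c q"] off[of "snd c q"] C by (cases "snd c q \<in> C") auto
  then show ?thesis using True is_chartD[OF c] inv by (simp add: lift_def)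
qed (simp add: lift_def)

lemma lift_in_Diff:
  assumes c: "Cr_chart r \<A> c" and C: "compact C" "C \<subseteq> snd c ` fst c"
    and off: "\<And>w. w \<notin> C \<Longrightarrow> g w = w" and bij: "bij g"
    and k: "Ck_on r g UNIV" "Ck_on r (inv g) UNIV"
  shows "lift c g \<in> Diff r \<A>"
proof -
  note ic = Cr_chart_is_chart[OF c]
  have gi: "g (inv g w) = w" "inv g (g w) = w" for w
    using bij by (auto simp: bij_is_surj surj_f_inv_f bij_is_inj)
  have on: "g w \<in> C" if "w \<in> C" for w
    using off[of "g w"] gi(2)[of w] gi(2)[of "g w"] that by metis
  have off': "inv g w = w" if "w \<notin> C" for w using off[OF that] gi(2)[of w] by metis
  have on': "inv g w \<in> C" if "w \<in> C" for w using off[of "inv g w"] gi(1)[of w] that by metis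
  have l1: "lift c (inv g) (lift c g q) = q" for q by (rule lift_inverse[OF ic C(2) off on gi(2)])
  have l2: "lift c g (lift c (inv g) q) = q" for q by (rule lift_inverse[OF ic C(2) off' on' gi(1)])
  have b: "bij (lift c g)" by (rule o_bij[of "lift c (inv g)"]) (auto simp: o_def l1 l2)
  have i: "inv (lift c g) = lift c (inv g)" by (rule inv_equality) (auto simp: l1 l2)
  have "Cr_map r \<A> (lift c h)" if "\<And>w. w \<notin> C \<Longrightarrow> h w = w" "\<And>w. w \<in> C \<Longrightarrow> h w \<in> C" "Ck_on r h UNIV" for h
  proof -
    have kh: "Ck_at r (\<lambda>z. h (snd z)) (q, w)" for q :: real and w
      by (rule Ck_at_compose[where f=snd and g=h])
        (auto intro: Ck_at_bounded_linear bounded_linear_snd Ck_on_imp_at[OF open_UNIV that(3)])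
    have "smooth_family_at r \<A> (\<lambda>p. lift c h) (0::real) x" for x
      by (rule smooth_family_at_lift[where g="\<lambda>_. h" and W=UNIV, OF c C]) (use that kh in auto)
    from smooth_family_imp_Cr_map[OF this] show ?thesis .
  qed
  then show ?thesis using b i off on off' on' k by (auto simp: Diff_def)
qed

text \<open>The chart required of a parametrization is \<open>c\<close> followed by \<open>h\<close>.\<close>

lemma chart_inv_parametrization:
  assumes c: "Cr_chart r \<A> c" and k: "Ck_on r g UNIV" "Ck_on r h UNIV"
    and gh: "\<And>v. h (g v) = v" "\<And>w. g (h w) = w"
    and O: "open \<Omega>" "g ` \<Omega> \<subseteq> snd c ` fst c"
  shows "Cr_parametrization r \<A> (\<lambda>v. chart_inv c (g v)) \<Omega>"
proof -
  note ic = Cr_chart_is_chart[OF c]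
  let ?P = "\<lambda>v. chart_inv c (g v)"
  let ?V = "?P ` \<Omega>"
  have inj: "inj_on ?P \<Omega>"
    using O(2) is_chartD(4)[OF ic] gh(1) by (intro inj_onI) (metis image_subset_iff)
  have og: "open (g ` \<Omega>)"
  proof -
    have "g ` \<Omega> = h -` \<Omega>" using gh by (auto simp: image_iff) (metis gh(2))
    then show ?thesis
      using continuous_on_open_vimage[of UNIV h] Ck_on_imp_continuous_on[OF k(2)] O(1) by auto
  qed
  have V: "?V = chart_inv c ` (g ` \<Omega>)" by auto
  have oV: "open ?V" unfolding V by (rule is_chart_open_inv_image[OF ic og O(2)])
  have Vc: "?V \<subseteq> fst c" using O(2) is_chartD[OF ic] by auto
  have inv: "inv_into \<Omega> ?P q = h (snd c q)" if "q \<in> ?V" for q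
  proof -
    from that obtain v where v: "v \<in> \<Omega>" "q = ?P v" by auto
    moreover from v(1) have "g v \<in> snd c ` fst c" using O(2) by blast
    ultimately have "snd c q = g v" using is_chartD(4)[OF ic] by simp
    then show ?thesis using v gh inv_into_f_f[OF inj v(1)] by simp
  qed
  let ?c = "(?V, inv_into \<Omega> ?P)"
  have im: "snd ?c ` fst ?c = \<Omega>" using inv_into_image_cancel[OF inj subset_refl] by simp
  have ci: "chart_inv ?c v = ?P v" if "v \<in> \<Omega>" for v
  proof -
    have "inj_on (inv_into \<Omega> ?P) ?V" by (rule inj_on_inv_into) auto
    from inv_into_f_f[OF this imageI[OF that]] show ?thesis
      using inv_into_f_f[OF inj that] by (simp add: chart_inv_def)
  qed
  have "homeomorphism ?V \<Omega> (inv_into \<Omega> ?P) (chart_inv ?c)"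
    unfolding homeomorphism_def
  proof (intro conjI ballI)
    have "continuous_on ?V (\<lambda>q. h (snd c q))"
      by (rule continuous_on_compose2[OF Ck_on_imp_continuous_on[OF k(2)] continuous_on_subset[OF is_chartD(6)[OF ic] Vc]]) auto
    then show "continuous_on ?V (inv_into \<Omega> ?P)" by (rule continuous_on_eq) (simp add: inv)
    have "continuous_on \<Omega> ?P"
      by (rule continuous_on_compose2[OF is_chartD(7)[OF ic] continuous_on_subset[OF Ck_on_imp_continuous_on[OF k(1)]]])
        (use O in auto)
    then show "continuous_on \<Omega> (chart_inv ?c)" by (rule continuous_on_eq) (simp add: ci)
    show "inv_into \<Omega> ?P ` ?V = \<Omega>" using im by simp
    then show "chart_inv ?c ` \<Omega> = ?V" using ci by (auto simp: image_iff)
    show "chart_inv ?c (inv_into \<Omega> ?P q) = q" if q: "q \<in> ?V" for q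
      using q ci inv_into_f_f[OF inj] by auto
    show "inv_into \<Omega> ?P (chart_inv ?c v) = v" if "v \<in> \<Omega>" for v
      using that ci inv_into_f_f[OF inj] by simp
  qed
  then have chart: "is_chart ?c" unfolding is_chart_def im using oV O by simp
  have "compatible r ?c d" if d: "d \<in> \<A>" for d
    unfolding compatible_def
  proof (intro conjI Ck_on_atI)
    note id = atlas_is_chart[OF d]
    fix v assume "v \<in> snd ?c ` (fst ?c \<inter> fst d)"
    then obtain q where q: "q \<in> ?V" "q \<in> fst d" "v = inv_into \<Omega> ?P q" by auto
    then have v: "v \<in> \<Omega>" "?P v = q" using im inv_into_f_f[OF inj] by auto
    from v(1) have "g v \<in> snd c ` fst c" using O(2) by blast
    then have gv: "g v = snd c q" "q \<in> fst c"
      using is_chartD(4)[OF ic, of "g v"] is_chartD(5)[OF ic, of "g v"] v(2) by simp_all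
    have "Ck_at r (\<lambda>v. snd d (chart_inv c (g v))) v"
      by (rule Ck_at_compose[where f=g, OF Ck_on_imp_at[OF open_UNIV k(1) UNIV_I]])
        (use chart_change[OF c atlas_Cr_chart[OF d] gv(2) q(2)] gv(1) in simp)
    then show "Ck_at r (snd d \<circ> chart_inv ?c) v"
    proof (rule Ck_at_cong)
      show "\<forall>\<^sub>F y in nhds v. snd d (chart_inv c (g y)) = (snd d \<circ> chart_inv ?c) y"
        unfolding eventually_nhds by (rule exI[of _ \<Omega>]) (use O v ci in auto)
    qed
  next
    note id = atlas_is_chart[OF d]
    fix u assume "u \<in> snd d ` (fst ?c \<inter> fst d)"
    then obtain q where q: "q \<in> ?V" "q \<in> fst d" "u = snd d q" by auto
    have "Ck_at r (\<lambda>u. h (snd c (chart_inv d u))) u"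
      by (rule Ck_at_compose[where g=h, OF _ Ck_on_imp_at[OF open_UNIV k(2) UNIV_I]])
        (use q Vc chart_change[OF atlas_Cr_chart[OF d] c q(2)] in auto)
    then show "Ck_at r (snd ?c \<circ> chart_inv d) u"
    proof (rule Ck_at_cong)
      have "isCont (chart_inv d) u" using q is_chart_isCont[OF id] by auto
      from isCont_eventually_in[OF this oV]
      have "\<forall>\<^sub>F y in nhds u. chart_inv d y \<in> ?V" using q is_chartD[OF id] by auto
      then show "\<forall>\<^sub>F y in nhds u. h (snd c (chart_inv d y)) = (snd ?c \<circ> chart_inv d) y"
        by eventually_elim (simp add: inv)
    qed
  qed
  then have "Cr_chart r \<A> ?c" using chart by (simp add: Cr_chart_def)
  then show ?thesis using O inj by (simp add: Cr_parametrization_def)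
qed

end

declare split_paired_All [simp del] split_paired_Ex [simp del]

section \<open>Localized perturbations of the identity\<close>

lemma has_derivative_max_power:
  "((\<lambda>s::real. max 0 s ^ Suc (Suc n)) has_derivative (\<lambda>h. (real (Suc (Suc n)) * max 0 s ^ Suc n) * h)) (at s)"
proof -
  consider "s > 0" | "s < 0" | "s = 0" by linarith
  then show ?thesis
  proof cases
    case 1
    have "((\<lambda>s::real. s ^ Suc (Suc n)) has_field_derivative real (Suc (Suc n)) * s ^ Suc n) (at s)"
      using DERIV_pow[of "Suc (Suc n)" s] by (simp only: diff_Suc_Suc minus_nat.diff_0)
    moreover have "max 0 s = s" using 1 by simp
    ultimately have "((\<lambda>s::real. s ^ Suc (Suc n)) has_derivative (\<lambda>h. (real (Suc (Suc n)) * max 0 s ^ Suc n) * h)) (at s)"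
      by (simp only: has_field_derivative_def)
    then show ?thesis
      by (rule has_derivative_transform_within_open[of _ _ _ _ "{0<..}"]) (use 1 in auto)
  next
    case 2
    have "((\<lambda>s::real. 0) has_derivative (\<lambda>h. (real (Suc (Suc n)) * max 0 s ^ Suc n) * h)) (at s)"
      using 2 by (auto simp: max_def)
    then show ?thesis
      by (rule has_derivative_transform_within_open[of _ _ _ _ "{..<0}"]) (use 2 in auto)
  next
    case 3
    have "((\<lambda>s::real. max 0 s ^ Suc (Suc n)) has_field_derivative 0) (at 0)"
      unfolding has_field_derivative_iff
    proof (rule Lim_null_comparison)
      show "\<forall>\<^sub>F y in at 0. norm ((max 0 y ^ Suc (Suc n) - max 0 (0::real) ^ Suc (Suc n)) / (y - 0)) \<le> max 0 y ^ Suc n"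
        by (rule always_eventually) (auto simp: max_def)
      have "((\<lambda>y::real. max 0 y ^ Suc n) \<longlongrightarrow> max 0 0 ^ Suc n) (at 0)" by (intro tendsto_intros)
      then show "((\<lambda>y::real. max 0 y ^ Suc n) \<longlongrightarrow> 0) (at 0)" by simp
    qed
    then show ?thesis using 3 by (simp add: has_field_derivative_def lambda_zero)
  qed
qed

text \<open>A bump function of finite order is enough and can be built from powers of the positive part.\<close>

lemma Ck_on_max_power: "Ck_on k (\<lambda>s::real. max 0 s ^ Suc k) UNIV"
proof (induction k)
  case 0
  then show ?case by (auto intro!: continuous_intros)
next
  case (Suc k)
  show ?case
  proof (rule Ck_on_SucI[OF open_UNIV has_derivative_max_power])
    show "Ck_on k (\<lambda>s::real. real (Suc (Suc k)) * max 0 s ^ Suc k * i) UNIV" for i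
      by (intro Ck_on_mult Suc Ck_on_const open_UNIV)
  qed
qed

lemma bump_function:
  fixes ctr :: "'a::euclidean_space"
  assumes "\<rho> > 0"
  shows "\<exists>bmp :: 'a \<Rightarrow> real. (\<forall>w. Ck_at k bmp w) \<and> (\<forall>w. dist ctr w < \<rho> / 2 \<longrightarrow> bmp w = 1) \<and>
    (\<forall>w. dist ctr w \<ge> \<rho> \<longrightarrow> bmp w = 0)"
proof -
  define \<phi> where "\<phi> = (\<lambda>s::real. max 0 s ^ Suc k)"
  define t where "t = (\<lambda>w. (\<Sum>i\<in>Basis. ((w - ctr) \<bullet> i) ^ 2) / \<rho> ^ 2)"
  have t: "t w = (dist ctr w / \<rho>) ^ 2" for w
  proof -
    have "(dist ctr w) ^ 2 = (w - ctr) \<bullet> (w - ctr)"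
      by (subst dist_commute) (simp only: dist_norm power2_norm_eq_inner)
    also have "\<dots> = (\<Sum>i\<in>Basis. ((w - ctr) \<bullet> i) ^ 2)"
      by (subst euclidean_inner) (simp add: power2_eq_square)
    finally show ?thesis by (simp add: t_def power_divide)
  qed
  have k\<phi>: "Ck_at k \<phi> s" for s
    unfolding \<phi>_def by (rule Ck_on_imp_at[OF open_UNIV Ck_on_max_power]) simp
  have kt: "Ck_at k t w" for w
    unfolding t_def divide_inverse
    by (intro Ck_at_mult Ck_at_sum Ck_at_power Ck_at_compose_linear[OF bounded_linear_inner_left] Ck_at_intros finite_Basis)
  have c1: "Ck_at k (\<lambda>w. \<phi> (2 - 2 * t w)) w" for w
    by (rule Ck_at_compose[where f="\<lambda>w. 2 - 2 * t w", OF _ k\<phi>]) (intro Ck_at_intros kt)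
  have c2: "Ck_at k (\<lambda>w. \<phi> (1 - \<phi> (2 - 2 * t w))) w" for w
    by (rule Ck_at_compose[where f="\<lambda>w. 1 - \<phi> (2 - 2 * t w)", OF _ k\<phi>]) (intro Ck_at_intros c1)
  show ?thesis
  proof (intro exI[of _ "\<lambda>w. 1 - \<phi> (1 - \<phi> (2 - 2 * t w))"] conjI allI impI)
    show "Ck_at k (\<lambda>w. 1 - \<phi> (1 - \<phi> (2 - 2 * t w))) w" for w by (intro Ck_at_intros c2)
    show "1 - \<phi> (1 - \<phi> (2 - 2 * t w)) = 1" if "dist ctr w < \<rho> / 2" for w
    proof -
      have "(dist ctr w / \<rho>) ^ 2 \<le> (1 / 2) ^ 2" using that assms by (intro power_mono) (auto simp: field_simps)
      moreover have "(1 / 2 :: real) ^ 2 = 1 / 4" by (simp add: power2_eq_square)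
      ultimately have "t w \<le> 1 / 2" unfolding t by linarith
      then have "\<phi> (2 - 2 * t w) \<ge> 1" unfolding \<phi>_def by (intro one_le_power) auto
      then show ?thesis by (simp add: \<phi>_def)
    qed
    show "1 - \<phi> (1 - \<phi> (2 - 2 * t w)) = 0" if "dist ctr w \<ge> \<rho>" for w
    proof -
      have "(dist ctr w / \<rho>) ^ 2 \<ge> 1" using that assms by (intro one_le_power) (auto simp: field_simps)
      then have "2 - 2 * t w \<le> 0" by (simp add: t)
      then show ?thesis by (simp add: \<phi>_def)
    qed
  qed
qed

lemma Basis_R3: "(Basis :: R3 set) = {(1, 0, 0), (0, 1, 0), (0, 0, 1)}"
  by (auto simp: Basis_prod_def zero_prod_def)

lemma linear_R3:
  fixes A :: "R3 \<Rightarrow> 'b::real_vector"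
  assumes "linear A"
  shows "A (x, y, z) = x *\<^sub>R A (1, 0, 0) + y *\<^sub>R A (0, 1, 0) + z *\<^sub>R A (0, 0, 1)"
proof -
  have "(x, y, z) = x *\<^sub>R (1, 0, 0) + y *\<^sub>R (0, 1, 0) + z *\<^sub>R (0, 0, 1::real)" by simp
  then show ?thesis by (simp only: linear_add[OF assms] linear_scale[OF assms])
qed

definition det3 :: "R3 \<Rightarrow> R3 \<Rightarrow> R3 \<Rightarrow> real" where
  "det3 a b c = fst a * (fst (snd b) * snd (snd c) - snd (snd b) * fst (snd c))
     - fst (snd a) * (fst b * snd (snd c) - snd (snd b) * fst c)
     + snd (snd a) * (fst b * fst (snd c) - fst (snd b) * fst c)"

lemma det3_combination:
  "det3 (x1 *\<^sub>R a + y1 *\<^sub>R b + z1 *\<^sub>R c) (x2 *\<^sub>R a + y2 *\<^sub>R b + z2 *\<^sub>R c) (x3 *\<^sub>R a + y3 *\<^sub>R b + z3 *\<^sub>R c)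
    = det3 (x1, y1, z1) (x2, y2, z2) (x3, y3, z3) * det3 a b c"
  unfolding det3_def fst_add snd_add fst_scaleR snd_scaleR fst_conv snd_conv real_scaleR_def
  by algebra

lemma cramer3:
  assumes "x *\<^sub>R a + y *\<^sub>R b + z *\<^sub>R c = e"
  shows "det3 e b c = x * det3 a b c" "det3 a e c = y * det3 a b c" "det3 a b e = z * det3 a b c"
  unfolding assms[symmetric] det3_def fst_add snd_add fst_scaleR snd_scaleR real_scaleR_def
  by algebra+

lemma Ck_on_det3:
  assumes "open S" "Ck_on k a S" "Ck_on k b S" "Ck_on k c S"
  shows "Ck_on k (\<lambda>x. det3 (a x) (b x) (c x)) S"
  unfolding det3_def by (intro Ck_on_add Ck_on_diff Ck_on_mult Ck_on_fst Ck_on_snd assms)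

text \<open>By Cramer's rule the partial derivatives of the inverse are rational in those of the map,
  taken at the preimage; this passes smoothness from order \<open>j\<close> to order \<open>j + 1\<close>.\<close>

lemma Ck_on_inverse_map:
  fixes g h :: "R3 \<Rightarrow> R3"
  assumes g: "Ck_on k g UNIV" and gh: "\<And>y. g (h y) = y" and hg: "\<And>x. h (g x) = x"
    and ch: "continuous_on UNIV h" and inj: "\<And>x. inj (frechet_derivative g (at x))"
  shows "Ck_on k h UNIV"
proof -
  have "j \<le> k \<Longrightarrow> Ck_on j h UNIV" for j
  proof (induction j)
    case 0
    then show ?case using ch by simp
  next
    case (Suc j)
    then have hj: "Ck_on j h UNIV" and gj: "Ck_on (Suc j) g UNIV"
      using Ck_on_le[OF g Suc.prems] by simp_all
    define A where "A = (\<lambda>y. frechet_derivative g (at (h y)))"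
    have dg: "(g has_derivative A y) (at (h y))" for y
      unfolding A_def by (rule Ck_on_has_derivative[OF gj]) simp
    have lA: "linear (A y)" for y using dg by (metis has_derivative_linear)
    define V where "V = (\<lambda>y. inv (A y))"
    have injA: "inj (A y)" for y unfolding A_def by (rule inj)
    have surA: "surj (A y)" for y using linear_injective_imp_surjective[OF lA injA] by simp
    have VA: "V y (A y v) = v" for y v unfolding V_def using injA by simp
    have AV: "A y (V y v) = v" for y v unfolding V_def using surA by (simp add: surj_f_inv_f)
    have lV: "linear (V y)" for y
      unfolding V_def using linear_injective_left_inverse lA injA
      by (metis inj_linear_imp_inv_linear)
    have dh: "(h has_derivative V y) (at y)" for y
    proof (rule has_derivative_inverse_basic[where g=h and f=g and y=y, OF dg])
      show "bounded_linear (V y)" using lV by (simp add: linear_conv_bounded_linear)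
      show "V y \<circ> A y = id" by (rule ext) (simp only: o_apply VA id_apply)
      show "continuous (at y) h" using ch by (simp add: continuous_on_eq_continuous_at)
      show "open (UNIV :: R3 set)" "y \<in> UNIV" by auto
      show "g (h x) = x" for x by (rule gh)
    qed
    let ?a = "\<lambda>y. A y (1, 0, 0)" and ?b = "\<lambda>y. A y (0, 1, 0)" and ?c = "\<lambda>y. A y (0, 0, 1)"
    let ?d = "\<lambda>y. det3 (?a y) (?b y) (?c y)"
    have col: "Ck_on j (\<lambda>y. A y i) UNIV" if "i \<in> Basis" for i
      unfolding A_def
      by (rule Ck_on_compose[OF open_UNIV open_UNIV hj]) (use gj that in auto)
    have cols: "Ck_on j ?a UNIV" "Ck_on j ?b UNIV" "Ck_on j ?c UNIV" by (auto intro!: col simp: Basis_R3)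
    have comb: "fst v *\<^sub>R ?a y + fst (snd v) *\<^sub>R ?b y + snd (snd v) *\<^sub>R ?c y = A y v" for v y
      using linear_R3[OF lA, of y "fst v" "fst (snd v)" "snd (snd v)"] by simp
    have dnz: "?d y \<noteq> 0" for y
    proof -
      have "det3 (A y (V y (1,0,0))) (A y (V y (0,1,0))) (A y (V y (0,0,1)))
          = det3 (V y (1,0,0)) (V y (0,1,0)) (V y (0,0,1)) * ?d y"
        unfolding comb[symmetric, of y "V y _"] det3_combination by simp
      then have "det3 (V y (1,0,0)) (V y (0,1,0)) (V y (0,0,1)) * ?d y = 1"
        by (simp add: AV) (simp add: det3_def)
      then show ?thesis by auto
    qed
    show ?case
    proof (rule Ck_on_SucI[OF open_UNIV dh])
      fix i :: R3 assume "i \<in> Basis"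
      have eq: "(det3 i (?b y) (?c y) * inverse (?d y), det3 (?a y) i (?c y) * inverse (?d y),
          det3 (?a y) (?b y) i * inverse (?d y)) = V y i" for y
        using cramer3[of "fst (V y i)" "?a y" "fst (snd (V y i))" "?b y" "snd (snd (V y i))" "?c y" i]
          dnz[of y] comb[of "V y i" y] AV[of y i]
        by (simp add: prod_eq_iff)
      have "Ck_on j (\<lambda>y. (det3 i (?b y) (?c y) * inverse (?d y), det3 (?a y) i (?c y) * inverse (?d y),
          det3 (?a y) (?b y) i * inverse (?d y))) UNIV"
        by (intro Ck_on_Pair Ck_on_mult Ck_on_inverse Ck_on_det3 cols Ck_on_const open_UNIV dnz)
      then show "Ck_on j (\<lambda>y. V y i) UNIV" by (simp only: eq)
    qed
  qed
  then show ?thesis by simp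
qed

text \<open>The preimage of \<open>y\<close> is the fixed point of the contraction \<open>w \<mapsto> y - \<theta> w\<close>.  The map shrinks distances
  by at most the factor \<open>1/2\<close>, so its inverse is continuous and its derivatives are injective.\<close>

lemma id_plus_contraction_diffeo:
  fixes \<theta> :: "R3 \<Rightarrow> R3"
  assumes k: "Ck_on k \<theta> UNIV" "k \<ge> 1" and L: "\<And>w w'. norm (\<theta> w - \<theta> w') \<le> 1 / 2 * norm (w - w')"
  shows "bij (\<lambda>w. w + \<theta> w)" "Ck_on k (\<lambda>w. w + \<theta> w) UNIV" "Ck_on k (inv (\<lambda>w. w + \<theta> w)) UNIV"
proof -
  let ?g = "\<lambda>w. w + \<theta> w"
  have low: "norm (?g w - ?g w') \<ge> 1 / 2 * norm (w - w')" for w w'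
  proof -
    have "norm (w - w') \<le> norm (?g w - ?g w') + norm (\<theta> w' - \<theta> w)"
      using norm_triangle_ineq[of "?g w - ?g w'" "\<theta> w' - \<theta> w"] by (simp add: algebra_simps)
    then show ?thesis using L[of w' w] by (simp add: norm_minus_commute)
  qed
  have "inj ?g"
  proof (rule injI)
    fix w w' assume "?g w = ?g w'"
    then show "w = w'" using low[of w w'] by simp
  qed
  moreover have "\<exists>w. ?g w = y" for y
  proof -
    have "\<exists>!w\<in>UNIV. y - \<theta> w = w"
    proof (rule Banach_fix[where c="1/2"])
      show "dist (y - \<theta> w) (y - \<theta> w') \<le> 1 / 2 * dist w w'" for w w'
        using L[of w' w] by (simp add: dist_norm norm_minus_commute)
    qed (auto simp: complete_UNIV)
    then obtain w where "y - \<theta> w = w" by blast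
    then show ?thesis by (intro exI[of _ w]) (metis add.commute diff_add_cancel)
  qed
  ultimately show b: "bij ?g" by (metis bijI surjI surj_def)
  show kg: "Ck_on k ?g UNIV" by (intro Ck_on_add k Ck_on_ident open_UNIV)
  have gi: "?g (inv ?g y) = y" "inv ?g (?g x) = x" for x y
    using surj_f_inv_f[OF bij_is_surj[OF b], of y] inv_f_f[OF bij_is_inj[OF b], of x] by simp_all
  show "Ck_on k (inv ?g) UNIV"
  proof (rule Ck_on_inverse_map[OF kg gi])
    have lip: "dist (inv ?g y) (inv ?g y') \<le> 2 * dist y y'" for y y'
      using low[of "inv ?g y" "inv ?g y'"] gi(1)[of y] gi(1)[of y'] by (simp add: dist_norm)
    show "continuous_on UNIV (inv ?g)"
      unfolding continuous_on_iff
    proof (intro ballI allI impI)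
      fix x :: R3 and e :: real assume e: "e > 0"
      have "dist (inv ?g x') (inv ?g x) < e" if "dist x' x < e / 2" for x'
        using lip[of x' x] that by linarith
      then show "\<exists>d>0. \<forall>x'\<in>UNIV. dist x' x < d \<longrightarrow> dist (inv ?g x') (inv ?g x) < e"
        using e half_gt_zero by blast
    qed
    fix x
    obtain k' where k': "k = Suc k'" using k(2) by (cases k) auto
    have dg: "(?g has_derivative frechet_derivative ?g (at x)) (at x)"
      by (rule Ck_on_has_derivative[OF kg[unfolded k']]) simp
    have lin: "linear (frechet_derivative ?g (at x))" using dg by (rule has_derivative_linear)
    show "inj (frechet_derivative ?g (at x))"
    proof (rule linear_injective_0[OF lin, THEN iffD2], intro allI impI)
      fix v assume v: "frechet_derivative ?g (at x) v = 0"
      show "v = 0"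
      proof (rule ccontr)
        assume nv: "v \<noteq> 0"
        obtain d where d: "d > 0" "\<And>y. norm (y - x) < d \<Longrightarrow>
            norm (?g y - ?g x - frechet_derivative ?g (at x) (y - x)) \<le> 1 / 4 * norm (y - x)"
          using dg[unfolded has_derivative_at_alt, THEN conjunct2, THEN spec, of "1 / 4"] by auto
        define s where "s = d / (2 * norm v)"
        have s: "s > 0" "norm (s *\<^sub>R v) < d" using d nv by (auto simp: s_def)
        have "norm (?g (x + s *\<^sub>R v) - ?g x) \<le> 1 / 4 * norm (s *\<^sub>R v)"
          using d(2)[of "x + s *\<^sub>R v"] s v linear_scale[OF lin] by simp
        moreover have "norm (?g (x + s *\<^sub>R v) - ?g x) \<ge> 1 / 2 * norm (s *\<^sub>R v)"
          using low[of "x + s *\<^sub>R v" x] by simp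
        moreover have "norm (s *\<^sub>R v) > 0" using s nv by simp
        ultimately show False by linarith
      qed
    qed
  qed
qed

text \<open>The derivative vanishes off \<open>C\<close> and is bounded on it; the mean value inequality does the rest.\<close>

lemma compact_support_imp_lipschitz:
  fixes \<theta> :: "'a::euclidean_space \<Rightarrow> 'b::euclidean_space"
  assumes k: "Ck_on 1 \<theta> UNIV" and C: "compact C" and off: "\<And>w. w \<notin> C \<Longrightarrow> \<theta> w = 0"
  obtains B where "B \<ge> 0" "\<And>w w'. norm (\<theta> w - \<theta> w') \<le> B * norm (w - w')"
proof -
  have "\<forall>i\<in>Basis. \<exists>B\<ge>0. \<forall>w. norm (frechet_derivative \<theta> (at w) i) \<le> B"
  proof
    fix i :: 'a assume i: "i \<in> Basis"
    have "continuous_on UNIV (\<lambda>w. frechet_derivative \<theta> (at w) i)" using k i by simp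
    then have "compact ((\<lambda>w. frechet_derivative \<theta> (at w) i) ` C)"
      using C by (intro compact_continuous_image) (auto intro: continuous_on_subset)
    from compact_imp_bounded[OF this] obtain B
      where B: "\<And>w. w \<in> C \<Longrightarrow> norm (frechet_derivative \<theta> (at w) i) \<le> B"
      by (auto simp: bounded_iff)
    have "norm (frechet_derivative \<theta> (at w) i) \<le> max B 0" for w
    proof (cases "w \<in> C")
      case False
      have "frechet_derivative \<theta> (at w) = frechet_derivative (\<lambda>_. 0) (at w)"
        by (rule frechet_derivative_cong_open[of "- C"]) (use False off C in \<open>auto simp: compact_imp_closed\<close>)
      then show ?thesis by simp
    qed (use B in force)
    then show "\<exists>B\<ge>0. \<forall>w. norm (frechet_derivative \<theta> (at w) i) \<le> B" by (intro exI[of _ "max B 0"]) auto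
  qed
  then obtain B where B': "\<forall>i\<in>Basis. B i \<ge> 0 \<and> (\<forall>w. norm (frechet_derivative \<theta> (at w) i) \<le> B i)"
    by (metis (no_types, lifting))
  have B: "\<And>i. i \<in> Basis \<Longrightarrow> B i \<ge> 0"
    "\<And>i w. i \<in> Basis \<Longrightarrow> norm (frechet_derivative \<theta> (at w) i) \<le> B i" using B' by auto
  show ?thesis
  proof (rule that)
    show "(\<Sum>i\<in>Basis. B i) \<ge> 0" using B by (intro sum_nonneg) auto
    have hd: "(\<theta> has_derivative frechet_derivative \<theta> (at x)) (at x)" for x
      using k by (intro has_frechet_derivative) simp
    show "norm (\<theta> w - \<theta> w') \<le> (\<Sum>i\<in>Basis. B i) * norm (w - w')" for w w'
    proof (rule differentiable_bound[of UNIV \<theta> "\<lambda>x. frechet_derivative \<theta> (at x)"])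
      fix x :: 'a
      show "(\<theta> has_derivative frechet_derivative \<theta> (at x)) (at x within UNIV)" using hd by simp
      have "onorm (frechet_derivative \<theta> (at x)) \<le> (\<Sum>i\<in>Basis. norm (frechet_derivative \<theta> (at x) i))"
        by (rule onorm_componentwise[OF has_derivative_bounded_linear[OF hd]])
      also have "\<dots> \<le> (\<Sum>i\<in>Basis. B i)" by (intro sum_mono B)
      finally show "onorm (frechet_derivative \<theta> (at x)) \<le> (\<Sum>i\<in>Basis. B i)" .
    qed auto
  qed
qed

text \<open>A displacement \<open>\<theta>\<close>, prescribed in a chart near \<open>x0\<close>, is multiplied by a bump function.  As it is
  linear in the parameter \<open>p\<close>, its Lipschitz constant is a multiple of \<open>norm p\<close>, so for small \<open>p\<close> it
  displaces the identity to a diffeomorphism.\<close>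

lemma localized_perturbation:
  fixes \<theta> :: "'p::euclidean_space \<Rightarrow> R3 \<Rightarrow> R3" and \<A> :: "'m::t2_space chart set"
  assumes M: "closed_3_manifold \<A>" and c: "Cr_chart r \<A> c" and r: "r \<ge> 1"
    and x0: "x0 \<in> fst c" and Ob: "open Ob" "x0 \<in> Ob"
    and lin: "\<And>w. linear (\<lambda>p. \<theta> p w)"
    and rho0: "\<rho>0 > 0" and k: "\<And>p w. w \<in> ball (snd c x0) \<rho>0 \<Longrightarrow> Ck_at r (\<lambda>z. \<theta> (fst z) (snd z)) (p, w)"
  shows "\<exists>h \<delta> N. \<delta> > 0 \<and> open N \<and> x0 \<in> N \<and> N \<subseteq> Ob \<inter> fst c \<and> (\<forall>q. h 0 q = q) \<and>
    (\<forall>p\<in>ball 0 \<delta>. h p \<in> Diff r \<A> \<and> (\<forall>x. smooth_family_at r \<A> h p x) \<and>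
       (\<forall>q. q \<notin> Ob \<longrightarrow> h p q = q) \<and> (\<forall>q\<in>Ob. h p q \<in> Ob) \<and>
       (\<forall>q\<in>N. h p q \<in> fst c \<and> snd c (h p q) = snd c q + \<theta> p (snd c q)))"
proof -
  note ic = Cr_chart_is_chart[OF c]
  let ?w0 = "snd c x0"
  have "open (snd c ` (fst c \<inter> Ob))"
    by (rule is_chart_open_image[OF ic open_Int[OF is_chartD(1)[OF ic] Ob(1)]]) simp
  then obtain \<rho>1 where rho1: "\<rho>1 > 0" "ball ?w0 \<rho>1 \<subseteq> snd c ` (fst c \<inter> Ob)"
    using x0 Ob(2) by (metis IntI imageI openE)
  define \<rho> where "\<rho> = min \<rho>0 \<rho>1 / 2"
  have rho: "\<rho> > 0" "\<rho> < \<rho>0" "\<rho> < \<rho>1" using rho0 rho1 by (auto simp: \<rho>_def)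
  define C where "C = cball ?w0 \<rho>"
  have C: "compact C" "C \<subseteq> snd c ` (fst c \<inter> Ob)" using rho rho1(2) by (auto simp: C_def)
  have C': "C \<subseteq> snd c ` fst c" using C(2) by blast
  obtain bmp :: "R3 \<Rightarrow> real" where "\<forall>w. Ck_at r bmp w" "\<forall>w. dist ?w0 w < \<rho> / 2 \<longrightarrow> bmp w = 1"
    "\<forall>w. dist ?w0 w \<ge> \<rho> \<longrightarrow> bmp w = 0"
    using bump_function[OF rho(1), where k=r and ctr="?w0"] by blast
  then have bmp: "\<And>w. Ck_at r bmp w" "\<And>w. dist ?w0 w < \<rho> / 2 \<Longrightarrow> bmp w = 1"
    "\<And>w. dist ?w0 w \<ge> \<rho> \<Longrightarrow> bmp w = 0" by simp_all
  define T where "T = (\<lambda>p w. bmp w *\<^sub>R \<theta> p w)"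
  have Toff: "T p w = 0" if "w \<notin> C" for p w using that bmp(3)[of w] by (simp add: T_def C_def)
  have Tlin: "linear (\<lambda>p. T p w)" for w unfolding T_def using lin by (rule linear_compose_scale_right)
  have kT: "Ck_at r (\<lambda>z. T (fst z) (snd z)) (p, w)" for p w
  proof (cases "w \<in> ball ?w0 \<rho>0")
    case True
    have "Ck_at r (\<lambda>z. bmp (snd z)) (p, w)"
      by (rule Ck_at_compose[where f=snd and g=bmp]) (auto intro: bmp Ck_at_bounded_linear bounded_linear_snd)
    then show ?thesis unfolding T_def by (intro Ck_at_scaleR k[OF True])
  next
    case False
    have "Ck_at r (\<lambda>z. 0 :: R3) (p, w)" by simp
    then show ?thesis
    proof (rule Ck_at_cong)
      show "\<forall>\<^sub>F y in nhds (p, w). 0 = T (fst y) (snd y)"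
        unfolding eventually_nhds
        by (rule exI[of _ "UNIV \<times> (- C)"])
          (use False rho C(1) Toff in \<open>auto simp: C_def intro: open_Times\<close>)
    qed
  qed
  have kTp: "Ck_on r (T p) UNIV" for p
  proof (rule Ck_on_atI)
    fix w :: R3
    have "Ck_at r (\<lambda>w. (p, w)) w" by (intro Ck_at_intros)
    from Ck_at_compose[OF this kT[of p w]] show "Ck_at r (T p) w" by simp
  qed
  have "\<forall>b\<in>Basis. \<exists>B\<ge>0. \<forall>w w'. norm (T b w - T b w') \<le> B * norm (w - w')"
  proof
    fix b :: 'p
    show "\<exists>B\<ge>0. \<forall>w w'. norm (T b w - T b w') \<le> B * norm (w - w')"
      using compact_support_imp_lipschitz[OF Ck_on_le[OF kTp r] C(1), of b] Toff by metis
  qed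
  then obtain B where B: "\<And>b. b \<in> Basis \<Longrightarrow> B b \<ge> 0"
    "\<And>b w w'. b \<in> Basis \<Longrightarrow> norm (T b w - T b w') \<le> B b * norm (w - w')" by metis
  define K where "K = (\<Sum>b\<in>Basis. B b) + 1"
  have K: "K > 0" unfolding K_def using B by (intro add_nonneg_pos sum_nonneg) auto
  have Tlip: "norm (T p w - T p w') \<le> K * norm p * norm (w - w')" for p w w'
  proof -
    have ex: "T p w = (\<Sum>b\<in>Basis. (p \<bullet> b) *\<^sub>R T b w)" for w
    proof -
      have "T p w = T (\<Sum>b\<in>Basis. (p \<bullet> b) *\<^sub>R b) w" by (simp add: euclidean_representation)
      then show ?thesis by (simp add: linear_sum[OF Tlin] linear_scale[OF Tlin])
    qed
    have "norm (T p w - T p w') = norm (\<Sum>b\<in>Basis. (p \<bullet> b) *\<^sub>R (T b w - T b w'))"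
      unfolding ex by (simp add: sum_subtractf scaleR_diff_right)
    also have "\<dots> \<le> (\<Sum>b\<in>Basis. norm p * (B b * norm (w - w')))"
      by (intro sum_norm_le) (auto intro!: mult_mono B Basis_le_norm)
    also have "\<dots> = (\<Sum>b\<in>Basis. B b) * norm p * norm (w - w')"
      by (simp add: sum_distrib_left sum_distrib_right mult_ac)
    also have "\<dots> \<le> K * norm p * norm (w - w')" by (intro mult_right_mono) (auto simp: K_def)
    finally show ?thesis .
  qed
  define \<delta> where "\<delta> = 1 / (2 * K)"
  have \<delta>: "\<delta> > 0" using K by (simp add: \<delta>_def)
  have half: "norm (T p w - T p w') \<le> 1 / 2 * norm (w - w')" if "p \<in> ball 0 \<delta>" for p w w'
  proof -
    have "K * norm p \<le> 1 / 2" using that K by (simp add: \<delta>_def field_simps)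
    then have "K * norm p * norm (w - w') \<le> 1 / 2 * norm (w - w')" by (intro mult_right_mono) auto
    then show ?thesis using Tlip[of p w w'] by linarith
  qed
  define g where "g = (\<lambda>p w. w + T p w)"
  note dif = id_plus_contraction_diffeo[OF kTp r half, folded g_def]
  have goff: "g p w = w" if "w \<notin> C" for p w using that Toff by (simp add: g_def)
  have gon: "g p w \<in> C" if "p \<in> ball 0 \<delta>" "w \<in> C" for p w
  proof (rule ccontr)
    assume "g p w \<notin> C"
    then have "g p (g p w) = g p w" by (rule goff)
    then have "g p w = w" using bij_is_inj[OF dif(1)[OF that(1)]] by (metis g_def injD)
    then show False using \<open>g p w \<notin> C\<close> that by simp
  qed
  have bijg: "bij (g p)" "Ck_on r (g p) UNIV" "Ck_on r (inv (g p)) UNIV" if "p \<in> ball 0 \<delta>" for p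
    using dif[OF that] unfolding g_def by auto
  define h where "h = (\<lambda>p. lift c (g p))"
  define N where "N = chart_inv c ` ball ?w0 (\<rho> / 2)"
  have bC: "ball ?w0 (\<rho> / 2) \<subseteq> C" using rho by (auto simp: C_def)
  have N: "q \<in> fst c" "q \<in> Ob" "snd c q \<in> ball ?w0 (\<rho> / 2)" if qN: "q \<in> N" for q
  proof -
    obtain w where w: "q = chart_inv c w" "w \<in> ball ?w0 (\<rho> / 2)" using qN unfolding N_def by blast
    then obtain y where y: "w = snd c y" "y \<in> fst c" "y \<in> Ob" using bC C(2) by blast
    then show "q \<in> fst c" "q \<in> Ob" "snd c q \<in> ball ?w0 (\<rho> / 2)" using w is_chartD(3)[OF ic y(2)] by simp_all
  qed
  show ?thesis
  proof (intro exI[of _ h] exI[of _ \<delta>] exI[of _ N] conjI allI ballI impI \<delta>)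
    show "open N" unfolding N_def by (rule is_chart_open_inv_image[OF ic open_ball]) (use bC C' in blast)
    show "x0 \<in> N" unfolding N_def
      by (rule image_eqI[of _ _ ?w0]) (use is_chartD(3)[OF ic x0] rho in auto)
    show "N \<subseteq> Ob \<inter> fst c" using N by blast
    show "h p \<in> Diff r \<A>" if "p \<in> ball 0 \<delta>" for p
      unfolding h_def by (rule lift_in_Diff[OF M c C(1) C' goff bijg[OF that]])
    show "smooth_family_at r \<A> h p x" if "p \<in> ball 0 \<delta>" for p x
      unfolding h_def
    proof (rule smooth_family_at_lift[OF M c C(1) C' open_ball that goff gon])
      show "Ck_at r (\<lambda>z. g (fst z) (snd z)) (q, w)" for q w
        unfolding g_def by (intro Ck_at_add kT) (auto intro: Ck_at_bounded_linear bounded_linear_snd)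
    qed
    show "h 0 q = q" for q
      using linear_0[OF Tlin] is_chartD(3)[OF ic] by (simp add: h_def lift_def g_def)
    show "h p q = q" if "p \<in> ball 0 \<delta>" "q \<notin> Ob" for p q
    proof (cases "q \<in> fst c")
      case True
      have "snd c q \<notin> C"
      proof
        assume "snd c q \<in> C"
        then obtain y where "snd c q = snd c y" "y \<in> fst c" "y \<in> Ob" using C(2) by blast
        then show False using is_chartD(3)[OF ic] True that(2) by metis
      qed
      then show ?thesis using goff True is_chartD(3)[OF ic] by (simp add: h_def lift_def)
    qed (simp add: h_def lift_def)
    show "h p q \<in> Ob" if "p \<in> ball 0 \<delta>" "q \<in> Ob" for p q
    proof (cases "q \<in> fst c")
      case True
      show ?thesis
      proof (cases "snd c q \<in> C")
        case inC: True
        then have "g p (snd c q) \<in> C" by (rule gon[OF that(1)])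
        then obtain y where y: "g p (snd c q) = snd c y" "y \<in> fst c" "y \<in> Ob" using C(2) by blast
        then show ?thesis using True is_chartD(3)[OF ic] by (simp add: h_def lift_def)
      next
        case False
        then show ?thesis using goff True is_chartD(3)[OF ic] that by (simp add: h_def lift_def)
      qed
    qed (use that in \<open>simp add: h_def lift_def\<close>)
    fix p :: 'p and q :: 'm assume p: "p \<in> ball 0 \<delta>" and q: "q \<in> N"
    have "g p (snd c q) \<in> C" using gon[OF p] N(3)[OF q] bC by blast
    then have im: "g p (snd c q) \<in> snd c ` fst c" using C' by blast
    have hq: "h p q = chart_inv c (g p (snd c q))" using N(1)[OF q] by (simp add: h_def lift_def)
    show "h p q \<in> fst c" unfolding hq by (rule is_chartD(5)[OF ic im])
    have "bmp (snd c q) = 1" using bmp(2) N(3)[OF q] by simp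
    then show "snd c (h p q) = snd c q + \<theta> p (snd c q)"
      unfolding hq is_chartD(4)[OF ic im] by (simp add: g_def T_def)
  qed
qed

section \<open>Passages near a linearizable saddle\<close>

lemma funpow_in_Diff:
  assumes "closed_3_manifold \<A>" "f \<in> Diff r \<A>" shows "f ^^ n \<in> Diff r \<A>"
proof (induction n)
  case 0
  have "inv (id :: 'a \<Rightarrow> 'a) = id" by (rule inv_id)
  then show ?case using Cr_map_id[OF assms(1), of r] by (simp add: Diff_def id_def[symmetric])
next
  case (Suc n)
  then show ?case using Diff_compose[OF assms(1) Suc assms(2)] by (simp only: funpow.simps)
qed

lemma Diff_continuous: "f \<in> Diff r \<A> \<Longrightarrow> continuous_on UNIV f"
  by (auto simp: Diff_def Cr_map_def)

lemma inv_in_Diff: "f \<in> Diff r \<A> \<Longrightarrow> inv f \<in> Diff r \<A>"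
  by (auto simp: Diff_def bij_imp_bij_inv inv_inv_eq)

text \<open>The derivative of the chart expression of the inverse is a left inverse.\<close>

lemma Diff_derivative_inj:
  assumes M: "closed_3_manifold \<A>" and g: "g \<in> Diff r \<A>" and r: "r \<ge> 1"
    and c: "Cr_chart r \<A> c" "x \<in> fst c" and d: "Cr_chart r \<A> d" "g x \<in> fst d"
    and D: "((\<lambda>u. snd d (g (chart_inv c u))) has_derivative A) (at (snd c x))"
  shows "inj A"
proof -
  note ic = Cr_chart_is_chart[OF c(1)] and id = Cr_chart_is_chart[OF d(1)]
  have bij: "bij g" and kg: "Cr_map r \<A> g" and ki: "Cr_map r \<A> (inv g)" using g by (auto simp: Diff_def)
  have gi: "inv g (g y) = y" for y using bij by (simp add: bij_is_inj)
  let ?G = "\<lambda>u. snd d (g (chart_inv c u))" and ?H = "\<lambda>u. snd c (inv g (chart_inv d u))"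
  have "Ck_at r ?H (snd d (g x))"
    by (rule Cr_map_chart_expression[OF M ki d(1) c(1) d(2)]) (use gi c in simp)
  then have "Ck_at 1 ?H (snd d (g x))" by (rule Ck_at_le[OF _ r])
  then have "?H differentiable (at (snd d (g x)))" using Ck_at_differentiable[of 0] by simp
  then obtain B where B: "(?H has_derivative B) (at (snd d (g x)))" by (auto simp: differentiable_def)
  have Gx: "?G (snd c x) = snd d (g x)" using is_chartD(3)[OF ic c(2)] by simp
  have "((\<lambda>u. ?H (?G u)) has_derivative (\<lambda>h. B (A h))) (at (snd c x))"
    by (rule has_derivative_compose[OF D]) (use B Gx in simp)
  moreover have "((\<lambda>u. ?H (?G u)) has_derivative (\<lambda>h. h)) (at (snd c x))"
  proof -
    have cc: "isCont (chart_inv c) (snd c x)" by (rule is_chart_isCont(2)[OF ic imageI[OF c(2)]])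
    have "isCont g (chart_inv c (snd c x))"
      using Diff_continuous[OF g] by (simp add: continuous_on_eq_continuous_at)
    from isCont_eventually_in[OF isCont_o2[OF cc this] is_chartD(1)[OF id]]
    have 1: "\<forall>\<^sub>F u in nhds (snd c x). g (chart_inv c u) \<in> fst d" using is_chartD(3)[OF ic c(2)] d by simp
    have 2: "\<forall>\<^sub>F u in nhds (snd c x). u \<in> snd c ` fst c"
      using is_chartD(2)[OF ic] c(2) by (auto simp: eventually_nhds)
    have "\<forall>\<^sub>F u in nhds (snd c x). ?H (?G u) = u"
      using 1 2 by eventually_elim (simp add: is_chartD(3)[OF id] gi is_chartD(4)[OF ic])
    then obtain S where "open S" "snd c x \<in> S" "\<And>u. u \<in> S \<Longrightarrow> ?H (?G u) = u" by (auto simp: eventually_nhds)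
    then show ?thesis
      using has_derivative_transform_within_open[of "\<lambda>h. h" "\<lambda>h. h" "snd c x" UNIV S "\<lambda>u. ?H (?G u)"]
      by simp
  qed
  ultimately have "(\<lambda>h. B (A h)) = (\<lambda>h. h)" by (rule has_derivative_unique)
  then show ?thesis by (metis injI)
qed

lemma periodic_pointD:
  assumes "periodic_point f x"
  shows "period f x > 0" "(f ^^ period f x) x = x"
proof -
  obtain n where "n > 0 \<and> (f ^^ n) x = x" using assms by (auto simp: periodic_point_def)
  then have "0 < period f x \<and> (f ^^ period f x) x = x" unfolding period_def by (rule LeastI)
  then show "period f x > 0" "(f ^^ period f x) x = x" by auto
qed

lemma inv_funpow_cancel:
  assumes "bij f" shows "(inv f ^^ n) ((f ^^ n) x) = x" "(f ^^ n) ((inv f ^^ n) x) = x"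
proof -
  show "(inv f ^^ n) ((f ^^ n) x) = x"
  proof (induction n)
    case (Suc n)
    have "(inv f ^^ Suc n) ((f ^^ Suc n) x) = (inv f ^^ n) (inv f (f ((f ^^ n) x)))"
      by (simp only: funpow_Suc_right[of n "inv f"] funpow.simps(2)[of n f] o_apply)
    then show ?case using Suc assms by (simp add: bij_is_inj)
  qed simp
  show "(f ^^ n) ((inv f ^^ n) x) = x"
  proof (induction n)
    case (Suc n)
    have "(f ^^ Suc n) ((inv f ^^ Suc n) x) = (f ^^ n) (f (inv f ((inv f ^^ n) x)))"
      by (simp only: funpow_Suc_right[of n f] funpow.simps(2)[of n "inv f"] o_apply)
    then show ?case using Suc assms by (simp add: bij_is_surj surj_f_inv_f)
  qed simp
qed

lemma period_inv: "bij f \<Longrightarrow> period (inv f) x = period f x"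
proof -
  assume b: "bij f"
  have "(inv f ^^ n) x = x \<longleftrightarrow> (f ^^ n) x = x" for n
    using inv_funpow_cancel[OF b] by metis
  then show ?thesis by (simp add: period_def)
qed

lemma funpow_fixed: "g x = x \<Longrightarrow> (g ^^ n) x = x"
  by (induction n) auto

lemma funpow_mult_fixed: "(f ^^ p) x = x \<Longrightarrow> (f ^^ (p * n)) x = x"
  using funpow_fixed[of "f ^^ p" x n] by (simp add: funpow_mult mult.commute)

definition diag3 :: "real \<Rightarrow> real \<Rightarrow> real \<Rightarrow> nat \<Rightarrow> R3 \<Rightarrow> R3" where
  "diag3 l s t n w = (l ^ n * fst w, s ^ n * fst (snd w), t ^ n * snd (snd w))"

lemma diag3_0 [simp]: "diag3 l s t 0 w = w"
  by (simp add: diag3_def)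

lemma diag3_Suc: "diag3 l s t (Suc n) w = (l * fst (diag3 l s t n w), s * fst (snd (diag3 l s t n w)), t * snd (snd (diag3 l s t n w)))"
  by (simp add: diag3_def mult.assoc)

lemma diag3_add: "diag3 l s t m (diag3 l s t n w) = diag3 l s t (m + n) w"
  by (simp add: diag3_def power_add mult.assoc)

lemma continuous_on_funpow:
  fixes f :: "'a::topological_space \<Rightarrow> 'a"
  assumes "continuous_on UNIV f" shows "continuous_on UNIV (f ^^ i)"
proof (induction i)
  case (Suc i)
  then have "continuous_on UNIV (f \<circ> (f ^^ i))"
    using assms by (intro continuous_on_compose) (auto intro: continuous_on_subset)
  then show ?case by simp
qed (simp add: id_def continuous_on_id)

lemma open_funpow_condition:
  fixes f :: "'a::topological_space \<Rightarrow> 'a"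
  assumes "continuous_on UNIV f" "open V" shows "open {q. (f ^^ i) q \<in> V}"
proof -
  have "continuous_on UNIV (f ^^ i)" by (rule continuous_on_funpow[OF assms(1)])
  then show ?thesis using continuous_on_open_vimage[of UNIV "f ^^ i"] assms(2) by (auto simp: vimage_def)
qed

lemma linear_orbit_in_chart:
  assumes lin: "linearizing_chart r \<A> f S c l s t"
    and orb: "\<And>j. j \<le> n \<Longrightarrow> (f ^^ (period f S * j)) q \<in> fst c" and j: "j \<le> n"
  shows "snd c ((f ^^ (period f S * j)) q) = diag3 l s t j (snd c q)"
  using j
proof (induction j)
  case (Suc j)
  have e: "(f ^^ (period f S * Suc j)) q = (f ^^ period f S) ((f ^^ (period f S * j)) q)"
    by (simp add: funpow_add)
  have "(f ^^ (period f S * j)) q \<in> fst c" "(f ^^ period f S) ((f ^^ (period f S * j)) q) \<in> fst c"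
    using orb[of j] orb[of "Suc j", unfolded e] Suc.prems by simp_all
  then have "snd c ((f ^^ period f S) ((f ^^ (period f S * j)) q)) =
      (case snd c ((f ^^ (period f S * j)) q) of (u, v, w) \<Rightarrow> (l * u, s * v, t * w))"
    using lin unfolding linearizing_chart_def by blast
  then show ?case unfolding e using Suc by (simp add: diag3_Suc split_beta)
qed simp

lemma power_abs_small:
  fixes l :: real
  assumes "\<bar>l\<bar> < 1" "K > 0" "\<epsilon> > 0"
  shows "\<exists>J. \<forall>j\<ge>J. \<bar>l\<bar> ^ j * K < \<epsilon>"
proof -
  have "(\<lambda>j. \<bar>l\<bar> ^ j * K) \<longlonglongrightarrow> 0 * K"
    using assms(1) by (intro tendsto_mult LIMSEQ_power_zero) auto
  then have "\<forall>\<^sub>F j in sequentially. \<bar>l\<bar> ^ j * K < \<epsilon>" using assms(3) by (intro order_tendstoD) auto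
  then show ?thesis by (simp add: eventually_sequentially)
qed

text \<open>In the middle of a long passage, a coordinate is small: a contracted one because of its
  initial value, an expanded one because of its final value.\<close>

lemma middle_coordinate_small:
  fixes l K \<epsilon> :: real
  assumes "\<bar>l\<bar> \<noteq> 1" "l \<noteq> 0" "K > 0" "\<epsilon> > 0"
  shows "\<exists>J. \<forall>n j u. J \<le> j \<and> j + J \<le> n \<and> \<bar>u\<bar> \<le> K \<and> \<bar>l ^ n * u\<bar> \<le> K \<longrightarrow> \<bar>l ^ j * u\<bar> < \<epsilon>"
proof (cases "\<bar>l\<bar> < 1")
  case True
  obtain J where J: "\<And>j. j \<ge> J \<Longrightarrow> \<bar>l\<bar> ^ j * K < \<epsilon>" using power_abs_small[OF True assms(3,4)] by blast
  have "\<bar>l ^ j * u\<bar> < \<epsilon>" if "J \<le> j" "\<bar>u\<bar> \<le> K" for j u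
  proof -
    have "\<bar>l ^ j * u\<bar> \<le> \<bar>l\<bar> ^ j * K" using that by (auto simp: abs_mult power_abs intro: mult_left_mono)
    then show ?thesis using J[OF that(1)] by simp
  qed
  then show ?thesis by blast
next
  case False
  then have "\<bar>inverse l\<bar> < 1" using assms(1,2) by (simp add: abs_inverse field_simps)
  then obtain J where J: "\<And>j. j \<ge> J \<Longrightarrow> \<bar>inverse l\<bar> ^ j * K < \<epsilon>" using power_abs_small[OF _ assms(3,4)] by blast
  have "\<bar>l ^ j * u\<bar> < \<epsilon>" if "j + J \<le> n" "\<bar>l ^ n * u\<bar> \<le> K" for n j u
  proof -
    define i where "i = n - j"
    have i: "n = j + i" "i \<ge> J" using that(1) by (auto simp: i_def)
    have "l ^ j * u = inverse l ^ i * (l ^ n * u)"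
      using assms(2) by (simp add: i(1) power_add power_inverse field_simps)
    then have "\<bar>l ^ j * u\<bar> = \<bar>inverse l ^ i * (l ^ n * u)\<bar>" by (simp only:)
    then have "\<bar>l ^ j * u\<bar> = \<bar>inverse l\<bar> ^ i * \<bar>l ^ n * u\<bar>" by (simp only: abs_mult power_abs)
    also have "\<dots> \<le> \<bar>inverse l\<bar> ^ i * K" using that(2) by (intro mult_left_mono) auto
    finally show ?thesis using J[OF i(2)] by simp
  qed
  then show ?thesis by blast
qed

lemma norm_R3_le: "norm (w :: R3) \<le> \<bar>fst w\<bar> + \<bar>fst (snd w)\<bar> + \<bar>snd (snd w)\<bar>"
  using norm_Pair_le[of "fst w" "snd w"] norm_Pair_le[of "fst (snd w)" "snd (snd w)"] by simp

lemma abs_component_le_norm: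
  fixes w :: R3 shows "\<bar>fst w\<bar> \<le> norm w" "\<bar>fst (snd w)\<bar> \<le> norm w" "\<bar>snd (snd w)\<bar> \<le> norm w"
proof -
  have 1: "\<bar>fst w\<bar> \<le> norm w" "norm (snd w) \<le> norm w"
    using norm_fst_le[of "fst w" "snd w"] norm_snd_le[of "snd w" "fst w"] by simp_all
  have 2: "\<bar>fst (snd w)\<bar> \<le> norm (snd w)" "\<bar>snd (snd w)\<bar> \<le> norm (snd w)"
    using norm_fst_le[of "fst (snd w)" "snd (snd w)"] norm_snd_le[of "snd (snd w)" "fst (snd w)"] by simp_all
  show "\<bar>fst w\<bar> \<le> norm w" "\<bar>fst (snd w)\<bar> \<le> norm w" "\<bar>snd (snd w)\<bar> \<le> norm w"
    using 1 2 by linarith+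
qed

text \<open>An orbit segment that enters the chart near \<open>A\<close> and whose linear continuation leaves it near
  \<open>B\<close> follows the linear map, and it shadows the forward orbit of \<open>A\<close>, the orbit of \<open>S\<close> and the
  backward orbit of \<open>B\<close>; hence it stays in any neighbourhood \<open>E\<close> of these.\<close>

lemma saddle_passage:
  assumes lin: "linearizing_chart r \<A> f S c l s t" and bij: "bij f" and cont: "continuous_on UNIV f"
    and per: "periodic_point f S"
    and ev: "\<bar>l\<bar> \<noteq> 1" "l \<noteq> 0" "\<bar>s\<bar> \<noteq> 1" "s \<noteq> 0" "\<bar>t\<bar> \<noteq> 1" "t \<noteq> 0"
    and A: "A \<in> local_stable_manifold f S (fst c)" and B: "B \<in> local_unstable_manifold f S (fst c)"
    and E: "open E" "\<And>i. i > 0 \<Longrightarrow> (f ^^ i) A \<in> E" "\<And>i. (inv f ^^ i) B \<in> E" "\<And>i. (f ^^ i) S \<in> E"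
  shows "\<exists>\<delta>>0. \<exists>n0. \<forall>n\<ge>n0. \<forall>w. dist w (snd c A) < \<delta> \<and> dist (diag3 l s t n w) (snd c B) < \<delta> \<longrightarrow>
    w \<in> snd c ` fst c \<and> diag3 l s t n w \<in> snd c ` fst c \<and>
    (f ^^ (period f S * n)) (chart_inv c w) = chart_inv c (diag3 l s t n w) \<and>
    (\<forall>i. 0 < i \<and> i \<le> period f S * n \<longrightarrow> (f ^^ i) (chart_inv c w) \<in> E)"
proof -
  let ?p = "period f S"
  let ?D = "diag3 l s t"
  have ic: "is_chart c" and Sc: "S \<in> fst c" "snd c S = (0, 0, 0)"
    using lin by (auto simp: linearizing_chart_def Cr_chart_def)
  have p: "?p > 0" "(f ^^ ?p) S = S" using periodic_pointD[OF per] by auto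
  have Ac: "\<And>n. (f ^^ (?p * n)) A \<in> fst c" using A by (auto simp: local_stable_manifold_def)
  have Bc: "\<And>n. (inv f ^^ (?p * n)) B \<in> fst c"
    using B by (auto simp: local_stable_manifold_def local_unstable_manifold_def period_inv[OF bij])
  have opn: "open {q. (f ^^ i) q \<in> V}" if "open V" for i V by (rule open_funpow_condition[OF cont that])
  define W where "W = fst c \<inter> {q. (f ^^ ?p) q \<in> fst c} \<inter> (\<Inter>i\<in>{..?p}. {q. (f ^^ i) q \<in> E})"
  have oW: "open W" unfolding W_def
    by (intro open_Int open_INT ballI opn is_chartD(1)[OF ic] E(1)) auto
  have SW: "S \<in> W" unfolding W_def using Sc p E(4) by auto
  have "open (snd c ` W)" by (rule is_chart_open_image[OF ic oW]) (auto simp: W_def)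
  then obtain e where e: "e > 0" "ball (0, 0, 0) e \<subseteq> snd c ` W"
    using SW Sc(2) by (metis imageI openE)
  define K where "K = norm (snd c A) + norm (snd c B) + 1"
  have K: "K > 0" by (simp add: K_def add_nonneg_pos)
  obtain J1 where J1: "\<And>n j u. J1 \<le> j \<Longrightarrow> j + J1 \<le> n \<Longrightarrow> \<bar>u\<bar> \<le> K \<Longrightarrow> \<bar>l ^ n * u\<bar> \<le> K \<Longrightarrow> \<bar>l ^ j * u\<bar> < e / 3"
    using middle_coordinate_small[OF ev(1,2) K, of "e / 3"] e(1) by auto
  obtain J2 where J2: "\<And>n j u. J2 \<le> j \<Longrightarrow> j + J2 \<le> n \<Longrightarrow> \<bar>u\<bar> \<le> K \<Longrightarrow> \<bar>s ^ n * u\<bar> \<le> K \<Longrightarrow> \<bar>s ^ j * u\<bar> < e / 3"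
    using middle_coordinate_small[OF ev(3,4) K, of "e / 3"] e(1) by auto
  obtain J3 where J3: "\<And>n j u. J3 \<le> j \<Longrightarrow> j + J3 \<le> n \<Longrightarrow> \<bar>u\<bar> \<le> K \<Longrightarrow> \<bar>t ^ n * u\<bar> \<le> K \<Longrightarrow> \<bar>t ^ j * u\<bar> < e / 3"
    using middle_coordinate_small[OF ev(5,6) K, of "e / 3"] e(1) by auto
  define J where "J = J1 + J2 + J3"
  have mid: "?D j w \<in> snd c ` W"
    if "J \<le> j" "j + J \<le> n" "norm w \<le> K" "norm (?D n w) \<le> K" for j n w
  proof -
    have "\<bar>l ^ j * fst w\<bar> < e / 3"
      using that abs_component_le_norm(1)[of w] abs_component_le_norm(1)[of "?D n w"]
      by (intro J1[of j n]) (auto simp: diag3_def J_def)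
    moreover have "\<bar>s ^ j * fst (snd w)\<bar> < e / 3"
      using that abs_component_le_norm(2)[of w] abs_component_le_norm(2)[of "?D n w"]
      by (intro J2[of j n]) (auto simp: diag3_def J_def)
    moreover have "\<bar>t ^ j * snd (snd w)\<bar> < e / 3"
      using that abs_component_le_norm(3)[of w] abs_component_le_norm(3)[of "?D n w"]
      by (intro J3[of j n]) (auto simp: diag3_def J_def)
    ultimately have "norm (?D j w) < e" using norm_R3_le[of "?D j w"] by (simp add: diag3_def)
    then have "?D j w \<in> ball (0, 0, 0) e" by (simp add: dist_norm flip: zero_prod_def)
    then show ?thesis using e(2) by blast
  qed
  define N1 where "N1 = (\<Inter>i\<in>{1..?p * J}. {q. (f ^^ i) q \<in> E}) \<inter> (\<Inter>j\<in>{..J}. {q. (f ^^ (?p * j)) q \<in> fst c})"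
  have oN1: "open N1" unfolding N1_def by (intro open_Int open_INT ballI opn is_chartD(1)[OF ic] E(1)) auto
  have AN1: "A \<in> N1" unfolding N1_def using E(2) Ac by auto
  define B' where "B' = (inv f ^^ (?p * J)) B"
  define N3 where "N3 = (\<Inter>i\<in>{..?p * J}. {q. (f ^^ i) q \<in> E}) \<inter> (\<Inter>j\<in>{..J}. {q. (f ^^ (?p * j)) q \<in> fst c})"
  have oN3: "open N3" unfolding N3_def by (intro open_Int open_INT ballI opn is_chartD(1)[OF ic] E(1)) auto
  have fB': "(f ^^ i) B' = (inv f ^^ (?p * J - i)) B" if "i \<le> ?p * J" for i
  proof -
    have "B' = (inv f ^^ (i + (?p * J - i))) B" using that by (simp add: B'_def)
    also have "\<dots> = (inv f ^^ i) ((inv f ^^ (?p * J - i)) B)" by (simp only: funpow_add o_apply)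
    finally show ?thesis using inv_funpow_cancel(2)[OF bij] by simp
  qed
  have B'c: "(f ^^ (?p * j)) B' \<in> fst c" if "j \<le> J" for j
    using fB'[of "?p * j"] Bc[of "J - j"] that by (simp add: diff_mult_distrib2)
  have BN3: "B' \<in> N3" unfolding N3_def using E(3) fB' B'c by auto
  have B'0: "B' \<in> fst c" using B'c[of 0] by simp
  have DB': "snd c B = ?D J (snd c B')"
    using linear_orbit_in_chart[OF lin B'c, of J J] fB'[of "?p * J"] by simp
  define Di where "Di = (\<lambda>u::R3. (fst u / l ^ J, fst (snd u) / s ^ J, snd (snd u) / t ^ J))"
  have Di: "Di (?D J w) = w" for w using ev by (simp add: Di_def diag3_def)
  have "isCont Di (snd c B)" unfolding Di_def using ev by (intro continuous_intros) auto
  moreover have "open (snd c ` (N3 \<inter> fst c))"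
    by (rule is_chart_open_image[OF ic open_Int[OF oN3 is_chartD(1)[OF ic]]]) simp
  moreover have "Di (snd c B) \<in> snd c ` (N3 \<inter> fst c)" using BN3 B'0 by (simp add: DB' Di)
  ultimately have "\<forall>\<^sub>F u in nhds (snd c B). Di u \<in> snd c ` (N3 \<inter> fst c)" by (rule isCont_eventually_in)
  then obtain d3 where d3: "d3 > 0" "\<And>u. dist u (snd c B) < d3 \<Longrightarrow> Di u \<in> snd c ` (N3 \<inter> fst c)"
    unfolding eventually_nhds_metric by blast
  have A0: "A \<in> fst c" using Ac[of 0] by simp
  have "open (snd c ` (N1 \<inter> fst c))"
    by (rule is_chart_open_image[OF ic open_Int[OF oN1 is_chartD(1)[OF ic]]]) simp
  moreover have "snd c A \<in> snd c ` (N1 \<inter> fst c)" using AN1 A0 by simp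
  ultimately obtain d1 where d1: "d1 > 0" "ball (snd c A) d1 \<subseteq> snd c ` (N1 \<inter> fst c)" by (rule openE)
  define \<delta> where "\<delta> = Min {d1, d3, 1}"
  have \<delta>: "\<delta> > 0" "\<delta> \<le> d1" "\<delta> \<le> d3" "\<delta> \<le> 1" using d1 d3 by (auto simp: \<delta>_def)
  show ?thesis
  proof (intro exI[of _ \<delta>] conjI \<delta>(1) exI[of _ "2 * J"] allI impI)
    fix n w assume n: "2 * J \<le> n" and "dist w (snd c A) < \<delta> \<and> dist (?D n w) (snd c B) < \<delta>"
    then have wA: "dist w (snd c A) < \<delta>" and wB: "dist (?D n w) (snd c B) < \<delta>" by auto
    have wN: "w \<in> snd c ` (N1 \<inter> fst c)" using wA \<delta>(2) d1(2) by (auto simp: dist_commute)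
    define q where "q = chart_inv c w"
    obtain y where y: "w = snd c y" "y \<in> N1" "y \<in> fst c" using wN by blast
    have q: "q \<in> N1" "q \<in> fst c" "snd c q = w" using y is_chartD(3)[OF ic y(3)] by (auto simp: q_def)
    have nw: "norm w \<le> K"
      using wA \<delta>(4) norm_triangle_sub[of w "snd c A"] norm_ge_zero[of "snd c B"]
      by (simp only: K_def dist_norm)
    have nDw: "norm (?D n w) \<le> K"
      using wB \<delta>(4) norm_triangle_sub[of "?D n w" "snd c B"] norm_ge_zero[of "snd c A"]
      by (simp only: K_def dist_norm)
    let ?q = "\<lambda>j. (f ^^ (?p * j)) q"
    have s1: "?q j \<in> fst c" if "j \<le> J" for j using q that by (auto simp: N1_def)
    have c1: "snd c (?q J) = ?D J w" using linear_orbit_in_chart[OF lin s1, of J J] q by simp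
    have step: "?q (Suc j) = (f ^^ ?p) (?q j)" for j by (simp add: funpow_add)
    have W: "j + J \<le> n \<Longrightarrow> ?q j \<in> W \<and> snd c (?q j) = ?D j w" if "J \<le> j" for j
      using that
    proof (induction j rule: dec_induct)
      case base
      have "?D J w \<in> snd c ` W" by (rule mid[OF _ base nw nDw]) simp
      then obtain y where y: "snd c (?q J) = snd c y" "y \<in> W" using c1 by auto
      have "?q J \<in> fst c" "y \<in> fst c" using s1[of J] y(2) by (auto simp: W_def)
      then have "?q J = y" using y(1) is_chartD(3)[OF ic] by metis
      then show ?case using y c1 by simp
    next
      case (step j)
      then have IH: "?q j \<in> W" "snd c (?q j) = ?D j w" by auto
      then have in1: "?q j \<in> fst c" "(f ^^ ?p) (?q j) \<in> fst c" by (auto simp: W_def)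
      then have "snd c ((f ^^ ?p) (?q j)) = (case snd c (?q j) of (u, v, w) \<Rightarrow> (l * u, s * v, t * w))"
        using lin unfolding linearizing_chart_def by blast
      then have cS: "snd c (?q (Suc j)) = ?D (Suc j) w"
        using IH(2) \<open>\<And>j. ?q (Suc j) = (f ^^ ?p) (?q j)\<close> by (simp add: diag3_Suc split_beta)
      have "?D (Suc j) w \<in> snd c ` W" by (rule mid[OF _ step.prems nw nDw]) (use step in simp)
      then obtain y where y: "snd c (?q (Suc j)) = snd c y" "y \<in> W" using cS by auto
      have "?q (Suc j) \<in> fst c" "y \<in> fst c"
        using in1(2) y(2) \<open>\<And>j. ?q (Suc j) = (f ^^ ?p) (?q j)\<close> by (auto simp: W_def)
      then have "?q (Suc j) = y" using y(1) is_chartD(3)[OF ic] by metis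
      then show ?case using y cS by simp
    qed
    define q3 where "q3 = ?q (n - J)"
    have q3: "q3 \<in> fst c" "snd c q3 = ?D (n - J) w"
      using W[of "n - J"] n by (auto simp: q3_def W_def)
    have "Di (?D n w) = ?D (n - J) w"
    proof -
      have "?D n w = ?D J (?D (n - J) w)" using n by (simp add: diag3_add)
      then show ?thesis by (simp add: Di)
    qed
    then have "snd c q3 \<in> snd c ` (N3 \<inter> fst c)" using d3(2)[of "?D n w"] wB \<delta>(3) q3(2) by simp
    then have q3N: "q3 \<in> N3" using q3(1) is_chartD(3)[OF ic] by (metis IntE imageE)
    have q3c: "(f ^^ (?p * j)) q3 \<in> fst c" if "j \<le> J" for j using q3N that by (auto simp: N3_def)
    have qn: "?q n = (f ^^ (?p * J)) q3"
    proof -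
      have "?p * n = ?p * J + ?p * (n - J)" using n by (simp add: diff_mult_distrib2)
      then show ?thesis unfolding q3_def by (simp only: funpow_add o_apply)
    qed
    have "snd c (?q n) = ?D J (?D (n - J) w)"
      using linear_orbit_in_chart[OF lin q3c, of J J] qn q3(2) by simp
    then have cn: "snd c (?q n) = ?D n w" using n by (simp add: diag3_add)
    have qnc: "?q n \<in> fst c" using q3c[of J] qn by simp
    show "w \<in> snd c ` fst c" using q by auto
    show "?D n w \<in> snd c ` fst c" using cn qnc by (metis imageI)
    show "(f ^^ (?p * n)) (chart_inv c w) = chart_inv c (?D n w)"
      using is_chartD(3)[OF ic qnc] cn by (simp add: q_def)
    fix i assume i: "0 < i \<and> i \<le> ?p * n"
    have "(f ^^ i) q \<in> E"
    proof -
      consider "i \<le> ?p * J" | "?p * J < i" "i < ?p * (n - J)" | "?p * (n - J) \<le> i" by linarith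
      then show ?thesis
      proof cases
        case 1
        then show ?thesis using q(1) i by (auto simp: N1_def)
      next
        case 2
        define j where "j = i div ?p"
        have ij: "i = i mod ?p + ?p * j" by (simp add: j_def)
        have "J \<le> j" using 2(1) p(1) unfolding j_def
          by (metis less_imp_le_nat nonzero_mult_div_cancel_left div_le_mono not_gr_zero)
        moreover have "j < n - J" using 2(2) p(1) unfolding j_def by (simp add: less_mult_imp_div_less mult.commute)
        ultimately have "?q j \<in> W" using W[of j] n by auto
        moreover have "(f ^^ i) q = (f ^^ (i mod ?p)) (?q j)" by (subst ij) (simp add: funpow_add)
        moreover have "i mod ?p \<le> ?p" using p(1) by (simp add: less_imp_le)
        ultimately show ?thesis by (auto simp: W_def)
      next
        case 3
        define k where "k = i - ?p * (n - J)"
        have ik: "i = k + ?p * (n - J)" using 3 by (simp add: k_def)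
        have "?p * (n - J) = ?p * n - ?p * J" by (simp add: diff_mult_distrib2)
        then have "k \<le> ?p * J" using i unfolding k_def by linarith
        moreover have "(f ^^ i) q = (f ^^ k) q3" unfolding q3_def by (subst ik) (simp add: funpow_add)
        ultimately show ?thesis using q3N by (auto simp: N3_def)
      qed
    qed
    then show "(f ^^ i) (chart_inv c w) \<in> E" by (simp add: q_def)
  qed
qed

section \<open>The return map along the cycle\<close>

lemma compact_insert_limit:
  fixes u :: "nat \<Rightarrow> 'a::topological_space"
  assumes "u \<longlonglongrightarrow> l" shows "compact (insert l (range u))"
proof (rule compactI)
  fix C assume C: "\<forall>B\<in>C. open B" "insert l (range u) \<subseteq> \<Union>C"
  then obtain B where B: "B \<in> C" "l \<in> B" by blast
  then have "\<forall>\<^sub>F n in sequentially. u n \<in> B" using C(1) assms by (intro topological_tendstoD) auto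
  then obtain n0 where n0: "\<And>n. n \<ge> n0 \<Longrightarrow> u n \<in> B" by (auto simp: eventually_sequentially)
  have "\<forall>n. \<exists>B. B \<in> C \<and> u n \<in> B" using C(2) by blast
  then obtain g where g: "\<And>n. g n \<in> C \<and> u n \<in> g n" by metis
  show "\<exists>C'\<subseteq>C. finite C' \<and> insert l (range u) \<subseteq> \<Union>C'"
  proof (intro exI[of _ "insert B (g ` {..<n0})"] conjI)
    show "insert l (range u) \<subseteq> \<Union>(insert B (g ` {..<n0}))"
    proof
      fix x assume "x \<in> insert l (range u)"
      then consider "x = l" | n where "x = u n" by blast
      then show "x \<in> \<Union>(insert B (g ` {..<n0}))"
      proof cases
        case 2
        then show ?thesis using n0[of n] g[of n] by (cases "n < n0") auto
      qed (use B in auto)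
    qed
  qed (use B g in auto)
qed

text \<open>The orbit of \<open>y\<close> splits into \<open>p\<close> sequences, one for each residue modulo \<open>p\<close>, and each of them
  converges to a point of the orbit of \<open>S\<close>.\<close>

lemma compact_orbit_closure:
  fixes g :: "'a::t2_space \<Rightarrow> 'a"
  assumes cont: "continuous_on UNIV g" and p: "p > 0" "(g ^^ p) S = S"
    and lim: "(\<lambda>n. (g ^^ (p * n)) y) \<longlonglongrightarrow> S"
  shows "compact (range (\<lambda>i. (g ^^ i) y) \<union> range (\<lambda>i. (g ^^ i) S))"
proof -
  have ci: "isCont (g ^^ i) x" for i x
    using continuous_on_funpow[OF cont] by (simp add: continuous_on_eq_continuous_at)
  have dm: "(g ^^ i) x = (g ^^ (i mod p)) ((g ^^ (p * (i div p))) x)" for i x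
  proof -
    have "(g ^^ i) x = (g ^^ (i mod p + p * (i div p))) x" by simp
    then show ?thesis by (simp only: funpow_add o_apply)
  qed
  let ?K = "\<Union>i\<in>{..<p}. insert ((g ^^ i) S) (range (\<lambda>n. (g ^^ i) ((g ^^ (p * n)) y)))"
  have "compact ?K"
    by (intro compact_UN compact_insert_limit isCont_tendsto_compose[OF ci lim]) auto
  moreover have "range (\<lambda>i. (g ^^ i) y) \<union> range (\<lambda>i. (g ^^ i) S) = ?K"
  proof (intro set_eqI iffI)
    fix x assume "x \<in> range (\<lambda>i. (g ^^ i) y) \<union> range (\<lambda>i. (g ^^ i) S)"
    then consider i where "x = (g ^^ i) y" | i where "x = (g ^^ i) S" by blast
    then show "x \<in> ?K"
    proof cases
      case 1
      then have "x = (g ^^ (i mod p)) ((g ^^ (p * (i div p))) y)" using dm by simp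
      then show ?thesis using p(1) by (intro UN_I[of "i mod p"]) auto
    next
      case 2
      then have "x = (g ^^ (i mod p)) S" using dm[of i S] funpow_mult_fixed[OF p(2)] by simp
      then show ?thesis using p(1) by (intro UN_I[of "i mod p"]) auto
    qed
  next
    fix x assume "x \<in> ?K"
    then obtain i where "x = (g ^^ i) S \<or> (\<exists>n. x = (g ^^ i) ((g ^^ (p * n)) y))" by blast
    then show "x \<in> range (\<lambda>i. (g ^^ i) y) \<union> range (\<lambda>i. (g ^^ i) S)"
    proof
      assume "\<exists>n. x = (g ^^ i) ((g ^^ (p * n)) y)"
      then obtain n where "x = (g ^^ (i + p * n)) y" by (auto simp: funpow_add)
      then show ?thesis by blast
    qed blast
  qed
  ultimately show ?thesis by simp
qed

lemma compact_separation:
  fixes K :: "'a::t2_space set"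
  assumes "compact K" "x \<notin> K"
  obtains U V where "open U" "open V" "x \<in> U" "K \<subseteq> V" "U \<inter> V = {}"
proof -
  have "\<forall>y\<in>K. \<exists>U V. open U \<and> open V \<and> x \<in> U \<and> y \<in> V \<and> U \<inter> V = {}"
    using assms(2) hausdorff by metis
  then obtain U V where UV: "\<And>y. y \<in> K \<Longrightarrow> open (U y) \<and> open (V y) \<and> x \<in> U y \<and> y \<in> V y \<and> U y \<inter> V y = {}"
    by metis
  have op: "\<forall>B\<in>V ` K. open B" and cov: "K \<subseteq> \<Union>(V ` K)" using UV by auto
  obtain F where F: "F \<subseteq> V ` K" "finite F" "K \<subseteq> \<Union>F"
    using compactE[OF assms(1) cov] op by metis
  obtain T where T: "T \<subseteq> K" "finite T" "F = V ` T" using finite_subset_image[OF F(2,1)] by blast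
  show ?thesis
  proof (rule that[of "\<Inter>y\<in>T. U y" "\<Union>y\<in>T. V y"])
    show "open (\<Inter>y\<in>T. U y)" using T UV by (intro open_INT) auto
    show "open (\<Union>y\<in>T. V y)" using T UV by (intro open_UN) auto
    show "x \<in> (\<Inter>y\<in>T. U y)" using T UV by auto
    show "K \<subseteq> (\<Union>y\<in>T. V y)" using F T by auto
    show "(\<Inter>y\<in>T. U y) \<inter> (\<Union>y\<in>T. V y) = {}" using T UV by fastforce
  qed
qed

text \<open>The hypotheses on the cycle that govern which orbits return: linearizing charts at the two saddles,
  their numbers of contracted and expanded directions, and the normalized heteroclinic points.\<close>

locale saddle_cycle =
  fixes \<A> :: "'m::t2_space chart set" and f :: "'m \<Rightarrow> 'm" and P Q X Y :: 'm and r N1 N2 :: nat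
    and cP cQ :: "'m chart" and lP sP zP l s z :: real
  assumes M: "closed_3_manifold \<A>" and r: "r \<ge> 2" and f: "f \<in> Diff r \<A>"
    and perP: "periodic_point f P" and perQ: "periodic_point f Q"
    and linP: "linearizing_chart r \<A> f P cP lP sP zP" and linQ: "linearizing_chart r \<A> f Q cQ l s z"
    and evP: "\<bar>lP\<bar> < 1" "1 < \<bar>sP\<bar>" "1 < \<bar>zP\<bar>" and evQ: "\<bar>l\<bar> < 1" "1 < \<bar>s\<bar>" "\<bar>z\<bar> < 1"
    and N: "N1 > 0" "N2 > 0"
    and X: "X \<in> local_unstable_manifold f Q (fst cQ)" "snd cQ X = (0, 1, 0)"
    and p1: "(f ^^ N1) X \<in> local_stable_manifold f P (fst cP)" "snd cP ((f ^^ N1) X) = (1, 0, 0)"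
    and Y: "Y \<in> local_unstable_manifold f P (fst cP)" "snd cP Y = (0, 1, 1)"
    and p2: "(f ^^ N2) Y \<in> local_stable_manifold f Q (fst cQ)" "snd cQ ((f ^^ N2) Y) = (1, 0, 1)"
begin

abbreviation "p1 \<equiv> (f ^^ N1) X"
abbreviation "p2 \<equiv> (f ^^ N2) Y"
abbreviation "pP \<equiv> period f P"
abbreviation "pQ \<equiv> period f Q"

lemma bij_f: "bij f" using f by (simp add: Diff_def)
lemma cont_f: "continuous_on UNIV f" by (rule Diff_continuous[OF f])
lemma cont_fi: "continuous_on UNIV (inv f)" by (rule Diff_continuous[OF inv_in_Diff[OF f]])

lemma charts: "Cr_chart r \<A> cP" "Cr_chart r \<A> cQ" "is_chart cP" "is_chart cQ"
  "P \<in> fst cP" "Q \<in> fst cQ" "snd cP P = (0, 0, 0)" "snd cQ Q = (0, 0, 0)"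
  using linP linQ by (auto simp: linearizing_chart_def Cr_chart_def)

lemma pP: "pP > 0" "(f ^^ pP) P = P" and pQ: "pQ > 0" "(f ^^ pQ) Q = Q"
  using periodic_pointD[OF perP] periodic_pointD[OF perQ] by auto

lemma lims:
  "(\<lambda>n. (f ^^ (pP * n)) p1) \<longlonglongrightarrow> P" "(\<lambda>n. (f ^^ (pQ * n)) p2) \<longlonglongrightarrow> Q"
  "(\<lambda>n. (inv f ^^ (pQ * n)) X) \<longlonglongrightarrow> Q" "(\<lambda>n. (inv f ^^ (pP * n)) Y) \<longlonglongrightarrow> P"
  using p1 p2 X Y
  by (auto simp: local_stable_manifold_def local_unstable_manifold_def period_inv[OF bij_f])

lemma in_charts: "p1 \<in> fst cP" "Y \<in> fst cP" "p2 \<in> fst cQ" "X \<in> fst cQ"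
proof -
  have "(f ^^ (pP * 0)) p1 \<in> fst cP" "(inv f ^^ (pP * 0)) Y \<in> fst cP"
    "(f ^^ (pQ * 0)) p2 \<in> fst cQ" "(inv f ^^ (pQ * 0)) X \<in> fst cQ"
    using p1(1) p2(1) X(1) Y(1) period_inv[OF bij_f]
    unfolding local_stable_manifold_def local_unstable_manifold_def mem_Collect_eq by metis+
  then show "p1 \<in> fst cP" "Y \<in> fst cP" "p2 \<in> fst cQ" "X \<in> fst cQ" by simp_all
qed

lemma funpow_inj: "(f ^^ i) a = (f ^^ i) b \<Longrightarrow> a = b"
  using inv_funpow_cancel(1)[OF bij_f] by metis

text \<open>Points close enough to \<open>S\<close> stay in the linearizing chart for all of the first \<open>n\<close> turns.\<close>

lemma period_power_linear_near:
  assumes lin: "linearizing_chart r \<A> f S c a b e" and per: "periodic_point f S"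
  shows "\<forall>\<^sub>F u in nhds (0, 0, 0). u \<in> snd c ` fst c \<and>
    (f ^^ (period f S * n)) (chart_inv c u) \<in> fst c \<and>
    snd c ((f ^^ (period f S * n)) (chart_inv c u)) = diag3 a b e n u"
proof -
  have ic: "is_chart c" and Sc: "S \<in> fst c" "snd c S = (0, 0, 0)"
    using lin by (auto simp: linearizing_chart_def Cr_chart_def)
  define V where "V = (\<Inter>j\<in>{..n}. {q. (f ^^ (period f S * j)) q \<in> fst c})"
  have oV: "open V" unfolding V_def
    by (intro open_INT ballI open_funpow_condition[OF cont_f] is_chartD(1)[OF ic]) auto
  have "S \<in> V" unfolding V_def using funpow_mult_fixed[OF periodic_pointD(2)[OF per]] Sc by auto
  have i: "chart_inv c (0, 0, 0) = S" using is_chartD(3)[OF ic Sc(1)] Sc(2) by simp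
  have im: "(0, 0, 0) \<in> snd c ` fst c" using Sc by (metis imageI)
  have "\<forall>\<^sub>F u in nhds (0, 0, 0). chart_inv c u \<in> V"
    by (rule isCont_eventually_in[OF is_chart_isCont(2)[OF ic im] oV]) (use i \<open>S \<in> V\<close> in simp)
  moreover have "\<forall>\<^sub>F u in nhds (0, 0, 0). u \<in> snd c ` fst c"
    using is_chartD(2)[OF ic] im unfolding eventually_nhds by blast
  ultimately show ?thesis
  proof eventually_elim
    case (elim u)
    have "(f ^^ (period f S * j)) (chart_inv c u) \<in> fst c" if "j \<le> n" for j
      using elim that by (auto simp: V_def)
    from linear_orbit_in_chart[OF lin this, of n n] this[of n] show ?case
      using elim is_chartD(4)[OF ic] by simp
  qed
qed

lemma eigenvalue_nonzero:
  assumes lin: "linearizing_chart r \<A> f S c a b e" and per: "periodic_point f S"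
  shows "a \<noteq> 0" "b \<noteq> 0" "e \<noteq> 0"
proof -
  have ic: "is_chart c" and Sc: "S \<in> fst c" "snd c S = (0, 0, 0)" and cr: "Cr_chart r \<A> c"
    using lin by (auto simp: linearizing_chart_def Cr_chart_def)
  have fS: "(f ^^ (period f S * 1)) S = S" using periodic_pointD(2)[OF per] by simp
  let ?g = "\<lambda>u. snd c ((f ^^ (period f S * 1)) (chart_inv c u))"
  have "bounded_linear (diag3 a b e 1)"
    unfolding diag3_def by (intro bounded_linear_Pair bounded_linear_mult_right[THEN bounded_linear_compose]
        bounded_linear_fst bounded_linear_snd_comp bounded_linear_fst_comp bounded_linear_snd bounded_linear_ident)
  then have D: "(diag3 a b e 1 has_derivative diag3 a b e 1) (at (0, 0, 0))"
    by (rule bounded_linear_imp_has_derivative)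
  obtain V where V: "open V" "(0, 0, 0) \<in> V" "\<And>u. u \<in> V \<Longrightarrow> ?g u = diag3 a b e 1 u"
    using period_power_linear_near[OF lin per, of 1] unfolding eventually_nhds by blast
  have "(?g has_derivative diag3 a b e 1) (at (snd c S))" unfolding Sc(2)
    by (rule has_derivative_transform_within_open[OF D V(1,2)]) (use V(3) in auto)
  then have "inj (diag3 a b e 1)"
    using Sc(1) fS r by (intro Diff_derivative_inj[OF M funpow_in_Diff[OF M f] _ cr Sc(1) cr]) auto
  then have "diag3 a b e 1 (1, 0, 0) \<noteq> diag3 a b e 1 (0, 0, 0)" "diag3 a b e 1 (0, 1, 0) \<noteq> diag3 a b e 1 (0, 0, 0)"
    "diag3 a b e 1 (0, 0, 1) \<noteq> diag3 a b e 1 (0, 0, 0)" by (auto simp: inj_eq)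
  then show "a \<noteq> 0" "b \<noteq> 0" "e \<noteq> 0" by (auto simp: diag3_def)
qed

text \<open>If \<open>P\<close> were on the orbit of \<open>Q\<close>, the derivative of an iterate of \<open>f\<close> would conjugate a power of the
  return derivative at \<open>Q\<close>, with two contracted directions, to one at \<open>P\<close>, with only one.\<close>

lemma orbits_disjoint: "(f ^^ i) Q \<noteq> P"
proof
  assume QP: "(f ^^ i) Q = P"
  let ?F = "\<lambda>u. snd cP ((f ^^ i) (chart_inv cQ u))"
  have "Ck_at r ?F (snd cQ Q)"
    by (rule Cr_map_chart_expression[OF M _ charts(2,1,6)])
      (use funpow_in_Diff[OF M f, of i] QP charts in \<open>auto simp: Diff_def\<close>)
  then have "Ck_at (Suc 0) ?F (snd cQ Q)" by (rule Ck_at_le) (use r in simp)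
  from Ck_at_differentiable[OF this] obtain A where "(?F has_derivative A) (at (snd cQ Q))"
    unfolding differentiable_def by blast
  then have A: "(?F has_derivative A) (at (0, 0, 0))" by (simp add: charts)
  have linA: "linear A" using A by (rule has_derivative_linear)
  have injA: "inj A"
    using Diff_derivative_inj[OF M funpow_in_Diff[OF M f] _ charts(2,6) charts(1), of i A] A QP charts r by simp
  let ?DQ = "diag3 l s z pP" and ?DP = "diag3 lP sP zP pQ"
  have dlin: "bounded_linear (diag3 a b e n)" for a b e n
    unfolding diag3_def by (intro bounded_linear_Pair bounded_linear_mult_right[THEN bounded_linear_compose]
        bounded_linear_fst bounded_linear_snd_comp bounded_linear_fst_comp bounded_linear_snd bounded_linear_ident)
  have dz: "diag3 a b e n (0, 0, 0) = (0, 0, 0)" for a b e n by (simp add: diag3_def)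
  have D1: "((\<lambda>u. ?F (?DQ u)) has_derivative (\<lambda>h. A (?DQ h))) (at (0, 0, 0))"
    by (rule has_derivative_compose[OF bounded_linear_imp_has_derivative[OF dlin]]) (use A dz in simp)
  have F0: "?F (0, 0, 0) = (0, 0, 0)"
    using is_chartD(3)[OF charts(4,6)] charts(8) QP charts(7) by simp
  have D2: "((\<lambda>u. ?DP (?F u)) has_derivative (\<lambda>h. ?DP (A h))) (at (0, 0, 0))"
    by (rule has_derivative_compose[OF A]) (use bounded_linear_imp_has_derivative[OF dlin] in simp)
  have "\<forall>\<^sub>F u in nhds (0, 0, 0). ?F (?DQ u) = ?DP (?F u)"
  proof -
    note eQ = period_power_linear_near[OF linQ perQ, of pP]
    have cF: "isCont ?F (0, 0, 0)" using A by (rule has_derivative_continuous)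
    have im: "(0, 0, 0) \<in> snd cQ ` fst cQ" using charts by (metis imageI)
    have cq: "isCont (chart_inv cQ) (0, 0, 0)" by (rule is_chart_isCont(2)[OF charts(4) im])
    have q0: "chart_inv cQ (0, 0, 0) = Q" using is_chartD(3)[OF charts(4,6)] charts(8) by simp
    have "open {q. (f ^^ i) q \<in> fst cP}" by (rule open_funpow_condition[OF cont_f is_chartD(1)[OF charts(3)]])
    from isCont_eventually_in[OF cq this]
    have e1: "\<forall>\<^sub>F u in nhds (0, 0, 0). (f ^^ i) (chart_inv cQ u) \<in> fst cP" using q0 QP charts by simp
    have e2: "\<forall>\<^sub>F u in nhds (0, 0, 0). ?F u \<in> snd cP ` fst cP \<and>
        (f ^^ (pP * pQ)) (chart_inv cP (?F u)) \<in> fst cP \<and>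
        snd cP ((f ^^ (pP * pQ)) (chart_inv cP (?F u))) = ?DP (?F u)"
    proof -
      have "filterlim ?F (nhds (0, 0, 0)) (nhds (0, 0, 0))"
        using cF tendsto_at_iff_tendsto_nhds[of ?F "(0, 0, 0)"] by (simp only: isCont_def F0)
      from eventually_compose_filterlim[OF period_power_linear_near[OF linP perP, of pQ] this] show ?thesis .
    qed
    show ?thesis using eQ e1 e2
    proof eventually_elim
      case (elim u)
      let ?q = "chart_inv cQ u"
      have a: "chart_inv cP (?F u) = (f ^^ i) ?q" using elim is_chartD(3)[OF charts(3)] by simp
      have "(f ^^ (pP * pQ)) ((f ^^ i) ?q) = (f ^^ i) ((f ^^ (pQ * pP)) ?q)"
        by (metis add.commute comp_apply funpow_add mult.commute)
      then have b: "?DP (?F u) = snd cP ((f ^^ i) ((f ^^ (pQ * pP)) ?q))" using elim a by simp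
      have "chart_inv cQ (?DQ u) = (f ^^ (pQ * pP)) ?q" using elim is_chartD(3)[OF charts(4)] by metis
      then show ?case using b by simp
    qed
  qed
  then obtain V where V: "open V" "(0, 0, 0) \<in> V" "\<And>u. u \<in> V \<Longrightarrow> ?F (?DQ u) = ?DP (?F u)"
    unfolding eventually_nhds by blast
  have "((\<lambda>u. ?DP (?F u)) has_derivative (\<lambda>h. A (?DQ h))) (at (0, 0, 0))"
    by (rule has_derivative_transform_within_open[OF D1 V(1,2)]) (use V(3) in auto)
  then have "(\<lambda>h. ?DP (A h)) = (\<lambda>h. A (?DQ h))" using D2 has_derivative_unique by blast
  then have comm: "?DP (A h) = A (?DQ h)" for h by metis
  have axis: "fst (snd v) = 0 \<and> snd (snd v) = 0" if "?DP v = c *\<^sub>R v" "\<bar>c\<bar> < 1" for v c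
  proof -
    have "\<bar>c\<bar> < \<bar>sP ^ pQ\<bar>" "\<bar>c\<bar> < \<bar>zP ^ pQ\<bar>"
      using that(2) one_less_power[OF evP(2) pQ(1)] one_less_power[OF evP(3) pQ(1)]
      unfolding power_abs by linarith+
    then have "sP ^ pQ \<noteq> c" "zP ^ pQ \<noteq> c" by auto
    moreover have "sP ^ pQ * fst (snd v) = c * fst (snd v)" "zP ^ pQ * snd (snd v) = c * snd (snd v)"
      using that(1) by (auto simp: diag3_def prod_eq_iff)
    ultimately show ?thesis by auto
  qed
  have e1: "?DP (A (1, 0, 0)) = (l ^ pP) *\<^sub>R A (1, 0, 0)" and e3: "?DP (A (0, 0, 1)) = (z ^ pP) *\<^sub>R A (0, 0, 1)"
    unfolding comm linear_scale[OF linA, symmetric] by (simp_all add: diag3_def)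
  have "\<bar>l ^ pP\<bar> < 1" "\<bar>z ^ pP\<bar> < 1"
    using evQ(1,3) pP(1) by (auto simp: power_abs power_less_one_iff)
  then have "fst (snd (A (1, 0, 0))) = 0 \<and> snd (snd (A (1, 0, 0))) = 0"
    "fst (snd (A (0, 0, 1))) = 0 \<and> snd (snd (A (0, 0, 1))) = 0"
    using axis[OF e1] axis[OF e3] by auto
  then have A1: "A (1, 0, 0) = (fst (A (1, 0, 0)), 0, 0)" and A3: "A (0, 0, 1) = (fst (A (0, 0, 1)), 0, 0)"
    by (auto simp: prod_eq_iff)
  define a1 where "a1 = fst (A (1, 0, 0))"
  define a3 where "a3 = fst (A (0, 0, 1))"
  have "A (a3, 0, - a1) = a3 *\<^sub>R A (1, 0, 0) + 0 *\<^sub>R A (0, 1, 0) + (- a1) *\<^sub>R A (0, 0, 1)"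
    by (rule linear_R3[OF linA])
  also have "\<dots> = 0" unfolding A1[folded a1_def] A3[folded a3_def] by (simp add: zero_prod_def)
  finally have "A (a3, 0, - a1) = A 0" using linear_0[OF linA] by simp
  then have "(a3, 0::real, - a1) = 0" using injA by (simp add: inj_eq)
  then have "A (1, 0, 0) = A 0" using A1[folded a1_def] linear_0[OF linA] by (simp add: zero_prod_def)
  then have "(1::real, 0::real, 0::real) = 0" using injA by (metis injD)
  then show False by (simp add: zero_prod_def)
qed

lemma common_subsequence:
  assumes "(\<lambda>n. (f ^^ (p * n)) y) \<longlonglongrightarrow> a" "(\<lambda>n. (f ^^ (q * n)) y) \<longlonglongrightarrow> b" "p > 0" "q > 0"
  shows "a = b"
proof -
  have "(\<lambda>n. (f ^^ (p * (q * n))) y) \<longlonglongrightarrow> a"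
    using LIMSEQ_subseq_LIMSEQ[OF assms(1), of "\<lambda>n. q * n"] assms(4) by (simp add: o_def strict_mono_def)
  moreover have "(\<lambda>n. (f ^^ (q * (p * n))) y) \<longlonglongrightarrow> b"
    using LIMSEQ_subseq_LIMSEQ[OF assms(2), of "\<lambda>n. p * n"] assms(3) by (simp add: o_def strict_mono_def)
  ultimately show ?thesis by (intro LIMSEQ_unique) (simp_all add: mult.left_commute)
qed

lemma isCont_funpow: "isCont (f ^^ i) x"
  using continuous_on_funpow[OF cont_f] by (simp add: continuous_on_eq_continuous_at)

lemma shifted_limit:
  assumes "(\<lambda>n. (f ^^ (p * n)) y) \<longlonglongrightarrow> a"
  shows "(\<lambda>n. (f ^^ (p * n)) ((f ^^ i) y)) \<longlonglongrightarrow> (f ^^ i) a"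
proof -
  have "(f ^^ (p * n)) ((f ^^ i) y) = (f ^^ i) ((f ^^ (p * n)) y)" for n
    by (metis add.commute comp_apply funpow_add)
  then show ?thesis using isCont_tendsto_compose[OF isCont_funpow assms] by simp
qed

lemma not_periodic:
  assumes "(f ^^ i) y = y" "i > 0" "(\<lambda>n. (f ^^ (p * n)) y) \<longlonglongrightarrow> a" "p > 0"
  shows "y = a"
proof -
  have "(f ^^ (i * n)) y = y" for n by (rule funpow_mult_fixed[OF assms(1)])
  then have "(\<lambda>n. (f ^^ (i * n)) y) \<longlonglongrightarrow> y" by simp
  from common_subsequence[OF this assms(3,2,4)] show ?thesis .
qed

lemma P_orbit_return: "(f ^^ i) P = Q \<Longrightarrow> False"
proof -
  assume "(f ^^ i) P = Q"
  then have "(f ^^ (pP * i - i)) Q = (f ^^ (pP * i - i + i)) P" by (simp add: funpow_add)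
  also have "pP * i - i + i = pP * i" using pP(1) by simp
  finally show False using funpow_mult_fixed[OF pP(2), of i] orbits_disjoint by auto
qed

lemma p1_ne_P: "p1 \<noteq> P" using p1(2) charts by auto
lemma p2_ne_Q: "p2 \<noteq> Q" using p2(2) charts by auto

text \<open>A coincidence would make a heteroclinic point periodic, or let one forward orbit converge to the
  orbits of both saddles.\<close>

lemma separation_facts:
  "i > 0 \<Longrightarrow> (f ^^ i) p1 \<noteq> p1" "i > 0 \<Longrightarrow> (f ^^ i) p2 \<noteq> p2" "(f ^^ i) p1 \<noteq> p2" "(f ^^ i) p2 \<noteq> p1"
  "(f ^^ i) P \<noteq> p1" "(f ^^ i) P \<noteq> p2" "(f ^^ i) Q \<noteq> p1" "(f ^^ i) Q \<noteq> p2"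
proof -
  show "i > 0 \<Longrightarrow> (f ^^ i) p1 \<noteq> p1" using not_periodic[OF _ _ lims(1) pP(1)] p1_ne_P by blast
  show "i > 0 \<Longrightarrow> (f ^^ i) p2 \<noteq> p2" using not_periodic[OF _ _ lims(2) pQ(1)] p2_ne_Q by blast
  show "(f ^^ i) p1 \<noteq> p2"
  proof
    assume "(f ^^ i) p1 = p2"
    from common_subsequence[OF shifted_limit[OF lims(1), of i, unfolded this] lims(2) pP(1) pQ(1)]
    show False using P_orbit_return by blast
  qed
  show "(f ^^ i) p2 \<noteq> p1"
  proof
    assume "(f ^^ i) p2 = p1"
    from common_subsequence[OF shifted_limit[OF lims(2), of i, unfolded this] lims(1) pQ(1) pP(1)]
    show False using orbits_disjoint by blast
  qed
  have cP: "(\<lambda>n. (f ^^ (pP * n)) ((f ^^ i) P)) \<longlonglongrightarrow> (f ^^ i) P"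
    by (rule shifted_limit) (simp add: funpow_mult_fixed[OF pP(2)])
  have cQ: "(\<lambda>n. (f ^^ (pQ * n)) ((f ^^ i) Q)) \<longlonglongrightarrow> (f ^^ i) Q"
    by (rule shifted_limit) (simp add: funpow_mult_fixed[OF pQ(2)])
  show "(f ^^ i) P \<noteq> p1"
    using common_subsequence[OF cP _ pP(1) pP(1)] lims(1) p1_ne_P by metis
  show "(f ^^ i) P \<noteq> p2"
    using common_subsequence[OF cP _ pP(1) pQ(1)] lims(2) P_orbit_return by metis
  show "(f ^^ i) Q \<noteq> p1"
    using common_subsequence[OF cQ _ pQ(1) pP(1)] lims(1) orbits_disjoint by metis
  show "(f ^^ i) Q \<noteq> p2"
    using common_subsequence[OF cQ _ pQ(1) pQ(1)] lims(2) p2_ne_Q by metis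
qed

text \<open>The cycle without the two points \<open>p1\<close> and \<open>p2\<close> at which it is perturbed.  Forward orbits start one
  step later, at \<open>f p1\<close> and \<open>f p2\<close>; adding the orbits of the saddles makes each part compact.\<close>

definition rest :: "'m set" where
  "rest = (range (\<lambda>i. (f ^^ i) (f p1)) \<union> range (\<lambda>i. (f ^^ i) (f P))) \<union>
     (range (\<lambda>i. (f ^^ i) (f p2)) \<union> range (\<lambda>i. (f ^^ i) (f Q))) \<union>
     (range (\<lambda>i. (inv f ^^ i) X) \<union> range (\<lambda>i. (inv f ^^ i) Q)) \<union>
     (range (\<lambda>i. (inv f ^^ i) Y) \<union> range (\<lambda>i. (inv f ^^ i) P)) \<union>
     ((\<lambda>i. (f ^^ i) X) ` {0<..<N1} \<union> (\<lambda>i. (f ^^ i) Y) ` {0<..<N2})"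

lemma compact_rest: "compact rest"
proof -
  have s: "(f ^^ p) (f x) = f ((f ^^ p) x)" for p x by (simp add: funpow_swap1)
  have t: "(\<lambda>n. (f ^^ (p * n)) (f y)) \<longlonglongrightarrow> f a" if "(\<lambda>n. (f ^^ (p * n)) y) \<longlonglongrightarrow> a" for p y a
    using shifted_limit[OF that, of 1] by simp
  have i: "(inv f ^^ pP) P = P" "(inv f ^^ pQ) Q = Q"
    using inv_funpow_cancel(1)[OF bij_f, of pP P] inv_funpow_cancel(1)[OF bij_f, of pQ Q] pP pQ by simp_all
    have a: "compact (range (\<lambda>i. (f ^^ i) (f p1)) \<union> range (\<lambda>i. (f ^^ i) (f P)))"
      using pP by (intro compact_orbit_closure[OF cont_f pP(1) _ t[OF lims(1)]]) (simp add: s)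
    have b: "compact (range (\<lambda>i. (f ^^ i) (f p2)) \<union> range (\<lambda>i. (f ^^ i) (f Q)))"
      using pQ by (intro compact_orbit_closure[OF cont_f pQ(1) _ t[OF lims(2)]]) (simp add: s)
    have c: "compact (range (\<lambda>i. (inv f ^^ i) X) \<union> range (\<lambda>i. (inv f ^^ i) Q))"
      by (rule compact_orbit_closure[OF cont_fi pQ(1) i(2) lims(3)])
    have d: "compact (range (\<lambda>i. (inv f ^^ i) Y) \<union> range (\<lambda>i. (inv f ^^ i) P))"
      by (rule compact_orbit_closure[OF cont_fi pP(1) i(1) lims(4)])
    show ?thesis unfolding rest_def
      by (rule compact_Un[OF compact_Un[OF compact_Un[OF compact_Un[OF a b] c] d]])
        (simp add: finite_imp_compact)
qed

lemma inv_eq: "(inv f ^^ i) a = b \<longleftrightarrow> a = (f ^^ i) b"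
  using inv_funpow_cancel[OF bij_f] by metis

lemma not_in_rest: "p1 \<notin> rest" "p2 \<notin> rest"
proof -
  have fw: "(f ^^ i) (f y) = (f ^^ Suc i) y" for i y by (simp add: funpow_swap1)
  have X1: "(f ^^ (i + N1)) X = (f ^^ i) p1" for i by (simp add: funpow_add)
  have Y1: "(f ^^ (i + N2)) Y = (f ^^ i) p2" for i by (simp add: funpow_add)
  have bX: "(inv f ^^ i) X = y \<Longrightarrow> (f ^^ (N1 + i)) y = p1" for i y by (simp add: inv_eq funpow_add)
  have bY: "(inv f ^^ i) Y = y \<Longrightarrow> (f ^^ (N2 + i)) y = p2" for i y by (simp add: inv_eq funpow_add)
  have mX: "(f ^^ (N1 - i)) ((f ^^ i) X) = p1" if "i < N1" for i
  proof -
    have "(f ^^ (N1 - i)) ((f ^^ i) X) = (f ^^ (N1 - i + i)) X" by (simp only: funpow_add o_apply)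
    then show ?thesis using that by simp
  qed
  have mY: "(f ^^ (N2 - i)) ((f ^^ i) Y) = p2" if "i < N2" for i
  proof -
    have "(f ^^ (N2 - i)) ((f ^^ i) Y) = (f ^^ (N2 - i + i)) Y" by (simp only: funpow_add o_apply)
    then show ?thesis using that by simp
  qed
  have iP: "(inv f ^^ i) P \<noteq> y" if "\<And>j. (f ^^ j) P \<noteq> y" for i y
  proof
    assume "(inv f ^^ i) P = y"
    then have e: "(f ^^ i) y = P" by (simp add: inv_eq)
    have "(f ^^ i) ((f ^^ (pP * i - i)) P) = (f ^^ (i + (pP * i - i))) P" by (simp only: funpow_add o_apply)
    also have "i + (pP * i - i) = pP * i" using pP(1) by simp
    finally have "(f ^^ i) ((f ^^ (pP * i - i)) P) = (f ^^ i) y" using e funpow_mult_fixed[OF pP(2)] by simp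
    then show False using funpow_inj that by blast
  qed
  have iQ: "(inv f ^^ i) Q \<noteq> y" if "\<And>j. (f ^^ j) Q \<noteq> y" for i y
  proof
    assume "(inv f ^^ i) Q = y"
    then have e: "(f ^^ i) y = Q" by (simp add: inv_eq)
    have "(f ^^ i) ((f ^^ (pQ * i - i)) Q) = (f ^^ (i + (pQ * i - i))) Q" by (simp only: funpow_add o_apply)
    also have "i + (pQ * i - i) = pQ * i" using pQ(1) by simp
    finally have "(f ^^ i) ((f ^^ (pQ * i - i)) Q) = (f ^^ i) y" using e funpow_mult_fixed[OF pQ(2)] by simp
    then show False using funpow_inj that by blast
  qed
  note sf = separation_facts
  have sum_pos: "N1 + i > 0" "N2 + i > 0" for i using N by auto
  have diff_pos: "i < N1 \<Longrightarrow> N1 - i > 0" "i < N2 \<Longrightarrow> N2 - i > 0" for i by auto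
  have cases: "(\<exists>i. y = (f ^^ Suc i) p1) \<or> (\<exists>i. y = (f ^^ Suc i) P) \<or> (\<exists>i. y = (f ^^ Suc i) p2) \<or>
      (\<exists>i. y = (f ^^ Suc i) Q) \<or> (\<exists>i. (inv f ^^ i) X = y) \<or> (\<exists>i. (inv f ^^ i) Q = y) \<or>
      (\<exists>i. (inv f ^^ i) Y = y) \<or> (\<exists>i. (inv f ^^ i) P = y) \<or>
      (\<exists>i. i < N1 \<and> y = (f ^^ i) X) \<or> (\<exists>i. i < N2 \<and> y = (f ^^ i) Y)" if "y \<in> rest" for y
    using that unfolding rest_def fw Un_iff image_iff Bex_def greaterThanLessThan_iff by blast
  show "p1 \<notin> rest"
  proof
    assume "p1 \<in> rest"
    from cases[OF this] show False
    proof (elim disjE exE conjE)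
      fix i
      show "p1 = (f ^^ Suc i) p1 \<Longrightarrow> False" using sf(1)[of "Suc i"] by (metis zero_less_Suc)
      show "p1 = (f ^^ Suc i) P \<Longrightarrow> False" using sf(5)[of "Suc i"] by metis
      show "p1 = (f ^^ Suc i) p2 \<Longrightarrow> False" using sf(4)[of "Suc i"] by metis
      show "p1 = (f ^^ Suc i) Q \<Longrightarrow> False" using sf(7)[of "Suc i"] by metis
      show "(inv f ^^ i) X = p1 \<Longrightarrow> False" using bX[of i p1] sf(1)[OF sum_pos(1)[of i]] by blast
      show "(inv f ^^ i) Q = p1 \<Longrightarrow> False" using iQ[of p1 i] sf(7) by blast
      show "(inv f ^^ i) Y = p1 \<Longrightarrow> False" using bY[of i p1] sf(3)[of "N2 + i"] by blast
      show "(inv f ^^ i) P = p1 \<Longrightarrow> False" using iP[of p1 i] sf(5) by blast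
      show "False" if "i < N1" "p1 = (f ^^ i) X"
        using mX[OF that(1), folded that(2)] sf(1)[OF diff_pos(1)[OF that(1)]] by blast
      show "False" if "i < N2" "p1 = (f ^^ i) Y"
        using mY[OF that(1), folded that(2)] sf(3)[of "N2 - i"] by blast
    qed
  qed
  show "p2 \<notin> rest"
  proof
    assume "p2 \<in> rest"
    from cases[OF this] show False
    proof (elim disjE exE conjE)
      fix i
      show "p2 = (f ^^ Suc i) p1 \<Longrightarrow> False" using sf(3)[of "Suc i"] by metis
      show "p2 = (f ^^ Suc i) P \<Longrightarrow> False" using sf(6)[of "Suc i"] by metis
      show "p2 = (f ^^ Suc i) p2 \<Longrightarrow> False" using sf(2)[of "Suc i"] by (metis zero_less_Suc)
      show "p2 = (f ^^ Suc i) Q \<Longrightarrow> False" using sf(8)[of "Suc i"] by metis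
      show "(inv f ^^ i) X = p2 \<Longrightarrow> False" using bX[of i p2] sf(4)[of "N1 + i"] by blast
      show "(inv f ^^ i) Q = p2 \<Longrightarrow> False" using iQ[of p2 i] sf(8) by blast
      show "(inv f ^^ i) Y = p2 \<Longrightarrow> False" using bY[of i p2] sf(2)[OF sum_pos(2)[of i]] by blast
      show "(inv f ^^ i) P = p2 \<Longrightarrow> False" using iP[of p2 i] sf(6) by blast
      show "False" if "i < N1" "p2 = (f ^^ i) X"
        using mX[OF that(1), folded that(2)] sf(4)[of "N1 - i"] by blast
      show "False" if "i < N2" "p2 = (f ^^ i) Y"
        using mY[OF that(1), folded that(2)] sf(2)[OF diff_pos(2)[OF that(1)]] by blast
    qed
  qed
qed

lemma separation:
  obtains E O1 O2 where "open E" "open O1" "open O2" "p1 \<in> O1" "p2 \<in> O2" "rest \<subseteq> E"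
    "E \<inter> O1 = {}" "E \<inter> O2 = {}" "O1 \<inter> O2 = {}"
proof -
  obtain U1 V1 where 1: "open U1" "open V1" "p1 \<in> U1" "rest \<subseteq> V1" "U1 \<inter> V1 = {}"
    using compact_separation[OF compact_rest not_in_rest(1)] .
  obtain U2 V2 where 2: "open U2" "open V2" "p2 \<in> U2" "rest \<subseteq> V2" "U2 \<inter> V2 = {}"
    using compact_separation[OF compact_rest not_in_rest(2)] .
  have ne: "p1 \<noteq> p2" using separation_facts(3)[of 0] by simp
  then obtain U3 V3 where 3: "open U3" "open V3" "p1 \<in> U3" "p2 \<in> V3" "U3 \<inter> V3 = {}"
    using hausdorff[OF ne] by blast
  show ?thesis
    by (rule that[of "V1 \<inter> V2" "U1 \<inter> U3" "U2 \<inter> V3"]) (use 1 2 3 in auto)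
qed

lemma rest_members:
  "i > 0 \<Longrightarrow> (f ^^ i) p1 \<in> rest" "i > 0 \<Longrightarrow> (f ^^ i) p2 \<in> rest" "(inv f ^^ i) X \<in> rest" "(inv f ^^ i) Y \<in> rest"
  "(f ^^ i) P \<in> rest" "(f ^^ i) Q \<in> rest" "0 < i \<Longrightarrow> i < N1 \<Longrightarrow> (f ^^ i) X \<in> rest" "0 < i \<Longrightarrow> i < N2 \<Longrightarrow> (f ^^ i) Y \<in> rest"
proof -
  have fw: "(f ^^ Suc i) y = (f ^^ i) (f y)" for i y by (simp add: funpow_swap1)
  have a: "(f ^^ Suc i) p1 \<in> rest" "(f ^^ Suc i) p2 \<in> rest" "(f ^^ Suc i) P \<in> rest" "(f ^^ Suc i) Q \<in> rest" for i
    unfolding rest_def fw by blast+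
  show "i > 0 \<Longrightarrow> (f ^^ i) p1 \<in> rest" "i > 0 \<Longrightarrow> (f ^^ i) p2 \<in> rest"
    using a(1,2)[of "i - 1"] by simp_all
  show "(inv f ^^ i) X \<in> rest" "(inv f ^^ i) Y \<in> rest" unfolding rest_def by blast+
  show "0 < i \<Longrightarrow> i < N1 \<Longrightarrow> (f ^^ i) X \<in> rest" "0 < i \<Longrightarrow> i < N2 \<Longrightarrow> (f ^^ i) Y \<in> rest"
    unfolding rest_def by auto
  have "(inv f ^^ 0) P \<in> rest" "(inv f ^^ 0) Q \<in> rest" unfolding rest_def by blast+
  then show "(f ^^ i) P \<in> rest" "(f ^^ i) Q \<in> rest"
    using a(3,4)[of "i - 1"] by (cases i; simp)+
qed

end

lemma Ck_at_of_snd: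
  assumes "Ck_at k f (snd z)" shows "Ck_at k (\<lambda>z. f (snd z)) z"
  by (rule Ck_at_compose[where f=snd, OF _ assms]) (intro Ck_at_bounded_linear bounded_linear_snd)

context saddle_cycle
begin

text \<open>The displacements are to be affine in the coordinates that a point has before a crossing, whereas
  they act after it; these coordinates are recovered by the inverse of the crossing.  The parameters
  are grouped as \<open>((c, mu, nY), (nZ, ng, ne))\<close>: constants \<open>mu\<close>, \<open>nY\<close> and \<open>nZ\<close>, and the coefficients \<open>c\<close> of
  the height at \<open>Y\<close>, and \<open>ng\<close> and \<open>ne\<close> of the third and second coordinates at \<open>X\<close>.\<close>

definition entry_coords :: "R3 \<Rightarrow> R3" where
  "entry_coords w = snd cQ ((inv f ^^ N1) (chart_inv cP w)) - (0, 1, 0)"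

definition exit_height :: "R3 \<Rightarrow> real" where
  "exit_height w = snd (snd (snd cP ((inv f ^^ N2) (chart_inv cQ w)))) - 1"

definition shift1 :: "R3 \<times> R3 \<Rightarrow> R3 \<Rightarrow> R3" where
  "shift1 p w = (0, snd (snd (fst p)), fst (snd p) + fst (snd (snd p)) * snd (snd (entry_coords w))
     + snd (snd (snd p)) * fst (snd (entry_coords w)))"

definition shift2 :: "R3 \<times> R3 \<Rightarrow> R3 \<Rightarrow> R3" where
  "shift2 p w = (0, fst (snd (fst p)), fst (fst p) * exit_height w)"

lemma linear_shift: "linear (\<lambda>p. shift1 p w)" "linear (\<lambda>p. shift2 p w)"
  by (auto intro!: linearI simp: shift1_def shift2_def algebra_simps)

lemma inv_funpow_Cr_map: "Cr_map r \<A> (inv f ^^ n)"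
  using funpow_in_Diff[OF M inv_in_Diff[OF f]] by (simp add: Diff_def)

lemma Ck_at_entry_exit:
  "Ck_at r entry_coords (snd cP p1)" "Ck_at r exit_height (snd cQ p2)"
proof -
  have "Ck_at r (\<lambda>u. snd cQ ((inv f ^^ N1) (chart_inv cP u))) (snd cP p1)"
    by (rule Cr_map_chart_expression[OF M inv_funpow_Cr_map charts(1,2) in_charts(1)])
      (simp add: inv_funpow_cancel(1)[OF bij_f] in_charts)
  then show "Ck_at r entry_coords (snd cP p1)" unfolding entry_coords_def[abs_def]
    by (intro Ck_at_diff Ck_at_const)
  have "Ck_at r (\<lambda>u. snd cP ((inv f ^^ N2) (chart_inv cQ u))) (snd cQ p2)"
    by (rule Cr_map_chart_expression[OF M inv_funpow_Cr_map charts(2,1) in_charts(3)])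
      (simp add: inv_funpow_cancel(1)[OF bij_f] in_charts)
  then show "Ck_at r exit_height (snd cQ p2)" unfolding exit_height_def[abs_def]
    by (intro Ck_at_diff Ck_at_snd Ck_at_const)
qed

lemma Ck_at_ball: "Ck_at k g x \<Longrightarrow> \<exists>e>0. \<forall>y\<in>ball x e. Ck_at k g y"
  unfolding Ck_at_def by (meson openE subsetD)

text \<open>The unfolding.  One perturbation acts at \<open>f\<^bsup>N1\<^esup> X\<close>, in the second and third coordinates at
  \<open>P\<close>; its size depends affinely on the coordinates that the point had at \<open>X\<close>.  The other acts at
  \<open>f\<^bsup>N2\<^esup> Y\<close> and is affine in the height at \<open>Y\<close>.  Both are localized away from the rest of the
  cycle, so that the passages near the saddles are those of \<open>f\<close>, which are linear, and the return
  map is an explicit composition.\<close>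

lemma unfolding_family:
  assumes T1: "\<forall>\<^sub>F p in nhds 0. snd cP ((f ^^ N1) (chart_inv cQ ((0, 1, 0) + p))) = (1, 0, 0) + G1 p"
    and T2: "\<forall>\<^sub>F p in nhds 0. snd cQ ((f ^^ N2) (chart_inv cP ((0, 1, 1) + p))) = (1, 0, 1) + G2 p"
  obtains fam :: "R3 \<times> R3 \<Rightarrow> 'm \<Rightarrow> 'm" and \<delta> n0 where "\<delta> > 0"
    "\<And>p. p \<in> ball 0 \<delta> \<Longrightarrow> fam p \<in> Diff r \<A>"
    "\<And>p x. p \<in> ball 0 \<delta> \<Longrightarrow> smooth_family_at r \<A> fam p x" "fam 0 = f"
    "\<And>c mu nY nZ ng ne m n w v u. m \<ge> n0 \<Longrightarrow> n \<ge> n0 \<Longrightarrow> ((c, mu, nY), (nZ, ng, ne)) \<in> ball 0 \<delta> \<Longrightarrow>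
       dist w (1, 0, 1) < \<delta> \<Longrightarrow> dist (diag3 l s z n w) (0, 1, 0) < \<delta> \<Longrightarrow>
       v = (1, 0, 0) + G1 (diag3 l s z n w - (0, 1, 0))
         + (0, nY, nZ + ng * (z ^ n * snd (snd w)) + ne * (s ^ n * fst (snd w) - 1)) \<Longrightarrow>
       dist v (1, 0, 0) < \<delta> \<Longrightarrow> dist (diag3 lP sP zP m v) (0, 1, 1) < \<delta> \<Longrightarrow>
       u = (1, 0, 1) + G2 (diag3 lP sP zP m v - (0, 1, 1)) + (0, mu, c * (zP ^ m * snd (snd v) - 1)) \<Longrightarrow>
       (fam ((c, mu, nY), (nZ, ng, ne)) ^^ (N2 + pP * m + N1 + pQ * n)) (chart_inv cQ w) = chart_inv cQ u \<and>
       u \<in> snd cQ ` fst cQ"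
proof -
  obtain E O1 O2 where sep: "open E" "open O1" "open O2" "p1 \<in> O1" "p2 \<in> O2" "rest \<subseteq> E"
    "E \<inter> O1 = {}" "E \<inter> O2 = {}" "O1 \<inter> O2 = {}" using separation .
  obtain e1 where e1: "e1 > 0" "\<forall>y\<in>ball (snd cP p1) e1. Ck_at r entry_coords y"
    using Ck_at_ball[OF Ck_at_entry_exit(1)] by blast
  obtain e2 where e2: "e2 > 0" "\<forall>y\<in>ball (snd cQ p2) e2. Ck_at r exit_height y"
    using Ck_at_ball[OF Ck_at_entry_exit(2)] by blast
  have lin_at: "Ck_at r (\<lambda>z::(R3 \<times> R3) \<times> R3. fst z) z" for z by (intro Ck_at_bounded_linear bounded_linear_fst)
  have par_at: "Ck_at r (\<lambda>z::(R3 \<times> R3) \<times> R3. fst (fst (fst z))) z" "Ck_at r (\<lambda>z::(R3 \<times> R3) \<times> R3. fst (snd (fst (fst z)))) z"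
    "Ck_at r (\<lambda>z::(R3 \<times> R3) \<times> R3. snd (snd (fst (fst z)))) z" "Ck_at r (\<lambda>z::(R3 \<times> R3) \<times> R3. fst (snd (fst z))) z"
    "Ck_at r (\<lambda>z::(R3 \<times> R3) \<times> R3. fst (snd (snd (fst z)))) z" "Ck_at r (\<lambda>z::(R3 \<times> R3) \<times> R3. snd (snd (snd (fst z)))) z" for z
    by (rule Ck_at_bounded_linear, intro bounded_linear_fst_comp bounded_linear_snd_comp bounded_linear_ident)+
  have k1: "Ck_at r (\<lambda>z. shift1 (fst z) (snd z)) (p, w)" if w: "w \<in> ball (snd cP p1) e1" for p w
  proof -
    have "Ck_at r entry_coords (snd (p, w))" using e1(2) w by simp
    then have en: "Ck_at r (\<lambda>z. entry_coords (snd z)) (p, w)" by (rule Ck_at_of_snd)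
    have t1: "Ck_at r (\<lambda>z. fst (snd (snd (fst z))) * snd (snd (entry_coords (snd z)))) (p, w)"
      by (rule Ck_at_mult[OF par_at(5) Ck_at_snd[OF Ck_at_snd[OF en]]])
    have t2: "Ck_at r (\<lambda>z. snd (snd (snd (fst z))) * fst (snd (entry_coords (snd z)))) (p, w)"
      by (rule Ck_at_mult[OF par_at(6) Ck_at_fst[OF Ck_at_snd[OF en]]])
    show ?thesis unfolding shift1_def
      by (rule Ck_at_Pair, rule Ck_at_const, rule Ck_at_Pair, rule par_at(3), rule Ck_at_add[OF _ t2],
          rule Ck_at_add[OF _ t1], rule par_at(4))
  qed
  have k2: "Ck_at r (\<lambda>z. shift2 (fst z) (snd z)) (p, w)" if w: "w \<in> ball (snd cQ p2) e2" for p w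
  proof -
    have "Ck_at r exit_height (snd (p, w))" using e2(2) w by simp
    then have ex: "Ck_at r (\<lambda>z. exit_height (snd z)) (p, w)" by (rule Ck_at_of_snd)
    have t1: "Ck_at r (\<lambda>z. fst (fst (fst z)) * exit_height (snd z)) (p, w)"
      by (rule Ck_at_mult[OF par_at(1) ex])
    show ?thesis unfolding shift2_def
      by (rule Ck_at_Pair, rule Ck_at_const, rule Ck_at_Pair, rule par_at(2), rule t1)
  qed
  have r1: "r \<ge> 1" using r by simp
  obtain h1 d1 M1 where "d1 > 0 \<and> open M1 \<and> p1 \<in> M1 \<and> M1 \<subseteq> O1 \<inter> fst cP \<and> (\<forall>q. h1 0 q = q) \<and>
    (\<forall>p\<in>ball 0 d1. h1 p \<in> Diff r \<A> \<and> (\<forall>x. smooth_family_at r \<A> h1 p x) \<and>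
       (\<forall>q. q \<notin> O1 \<longrightarrow> h1 p q = q) \<and> (\<forall>q\<in>O1. h1 p q \<in> O1) \<and>
       (\<forall>q\<in>M1. h1 p q \<in> fst cP \<and> snd cP (h1 p q) = snd cP q + shift1 p (snd cP q)))"
    using localized_perturbation[OF M charts(1) r1 in_charts(1) sep(2,4) linear_shift(1) e1(1) k1] by blast
  then have h1: "d1 > 0" "open M1" "p1 \<in> M1" "M1 \<subseteq> O1 \<inter> fst cP"
    "\<And>p. p \<in> ball 0 d1 \<Longrightarrow> h1 p \<in> Diff r \<A>"
    "\<And>p x. p \<in> ball 0 d1 \<Longrightarrow> smooth_family_at r \<A> h1 p x" "\<And>q. h1 0 q = q"
    "\<And>p q. p \<in> ball 0 d1 \<Longrightarrow> q \<notin> O1 \<Longrightarrow> h1 p q = q" "\<And>p q. p \<in> ball 0 d1 \<Longrightarrow> q \<in> O1 \<Longrightarrow> h1 p q \<in> O1"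
    "\<And>p q. p \<in> ball 0 d1 \<Longrightarrow> q \<in> M1 \<Longrightarrow> h1 p q \<in> fst cP"
    "\<And>p q. p \<in> ball 0 d1 \<Longrightarrow> q \<in> M1 \<Longrightarrow> snd cP (h1 p q) = snd cP q + shift1 p (snd cP q)" by blast+
  obtain h2 d2 M2 where "d2 > 0 \<and> open M2 \<and> p2 \<in> M2 \<and> M2 \<subseteq> O2 \<inter> fst cQ \<and> (\<forall>q. h2 0 q = q) \<and>
    (\<forall>p\<in>ball 0 d2. h2 p \<in> Diff r \<A> \<and> (\<forall>x. smooth_family_at r \<A> h2 p x) \<and>
       (\<forall>q. q \<notin> O2 \<longrightarrow> h2 p q = q) \<and> (\<forall>q\<in>O2. h2 p q \<in> O2) \<and>
       (\<forall>q\<in>M2. h2 p q \<in> fst cQ \<and> snd cQ (h2 p q) = snd cQ q + shift2 p (snd cQ q)))"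
    using localized_perturbation[OF M charts(2) r1 in_charts(3) sep(3,5) linear_shift(2) e2(1) k2] by blast
  then have h2: "d2 > 0" "open M2" "p2 \<in> M2" "M2 \<subseteq> O2 \<inter> fst cQ"
    "\<And>p. p \<in> ball 0 d2 \<Longrightarrow> h2 p \<in> Diff r \<A>"
    "\<And>p x. p \<in> ball 0 d2 \<Longrightarrow> smooth_family_at r \<A> h2 p x" "\<And>q. h2 0 q = q"
    "\<And>p q. p \<in> ball 0 d2 \<Longrightarrow> q \<notin> O2 \<Longrightarrow> h2 p q = q" "\<And>p q. p \<in> ball 0 d2 \<Longrightarrow> q \<in> O2 \<Longrightarrow> h2 p q \<in> O2"
    "\<And>p q. p \<in> ball 0 d2 \<Longrightarrow> q \<in> M2 \<Longrightarrow> h2 p q \<in> fst cQ"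
    "\<And>p q. p \<in> ball 0 d2 \<Longrightarrow> q \<in> M2 \<Longrightarrow> snd cQ (h2 p q) = snd cQ q + shift2 p (snd cQ q)" by blast+
  define fam where "fam = (\<lambda>p q. h2 p (h1 p (f q)))"
  \<comment> \<open>The passages stay inside \<open>E\<close>, where \<open>f\<close> is not perturbed; a crossing is perturbed in its last step.\<close>
  have fam_E: "(fam p ^^ n) q = (f ^^ n) q"
    if p: "p \<in> ball 0 d1" "p \<in> ball 0 d2" and q: "\<And>i. 0 < i \<Longrightarrow> i \<le> n \<Longrightarrow> (f ^^ i) q \<in> E" for p n q
    using q
  proof (induction n)
    case (Suc n)
    have "f ((f ^^ n) q) \<in> E" using Suc.prems[of "Suc n"] by simp
    then have "f ((f ^^ n) q) \<notin> O1" "f ((f ^^ n) q) \<notin> O2" using sep by auto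
    then show ?case using Suc h1(8)[OF p(1)] h2(8)[OF p(2)] by (simp add: fam_def)
  qed simp
  have fam_step: "(fam p ^^ n) q = h2 p (h1 p ((f ^^ n) q))"
    if p: "p \<in> ball 0 d1" "p \<in> ball 0 d2" and n: "n > 0" and q: "\<And>i. 0 < i \<Longrightarrow> i < n \<Longrightarrow> (f ^^ i) q \<in> E" for p n q
  proof -
    obtain k where k: "n = Suc k" using n by (cases n) auto
    have "(fam p ^^ k) q = (f ^^ k) q" by (rule fam_E[OF p]) (use q k in auto)
    then show ?thesis by (simp add: k fam_def)
  qed
  note zQ = eigenvalue_nonzero[OF linQ perQ] and zP' = eigenvalue_nonzero[OF linP perP]
  have rE: "\<And>x. x \<in> rest \<Longrightarrow> x \<in> E" using sep by blast
  have eQ: "\<bar>l\<bar> \<noteq> 1" "\<bar>s\<bar> \<noteq> 1" "\<bar>z\<bar> \<noteq> 1" using evQ by auto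
  have rQ: "\<And>i. i > 0 \<Longrightarrow> (f ^^ i) p2 \<in> E" "\<And>i. (inv f ^^ i) X \<in> E" "\<And>i. (f ^^ i) Q \<in> E"
    using rE rest_members by simp_all
  obtain dQ nQ where dQ: "dQ > 0" and pasQ: "\<forall>n\<ge>nQ. \<forall>w. dist w (snd cQ p2) < dQ \<and>
      dist (diag3 l s z n w) (snd cQ X) < dQ \<longrightarrow>
      w \<in> snd cQ ` fst cQ \<and> diag3 l s z n w \<in> snd cQ ` fst cQ \<and>
      (f ^^ (pQ * n)) (chart_inv cQ w) = chart_inv cQ (diag3 l s z n w) \<and>
      (\<forall>i. 0 < i \<and> i \<le> pQ * n \<longrightarrow> (f ^^ i) (chart_inv cQ w) \<in> E)"
    using saddle_passage[OF linQ bij_f cont_f perQ eQ(1) zQ(1) eQ(2) zQ(2) eQ(3) zQ(3) p2(1) X(1) sep(1) rQ]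
    by blast
  have eP: "\<bar>lP\<bar> \<noteq> 1" "\<bar>sP\<bar> \<noteq> 1" "\<bar>zP\<bar> \<noteq> 1" using evP by auto
  have rP: "\<And>i. i > 0 \<Longrightarrow> (f ^^ i) p1 \<in> E" "\<And>i. (inv f ^^ i) Y \<in> E" "\<And>i. (f ^^ i) P \<in> E"
    using rE rest_members by simp_all
  obtain dP nP where dP: "dP > 0" and pasP: "\<forall>n\<ge>nP. \<forall>w. dist w (snd cP p1) < dP \<and>
      dist (diag3 lP sP zP n w) (snd cP Y) < dP \<longrightarrow>
      w \<in> snd cP ` fst cP \<and> diag3 lP sP zP n w \<in> snd cP ` fst cP \<and>
      (f ^^ (pP * n)) (chart_inv cP w) = chart_inv cP (diag3 lP sP zP n w) \<and>
      (\<forall>i. 0 < i \<and> i \<le> pP * n \<longrightarrow> (f ^^ i) (chart_inv cP w) \<in> E)"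
    using saddle_passage[OF linP bij_f cont_f perP eP(1) zP'(1) eP(2) zP'(2) eP(3) zP'(3) p1(1) Y(1) sep(1) rP]
    by blast
  define VX where "VX = fst cQ \<inter> {q. (f ^^ N1) q \<in> M1} \<inter> (\<Inter>i\<in>{0<..<N1}. {q. (f ^^ i) q \<in> E})"
  have oVX: "open VX" unfolding VX_def
    by (intro open_Int open_INT ballI open_funpow_condition[OF cont_f] is_chartD(1)[OF charts(4)] h1(2) sep(1)) auto
  have XVX: "X \<in> VX" unfolding VX_def using in_charts h1(3) rE rest_members(7) by auto
  define VY where "VY = fst cP \<inter> {q. (f ^^ N2) q \<in> M2} \<inter> (\<Inter>i\<in>{0<..<N2}. {q. (f ^^ i) q \<in> E})"
  have oVY: "open VY" unfolding VY_def
    by (intro open_Int open_INT ballI open_funpow_condition[OF cont_f] is_chartD(1)[OF charts(3)] h2(2) sep(1)) auto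
  have YVY: "Y \<in> VY" unfolding VY_def using in_charts h2(3) rE rest_members(8) by auto
  have "\<forall>\<^sub>F u in nhds (0, 1, 0). chart_inv cQ u \<in> VX"
    by (rule isCont_eventually_in[OF is_chart_isCont(2)[OF charts(4)] oVX])
      (use in_charts(4) X(2) XVX is_chartD(3)[OF charts(4) in_charts(4)] in \<open>auto simp: image_iff intro!: bexI[of _ X]\<close>)
  then obtain dX where dX: "dX > 0" "\<And>u. dist u (0, 1, 0) < dX \<Longrightarrow> chart_inv cQ u \<in> VX"
    unfolding eventually_nhds_metric by blast
  have "\<forall>\<^sub>F u in nhds (0, 1, 1). chart_inv cP u \<in> VY"
    by (rule isCont_eventually_in[OF is_chart_isCont(2)[OF charts(3)] oVY])
      (use in_charts(2) Y(2) YVY is_chartD(3)[OF charts(3) in_charts(2)] in \<open>auto simp: image_iff intro!: bexI[of _ Y]\<close>)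
  then obtain dY where dY: "dY > 0" "\<And>u. dist u (0, 1, 1) < dY \<Longrightarrow> chart_inv cP u \<in> VY"
    unfolding eventually_nhds_metric by blast
  obtain t1 where t1: "t1 > 0" "\<And>p. dist p 0 < t1 \<Longrightarrow> snd cP ((f ^^ N1) (chart_inv cQ ((0, 1, 0) + p))) = (1, 0, 0) + G1 p"
    using T1 unfolding eventually_nhds_metric by blast
  obtain t2 where t2: "t2 > 0" "\<And>p. dist p 0 < t2 \<Longrightarrow> snd cQ ((f ^^ N2) (chart_inv cP ((0, 1, 1) + p))) = (1, 0, 1) + G2 p"
    using T2 unfolding eventually_nhds_metric by blast
  define \<delta> where "\<delta> = Min {d1, d2, dQ, dP, dX, dY, t1, t2}"
  have \<delta>: "\<delta> > 0" "\<delta> \<le> d1" "\<delta> \<le> d2" "\<delta> \<le> dQ" "\<delta> \<le> dP" "\<delta> \<le> dX" "\<delta> \<le> dY" "\<delta> \<le> t1" "\<delta> \<le> t2"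
  proof -
    show "\<delta> > 0" unfolding \<delta>_def
      using h1(1) h2(1) dQ dP dX(1) dY(1) t1(1) t2(1) by (subst Min_gr_iff) simp_all
  qed (unfold \<delta>_def, (rule Min_le; simp)+)
  have in12: "p \<in> ball 0 d1" "p \<in> ball 0 d2" if "p \<in> ball 0 \<delta>" for p :: "R3 \<times> R3"
    using that \<delta>(2,3) unfolding mem_ball by linarith+
  show ?thesis
  proof (rule that[of \<delta> fam "max nP nQ", OF \<delta>(1)])
    fix p :: "R3 \<times> R3" assume p: "p \<in> ball 0 \<delta>"
    have fm: "fam p = h2 p \<circ> (h1 p \<circ> f)" by (auto simp: fam_def)
    show "fam p \<in> Diff r \<A>" unfolding fm
      by (rule Diff_compose[OF M Diff_compose[OF M f h1(5)[OF in12(1)[OF p]]] h2(5)[OF in12(2)[OF p]]])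
    fix x
    have "smooth_family_at r \<A> (\<lambda>p. f) p x" using f by (intro smooth_family_at_of_map[OF M]) (simp add: Diff_def)
    from smooth_family_at_compose[OF M this h1(6)[OF in12(1)[OF p]]]
    have s: "smooth_family_at r \<A> (\<lambda>p x. h1 p (f x)) p x" .
    from smooth_family_at_compose[OF M s h2(6)[OF in12(2)[OF p]]]
    show "smooth_family_at r \<A> fam p x" unfolding fam_def .
  next
    show "fam 0 = f" by (rule ext) (simp add: fam_def h1(7) h2(7))
  next
    fix c mu nY nZ ng ne :: real and m n :: nat and w v u :: R3
    assume mn: "max nP nQ \<le> m" "max nP nQ \<le> n" and par: "((c, mu, nY), (nZ, ng, ne)) \<in> ball 0 \<delta>"
      and w: "dist w (1, 0, 1) < \<delta>" "dist (diag3 l s z n w) (0, 1, 0) < \<delta>"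
      and v: "v = (1, 0, 0) + G1 (diag3 l s z n w - (0, 1, 0))
         + (0, nY, nZ + ng * (z ^ n * snd (snd w)) + ne * (s ^ n * fst (snd w) - 1))"
        "dist v (1, 0, 0) < \<delta>" "dist (diag3 lP sP zP m v) (0, 1, 1) < \<delta>"
      and u: "u = (1, 0, 1) + G2 (diag3 lP sP zP m v - (0, 1, 1)) + (0, mu, c * (zP ^ m * snd (snd v) - 1))"
    define p where "p = ((c, mu, nY), (nZ, ng, ne))"
    have p: "p \<in> ball 0 \<delta>" using par by (simp add: p_def)
    note p12 = in12[OF p]
    define q0 where "q0 = chart_inv cQ w"
    define q1 where "q1 = chart_inv cQ (diag3 l s z n w)"
    have P1: "w \<in> snd cQ ` fst cQ" "diag3 l s z n w \<in> snd cQ ` fst cQ" "(f ^^ (pQ * n)) q0 = q1"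
      "\<And>i. 0 < i \<Longrightarrow> i \<le> pQ * n \<Longrightarrow> (f ^^ i) q0 \<in> E"
      using pasQ[rule_format, of n w] mn w \<delta>(4) p2(2) X(2) unfolding q0_def q1_def by simp_all
    have A: "(fam p ^^ (pQ * n)) q0 = q1" using fam_E[OF p12 P1(4)] P1(3) by simp
    have q1V: "q1 \<in> VX" unfolding q1_def using dX(2) w(2) \<delta>(6) by simp
    have f1: "(f ^^ N1) q1 \<in> M1" using q1V by (simp add: VX_def)
    have f1O: "h1 p ((f ^^ N1) q1) \<in> O1" using h1(4,9) f1 p12 by blast
    have B: "(fam p ^^ N1) q1 = h1 p ((f ^^ N1) q1)"
    proof -
      have "(fam p ^^ N1) q1 = h2 p (h1 p ((f ^^ N1) q1))"
        by (rule fam_step[OF p12 N(1)]) (use q1V in \<open>auto simp: VX_def\<close>)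
      moreover have "h1 p ((f ^^ N1) q1) \<notin> O2" using f1O sep by blast
      ultimately show ?thesis using h2(8)[OF p12(2)] by simp
    qed
    define q2 where "q2 = h1 p ((f ^^ N1) q1)"
    have c1: "snd cQ q1 = diag3 l s z n w" unfolding q1_def by (rule is_chartD(4)[OF charts(4) P1(2)])
    have w1: "snd cP ((f ^^ N1) q1) = (1, 0, 0) + G1 (diag3 l s z n w - (0, 1, 0))"
      using t1(2)[of "diag3 l s z n w - (0, 1, 0)"] w(2) \<delta>(8) by (simp add: q1_def dist_norm)
    have en: "entry_coords (snd cP ((f ^^ N1) q1)) = diag3 l s z n w - (0, 1, 0)"
    proof -
      have "(f ^^ N1) q1 \<in> fst cP" using f1 h1(4) by blast
      then show ?thesis unfolding entry_coords_def
        using is_chartD(3)[OF charts(3)] inv_funpow_cancel(1)[OF bij_f] c1 by simp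
    qed
    have q2v: "snd cP q2 = v" "q2 \<in> fst cP"
    proof -
      have "snd cP q2 = snd cP ((f ^^ N1) q1) + shift1 p (snd cP ((f ^^ N1) q1))"
        unfolding q2_def by (rule h1(11)[OF p12(1) f1])
      from this[unfolded shift1_def en, unfolded w1]
      show "snd cP q2 = v" unfolding v(1) by (simp add: p_def diag3_def)
      show "q2 \<in> fst cP" unfolding q2_def by (rule h1(10)[OF p12(1) f1])
    qed
    have q2c: "q2 = chart_inv cP v" using is_chartD(3)[OF charts(3) q2v(2)] q2v(1) by simp
    define q3 where "q3 = chart_inv cP (diag3 lP sP zP m v)"
    have P3: "diag3 lP sP zP m v \<in> snd cP ` fst cP" "(f ^^ (pP * m)) q2 = q3"
      "\<And>i. 0 < i \<Longrightarrow> i \<le> pP * m \<Longrightarrow> (f ^^ i) q2 \<in> E"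
      using pasP[rule_format, of m v] mn v(2,3) \<delta>(5) p1(2) Y(2) unfolding q2c q3_def by simp_all
    have C: "(fam p ^^ (pP * m)) q2 = q3" using fam_E[OF p12 P3(3)] P3(2) by simp
    have q3V: "q3 \<in> VY" unfolding q3_def using dY(2) v(3) \<delta>(7) by simp
    have f3: "(f ^^ N2) q3 \<in> M2" using q3V by (simp add: VY_def)
    have D: "(fam p ^^ N2) q3 = h2 p ((f ^^ N2) q3)"
    proof -
      have "(fam p ^^ N2) q3 = h2 p (h1 p ((f ^^ N2) q3))"
        by (rule fam_step[OF p12 N(2)]) (use q3V in \<open>auto simp: VY_def\<close>)
      moreover have "(f ^^ N2) q3 \<notin> O1" using f3 h2(4) sep by blast
      ultimately show ?thesis using h1(8)[OF p12(1)] by simp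
    qed
    define q4 where "q4 = h2 p ((f ^^ N2) q3)"
    have c3: "snd cP q3 = diag3 lP sP zP m v" unfolding q3_def by (rule is_chartD(4)[OF charts(3) P3(1)])
    have w3: "snd cQ ((f ^^ N2) q3) = (1, 0, 1) + G2 (diag3 lP sP zP m v - (0, 1, 1))"
      using t2(2)[of "diag3 lP sP zP m v - (0, 1, 1)"] v(3) \<delta>(9) by (simp add: q3_def dist_norm)
    have ex: "exit_height (snd cQ ((f ^^ N2) q3)) = zP ^ m * snd (snd v) - 1"
    proof -
      have "(f ^^ N2) q3 \<in> fst cQ" using f3 h2(4) by blast
      then show ?thesis unfolding exit_height_def
        using is_chartD(3)[OF charts(4)] inv_funpow_cancel(1)[OF bij_f] c3 by (simp add: diag3_def)
    qed
    have q4u: "snd cQ q4 = u" "q4 \<in> fst cQ"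
    proof -
      have "snd cQ q4 = snd cQ ((f ^^ N2) q3) + shift2 p (snd cQ ((f ^^ N2) q3))"
        unfolding q4_def by (rule h2(11)[OF p12(2) f3])
      from this[unfolded shift2_def ex, unfolded w3]
      show "snd cQ q4 = u" unfolding u by (simp add: p_def)
      show "q4 \<in> fst cQ" unfolding q4_def by (rule h2(10)[OF p12(2) f3])
    qed
    have "(fam p ^^ (N2 + pP * m + N1 + pQ * n)) q0 = (fam p ^^ N2) ((fam p ^^ (pP * m)) ((fam p ^^ N1) ((fam p ^^ (pQ * n)) q0)))"
      by (simp only: funpow_add o_apply)
    also have "\<dots> = q4" by (simp only: A B C D flip: q2_def q4_def)
    also have "\<dots> = chart_inv cQ u" using is_chartD(3)[OF charts(4) q4u(2)] q4u(1) by simp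
    finally show "(fam ((c, mu, nY), (nZ, ng, ne)) ^^ (N2 + pP * m + N1 + pQ * n)) (chart_inv cQ w) = chart_inv cQ u \<and>
       u \<in> snd cQ ` fst cQ"
      using q4u by (auto simp: p_def q0_def)
  qed
qed

end

section \<open>The rescaled return maps\<close>

text \<open>The errors of the rescaled return maps are exponentially small in the number of turns, while the
  coefficients that multiply them grow at most polynomially.  These two classes keep track of that
  without rates.\<close>

definition negl :: "(nat \<Rightarrow> real) \<Rightarrow> (nat \<Rightarrow> real) \<Rightarrow> bool" where
  "negl N f \<longleftrightarrow> (\<forall>j. (\<lambda>k. N k ^ j * f k) \<longlonglongrightarrow> 0)"

definition polyb :: "(nat \<Rightarrow> real) \<Rightarrow> (nat \<Rightarrow> real) \<Rightarrow> bool" where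
  "polyb N g \<longleftrightarrow> (\<exists>K j. \<forall>k. \<bar>g k\<bar> \<le> K * N k ^ j)"

lemma negl_tendsto: "negl N f \<Longrightarrow> f \<longlonglongrightarrow> 0"
  unfolding negl_def by (drule spec[of _ 0]) simp

lemma negl_le:
  assumes "negl N f" "\<And>k. \<bar>g k\<bar> \<le> \<bar>f k\<bar>" shows "negl N g"
  unfolding negl_def
proof
  fix j
  have "(\<lambda>k. N k ^ j * f k) \<longlonglongrightarrow> 0" using assms(1) by (simp add: negl_def)
  then show "(\<lambda>k. N k ^ j * g k) \<longlonglongrightarrow> 0"
  proof (rule Lim_null_comparison[rotated, OF tendsto_rabs_zero])
    show "\<forall>\<^sub>F k in sequentially. norm (N k ^ j * g k) \<le> \<bar>N k ^ j * f k\<bar>"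
      by (rule always_eventually) (auto simp: abs_mult intro: mult_left_mono assms(2))
  qed
qed

lemma negl_add: "negl N f \<Longrightarrow> negl N g \<Longrightarrow> negl N (\<lambda>k. f k + g k)"
  unfolding negl_def distrib_left using tendsto_add_zero by blast

lemma negl_polyb:
  assumes f: "negl N f" and g: "polyb N g" and N: "\<And>k. N k \<ge> 1"
  shows "negl N (\<lambda>k. f k * g k)"
  unfolding negl_def
proof
  fix j
  obtain K i where K: "\<And>k. \<bar>g k\<bar> \<le> K * N k ^ i" using g by (auto simp: polyb_def)
  have "(\<lambda>k. N k ^ (j + i) * f k) \<longlonglongrightarrow> 0" using f by (simp add: negl_def)
  then have "(\<lambda>k. K * \<bar>N k ^ (j + i) * f k\<bar>) \<longlonglongrightarrow> 0"
    by (intro tendsto_mult_right_zero tendsto_rabs_zero)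
  then show "(\<lambda>k. N k ^ j * (f k * g k)) \<longlonglongrightarrow> 0"
  proof (rule Lim_null_comparison[rotated])
    have "norm (N k ^ j * (f k * g k)) \<le> K * \<bar>N k ^ (j + i) * f k\<bar>" for k
    proof -
      have "norm (N k ^ j * (f k * g k)) = \<bar>N k ^ j\<bar> * \<bar>f k\<bar> * \<bar>g k\<bar>" by (simp add: abs_mult)
      also have "\<dots> \<le> \<bar>N k ^ j\<bar> * \<bar>f k\<bar> * (K * N k ^ i)" by (intro mult_left_mono K) auto
      also have "\<dots> = K * \<bar>N k ^ (j + i) * f k\<bar>"
        using N[of k] by (simp add: abs_mult power_add mult_ac)
      finally show ?thesis .
    qed
    then show "\<forall>\<^sub>F k in sequentially. norm (N k ^ j * (f k * g k)) \<le> K * \<bar>N k ^ (j + i) * f k\<bar>"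
      by (rule always_eventually[OF allI])
  qed
qed

lemma polyb_const: "polyb N (\<lambda>k. c)"
  unfolding polyb_def by (intro exI[of _ "\<bar>c\<bar>"] exI[of _ 0]) simp

lemma polyb_self: "(\<And>k. N k \<ge> 1) \<Longrightarrow> polyb N N"
  unfolding polyb_def by (intro exI[of _ 1] exI[of _ 1]) (auto simp: abs_of_nonneg order_trans[of 0 1])

lemma polyb_bounded: "(\<And>k. \<bar>g k\<bar> \<le> K) \<Longrightarrow> polyb N g"
  unfolding polyb_def by (intro exI[of _ K] exI[of _ 0]) simp

lemma polyb_convergent: "g \<longlonglongrightarrow> c \<Longrightarrow> polyb N g"
proof -
  assume "g \<longlonglongrightarrow> c"
  then have "Bseq g" by (intro convergent_imp_Bseq) (auto simp: convergent_def)
  then obtain K where "\<And>k. norm (g k) \<le> K" by (auto simp: Bseq_def)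
  then show ?thesis by (intro polyb_bounded[of _ K]) auto
qed

lemma polyb_mult:
  assumes "polyb N f" "polyb N g" shows "polyb N (\<lambda>k. f k * g k)"
proof -
  obtain K i where K: "\<And>k. \<bar>f k\<bar> \<le> K * N k ^ i" using assms(1) by (auto simp: polyb_def)
  obtain K' i' where K': "\<And>k. \<bar>g k\<bar> \<le> K' * N k ^ i'" using assms(2) by (auto simp: polyb_def)
  have "\<bar>f k * g k\<bar> \<le> (K * K') * N k ^ (i + i')" for k
  proof -
    have "\<bar>f k * g k\<bar> \<le> (K * N k ^ i) * (K' * N k ^ i')"
      unfolding abs_mult by (intro mult_mono K K') (use order_trans[OF abs_ge_zero K[of k]] in auto)
    then show ?thesis by (simp add: power_add mult_ac)
  qed
  then show ?thesis unfolding polyb_def by blast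
qed

lemma polyb_add:
  assumes N: "\<And>k. N k \<ge> 1" and "polyb N f" "polyb N g" shows "polyb N (\<lambda>k. f k + g k)"
proof -
  obtain K i where K: "\<And>k. \<bar>f k\<bar> \<le> K * N k ^ i" using assms(2) by (auto simp: polyb_def)
  obtain K' i' where K': "\<And>k. \<bar>g k\<bar> \<le> K' * N k ^ i'" using assms(3) by (auto simp: polyb_def)
  have "\<bar>f k + g k\<bar> \<le> (\<bar>K\<bar> + \<bar>K'\<bar>) * N k ^ (i + i')" for k
  proof -
    have N0: "N k ^ j > 0" for j using N[of k] by (intro zero_less_power) auto
    have "K * N k ^ i \<le> \<bar>K\<bar> * N k ^ (i + i')"
      using N[of k] N0 by (intro mult_mono power_increasing) (auto intro: less_imp_le)
    moreover have "K' * N k ^ i' \<le> \<bar>K'\<bar> * N k ^ (i + i')"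
      using N[of k] N0 by (intro mult_mono power_increasing) (auto intro: less_imp_le)
    ultimately show ?thesis using K[of k] K'[of k] by (simp add: distrib_right)
  qed
  then show ?thesis unfolding polyb_def by blast
qed

text \<open>The exponents of the two passages enter only through the six multipliers \<open>L, S, Z\<close> (at
  \<open>Q\<close>) and \<open>LP, SP, ZP\<close> (at \<open>P\<close>) of the linear maps; \<open>N\<close> is a slowly growing auxiliary
  scale, here the number of returns near \<open>Q\<close>.\<close>

locale renormalization =
  fixes q :: nat and N L S Z LP SP ZP :: "nat \<Rightarrow> real" and \<xi> :: real
    and al1 al2 al3 be1 be2 ga1 a1 a2 a3 b1 b2 b3 b4 c1 c2 :: real
    and Ht1 Ht2 Ht3 H1 H2 H3 :: "R3 \<Rightarrow> real" and CB :: real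
  assumes N1: "\<And>k. N k \<ge> 1" and Ninf: "filterlim N at_top sequentially"
    and nz: "\<And>k. S k \<noteq> 0" "\<And>k. Z k \<noteq> 0" "\<And>k. SP k \<noteq> 0" "\<And>k. ZP k \<noteq> 0"
    and SPZP: "\<And>k. \<bar>SP k\<bar> \<le> \<bar>ZP k\<bar>" and ZP1: "\<And>k. \<bar>ZP k\<bar> \<ge> 1" and CB: "\<And>k. \<bar>ZP k * L k\<bar> \<le> CB"
    and ng: "negl N (\<lambda>k. ZP k * SP k * S k * Z k ^ 2)" "negl N (\<lambda>k. ZP k / (SP k ^ 3 * S k))"
      "negl N (\<lambda>k. LP k * SP k * S k)" "negl N (\<lambda>k. SP k * L k)" "negl N (\<lambda>k. L k / Z k)" "negl N Z"
      "negl N (\<lambda>k. 1 / SP k)" "negl N (\<lambda>k. 1 / S k)" "negl N (\<lambda>k. SP k / ZP k)" "negl N LP"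
      "negl N (\<lambda>k. 1 / (ZP k * Z k))"
    and \<xi>: "\<xi> > 0" and cnz: "be2 \<noteq> 0" "a3 \<noteq> 0" "b3 \<noteq> 0" "c2 \<noteq> 0"
    and H_smooth: "\<And>H. H \<in> {Ht1, Ht2, Ht3, H1, H2, H3} \<Longrightarrow>
        (\<exists>U. open U \<and> 0 \<in> U \<and> Ck_on (Suc (Suc q)) H U) \<and> H 0 = 0 \<and> (\<forall>j. frechet_derivative H (at 0) j = 0)"
    and H2_zz: "frechet_derivative (\<lambda>w. frechet_derivative H2 (at w) (0, 0, 1)) (at 0) (0, 0, 1) = 0"
begin

text \<open>\<open>C\<close> is the coefficient of the first coordinate at \<open>Q\<close> in the third coordinate at \<open>Y\<close>, one turn
  later; that of the third coordinate at \<open>Q\<close> is made equal to \<open>N\<close> by the perturbation.  The choices of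
  \<open>c3\<close> and \<open>e\<close> solve \<open>C a3 + N c3 = \<xi>\<close> and \<open>C a2 + N c2 + \<xi> e = 1\<close>, which are the coefficients of the
  limit family.  \<open>bb\<close> is the value at \<open>(1, e)\<close> of the quadratic form of the tangency, and \<open>d\<close> the
  coefficient of \<open>Y\<close> in the combination \<open>c3 x' - a3 z'\<close>, from which \<open>Z\<close> drops out.  \<open>eta\<close> is the size of the deviations at
  \<open>Y\<close>: such a deviation returns as \<open>eta\<^sup>2 bb\<close> in the second coordinate at \<open>Q\<close> and is expanded by
  \<open>S be2 SP\<close> on the way to \<open>Y\<close>, where it must have size \<open>eta\<close> again.  \<open>rho\<close> and \<open>rhoQ\<close> are the scales at
  which the nonlinear terms are blown up at \<open>Y\<close> and at \<open>X\<close>; the factor \<open>N\<close> absorbs the growth of \<open>e\<close>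
  in the first and makes the rescaled deviations tend to zero in the second.\<close>

definition "C k = ZP k * L k * ga1"
definition "c3 k = (\<xi> - C k * a3) / N k"
definition "e k = (1 - C k * a2 - N k * c2) / \<xi>"
definition "bb k = b2 + b4 * e k + b3 * e k ^ 2"
definition "d k = c3 k * a2 - a3 * c2"
definition "eta k = 1 / (SP k * S k * be2 * bb k)"
definition "rho k = N k * eta k"
definition "rhoQ k = N k * (\<bar>Z k\<bar> + \<bar>eta k / SP k\<bar>)"

lemma N_pos: "N k > 0" "N k \<noteq> 0"
  using N1[of k] by auto

lemma inverse_N: "(\<lambda>k. 1 / N k) \<longlonglongrightarrow> 0"
  using tendsto_inverse_0_at_top[OF Ninf] by (simp add: inverse_eq_divide)

lemma C_bound: "\<bar>C k\<bar> \<le> CB * \<bar>ga1\<bar>"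
  unfolding C_def abs_mult[of _ ga1] by (intro mult_right_mono CB) auto

lemma c3_lim: "c3 \<longlonglongrightarrow> 0"
proof (rule Lim_null_comparison)
  show "\<forall>\<^sub>F k in sequentially. norm (c3 k) \<le> (\<xi> + CB * \<bar>ga1\<bar> * \<bar>a3\<bar>) * (1 / N k)"
  proof (rule always_eventually[OF allI])
    fix k
    have "\<bar>\<xi> - C k * a3\<bar> \<le> \<xi> + \<bar>C k\<bar> * \<bar>a3\<bar>" using \<xi> by (simp add: abs_mult[symmetric])
    also have "\<dots> \<le> \<xi> + CB * \<bar>ga1\<bar> * \<bar>a3\<bar>" by (intro add_mono mult_right_mono C_bound) auto
    finally show "norm (c3 k) \<le> (\<xi> + CB * \<bar>ga1\<bar> * \<bar>a3\<bar>) * (1 / N k)"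
      unfolding c3_def using N_pos[of k] by (simp add: divide_right_mono)
  qed
  show "(\<lambda>k. (\<xi> + CB * \<bar>ga1\<bar> * \<bar>a3\<bar>) * (1 / N k)) \<longlonglongrightarrow> 0"
    by (rule tendsto_mult_right_zero[OF inverse_N])
qed

lemma d_lim: "d \<longlonglongrightarrow> - (a3 * c2)"
  unfolding d_def[abs_def] using tendsto_diff[OF tendsto_mult_left_zero[OF c3_lim, of a2] tendsto_const, of "a3 * c2"]
  by simp

lemma e_lim: "(\<lambda>k. e k / N k) \<longlonglongrightarrow> - (c2 / \<xi>)"
proof -
  have "(\<lambda>k. (1 - C k * a2) / \<xi> * (1 / N k)) \<longlonglongrightarrow> 0"
  proof (rule Lim_null_comparison)
    show "\<forall>\<^sub>F k in sequentially. norm ((1 - C k * a2) / \<xi> * (1 / N k)) \<le> (1 + CB * \<bar>ga1\<bar> * \<bar>a2\<bar>) / \<xi> * (1 / N k)"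
    proof (rule always_eventually[OF allI])
      fix k
      have "\<bar>1 - C k * a2\<bar> \<le> 1 + \<bar>C k\<bar> * \<bar>a2\<bar>" by (simp add: abs_mult[symmetric])
      also have "\<dots> \<le> 1 + CB * \<bar>ga1\<bar> * \<bar>a2\<bar>" by (intro add_mono mult_right_mono C_bound) auto
      finally have "\<bar>1 - C k * a2\<bar> / \<xi> / N k \<le> (1 + CB * \<bar>ga1\<bar> * \<bar>a2\<bar>) / \<xi> / N k"
        using \<xi> N_pos[of k] by (intro divide_right_mono) auto
      then show "norm ((1 - C k * a2) / \<xi> * (1 / N k)) \<le> (1 + CB * \<bar>ga1\<bar> * \<bar>a2\<bar>) / \<xi> * (1 / N k)"
        using \<xi> N_pos[of k] by (simp add: abs_mult)
    qed
    show "(\<lambda>k. (1 + CB * \<bar>ga1\<bar> * \<bar>a2\<bar>) / \<xi> * (1 / N k)) \<longlonglongrightarrow> 0"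
      by (rule tendsto_mult_right_zero[OF inverse_N])
  qed
  from tendsto_diff[OF this tendsto_const[of "c2 / \<xi>"]]
  have "(\<lambda>k. (1 - C k * a2) / \<xi> * (1 / N k) - c2 / \<xi>) \<longlonglongrightarrow> - (c2 / \<xi>)" by simp
  moreover have "(1 - C k * a2) / \<xi> * (1 / N k) - c2 / \<xi> = e k / N k" for k
    using \<xi> N_pos[of k] by (simp add: e_def field_simps)
  ultimately show ?thesis by simp
qed

lemma bb_lim: "(\<lambda>k. bb k / N k ^ 2) \<longlonglongrightarrow> b3 * (c2 / \<xi>) ^ 2"
proof -
  have "(\<lambda>k. b2 * (1 / N k) ^ 2 + b4 * (e k / N k) * (1 / N k) + b3 * (e k / N k) ^ 2)
      \<longlonglongrightarrow> b2 * 0 ^ 2 + b4 * (- (c2 / \<xi>)) * 0 + b3 * (- (c2 / \<xi>)) ^ 2"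
    by (intro tendsto_intros inverse_N e_lim)
  moreover have "b2 * (1 / N k) ^ 2 + b4 * (e k / N k) * (1 / N k) + b3 * (e k / N k) ^ 2 = bb k / N k ^ 2" for k
    using N_pos[of k] by (simp add: bb_def field_simps power2_eq_square)
  ultimately show ?thesis by simp
qed

lemma bb_d_eventually_nonzero: "\<forall>\<^sub>F k in sequentially. bb k \<noteq> 0 \<and> d k \<noteq> 0"
proof -
  have "b3 * (c2 / \<xi>) ^ 2 \<noteq> 0" "- (a3 * c2) \<noteq> 0" using cnz \<xi> by auto
  from tendsto_imp_eventually_ne[OF bb_lim this(1)] tendsto_imp_eventually_ne[OF d_lim this(2)]
  show ?thesis by eventually_elim auto
qed

end

text \<open>Both quantities are nonzero eventually; a shift of the sequences makes them nonzero throughout.\<close>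

locale renormalization_nondegenerate = renormalization +
  assumes bb0: "\<And>k. bb k \<noteq> 0" and d0: "\<And>k. d k \<noteq> 0"
begin

lemma quot_lim: "(\<lambda>k. N k ^ 2 / bb k) \<longlonglongrightarrow> 1 / (b3 * (c2 / \<xi>) ^ 2)"
  using tendsto_divide[OF tendsto_const[of 1] bb_lim] cnz \<xi> by simp

lemma eta0: "eta k \<noteq> 0"
  unfolding eta_def using nz bb0 cnz by simp

lemma rho0: "rho k \<noteq> 0"
  unfolding rho_def using N_pos eta0 by simp

lemma rhoQ_ge: "\<bar>Z k\<bar> * N k \<le> rhoQ k" "\<bar>eta k / SP k\<bar> * N k \<le> rhoQ k" "rhoQ k > 0"
proof -
  have "N k * \<bar>Z k\<bar> > 0" using N_pos[of k] nz(2)[of k] by simp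
  moreover have "N k * \<bar>eta k / SP k\<bar> \<ge> 0" using N_pos[of k] by simp
  ultimately show "\<bar>Z k\<bar> * N k \<le> rhoQ k" "\<bar>eta k / SP k\<bar> * N k \<le> rhoQ k" "rhoQ k > 0"
    unfolding rhoQ_def distrib_left by (simp_all only: mult.commute[of _ "N k"])
qed

lemma pb:
  "polyb N N" "polyb N C" "polyb N c3" "polyb N d" "polyb N (\<lambda>k. 1 / d k)" "polyb N e" "polyb N bb"
  "polyb N (\<lambda>k. 1 / bb k)" "\<And>c. polyb N (\<lambda>k. c)" "polyb N (\<lambda>k. 1 / N k)"
proof -
  show pN: "polyb N N" by (rule polyb_self[OF N1])
  show pC: "polyb N C" by (rule polyb_bounded[OF C_bound])
  show "polyb N c3" "polyb N d" by (rule polyb_convergent[OF c3_lim], rule polyb_convergent[OF d_lim])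
  have "(\<lambda>k. 1 / d k) \<longlonglongrightarrow> 1 / (- (a3 * c2))" by (intro tendsto_intros d_lim) (use cnz in auto)
  then show "polyb N (\<lambda>k. 1 / d k)" by (rule polyb_convergent)
  have "polyb N (\<lambda>k. (e k / N k) * N k)" by (intro polyb_mult polyb_convergent[OF e_lim] pN)
  moreover have "(\<lambda>k. (e k / N k) * N k) = e" using N_pos by auto
  ultimately show pe: "polyb N e" by simp
  show c: "polyb N (\<lambda>k. c)" for c by (rule polyb_const)
  show "polyb N bb" unfolding bb_def[abs_def] power2_eq_square
    by (intro polyb_add[OF N1] polyb_mult pe c)
  show iN: "polyb N (\<lambda>k. 1 / N k)" by (rule polyb_convergent[OF inverse_N])
  have "polyb N (\<lambda>k. (N k ^ 2 / bb k) * ((1 / N k) * (1 / N k)))"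
    by (intro polyb_mult polyb_convergent[OF quot_lim] iN)
  moreover have "(\<lambda>k. (N k ^ 2 / bb k) * ((1 / N k) * (1 / N k))) = (\<lambda>k. 1 / bb k)"
    using N_pos by (auto simp: power2_eq_square)
  ultimately show "polyb N (\<lambda>k. 1 / bb k)" by simp
qed

lemmas pbs = pb polyb_mult polyb_add[OF N1]

lemma negl_times: "negl N f \<Longrightarrow> polyb N g \<Longrightarrow> (\<And>k. h k = f k * g k) \<Longrightarrow> negl N h"
  using negl_polyb[where f=f and g=g, OF _ _ N1] by presburger

lemma negl_products:
  assumes "negl N f" "negl N g" shows "negl N (\<lambda>k. f k * g k)"
  by (rule negl_polyb[OF assms(1) polyb_convergent[OF negl_tendsto[OF assms(2)]] N1])

lemma negl_eta: "negl N eta"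
proof (rule negl_times[OF negl_products[OF ng(7,8)]])
  show "polyb N (\<lambda>k. (1 / bb k) * (1 / be2))" by (intro pbs)
  show "eta k = 1 / SP k * (1 / S k) * ((1 / bb k) * (1 / be2))" for k by (simp add: eta_def)
qed

lemma negl_rho: "negl N rho"
  by (rule negl_times[OF negl_eta pb(1)]) (simp add: rho_def)

lemma negl_rhoQ: "negl N rhoQ"
proof -
  have "negl N (\<lambda>k. eta k * (1 / SP k))" by (rule negl_products[OF negl_eta ng(7)])
  then have "negl N (\<lambda>k. \<bar>eta k / SP k\<bar>)" by (rule negl_le) simp
  moreover have "negl N (\<lambda>k. \<bar>Z k\<bar>)" by (rule negl_le[OF ng(6)]) simp
  ultimately have "negl N (\<lambda>k. \<bar>Z k\<bar> + \<bar>eta k / SP k\<bar>)" by (intro negl_add)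
  then show ?thesis by (rule negl_times[OF _ pb(1)]) (simp add: rhoQ_def)
qed

lemma inverse_eta: "1 / eta k = SP k * S k * be2 * bb k"
  by (simp add: eta_def)

lemma abs_aux: "\<bar>a * x ^ 2 / b\<bar> = \<bar>a / b\<bar> * x ^ 2" for a x b :: real
  by (simp add: abs_mult)

lemma rhoQ_sq: "rhoQ k ^ 2 \<le> 2 * N k ^ 2 * (Z k ^ 2 + (eta k / SP k) ^ 2)"
proof -
  have "(A + B) ^ 2 \<le> 2 * (A ^ 2 + B ^ 2)" for A B :: real
    using sum_squares_bound[of A B] by (simp add: power2_sum)
  from this[of "\<bar>Z k\<bar>" "\<bar>eta k / SP k\<bar>"]
  have "(\<bar>Z k\<bar> + \<bar>eta k / SP k\<bar>) ^ 2 \<le> 2 * (Z k ^ 2 + (eta k / SP k) ^ 2)" unfolding power2_abs .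
  from mult_left_mono[OF this zero_le_power2[of "N k"]] show ?thesis
    by (simp only: rhoQ_def power_mult_distrib mult_ac)
qed

text \<open>At \<open>X\<close> the deviations have the size of \<open>Z\<close> or \<open>eta / SP\<close>, up to a factor \<open>N\<close>.  Second order terms
  there, amplified by \<open>ZP\<close> on the way to \<open>Y\<close>, must be small compared to \<open>eta\<close>.  For the first size this
  is the first eigenvalue condition, for the second one the second.  The third one makes the first
  coordinate at \<open>Y\<close>, which is of order \<open>LP\<close>, small compared to \<open>eta\<close>.\<close>

lemma negl_ZP_rhoQ: "negl N (\<lambda>k. ZP k * rhoQ k ^ 2 / eta k)"
proof -
  have 1: "negl N (\<lambda>k. ZP k * Z k ^ 2 / eta k)"
  proof (rule negl_times[OF ng(1), of "\<lambda>k. be2 * bb k"])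
    show "ZP k * Z k ^ 2 / eta k = ZP k * SP k * S k * Z k ^ 2 * (be2 * bb k)" for k
      using inverse_eta[of k] by (simp add: divide_inverse)
  qed (intro pbs)
  have 2: "negl N (\<lambda>k. ZP k * (eta k / SP k) ^ 2 / eta k)"
  proof (rule negl_times[OF ng(2), of "\<lambda>k. (1 / be2) * (1 / bb k)"])
    show "ZP k * (eta k / SP k) ^ 2 / eta k = ZP k / (SP k ^ 3 * S k) * ((1 / be2) * (1 / bb k))" for k
      using nz[of k] bb0[of k] cnz by (simp add: eta_def field_simps power2_eq_square power3_eq_cube)
  qed (intro pbs)
  have a: "negl N (\<lambda>k. \<bar>ZP k * Z k ^ 2 / eta k\<bar> + \<bar>ZP k * (eta k / SP k) ^ 2 / eta k\<bar>)"
    by (intro negl_add negl_le[OF 1] negl_le[OF 2]) auto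
  have b: "negl N (\<lambda>k. (\<bar>ZP k * Z k ^ 2 / eta k\<bar> + \<bar>ZP k * (eta k / SP k) ^ 2 / eta k\<bar>) * (2 * (N k * N k)))"
    by (rule negl_polyb[OF a _ N1]) (intro pbs)
  show ?thesis
  proof (rule negl_le[OF b])
    fix k
    have "\<bar>ZP k * rhoQ k ^ 2 / eta k\<bar> = \<bar>ZP k / eta k\<bar> * rhoQ k ^ 2" by (simp add: abs_mult)
    also have "\<dots> \<le> \<bar>ZP k / eta k\<bar> * (2 * N k ^ 2 * (Z k ^ 2 + (eta k / SP k) ^ 2))"
      by (intro mult_left_mono rhoQ_sq) auto
    also have "\<dots> = (\<bar>ZP k * Z k ^ 2 / eta k\<bar> + \<bar>ZP k * (eta k / SP k) ^ 2 / eta k\<bar>) * (2 * (N k * N k))"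
      unfolding abs_aux by (simp only: distrib_left distrib_right power2_eq_square mult_ac)
    also have "\<dots> \<le> \<bar>\<dots>\<bar>" by (rule abs_ge_self)
    finally show "\<bar>ZP k * rhoQ k ^ 2 / eta k\<bar> \<le> \<bar>(\<bar>ZP k * Z k ^ 2 / eta k\<bar> + \<bar>ZP k * (eta k / SP k) ^ 2 / eta k\<bar>) * (2 * (N k * N k))\<bar>" .
  qed
qed

lemma negl_SP_rhoQ: "negl N (\<lambda>k. SP k * rhoQ k ^ 2 / eta k)"
  by (rule negl_le[OF negl_ZP_rhoQ]) (auto simp: abs_mult intro!: divide_right_mono mult_right_mono SPZP)

lemma negl_LP_eta: "negl N (\<lambda>k. LP k / eta k)"
proof (rule negl_times[OF ng(3), of "\<lambda>k. be2 * bb k"])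
  show "LP k / eta k = LP k * SP k * S k * (be2 * bb k)" for k
    using inverse_eta[of k] by (simp add: divide_inverse)
qed (intro pbs)

lemma negl_LP_rhoQ: "negl N (\<lambda>k. LP k * rhoQ k ^ 2 / eta k ^ 2)"
proof -
  have A: "negl N (\<lambda>k. SP k * S k * Z k ^ 2)"
  proof (rule negl_le[OF ng(1)])
    fix k
    have "1 * \<bar>SP k * S k * Z k ^ 2\<bar> \<le> \<bar>ZP k\<bar> * \<bar>SP k * S k * Z k ^ 2\<bar>"
      by (rule mult_right_mono[OF ZP1]) simp
    then show "\<bar>SP k * S k * Z k ^ 2\<bar> \<le> \<bar>ZP k * SP k * S k * Z k ^ 2\<bar>"
      by (simp add: abs_mult mult.assoc)
  qed
  have 1: "negl N (\<lambda>k. LP k * Z k ^ 2 / eta k ^ 2)"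
  proof (rule negl_times[OF negl_products[OF ng(3) A], of "\<lambda>k. (be2 * bb k) * (be2 * bb k)"])
    fix k
    have "LP k * Z k ^ 2 / eta k ^ 2 = LP k * Z k ^ 2 * (1 / eta k) ^ 2" by (simp add: power_divide)
    then show "LP k * Z k ^ 2 / eta k ^ 2 = LP k * SP k * S k * (SP k * S k * Z k ^ 2) * ((be2 * bb k) * (be2 * bb k))"
      unfolding inverse_eta by (simp add: power2_eq_square mult_ac)
  qed (intro pbs)
  have 2: "negl N (\<lambda>k. LP k * (eta k / SP k) ^ 2 / eta k ^ 2)"
  proof (rule negl_times[OF negl_products[OF ng(10) negl_products[OF ng(7,7)]] pb(9)[of 1]])
    show "LP k * (eta k / SP k) ^ 2 / eta k ^ 2 = LP k * (1 / SP k * (1 / SP k)) * 1" for k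
      using eta0[of k] by (simp add: power2_eq_square)
  qed
  have a: "negl N (\<lambda>k. \<bar>LP k * Z k ^ 2 / eta k ^ 2\<bar> + \<bar>LP k * (eta k / SP k) ^ 2 / eta k ^ 2\<bar>)"
    by (intro negl_add negl_le[OF 1] negl_le[OF 2]) auto
  have b: "negl N (\<lambda>k. (\<bar>LP k * Z k ^ 2 / eta k ^ 2\<bar> + \<bar>LP k * (eta k / SP k) ^ 2 / eta k ^ 2\<bar>) * (2 * (N k * N k)))"
    by (rule negl_polyb[OF a _ N1]) (intro pbs)
  show ?thesis
  proof (rule negl_le[OF b])
    fix k
    have "\<bar>LP k * rhoQ k ^ 2 / eta k ^ 2\<bar> = \<bar>LP k / eta k ^ 2\<bar> * rhoQ k ^ 2" by (simp add: abs_mult)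
    also have "\<dots> \<le> \<bar>LP k / eta k ^ 2\<bar> * (2 * N k ^ 2 * (Z k ^ 2 + (eta k / SP k) ^ 2))"
      by (intro mult_left_mono rhoQ_sq) auto
    also have "\<dots> = (\<bar>LP k * Z k ^ 2 / eta k ^ 2\<bar> + \<bar>LP k * (eta k / SP k) ^ 2 / eta k ^ 2\<bar>) * (2 * (N k * N k))"
      unfolding abs_aux by (simp only: distrib_left distrib_right power2_eq_square mult_ac)
    also have "\<dots> \<le> \<bar>\<dots>\<bar>" by (rule abs_ge_self)
    finally show "\<bar>LP k * rhoQ k ^ 2 / eta k ^ 2\<bar> \<le> \<bar>(\<bar>LP k * Z k ^ 2 / eta k ^ 2\<bar> + \<bar>LP k * (eta k / SP k) ^ 2 / eta k ^ 2\<bar>) * (2 * (N k * N k))\<bar>" .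
  qed
qed

end

declare Cr_tends.simps(2) [simp del]

context renormalization_nondegenerate
begin

abbreviation "R \<equiv> Suc (Suc q)"
abbreviation cu :: "real \<times> R3 \<Rightarrow> real" where "cu x \<equiv> fst (snd x)"
abbreviation cy :: "real \<times> R3 \<Rightarrow> real" where "cy x \<equiv> fst (snd (snd x))"
abbreviation cw :: "real \<times> R3 \<Rightarrow> real" where "cw x \<equiv> snd (snd (snd x))"

lemma C\<xi>: "C k * a3 + N k * c3 k = \<xi>" "C k * a2 + N k * c2 + \<xi> * e k = 1"
  using N_pos[of k] \<xi> by (simp_all add: c3_def e_def)

lemma eta_SP: "S k * (eta k ^ 2 * bb k) = eta k / (SP k * be2)"
  using nz[of k] bb0[of k] cnz by (simp add: eta_def field_simps power2_eq_square)

text \<open>The coordinates \<open>(u, y, w)\<close> at \<open>Q\<close> are explained by the inverse below: \<open>u\<close> is proportional to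
  \<open>C x' + N z'\<close>, the deviation in the third direction after the next turn, and \<open>w\<close> to \<open>c3 x' - a3 z'\<close>,
  which does not depend on the deviation in the third direction before the crossing.  The second
  coordinate is centred at \<open>1 / S\<close>, the height that is taken to \<open>X\<close>.\<close>

definition Psi :: "nat \<Rightarrow> R3 \<Rightarrow> R3" where
  "Psi k v = (1 + eta k * (a3 * fst v + N k * d k * snd (snd v)) / \<xi>, 1 / S k + eta k ^ 2 * bb k * fst (snd v),
     1 + eta k * (c3 k * fst v - C k * d k * snd (snd v)) / \<xi>)"

definition Psi_inv :: "nat \<Rightarrow> R3 \<Rightarrow> R3" where
  "Psi_inv k p = ((C k * (fst p - 1) + N k * (snd (snd p) - 1)) / eta k, (fst (snd p) - 1 / S k) / (eta k ^ 2 * bb k),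
     (c3 k * (fst p - 1) - a3 * (snd (snd p) - 1)) / (eta k * d k))"

lemma Psi_inverse: "Psi_inv k (Psi k v) = v" "Psi k (Psi_inv k p) = p"
proof -
  note z = eta0[of k] bb0[of k] d0[of k]
  have 1: "(C k * (eta k * (a3 * u + N k * d k * w) / \<xi>) + N k * (eta k * (c3 k * u - C k * d k * w) / \<xi>)) / eta k
      = (C k * a3 + N k * c3 k) * u / \<xi>" for u w
    using z \<xi> by (simp add: field_simps)
  have 2: "(c3 k * (eta k * (a3 * u + N k * d k * w) / \<xi>) - a3 * (eta k * (c3 k * u - C k * d k * w) / \<xi>)) / (eta k * d k)
      = (C k * a3 + N k * c3 k) * w / \<xi>" for u w
    using z \<xi> by (simp add: field_simps)
  show "Psi_inv k (Psi k v) = v"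
    using z \<xi> 1[of "fst v" "snd (snd v)"] 2[of "fst v" "snd (snd v)"]
    by (simp add: Psi_inv_def Psi_def C\<xi> prod_eq_iff)
  have 3: "eta k * (a3 * ((C k * a + N k * b) / eta k) + N k * d k * ((c3 k * a - a3 * b) / (eta k * d k))) / \<xi>
      = (C k * a3 + N k * c3 k) * a / \<xi>" for a b
    using z \<xi> by (simp add: field_simps)
  have 4: "eta k * (c3 k * ((C k * a + N k * b) / eta k) - C k * d k * ((c3 k * a - a3 * b) / (eta k * d k))) / \<xi>
      = (C k * a3 + N k * c3 k) * b / \<xi>" for a b
    using z \<xi> by (simp add: field_simps)
  show "Psi k (Psi_inv k p) = p"
    unfolding Psi_inv_def Psi_def fst_conv snd_conv 3 4 C\<xi> using z \<xi> by (simp add: prod_eq_iff)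
qed

text \<open>The stages of a return: \<open>pp\<close> is the deviation from \<open>X\<close>, \<open>vv\<close> the point of arrival near
  \<open>f\<^bsup>N1\<^esup> X\<close>, \<open>PP\<close> the deviation from \<open>Y\<close>, and \<open>out\<close> the point of return.\<close>

definition pp :: "nat \<Rightarrow> R3 \<Rightarrow> R3" where
  "pp k v = (L k * fst (Psi k v), S k * fst (snd (Psi k v)) - 1, Z k * snd (snd (Psi k v)))"

definition G1 :: "R3 \<Rightarrow> R3" where
  "G1 p = (al1 * fst p + al2 * fst (snd p) + al3 * snd (snd p) + Ht1 p,
     be1 * fst p + be2 * fst (snd p) + Ht2 p, ga1 * fst p + Ht3 p)"

text \<open>\<open>nuY\<close> and \<open>nuZ\<close> move the point of arrival to the heights \<open>1 / SP\<close> and \<open>1 / ZP\<close> that are taken to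
  \<open>Y\<close>, compensating the constant contributions of the other terms; \<open>nug\<close> and \<open>nue\<close> produce the
  coefficient \<open>N\<close> and the shear \<open>e\<close>.\<close>

definition "nuY k = 1 / SP k - be1 * L k"
definition "nuZ k = (1 - C k - N k) / ZP k"
definition "nug k = N k / (ZP k * Z k)"
definition "nue k = e k * SP k * be2 / ZP k"

definition vv :: "nat \<Rightarrow> R3 \<Rightarrow> R3" where
  "vv k v = (1, 0, 0) + G1 (pp k v)
     + (0, nuY k, nuZ k + nug k * (Z k * snd (snd (Psi k v))) + nue k * (S k * fst (snd (Psi k v)) - 1))"

definition PP :: "nat \<Rightarrow> R3 \<Rightarrow> R3" where
  "PP k v = (LP k * fst (vv k v), SP k * fst (snd (vv k v)) - 1, ZP k * snd (snd (vv k v)) - 1)"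

definition G2 :: "R3 \<Rightarrow> R3" where
  "G2 p = (a1 * fst p + a2 * fst (snd p) + a3 * snd (snd p) + H1 p,
     b1 * fst p + b2 * fst (snd p) ^ 2 + b3 * snd (snd p) ^ 2 + b4 * fst (snd p) * snd (snd p) + H2 p,
     c1 * fst p + c2 * fst (snd p) + H3 p)"

text \<open>The first terms put the return of the orbit of the centre back to the height \<open>1 / S\<close>, including the
  constant contribution of the first coordinate at \<open>Y\<close>; the last one is the parameter of the family in
  units of the second coordinate.\<close>

definition "mu2 k m = 1 / S k - b1 * LP k * (1 + al1 * L k + al3 * Z k) + eta k ^ 2 * bb k * m"

definition out :: "nat \<Rightarrow> real \<times> R3 \<Rightarrow> R3" where
  "out k x = (1, 0, 1) + G2 (PP k (snd x)) + (0, mu2 k (fst x), c3 k * (ZP k * snd (snd (vv k (snd x))) - 1))"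

text \<open>The analogue of \<open>negl\<close> for maps: such an error tends to zero in the \<open>C\<^sup>r\<close> topology even after
  multiplication by a polynomially bounded coefficient.\<close>

definition neglC :: "(nat \<Rightarrow> real \<times> R3 \<Rightarrow> real) \<Rightarrow> bool" where
  "neglC E \<longleftrightarrow> (\<forall>j. Cr_tends R (\<lambda>k x. N k ^ j * E k x) (\<lambda>x. 0))"

lemma neglC_tends: "neglC E \<Longrightarrow> Cr_tends R E (\<lambda>x. 0)"
  unfolding neglC_def by (drule spec[of _ 0]) simp

lemma neglC_mult: "negl N f \<Longrightarrow> Cr_tends R F F0 \<Longrightarrow> neglC (\<lambda>k x. f k * F k x)"
  unfolding neglC_def
proof
  fix j assume f: "negl N f" and F: "Cr_tends R F F0"
  have "(\<lambda>k. N k ^ j * f k) \<longlonglongrightarrow> 0" using f by (simp add: negl_def)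
  from Cr_tends_mult[OF Cr_tends_const[OF this] F]
  show "Cr_tends R (\<lambda>k x. N k ^ j * (f k * F k x)) (\<lambda>x. 0)" by (simp add: mult.assoc)
qed

lemma neglC_polyb: assumes "neglC E" "polyb N g" shows "neglC (\<lambda>k x. g k * E k x)"
  unfolding neglC_def
proof
  fix j
  obtain K i where K: "\<And>k. \<bar>g k\<bar> \<le> K * N k ^ i" using assms(2) by (auto simp: polyb_def)
  have "(\<lambda>k. g k / N k ^ Suc i) \<longlonglongrightarrow> 0"
  proof (rule Lim_null_comparison)
    show "\<forall>\<^sub>F k in sequentially. norm (g k / N k ^ Suc i) \<le> K * (1 / N k)"
    proof (rule always_eventually[OF allI])
      fix k
      have "\<bar>g k\<bar> / N k ^ Suc i \<le> (K * N k ^ i) / N k ^ Suc i"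
        using N_pos[of k] by (intro divide_right_mono K) auto
      then show "norm (g k / N k ^ Suc i) \<le> K * (1 / N k)" using N_pos[of k] by simp
    qed
    show "(\<lambda>k. K * (1 / N k)) \<longlonglongrightarrow> 0" by (rule tendsto_mult_right_zero[OF inverse_N])
  qed
  moreover have "Cr_tends R (\<lambda>k x. N k ^ (j + Suc i) * E k x) (\<lambda>x. 0)" using assms(1) by (simp only: neglC_def)
  ultimately have "Cr_tends R (\<lambda>k x. g k / N k ^ Suc i * (N k ^ (j + Suc i) * E k x)) (\<lambda>x. 0 * 0)"
    by (intro Cr_tends_mult Cr_tends_const)
  moreover have "g k / N k ^ Suc i * (N k ^ (j + Suc i) * E k x) = N k ^ j * (g k * E k x)" for k x
    using N_pos[of k] by (simp add: power_add)
  ultimately show "Cr_tends R (\<lambda>k x. N k ^ j * (g k * E k x)) (\<lambda>x. 0)" by simp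
qed

lemma neglC_add: "neglC E \<Longrightarrow> neglC E' \<Longrightarrow> neglC (\<lambda>k x. E k x + E' k x)"
proof -
  assume a: "neglC E" "neglC E'"
  show ?thesis unfolding neglC_def
  proof
    fix j
    have "Cr_tends R (\<lambda>k x. N k ^ j * E k x + N k ^ j * E' k x) (\<lambda>x. 0 + 0)"
      using a unfolding neglC_def by (intro Cr_tends_add) blast+
    then show "Cr_tends R (\<lambda>k x. N k ^ j * (E k x + E' k x)) (\<lambda>x. 0)" by (simp only: distrib_left add_0)
  qed
qed

lemma coord_tends: "Cr_tends n (\<lambda>k. cu) cu" "Cr_tends n (\<lambda>k. cy) cy" "Cr_tends n (\<lambda>k. cw) cw"
  "Cr_tends n (\<lambda>k::nat. (fst :: real \<times> R3 \<Rightarrow> real)) fst"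
  by (intro Cr_tends_linear bounded_linear_fst_comp bounded_linear_snd_comp bounded_linear_ident bounded_linear_fst)+

lemma neglC_lin: "negl N f \<Longrightarrow> negl N g \<Longrightarrow> neglC (\<lambda>k x. f k * cu x + g k * cw x)"
  by (rule neglC_add[OF neglC_mult[OF _ coord_tends(1)] neglC_mult[OF _ coord_tends(3)]])

lemma neglC_mult0: "negl N f \<Longrightarrow> Cr_tends R F (\<lambda>x. 0) \<Longrightarrow> neglC (\<lambda>k x. f k * F k x)"
  by (rule neglC_mult)

lemma negl_L: "negl N L"
  by (rule negl_times[OF negl_products[OF ng(5,6)] pb(9)[of 1]]) (use nz in simp)

text \<open>The constant terms \<open>L k\<close> and \<open>Z k\<close> are the deviation of the centre from \<open>X\<close>; because of them
  \<open>rhoQ\<close> contains \<open>Z\<close>.\<close>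

lemma pp_components:
  "fst (pp k (snd x)) = L k + L k * (eta k * (a3 / \<xi>) * cu x + eta k * (N k * d k) * (1 / \<xi>) * cw x)"
  "fst (snd (pp k (snd x))) = eta k / SP k * (1 / be2) * cy x"
  "snd (snd (pp k (snd x))) = Z k + Z k * (eta k * c3 k * (1 / \<xi>) * cu x + eta k * (C k * d k) * (- 1 / \<xi>) * cw x)"
proof -
  show "fst (pp k (snd x)) = L k + L k * (eta k * (a3 / \<xi>) * cu x + eta k * (N k * d k) * (1 / \<xi>) * cw x)"
    using \<xi> by (simp add: pp_def Psi_def field_simps)
  show "snd (snd (pp k (snd x))) = Z k + Z k * (eta k * c3 k * (1 / \<xi>) * cu x + eta k * (C k * d k) * (- 1 / \<xi>) * cw x)"
    using \<xi> by (simp add: pp_def Psi_def field_simps)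
  have "fst (snd (pp k (snd x))) = S k * (eta k ^ 2 * bb k) * cy x"
    using nz(1)[of k] by (simp add: pp_def Psi_def field_simps)
  then show "fst (snd (pp k (snd x))) = eta k / SP k * (1 / be2) * cy x" unfolding eta_SP by simp
qed

lemma Psi_dev_negl:
  "neglC (\<lambda>k x. eta k * (a3 / \<xi>) * cu x + eta k * (N k * d k) * (1 / \<xi>) * cw x)"
  "neglC (\<lambda>k x. eta k * c3 k * (1 / \<xi>) * cu x + eta k * (C k * d k) * (- 1 / \<xi>) * cw x)"
  by (intro neglC_lin negl_polyb[OF _ _ N1] negl_eta pbs)+

lemma rhoQ_quotients:
  "(\<lambda>k. L k / rhoQ k) \<longlonglongrightarrow> 0" "(\<lambda>k. Z k / rhoQ k) \<longlonglongrightarrow> 0" "(\<lambda>k. eta k / SP k / rhoQ k) \<longlonglongrightarrow> 0"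
proof -
  have gen: "A * n \<le> \<rho> \<Longrightarrow> \<rho> > 0 \<Longrightarrow> n > 0 \<Longrightarrow> A / \<rho> \<le> 1 / n" for A n \<rho> :: real by (simp add: field_simps)
  have Zr: "\<bar>Z k\<bar> / rhoQ k \<le> 1 / N k" for k
    by (rule gen[OF rhoQ_ge(1,3) N_pos(1)])
  show "(\<lambda>k. Z k / rhoQ k) \<longlonglongrightarrow> 0"
  proof (rule Lim_null_comparison[OF _ inverse_N])
    show "\<forall>\<^sub>F k in sequentially. norm (Z k / rhoQ k) \<le> 1 / N k"
      using Zr rhoQ_ge(3) by (intro always_eventually allI) (simp add: abs_of_pos)
  qed
  have "\<bar>eta k / SP k\<bar> / rhoQ k \<le> 1 / N k" for k
    by (rule gen[OF rhoQ_ge(2,3) N_pos(1)])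
  then show "(\<lambda>k. eta k / SP k / rhoQ k) \<longlonglongrightarrow> 0"
    by (intro Lim_null_comparison[OF always_eventually[OF allI] inverse_N])
      (simp only: real_norm_def abs_divide[of "eta _ / SP _"] abs_of_pos[OF rhoQ_ge(3)])
  have "(\<lambda>k. L k / Z k * (Z k / rhoQ k)) \<longlonglongrightarrow> 0 * 0"
    by (intro tendsto_mult negl_tendsto[OF ng(5)] \<open>(\<lambda>k. Z k / rhoQ k) \<longlonglongrightarrow> 0\<close>)
  then show "(\<lambda>k. L k / rhoQ k) \<longlonglongrightarrow> 0" using nz by simp
qed

lemma pp_scaled: "Cr_tends R (\<lambda>k (x :: real \<times> R3). (1 / rhoQ k) *\<^sub>R pp k (snd x)) (\<lambda>x. 0)"
proof -
  note A = Cr_tends_add[OF Cr_tends_const'[of R 1] neglC_tends[OF Psi_dev_negl(1)]]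
    and B = Cr_tends_add[OF Cr_tends_const'[of R 1] neglC_tends[OF Psi_dev_negl(2)]]
  have "Cr_tends R (\<lambda>k x. (L k / rhoQ k * (1 + (eta k * (a3 / \<xi>) * cu x + eta k * (N k * d k) * (1 / \<xi>) * cw x)),
      eta k / SP k / rhoQ k * ((1 / be2) * cy x),
      Z k / rhoQ k * (1 + (eta k * c3 k * (1 / \<xi>) * cu x + eta k * (C k * d k) * (- 1 / \<xi>) * cw x))))
      (\<lambda>x. (0 * (1 + 0), 0 * ((1 / be2) * cy x), 0 * (1 + 0)))"
    by (intro Cr_tends_Pair Cr_tends_mult[OF Cr_tends_const[OF rhoQ_quotients(1)] A]
        Cr_tends_mult[OF Cr_tends_const[OF rhoQ_quotients(2)] B]
        Cr_tends_mult[OF Cr_tends_const[OF rhoQ_quotients(3)]] Cr_tends_mult[OF Cr_tends_const' coord_tends(2)])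
  then have "Cr_tends R (\<lambda>k x. (L k / rhoQ k * (1 + (eta k * (a3 / \<xi>) * cu x + eta k * (N k * d k) * (1 / \<xi>) * cw x)),
      eta k / SP k / rhoQ k * ((1 / be2) * cy x),
      Z k / rhoQ k * (1 + (eta k * c3 k * (1 / \<xi>) * cu x + eta k * (C k * d k) * (- 1 / \<xi>) * cw x)))) (\<lambda>x. 0)"
    by (simp add: zero_prod_def)
  moreover have "(L k / rhoQ k * (1 + (eta k * (a3 / \<xi>) * cu x + eta k * (N k * d k) * (1 / \<xi>) * cw x)),
      eta k / SP k / rhoQ k * ((1 / be2) * cy x),
      Z k / rhoQ k * (1 + (eta k * c3 k * (1 / \<xi>) * cu x + eta k * (C k * d k) * (- 1 / \<xi>) * cw x)))
      = (1 / rhoQ k) *\<^sub>R pp k (snd x)" for k x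
    unfolding prod_eq_iff fst_scaleR snd_scaleR fst_conv snd_conv pp_components
    by (simp add: field_simps)
  ultimately show ?thesis by simp
qed

lemma pp_tends: "Cr_tends R (\<lambda>k (x :: real \<times> R3). pp k (snd x)) (\<lambda>x. 0)"
proof -
  have "Cr_tends R (\<lambda>k (x :: real \<times> R3). rhoQ k *\<^sub>R ((1 / rhoQ k) *\<^sub>R pp k (snd x))) (\<lambda>x. 0 *\<^sub>R 0)"
    by (intro Cr_tends_scaleR pp_scaled Cr_tends_const negl_tendsto[OF negl_rhoQ])
  moreover have "rhoQ k \<noteq> 0" for k using rhoQ_ge(3)[of k] by simp
  ultimately show ?thesis by simp
qed

lemma Ht_scaled:
  assumes "H \<in> {Ht1, Ht2, Ht3}"
  shows "Cr_tends R (\<lambda>k (x :: real \<times> R3). H (pp k (snd x)) / rhoQ k ^ 2) (\<lambda>x. 0)"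
proof -
  have "H \<in> {Ht1, Ht2, Ht3, H1, H2, H3}" using assms by blast
  from H_smooth[OF this] obtain U where U: "open U" "0 \<in> U" "Ck_on R H U"
    and H0: "H 0 = 0" "\<And>j. frechet_derivative H (at 0) j = 0" by blast
  have r0: "rhoQ k \<noteq> 0" for k using rhoQ_ge(3)[of k] by simp
  have "Cr_tends R (\<lambda>k (x :: real \<times> R3). (1 / rhoQ k ^ 2) *\<^sub>R H (rhoQ k *\<^sub>R ((1 / rhoQ k) *\<^sub>R pp k (snd x)))) (\<lambda>x. 0)"
    by (rule Cr_tends_rescale2_0[OF pp_scaled U H0 negl_tendsto[OF negl_rhoQ] r0])
  then show ?thesis using r0 by simp
qed

lemma Ht_tends: "H \<in> {Ht1, Ht2, Ht3} \<Longrightarrow> neglC (\<lambda>k x. H (pp k (snd x)))"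
proof -
  assume H: "H \<in> {Ht1, Ht2, Ht3}"
  have "negl N (\<lambda>k. rhoQ k * rhoQ k)" by (rule negl_products[OF negl_rhoQ negl_rhoQ])
  from neglC_mult[OF this Ht_scaled[OF H]]
  show ?thesis using rhoQ_ge(3) by (simp add: power2_eq_square less_imp_neq[symmetric])
qed

text \<open>\<open>EY\<close> and \<open>EZ\<close> are the errors in the second and third coordinate of the deviation from \<open>Y\<close>, in units
  of \<open>eta\<close>; apart from them it is \<open>(LP V1, eta y, eta (u + e y))\<close>.\<close>

definition V1 :: "nat \<Rightarrow> real \<times> R3 \<Rightarrow> real" where
  "V1 k x = 1 + al1 * fst (pp k (snd x)) + al2 * fst (snd (pp k (snd x))) + al3 * snd (snd (pp k (snd x))) + Ht1 (pp k (snd x))"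
definition "EY k x = SP k * L k * (be1 * a3 / \<xi>) * cu x + SP k * L k * (N k * d k * (be1 / \<xi>)) * cw x
    + SP k * rhoQ k ^ 2 / eta k * (Ht2 (pp k (snd x)) / rhoQ k ^ 2)"
definition EZ :: "nat \<Rightarrow> real \<times> R3 \<Rightarrow> real" where
  "EZ k x = ZP k * rhoQ k ^ 2 / eta k * (Ht3 (pp k (snd x)) / rhoQ k ^ 2)"

lemma pp_coord_tends:
  "Cr_tends R (\<lambda>k (x :: real \<times> R3). fst (pp k (snd x))) (\<lambda>x. 0)"
  "Cr_tends R (\<lambda>k (x :: real \<times> R3). fst (snd (pp k (snd x)))) (\<lambda>x. 0)"
  "Cr_tends R (\<lambda>k (x :: real \<times> R3). snd (snd (pp k (snd x)))) (\<lambda>x. 0)"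
  using Cr_tends_compose_linear[OF bounded_linear_fst pp_tends]
    Cr_tends_compose_linear[OF bounded_linear_fst_comp[OF bounded_linear_snd] pp_tends]
    Cr_tends_compose_linear[OF bounded_linear_snd_comp[OF bounded_linear_snd] pp_tends] by simp_all

lemma V1_tends: "Cr_tends R V1 (\<lambda>x. 1)"
proof -
  have h: "Cr_tends R (\<lambda>k (x :: real \<times> R3). Ht1 (pp k (snd x))) (\<lambda>x. 0)" by (rule neglC_tends[OF Ht_tends]) simp
  have m: "Cr_tends R (\<lambda>k x. c * F k x) (\<lambda>x. 0)" if "Cr_tends R F (\<lambda>x. 0)" for c and F :: "nat \<Rightarrow> real \<times> R3 \<Rightarrow> real"
    using Cr_tends_mult[OF Cr_tends_const'[of R c] that] by simp
  show ?thesis unfolding V1_def[abs_def]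
    using Cr_tends_add[OF Cr_tends_add[OF Cr_tends_add[OF Cr_tends_add[OF Cr_tends_const'[of R 1] m[OF pp_coord_tends(1)]]
        m[OF pp_coord_tends(2)]] m[OF pp_coord_tends(3)]] h] by simp
qed

lemma EY_negl: "neglC EY"
  unfolding EY_def[abs_def]
proof (rule neglC_add[OF neglC_lin neglC_mult0[OF negl_SP_rhoQ Ht_scaled]])
  show "negl N (\<lambda>k. SP k * L k * (be1 * a3 / \<xi>))" "negl N (\<lambda>k. SP k * L k * (N k * d k * (be1 / \<xi>)))"
    by (rule negl_polyb[OF ng(4) _ N1], intro pbs)+
qed simp

lemma EZ_negl: "neglC EZ"
  unfolding EZ_def[abs_def] by (rule neglC_mult0[OF negl_ZP_rhoQ Ht_scaled]) simp

lemma PP_components: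
  "fst (PP k (snd x)) = LP k * V1 k x"
  "fst (snd (PP k (snd x))) = eta k * (cy x + EY k x)"
  "snd (snd (PP k (snd x))) = eta k * (cu x + e k * cy x + EZ k x)"
proof -
  have r0: "rhoQ k \<noteq> 0" using rhoQ_ge(3)[of k] by simp
  have y1: "S k * fst (snd (Psi k (snd x))) - 1 = eta k / SP k * (1 / be2) * cy x"
    using pp_components(2)[of k x] by (simp add: pp_def)
  have zw: "Z k * snd (snd (Psi k (snd x))) = snd (snd (pp k (snd x)))" by (simp add: pp_def)
  show "fst (PP k (snd x)) = LP k * V1 k x"
    by (simp add: PP_def vv_def G1_def V1_def algebra_simps)
  have "fst (snd (PP k (snd x))) = SP k * (be1 * fst (pp k (snd x)) + be2 * fst (snd (pp k (snd x))) + Ht2 (pp k (snd x)) + nuY k) - 1"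
    by (simp add: PP_def vv_def G1_def)
  also have "\<dots> = eta k * (cy x + EY k x)"
    unfolding pp_components nuY_def EY_def
    using nz[of k] cnz \<xi> eta0[of k] r0 by (simp add: field_simps)
  finally show "fst (snd (PP k (snd x))) = eta k * (cy x + EY k x)" .
  have "snd (snd (PP k (snd x))) = ZP k * (ga1 * fst (pp k (snd x)) + Ht3 (pp k (snd x)) + nuZ k
      + nug k * snd (snd (pp k (snd x))) + nue k * (eta k / SP k * (1 / be2) * cy x)) - 1"
    unfolding y1[symmetric] zw[symmetric] by (simp add: PP_def vv_def G1_def algebra_simps)
  also have "\<dots> = eta k * ((C k * a3 + N k * c3 k) / \<xi> * cu x + e k * cy x + EZ k x)"
    unfolding pp_components nuZ_def nug_def nue_def EZ_def
    using nz[of k] cnz \<xi> eta0[of k] r0 by (simp add: field_simps) (simp add: C_def algebra_simps)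
  finally show "snd (snd (PP k (snd x))) = eta k * (cu x + e k * cy x + EZ k x)" using \<xi> by (simp add: C\<xi>)
qed

lemma X_negl: "neglC (\<lambda>k x. LP k * V1 k x / eta k)"
  using neglC_mult[OF negl_LP_eta V1_tends] by simp

definition PPs :: "nat \<Rightarrow> real \<times> R3 \<Rightarrow> R3" where
  "PPs k x = (1 / rho k) *\<^sub>R PP k (snd x)"

lemma PPs_components:
  "fst (PPs k x) = 1 / N k * (LP k * V1 k x / eta k)"
  "fst (snd (PPs k x)) = 1 / N k * (cy x + EY k x)"
  "snd (snd (PPs k x)) = 1 / N k * (cu x + EZ k x) + e k / N k * cy x"
  using eta0[of k] N_pos[of k] unfolding PPs_def fst_scaleR snd_scaleR PP_components rho_def
  by (simp_all add: field_simps)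

text \<open>Divided by \<open>rho\<close>, which exceeds \<open>eta\<close> by the factor \<open>N\<close>, only the shear term survives.  In
  the limit the second order terms at \<open>Y\<close> are thus seen along the third axis only.\<close>

lemma PPs_tends: "Cr_tends R PPs (\<lambda>x. (0, 0, - (c2 / \<xi>) * cy x))"
proof -
  have iN: "Cr_tends R (\<lambda>k (x :: real \<times> R3). 1 / N k) (\<lambda>x. 0)" by (rule Cr_tends_const[OF inverse_N])
  have 1: "Cr_tends R (\<lambda>k x. fst (PPs k x)) (\<lambda>x. 0)"
    unfolding PPs_components using Cr_tends_mult[OF iN neglC_tends[OF X_negl]] by simp
  have 2: "Cr_tends R (\<lambda>k x. fst (snd (PPs k x))) (\<lambda>x. 0)"
    unfolding PPs_components
    using Cr_tends_mult[OF iN Cr_tends_add[OF coord_tends(2) neglC_tends[OF EY_negl]]] by simp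
  have 3: "Cr_tends R (\<lambda>k x. snd (snd (PPs k x))) (\<lambda>x. - (c2 / \<xi>) * cy x)"
    unfolding PPs_components
    using Cr_tends_add[OF Cr_tends_mult[OF iN Cr_tends_add[OF coord_tends(1) neglC_tends[OF EZ_negl]]]
        Cr_tends_mult[OF Cr_tends_const[OF e_lim] coord_tends(2)]] by simp
  from Cr_tends_Pair[OF 1 Cr_tends_Pair[OF 2 3]] show ?thesis by simp
qed

lemma PP_rho: "PP k (snd x) = rho k *\<^sub>R PPs k x"
  using rho0[of k] by (simp add: PPs_def)

lemma PP_tends: "Cr_tends R (\<lambda>k (x :: real \<times> R3). PP k (snd x)) (\<lambda>x. 0)"
  using Cr_tends_scaleR[OF Cr_tends_const[OF negl_tendsto[OF negl_rho]] PPs_tends] by (simp add: PP_rho zero_prod_def)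

text \<open>The remainders of the other two coordinates only have to be small compared to \<open>eta\<close>, so that they
  can be blown up at a larger scale, at which the deviations tend to zero.\<close>

lemma H_negl:
  assumes "H \<in> {H1, H3}" shows "neglC (\<lambda>k x. H (PP k (snd x)) / eta k)"
proof -
  have "H \<in> {Ht1, Ht2, Ht3, H1, H2, H3}" using assms by blast
  from H_smooth[OF this] obtain U where U: "open U" "0 \<in> U" "Ck_on R H U"
    and H0: "H 0 = 0" "\<And>j. frechet_derivative H (at 0) j = 0" by blast
  define tau where "tau k = N k * rho k" for k
  have t: "negl N tau" by (rule negl_times[OF negl_rho pb(1)]) (simp add: tau_def)
  have t0: "tau k \<noteq> 0" for k using N_pos rho0 by (simp add: tau_def)
  have "Cr_tends R (\<lambda>k x. (1 / N k) *\<^sub>R PPs k x) (\<lambda>x. 0 *\<^sub>R (0, 0, - (c2 / \<xi>) * cy x))"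
    by (rule Cr_tends_scaleR[OF Cr_tends_const[OF inverse_N] PPs_tends])
  then have P: "Cr_tends R (\<lambda>k x. (1 / N k) *\<^sub>R PPs k x) (\<lambda>x. 0)" by (simp add: zero_prod_def)
  have "Cr_tends R (\<lambda>k (x :: real \<times> R3). (1 / tau k ^ 2) *\<^sub>R H (tau k *\<^sub>R ((1 / N k) *\<^sub>R PPs k x))) (\<lambda>x. 0)"
    by (rule Cr_tends_rescale2_0[OF P U H0 negl_tendsto[OF t] t0])
  moreover have "tau k *\<^sub>R ((1 / N k) *\<^sub>R PPs k x) = PP k (snd x)" for k x
    using N_pos[of k] by (simp add: tau_def PP_rho)
  ultimately have T: "Cr_tends R (\<lambda>k (x :: real \<times> R3). H (PP k (snd x)) / tau k ^ 2) (\<lambda>x. 0)" by simp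
  have "negl N (\<lambda>k. tau k ^ 2 / eta k)"
  proof (rule negl_times[OF negl_eta, of "\<lambda>k. N k * N k * (N k * N k)"])
    show "polyb N (\<lambda>k. N k * N k * (N k * N k))" by (intro pbs)
    show "tau k ^ 2 / eta k = eta k * (N k * N k * (N k * N k))" for k
      using eta0[of k] by (simp add: tau_def rho_def power2_eq_square)
  qed
  from neglC_mult0[OF this T] show ?thesis using t0 by simp
qed

text \<open>The remainder of the second coordinate competes with the quadratic terms, at the scale \<open>rho\<^sup>2\<close>.  The
  deviations tend to the third axis, along which the second derivative of \<open>H2\<close> vanishes.\<close>

lemma H2_tends: "Cr_tends R (\<lambda>k (x :: real \<times> R3). H2 (PP k (snd x)) / rho k ^ 2) (\<lambda>x. 0)"
proof -
  have "H2 \<in> {Ht1, Ht2, Ht3, H1, H2, H3}" by blast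
  from H_smooth[OF this] obtain U where U: "open U" "0 \<in> U" "Ck_on R H2 U"
    and H0: "H2 0 = 0" "\<And>j. frechet_derivative H2 (at 0) j = 0" by blast
  let ?p = "\<lambda>x :: real \<times> R3. (0 :: real, 0 :: real, - (c2 / \<xi>) * cy x)"
  have bl: "bounded_linear ?p"
    by (intro bounded_linear_Pair bounded_linear_zero bounded_linear_mult_right[THEN bounded_linear_compose]
        bounded_linear_fst_comp bounded_linear_snd_comp bounded_linear_ident)
  have fd: "frechet_derivative ?p (at x) = ?p" for x
    by (rule frechet_derivative_eqI[OF bounded_linear_imp_has_derivative[OF bl]])
  let ?dz = "frechet_derivative (\<lambda>w. frechet_derivative H2 (at w) (0, 0, 1)) (at 0)"
  have "(\<lambda>w. frechet_derivative H2 (at w) (0, 0, 1)) differentiable (at 0)"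
    using U by (simp add: Basis_R3)
  then have lin: "linear ?dz" by (rule linear_frechet_derivative)
  have dz: "?dz (0, 0, t) = 0" for t
  proof -
    have "?dz (0, 0, t) = ?dz (t *\<^sub>R (0, 0, 1))" by simp
    then show ?thesis by (simp only: linear_scale[OF lin] H2_zz scaleR_zero_right)
  qed
  have "Cr_tends R (\<lambda>k x. (1 / rho k ^ 2) *\<^sub>R H2 (rho k *\<^sub>R PPs k x)) (\<lambda>x. 0)"
  proof (rule Cr_tends_rescale2[where p="?p" and H=H2, OF PPs_tends _ U H0 _ negl_tendsto[OF negl_rho] rho0])
    show "(0, 0, - (c2 / \<xi>) * cy (0 :: real \<times> R3)) = (0 :: R3)" by (simp add: zero_prod_def)
    fix x i :: "real \<times> R3"
    show "(\<Sum>j\<in>Basis. (frechet_derivative ?p (at x) i \<bullet> j) *\<^sub>R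
        frechet_derivative (\<lambda>w. frechet_derivative H2 (at w) j) (at 0) (?p x)) = 0"
      unfolding fd Basis_R3 using dz by simp
  qed
  then show ?thesis by (simp add: PP_rho)
qed

definition "F k x = Psi_inv k (out k x)"

definition limit_map :: "real \<times> R3 \<Rightarrow> R3" where
  "limit_map x = (\<xi> * cu x + cy x, fst x + cy x ^ 2, cy x)"

lemma Psi_F: "Psi k (F k x) = out k x"
  unfolding F_def by (rule Psi_inverse(2))

lemma ZP_vv: "ZP k * snd (snd (vv k v)) - 1 = snd (snd (PP k v))"
  by (simp add: PP_def)

lemma out_components:
  fixes k x
  defines "p \<equiv> PP k (snd x)"
  shows "fst (out k x) - 1 = a1 * fst p + a2 * fst (snd p) + a3 * snd (snd p) + H1 p"
    "snd (snd (out k x)) - 1 = c1 * fst p + c2 * fst (snd p) + c3 k * snd (snd p) + H3 p"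
    "fst (snd (out k x)) - 1 / S k = eta k ^ 2 * bb k * fst x + (b1 * (fst p - LP k * (1 + al1 * L k + al3 * Z k))
       + b2 * fst (snd p) ^ 2 + b3 * snd (snd p) ^ 2 + b4 * fst (snd p) * snd (snd p) + H2 p)"
  unfolding out_def ZP_vv p_def[symmetric] by (simp_all add: G2_def mu2_def algebra_simps)

lemma F1_eq: "fst (F k x) = \<xi> * cu x + cy x + ((C k * a1 + N k * c1) * (LP k * V1 k x / eta k)
    + (C k * a2 + N k * c2) * EY k x + \<xi> * EZ k x + C k * (H1 (PP k (snd x)) / eta k) + N k * (H3 (PP k (snd x)) / eta k))"
proof -
  have "fst (F k x) = (C k * (fst (out k x) - 1) + N k * (snd (snd (out k x)) - 1)) / eta k"
    by (simp add: F_def Psi_inv_def)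
  also have "\<dots> = (C k * a1 + N k * c1) * (LP k * V1 k x / eta k) + (C k * a2 + N k * c2) * (cy x + EY k x)
      + (C k * a3 + N k * c3 k) * (cu x + e k * cy x + EZ k x)
      + C k * (H1 (PP k (snd x)) / eta k) + N k * (H3 (PP k (snd x)) / eta k)"
    unfolding out_components PP_components using eta0[of k] by (simp add: field_simps)
  also have "\<dots> = \<xi> * cu x + (C k * a2 + N k * c2 + \<xi> * e k) * cy x + ((C k * a1 + N k * c1) * (LP k * V1 k x / eta k)
    + (C k * a2 + N k * c2) * EY k x + \<xi> * EZ k x + C k * (H1 (PP k (snd x)) / eta k) + N k * (H3 (PP k (snd x)) / eta k))"
    unfolding C\<xi>(1) by (simp add: algebra_simps)
  finally show ?thesis by (simp add: C\<xi>(2))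
qed

lemma F3_eq: "snd (snd (F k x)) = cy x + (EY k x + (c3 k * a1 + (- a3 * c1)) * (1 / d k) * (LP k * V1 k x / eta k)
    + c3 k * (1 / d k) * (H1 (PP k (snd x)) / eta k) + (- a3) * (1 / d k) * (H3 (PP k (snd x)) / eta k))"
proof -
  have "snd (snd (F k x)) = (c3 k * (fst (out k x) - 1) - a3 * (snd (snd (out k x)) - 1)) / (eta k * d k)"
    by (simp add: F_def Psi_inv_def)
  also have "\<dots> = (c3 k * a2 - a3 * c2) / d k * (cy x + EY k x) + ((c3 k * a1 + (- a3 * c1)) * (1 / d k) * (LP k * V1 k x / eta k)
    + c3 k * (1 / d k) * (H1 (PP k (snd x)) / eta k) + (- a3) * (1 / d k) * (H3 (PP k (snd x)) / eta k))"
    unfolding out_components PP_components using eta0[of k] d0[of k] by (simp add: field_simps)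
  also have "(c3 k * a2 - a3 * c2) / d k = 1" using d0[of k] by (simp add: d_def)
  finally show ?thesis by simp
qed

text \<open>The first coordinate at \<open>Y\<close> enters the second coordinate at \<open>Q\<close> to first order.  Its constant part
  need not be small there and is removed by \<open>mu2\<close>; the rest \<open>XD\<close> is small at the scale \<open>rho\<^sup>2\<close>.\<close>

definition "XD k x = al1 * (L k * (eta k * (a3 / \<xi>) * cu x + eta k * (N k * d k) * (1 / \<xi>) * cw x))
    + al2 * (eta k / SP k * (1 / be2) * cy x)
    + al3 * (Z k * (eta k * c3 k * (1 / \<xi>) * cu x + eta k * (C k * d k) * (- 1 / \<xi>) * cw x)) + Ht1 (pp k (snd x))"

lemma X_dev: "LP k * V1 k x - LP k * (1 + al1 * L k + al3 * Z k) = LP k * XD k x"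
  unfolding V1_def XD_def pp_components by (simp add: algebra_simps)

lemma XD_tends: "Cr_tends R (\<lambda>k x. LP k * XD k x / rho k ^ 2) (\<lambda>x. 0)"
proof -
  have e1: "negl N (\<lambda>k. LP k * L k * eta k * c / rho k ^ 2)" for c
  proof (rule negl_times[OF negl_products[OF negl_LP_eta negl_L], of "\<lambda>k. (1 / N k) * (1 / N k) * c"])
    show "LP k * L k * eta k * c / rho k ^ 2 = LP k / eta k * L k * ((1 / N k) * (1 / N k) * c)" for k
      using eta0[of k] N_pos[of k] by (simp add: rho_def field_simps power2_eq_square)
  qed (intro pbs)
  have e2: "negl N (\<lambda>k. LP k * Z k * eta k * c / rho k ^ 2)" for c
  proof (rule negl_times[OF negl_products[OF negl_LP_eta ng(6)], of "\<lambda>k. (1 / N k) * (1 / N k) * c"])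
    show "LP k * Z k * eta k * c / rho k ^ 2 = LP k / eta k * Z k * ((1 / N k) * (1 / N k) * c)" for k
      using eta0[of k] N_pos[of k] by (simp add: rho_def field_simps power2_eq_square)
  qed (intro pbs)
  have e3: "negl N (\<lambda>k. LP k * (eta k / SP k) * c / rho k ^ 2)" for c
  proof (rule negl_times[OF negl_products[OF negl_LP_eta ng(7)], of "\<lambda>k. (1 / N k) * (1 / N k) * c"])
    show "LP k * (eta k / SP k) * c / rho k ^ 2 = LP k / eta k * (1 / SP k) * ((1 / N k) * (1 / N k) * c)" for k
      using eta0[of k] N_pos[of k] nz(3)[of k] by (simp add: rho_def field_simps power2_eq_square)
  qed (intro pbs)
  have e4: "negl N (\<lambda>k. LP k * rhoQ k ^ 2 / rho k ^ 2)"
  proof (rule negl_times[OF negl_LP_rhoQ, of "\<lambda>k. (1 / N k) * (1 / N k)"])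
    show "LP k * rhoQ k ^ 2 / rho k ^ 2 = LP k * rhoQ k ^ 2 / eta k ^ 2 * ((1 / N k) * (1 / N k))" for k
      using eta0[of k] N_pos[of k] by (simp add: rho_def field_simps power2_eq_square)
  qed (intro pbs)
  have l1: "neglC (\<lambda>k x. (LP k * L k * eta k * (al1 * a3 / \<xi>) / rho k ^ 2) * cu x
      + (LP k * L k * eta k * (al1 / \<xi>) / rho k ^ 2 * (N k * d k)) * cw x)"
    by (rule neglC_lin[OF e1 negl_polyb[OF e1 _ N1]]) (intro pbs)
  have l2: "neglC (\<lambda>k x. (LP k * Z k * eta k * (al3 / \<xi>) / rho k ^ 2 * c3 k) * cu x
      + (LP k * Z k * eta k * (- al3 / \<xi>) / rho k ^ 2 * (C k * d k)) * cw x)"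
    by (rule neglC_lin[OF negl_polyb[OF e2 _ N1] negl_polyb[OF e2 _ N1]]; intro pbs)
  have l3: "neglC (\<lambda>k x. LP k * (eta k / SP k) * (al2 / be2) / rho k ^ 2 * cy x)"
    by (rule neglC_mult[OF e3 coord_tends(2)])
  have l4: "neglC (\<lambda>k x. LP k * rhoQ k ^ 2 / rho k ^ 2 * (Ht1 (pp k (snd x)) / rhoQ k ^ 2))"
    by (rule neglC_mult0[OF e4 Ht_scaled]) simp
  have r0: "rhoQ k \<noteq> 0" for k using rhoQ_ge(3)[of k] by simp
  have "LP k * XD k x / rho k ^ 2 = (LP k * L k * eta k * (al1 * a3 / \<xi>) / rho k ^ 2) * cu x
      + (LP k * L k * eta k * (al1 / \<xi>) / rho k ^ 2 * (N k * d k)) * cw x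
      + ((LP k * Z k * eta k * (al3 / \<xi>) / rho k ^ 2 * c3 k) * cu x
      + (LP k * Z k * eta k * (- al3 / \<xi>) / rho k ^ 2 * (C k * d k)) * cw x)
      + LP k * (eta k / SP k) * (al2 / be2) / rho k ^ 2 * cy x
      + LP k * rhoQ k ^ 2 / rho k ^ 2 * (Ht1 (pp k (snd x)) / rhoQ k ^ 2)" for k x
    unfolding XD_def using rho0[of k] r0[of k] by (simp add: field_simps)
  then show ?thesis using neglC_tends[OF neglC_add[OF neglC_add[OF neglC_add[OF l1 l2] l3] l4]] by simp
qed

lemma F2_eq: "fst (snd (F k x)) = fst x + N k ^ 2 / bb k * (b1 * (LP k * XD k x / rho k ^ 2)
    + b2 * fst (snd (PPs k x)) ^ 2 + b3 * snd (snd (PPs k x)) ^ 2 + b4 * (fst (snd (PPs k x)) * snd (snd (PPs k x)))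
    + H2 (PP k (snd x)) / rho k ^ 2)"
proof -
  let ?p = "PP k (snd x)"
  have sq: "eta k ^ 2 * bb k = rho k ^ 2 * (bb k / N k ^ 2)"
    using N_pos[of k] by (simp add: rho_def field_simps)
  have "fst (snd (F k x)) = (fst (snd (out k x)) - 1 / S k) / (eta k ^ 2 * bb k)"
    by (simp add: F_def Psi_inv_def)
  also have "\<dots> = fst x + (b1 * (LP k * XD k x) + b2 * fst (snd ?p) ^ 2 + b3 * snd (snd ?p) ^ 2
      + b4 * fst (snd ?p) * snd (snd ?p) + H2 ?p) / (rho k ^ 2 * (bb k / N k ^ 2))"
    unfolding out_components PP_components(1) X_dev sq[symmetric] using eta0[of k] bb0[of k]
    by (simp add: add_divide_distrib)
  also have "\<dots> = fst x + N k ^ 2 / bb k * (b1 * (LP k * XD k x / rho k ^ 2)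
    + b2 * fst (snd (PPs k x)) ^ 2 + b3 * snd (snd (PPs k x)) ^ 2 + b4 * (fst (snd (PPs k x)) * snd (snd (PPs k x)))
    + H2 ?p / rho k ^ 2)"
    unfolding PPs_def fst_scaleR snd_scaleR
    using rho0[of k] bb0[of k] N_pos[of k] by (simp add: field_simps power2_eq_square)
  finally show ?thesis .
qed

text \<open>After division by \<open>rho\<^sup>2\<close> the deviation at \<open>Y\<close> is \<open>(0, 0, - (c2 / \<xi>) y)\<close> in the limit, so the quadratic
  form is \<open>b3 (c2 / \<xi>)\<^sup>2 y\<^sup>2\<close>, and \<open>b3 (c2 / \<xi>)\<^sup>2\<close> is also the limit of \<open>bb / N\<^sup>2\<close>.\<close>

lemma F_tends: "Cr_tends R F limit_map"
proof -
  have "neglC (\<lambda>k x. (C k * a1 + N k * c1) * (LP k * V1 k x / eta k)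
    + (C k * a2 + N k * c2) * EY k x + \<xi> * EZ k x + C k * (H1 (PP k (snd x)) / eta k) + N k * (H3 (PP k (snd x)) / eta k))"
    by (intro neglC_add neglC_polyb X_negl EY_negl EZ_negl H_negl pbs) simp_all
  from Cr_tends_add[OF Cr_tends_add[OF Cr_tends_mult[OF Cr_tends_const'[of R \<xi>] coord_tends(1)] coord_tends(2)] neglC_tends[OF this]]
  have 1: "Cr_tends R (\<lambda>k x. fst (F k x)) (\<lambda>x. \<xi> * cu x + cy x)" unfolding F1_eq by simp
  have "neglC (\<lambda>k x. EY k x + (c3 k * a1 + (- a3 * c1)) * (1 / d k) * (LP k * V1 k x / eta k)
    + c3 k * (1 / d k) * (H1 (PP k (snd x)) / eta k) + (- a3) * (1 / d k) * (H3 (PP k (snd x)) / eta k))"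
    by (intro neglC_add neglC_polyb X_negl EY_negl EZ_negl H_negl pbs) simp_all
  from Cr_tends_add[OF coord_tends(2) neglC_tends[OF this]]
  have 3: "Cr_tends R (\<lambda>k x. snd (snd (F k x))) cy" unfolding F3_eq by simp
  have Ys: "Cr_tends R (\<lambda>k x. fst (snd (PPs k x))) (\<lambda>x. 0)"
    using Cr_tends_compose_linear[OF bounded_linear_fst_comp[OF bounded_linear_snd] PPs_tends] by simp
  have Zs: "Cr_tends R (\<lambda>k x. snd (snd (PPs k x))) (\<lambda>x. - (c2 / \<xi>) * cy x)"
    using Cr_tends_compose_linear[OF bounded_linear_snd_comp[OF bounded_linear_snd] PPs_tends] by simp
  have "Cr_tends R (\<lambda>k x. N k ^ 2 / bb k * (b1 * (LP k * XD k x / rho k ^ 2)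
    + b2 * fst (snd (PPs k x)) ^ 2 + b3 * snd (snd (PPs k x)) ^ 2 + b4 * (fst (snd (PPs k x)) * snd (snd (PPs k x)))
    + H2 (PP k (snd x)) / rho k ^ 2))
    (\<lambda>x. 1 / (b3 * (c2 / \<xi>) ^ 2) * (b1 * 0 + b2 * 0 ^ 2 + b3 * (- (c2 / \<xi>) * cy x) ^ 2 + b4 * (0 * (- (c2 / \<xi>) * cy x)) + 0))"
    by (rule Cr_tends_mult[OF Cr_tends_const[OF quot_lim] Cr_tends_add[OF Cr_tends_add[OF Cr_tends_add[OF Cr_tends_add[OF
      Cr_tends_mult[OF Cr_tends_const' XD_tends] Cr_tends_mult[OF Cr_tends_const' Cr_tends_power2[OF Ys]]]
      Cr_tends_mult[OF Cr_tends_const' Cr_tends_power2[OF Zs]]] Cr_tends_mult[OF Cr_tends_const' Cr_tends_mult[OF Ys Zs]]] H2_tends]])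
  moreover have "1 / (b3 * (c2 / \<xi>) ^ 2) * (b1 * 0 + b2 * 0 ^ 2 + b3 * (- (c2 / \<xi>) * t) ^ 2 + b4 * (0 * (- (c2 / \<xi>) * t)) + 0)
      = t ^ 2" for t
    using cnz \<xi> by (simp add: power2_eq_square)
  ultimately have "Cr_tends R (\<lambda>k x. fst x + N k ^ 2 / bb k * (b1 * (LP k * XD k x / rho k ^ 2)
    + b2 * fst (snd (PPs k x)) ^ 2 + b3 * snd (snd (PPs k x)) ^ 2 + b4 * (fst (snd (PPs k x)) * snd (snd (PPs k x)))
    + H2 (PP k (snd x)) / rho k ^ 2)) (\<lambda>x. fst x + cy x ^ 2)"
    by (intro Cr_tends_add coord_tends(4)) simp
  then have 2: "Cr_tends R (\<lambda>k x. fst (snd (F k x))) (\<lambda>x. fst x + cy x ^ 2)" unfolding F2_eq .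
  from Cr_tends_Pair[OF 1 Cr_tends_Pair[OF 2 3]] show ?thesis unfolding limit_map_def[abs_def] by simp
qed

text \<open>Along the renormalization all points stay near the cycle and all parameters tend to zero.\<close>

lemma parameter_limits: "nuY \<longlonglongrightarrow> 0" "nuZ \<longlonglongrightarrow> 0" "nug \<longlonglongrightarrow> 0" "nue \<longlonglongrightarrow> 0"
  "(\<lambda>k. 1 / S k - b1 * LP k * (1 + al1 * L k + al3 * Z k)) \<longlonglongrightarrow> 0" "(\<lambda>k. eta k ^ 2 * bb k) \<longlonglongrightarrow> 0"
proof -
  note l = negl_tendsto
  show "nuY \<longlonglongrightarrow> 0" unfolding nuY_def[abs_def]
    using tendsto_diff[OF l[OF ng(7)] tendsto_mult_right_zero[OF l[OF negl_L], of be1]] by simp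
  have "negl N (\<lambda>k. 1 / ZP k)"
  proof (rule negl_le[OF ng(7)])
    show "\<bar>1 / ZP k\<bar> \<le> \<bar>1 / SP k\<bar>" for k
      using SPZP[of k] nz(3,4)[of k] by (simp add: frac_le)
  qed
  then have "negl N (\<lambda>k. 1 / ZP k * (1 + (- 1) * C k + (- 1) * N k))"
    by (rule negl_polyb[OF _ _ N1]) (intro pbs)
  from l[OF this] show "nuZ \<longlonglongrightarrow> 0" unfolding nuZ_def[abs_def] by simp
  have "negl N (\<lambda>k. 1 / (ZP k * Z k) * N k)" by (rule negl_polyb[OF ng(11) pb(1) N1])
  from l[OF this] show "nug \<longlonglongrightarrow> 0" unfolding nug_def[abs_def] by simp
  have "negl N (\<lambda>k. SP k / ZP k * (e k * be2))" by (rule negl_polyb[OF ng(9) _ N1]) (intro pbs)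
  from l[OF this] show "nue \<longlonglongrightarrow> 0" unfolding nue_def[abs_def] by (simp add: mult_ac)
  have "(\<lambda>k. 1 / S k - b1 * LP k * (1 + al1 * L k + al3 * Z k)) \<longlonglongrightarrow> 0 - b1 * 0 * (1 + al1 * 0 + al3 * 0)"
    by (intro tendsto_intros l[OF ng(8)] l[OF ng(10)] l[OF negl_L] l[OF ng(6)])
  then show "(\<lambda>k. 1 / S k - b1 * LP k * (1 + al1 * L k + al3 * Z k)) \<longlonglongrightarrow> 0" by simp
  have "negl N (\<lambda>k. eta k * eta k * bb k)" by (intro negl_polyb[OF _ _ N1] negl_products negl_eta pbs)
  from l[OF this] show "(\<lambda>k. eta k ^ 2 * bb k) \<longlonglongrightarrow> 0" by (simp add: power2_eq_square)
qed

lemma Psi_tends: "Cr_tends R (\<lambda>k (x :: real \<times> R3). Psi k (snd x)) (\<lambda>x. (1, 0, 1))"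
proof -
  have S0: "(\<lambda>k. 1 / S k) \<longlonglongrightarrow> 0" by (rule negl_tendsto[OF ng(8)])
  have "Cr_tends R (\<lambda>k x. (1 + (eta k * (a3 / \<xi>) * cu x + eta k * (N k * d k) * (1 / \<xi>) * cw x),
      1 / S k + eta k ^ 2 * bb k * cy x,
      1 + (eta k * c3 k * (1 / \<xi>) * cu x + eta k * (C k * d k) * (- 1 / \<xi>) * cw x)))
      (\<lambda>x. (1 + 0, 0 + 0 * cy x, 1 + 0))"
    by (rule Cr_tends_Pair[OF Cr_tends_add[OF Cr_tends_const' neglC_tends[OF Psi_dev_negl(1)]]
          Cr_tends_Pair[OF Cr_tends_add[OF Cr_tends_const[OF S0]
          Cr_tends_mult[OF Cr_tends_const[OF parameter_limits(6)] coord_tends(2)]]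
          Cr_tends_add[OF Cr_tends_const' neglC_tends[OF Psi_dev_negl(2)]]]])
  moreover have "(1 + (eta k * (a3 / \<xi>) * cu x + eta k * (N k * d k) * (1 / \<xi>) * cw x),
      1 / S k + eta k ^ 2 * bb k * cy x,
      1 + (eta k * c3 k * (1 / \<xi>) * cu x + eta k * (C k * d k) * (- 1 / \<xi>) * cw x)) = Psi k (snd x)" for k x
    using \<xi> by (simp add: Psi_def field_simps)
  ultimately show ?thesis by simp
qed

lemma vv_tends: "Cr_tends R (\<lambda>k (x :: real \<times> R3). vv k (snd x)) (\<lambda>x. (1, 0, 0))"
proof -
  have iZ: "(\<lambda>k. 1 / ZP k) \<longlonglongrightarrow> 0"
  proof (rule Lim_null_comparison[OF _ tendsto_rabs_zero[OF negl_tendsto[OF ng(7)]]])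
    show "\<forall>\<^sub>F k in sequentially. norm (1 / ZP k) \<le> \<bar>1 / SP k\<bar>"
      using SPZP nz(3,4) by (intro always_eventually allI) (simp add: frac_le)
  qed
  have 2: "Cr_tends R (\<lambda>k (x :: real \<times> R3). 1 / SP k * (1 + fst (snd (PP k (snd x))))) (\<lambda>x. 0)"
    using Cr_tends_mult[OF Cr_tends_const[OF negl_tendsto[OF ng(7)]]
        Cr_tends_add[OF Cr_tends_const'[of R 1] Cr_tends_compose_linear[OF bounded_linear_fst_comp[OF bounded_linear_snd] PP_tends]]]
    by simp
  have 3: "Cr_tends R (\<lambda>k (x :: real \<times> R3). 1 / ZP k * (1 + snd (snd (PP k (snd x))))) (\<lambda>x. 0)"
    using Cr_tends_mult[OF Cr_tends_const[OF iZ]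
        Cr_tends_add[OF Cr_tends_const'[of R 1] Cr_tends_compose_linear[OF bounded_linear_snd_comp[OF bounded_linear_snd] PP_tends]]]
    by simp
  have "vv k (snd x) = (V1 k x, 1 / SP k * (1 + fst (snd (PP k (snd x)))), 1 / ZP k * (1 + snd (snd (PP k (snd x)))))"
    for k and x :: "real \<times> R3"
    using nz(3,4)[of k] by (simp add: prod_eq_iff PP_def) (simp add: vv_def V1_def G1_def)
  then show ?thesis using Cr_tends_Pair[OF V1_tends Cr_tends_Pair[OF 2 3]] by simp
qed

end

section \<open>The number of iterates near the saddles\<close>

lemma power_times_exponential_tendsto_0:
  fixes \<theta> :: real
  assumes "0 \<le> \<theta>" "\<theta> < 1" shows "(\<lambda>n. real n ^ j * \<theta> ^ n) \<longlonglongrightarrow> 0"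
proof (cases "\<theta> = 0")
  case True
  have "\<forall>\<^sub>F n in sequentially. real n ^ j * \<theta> ^ n = 0"
    using eventually_gt_at_top[of 0] by eventually_elim (simp add: True)
  then show ?thesis by (rule tendsto_eventually)
next
  case False
  define \<tau> where "\<tau> = root (Suc j) \<theta>"
  have \<tau>: "0 \<le> \<tau>" "\<tau> < 1" "\<tau> ^ Suc j = \<theta>"
    using assms False by (auto simp: \<tau>_def real_root_pow_pos2 simp del: power_Suc)
  have "(\<lambda>n. real n * \<tau> ^ n) \<longlonglongrightarrow> 0" using \<tau> by (intro powser_times_n_limit_0) simp
  from tendsto_power[OF this, of "Suc j"] have "(\<lambda>n. (real n * \<tau> ^ n) ^ Suc j) \<longlonglongrightarrow> 0" by simp
  moreover have "(real n * \<tau> ^ n) ^ Suc j = real n ^ Suc j * \<theta> ^ n" for n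
    using \<tau>(3) by (simp only: power_mult_distrib power_mult[symmetric] mult.commute[of n "Suc j"] power_mult[of \<tau> "Suc j" n])
  ultimately have lim: "(\<lambda>n. real n ^ Suc j * \<theta> ^ n) \<longlonglongrightarrow> 0" by (simp only:)
  show ?thesis
  proof (rule Lim_null_comparison[OF _ lim])
    show "\<forall>\<^sub>F n in sequentially. norm (real n ^ j * \<theta> ^ n) \<le> real n ^ Suc j * \<theta> ^ n"
      using eventually_gt_at_top[of 0]
    proof eventually_elim
      case (elim n)
      have "real n ^ j * \<theta> ^ n \<le> real n ^ Suc j * \<theta> ^ n"
        using elim assms(1) by (intro mult_right_mono power_increasing) auto
      then show ?case using assms(1) by (simp add: abs_of_nonneg)
    qed
  qed
qed

locale exponents =
  fixes \<kappa> :: real and n m :: "nat \<Rightarrow> nat"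
  assumes \<kappa>: "\<kappa> > 0" and n1: "\<And>k. n k \<ge> 1" and ninf: "filterlim n at_top sequentially"
    and m: "\<And>k. m k = nat \<lfloor>\<kappa> * real (n k)\<rfloor>"
begin

lemma m_bounds: "real (m k) \<le> \<kappa> * real (n k)" "\<kappa> * real (n k) - 1 \<le> real (m k)"
proof -
  have "0 \<le> \<kappa> * real (n k)" using \<kappa> by simp
  then have "real (m k) = of_int \<lfloor>\<kappa> * real (n k)\<rfloor>" unfolding m by simp
  then show "real (m k) \<le> \<kappa> * real (n k)" "\<kappa> * real (n k) - 1 \<le> real (m k)" by linarith+
qed

lemma m_inf: "filterlim m at_top sequentially"
proof -
  have "filterlim (\<lambda>k. real (n k)) at_top sequentially" by (rule filterlim_compose[OF filterlim_real_sequentially ninf])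
  then have "filterlim (\<lambda>k. - 1 + \<kappa> * real (n k)) at_top sequentially"
    using \<kappa> by (intro filterlim_tendsto_add_at_top[OF tendsto_const] filterlim_tendsto_pos_mult_at_top[OF tendsto_const])
  then have "filterlim (\<lambda>k. real (m k)) at_top sequentially"
    by (rule filterlim_at_top_mono) (use m_bounds(2) in \<open>auto intro!: always_eventually simp: algebra_simps\<close>)
  then show ?thesis by (rule filterlim_sequentially_iff_filterlim_real[THEN iffD2])
qed

text \<open>Rounding \<open>\<kappa> n\<close> down costs a bounded factor only, whether the base is larger or smaller than \<open>1\<close>.\<close>

lemma power_m_le:
  fixes a :: real
  assumes a: "a > 0" shows "a ^ m k \<le> (1 + 1 / a) * (a powr \<kappa>) ^ n k"
proof -
  have e: "(a powr \<kappa>) ^ n k = a powr (\<kappa> * real (n k))" using a by (simp add: powr_powr flip: powr_realpow)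
  have m: "a ^ m k = a powr real (m k)" using a by (simp add: powr_realpow)
  have p: "0 < a powr (\<kappa> * real (n k))" using a by simp
  show ?thesis
  proof (cases "a \<ge> 1")
    case True
    have "a powr real (m k) \<le> a powr (\<kappa> * real (n k))" by (rule powr_mono[OF m_bounds(1) True])
    also have "\<dots> \<le> (1 + 1 / a) * a powr (\<kappa> * real (n k))" using p a by (simp add: distrib_right)
    finally show ?thesis unfolding e m .
  next
    case False
    have "a powr real (m k) \<le> a powr (\<kappa> * real (n k) - 1)"
      by (rule powr_mono'[OF m_bounds(2)]) (use a False in auto)
    also have "\<dots> = 1 / a * a powr (\<kappa> * real (n k))" using a by (simp add: powr_diff)
    also have "\<dots> \<le> (1 + 1 / a) * a powr (\<kappa> * real (n k))" using p by (simp add: distrib_right)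
    finally show ?thesis unfolding e m .
  qed
qed

lemma exponential_negl:
  assumes "a > 0" "b \<ge> 0" "a powr \<kappa> * b < 1"
    and f: "\<And>k. \<bar>f k\<bar> \<le> a ^ m k * b ^ n k"
  shows "negl (\<lambda>k. real (n k)) f"
proof -
  have "negl (\<lambda>k. real (n k)) (\<lambda>k. (1 + 1 / a) * (a powr \<kappa> * b) ^ n k)"
    unfolding negl_def
  proof
    fix j
    have "(\<lambda>i. real i ^ j * (a powr \<kappa> * b) ^ i) \<longlonglongrightarrow> 0"
      using assms by (intro power_times_exponential_tendsto_0) auto
    from filterlim_compose[OF this ninf]
    have "(\<lambda>k. (1 + 1 / a) * (real (n k) ^ j * (a powr \<kappa> * b) ^ n k)) \<longlonglongrightarrow> 0" by (rule tendsto_mult_right_zero)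
    then show "(\<lambda>k. real (n k) ^ j * ((1 + 1 / a) * (a powr \<kappa> * b) ^ n k)) \<longlonglongrightarrow> 0" by (simp only: mult.left_commute)
  qed
  then show ?thesis
  proof (rule negl_le)
    fix k
    have "\<bar>f k\<bar> \<le> a ^ m k * b ^ n k" by (rule f)
    also have "\<dots> \<le> (1 + 1 / a) * (a powr \<kappa>) ^ n k * b ^ n k"
      using assms by (intro mult_right_mono power_m_le) auto
    also have "\<dots> = (1 + 1 / a) * (a powr \<kappa> * b) ^ n k" by (simp only: power_mult_distrib mult.assoc)
    also have "\<dots> \<le> \<bar>\<dots>\<bar>" by (rule abs_ge_self)
    finally show "\<bar>f k\<bar> \<le> \<bar>(1 + 1 / a) * (a powr \<kappa> * b) ^ n k\<bar>" .
  qed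
qed

end

text \<open>With \<open>m\<close> the integer part of \<open>\<kappa> n\<close>, where \<open>\<kappa>\<close> is the exponent in the eigenvalue
  conditions, the product of the strongest expansion near \<open>P\<close> with the strongest contraction near
  \<open>Q\<close> stays bounded, and the eigenvalue conditions become exponential decay.\<close>

lemma renormalization_exponents:
  fixes lP sP zP l s z :: real and n :: "nat \<Rightarrow> nat"
  assumes ev: "eigenvalue_conditions lP sP zP l s z" and ev0: "lP \<noteq> 0" "l \<noteq> 0" "z \<noteq> 0"
    and n1: "\<And>k. n k \<ge> 1" and ninf: "filterlim n at_top sequentially"
    and \<kappa>: "\<kappa> = ln (inverse \<bar>l\<bar>) / ln \<bar>zP\<bar>" and m: "\<And>k. m k = nat \<lfloor>\<kappa> * real (n k)\<rfloor>"
    and c: "\<xi> > 0" "be2 \<noteq> 0" "a3 \<noteq> 0" "b3 \<noteq> 0" "c2 \<noteq> 0"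
    and H_smooth: "\<And>H. H \<in> {Ht1, Ht2, Ht3, H1, H2, H3} \<Longrightarrow>
        (\<exists>U. open U \<and> 0 \<in> U \<and> Ck_on (Suc (Suc q)) H U) \<and> H 0 = 0 \<and> (\<forall>j. frechet_derivative H (at 0) j = 0)"
    and H2_zz: "frechet_derivative (\<lambda>w. frechet_derivative H2 (at w) (0, 0, 1)) (at 0) (0, 0, 1) = 0"
  shows "filterlim m at_top sequentially"
    "renormalization q (\<lambda>k. real (n k)) (\<lambda>k. l ^ n k) (\<lambda>k. s ^ n k) (\<lambda>k. z ^ n k)
      (\<lambda>k. lP ^ m k) (\<lambda>k. sP ^ m k) (\<lambda>k. zP ^ m k) \<xi> be2 a3 b3 c2 Ht1 Ht2 Ht3 H1 H2 H3 2"
proof -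
  have ev1: "\<bar>lP\<bar> < 1" "1 < \<bar>sP\<bar>" "\<bar>sP\<bar> < \<bar>zP\<bar>" "\<bar>l\<bar> < \<bar>z\<bar>" "\<bar>z\<bar> < 1" "1 < \<bar>s\<bar>"
    and ev2: "\<bar>\<bar>sP * zP\<bar> powr \<kappa> * s * z ^ 2\<bar> < 1" "\<bar>\<bar>inverse (sP ^ 3) * zP\<bar> powr \<kappa> * inverse s\<bar> < 1"
      "\<bar>\<bar>lP * sP\<bar> powr \<kappa> * s\<bar> < 1"
    using ev unfolding eigenvalue_conditions_def Let_def \<kappa> by auto
  have z1: "\<bar>zP\<bar> > 1" and l1: "\<bar>l\<bar> < 1" using ev1 by linarith+
  have nz: "sP \<noteq> 0" "zP \<noteq> 0" "s \<noteq> 0" using ev1 z1 by auto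
  have "ln (inverse \<bar>l\<bar>) > 0" using l1 ev0 by (simp add: ln_inverse)
  then have \<kappa>0: "\<kappa> > 0" unfolding \<kappa> by (rule divide_pos_pos) (rule ln_gt_zero[OF z1])
  note \<kappa>_eq = \<kappa>
  interpret exponents \<kappa> n m by unfold_locales (use \<kappa>0 n1 ninf m in auto)
  show "filterlim m at_top sequentially" by (rule m_inf)
  have zk: "\<bar>zP\<bar> powr \<kappa> = 1 / \<bar>l\<bar>"
  proof -
    have "\<kappa> * ln \<bar>zP\<bar> = ln (inverse \<bar>l\<bar>)" using ln_gt_zero[OF z1] unfolding \<kappa>_eq by (simp del: ln_gt_zero_iff)
    then have "\<bar>zP\<bar> powr \<kappa> = exp (ln (inverse \<bar>l\<bar>))" using nz by (simp add: powr_def)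
    then show ?thesis using ev0 by (simp add: inverse_eq_divide)
  qed
  have lt1: "x powr \<kappa> < 1" if "0 < x" "x < 1" for x :: real
    using powr_less_mono2[OF \<kappa>0, of x 1] that by simp
  show "renormalization q (\<lambda>k. real (n k)) (\<lambda>k. l ^ n k) (\<lambda>k. s ^ n k) (\<lambda>k. z ^ n k)
      (\<lambda>k. lP ^ m k) (\<lambda>k. sP ^ m k) (\<lambda>k. zP ^ m k) \<xi> be2 a3 b3 c2 Ht1 Ht2 Ht3 H1 H2 H3 2"
  proof unfold_locales
    show "1 \<le> real (n k)" for k using n1[of k] by simp
    show "filterlim (\<lambda>k. real (n k)) at_top sequentially"
      by (rule filterlim_compose[OF filterlim_real_sequentially ninf])
    show "s ^ n k \<noteq> 0" "z ^ n k \<noteq> 0" "sP ^ m k \<noteq> 0" "zP ^ m k \<noteq> 0" for k using nz ev0 by auto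
    show "\<bar>sP ^ m k\<bar> \<le> \<bar>zP ^ m k\<bar>" for k
      unfolding power_abs using ev1 by (intro power_mono) auto
    show "1 \<le> \<bar>zP ^ m k\<bar>" for k unfolding power_abs using z1 by (intro one_le_power) auto
    show "\<bar>zP ^ m k * l ^ n k\<bar> \<le> 2" for k
    proof -
      have "\<bar>zP\<bar> ^ m k * \<bar>l\<bar> ^ n k \<le> (1 + 1 / \<bar>zP\<bar>) * (1 / \<bar>l\<bar>) ^ n k * \<bar>l\<bar> ^ n k"
        using power_m_le[of "\<bar>zP\<bar>" k] nz unfolding zk by (intro mult_right_mono) auto
      also have "\<dots> = 1 + 1 / \<bar>zP\<bar>" using ev0 by (simp add: power_divide)
      also have "\<dots> \<le> 2" using z1 by simp
      finally show ?thesis by (simp add: abs_mult power_abs)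
    qed
    let ?N = "\<lambda>k. real (n k)"
    show "negl ?N (\<lambda>k. zP ^ m k * sP ^ m k * s ^ n k * (z ^ n k)\<^sup>2)"
    proof (rule exponential_negl[of "\<bar>sP * zP\<bar>" "\<bar>s\<bar> * z ^ 2"])
      show "\<bar>sP * zP\<bar> powr \<kappa> * (\<bar>s\<bar> * z ^ 2) < 1" using ev2(1) by (simp add: abs_mult mult.assoc)
      show "\<bar>zP ^ m k * sP ^ m k * s ^ n k * (z ^ n k)\<^sup>2\<bar> \<le> \<bar>sP * zP\<bar> ^ m k * (\<bar>s\<bar> * z ^ 2) ^ n k" for k
      proof -
        have "(z ^ n k)\<^sup>2 = (z\<^sup>2) ^ n k" by (simp add: mult.commute flip: power_mult)
        then show ?thesis by (simp add: abs_mult power_mult_distrib power_abs mult_ac)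
      qed
    qed (use nz in auto)
    show "negl ?N (\<lambda>k. zP ^ m k / ((sP ^ m k) ^ 3 * s ^ n k))"
    proof (rule exponential_negl[of "\<bar>inverse (sP ^ 3) * zP\<bar>" "\<bar>inverse s\<bar>"])
      show "\<bar>inverse (sP ^ 3) * zP\<bar> powr \<kappa> * \<bar>inverse s\<bar> < 1" using ev2(2) by (simp add: abs_mult)
      show "\<bar>zP ^ m k / ((sP ^ m k) ^ 3 * s ^ n k)\<bar> \<le> \<bar>inverse (sP ^ 3) * zP\<bar> ^ m k * \<bar>inverse s\<bar> ^ n k" for k
        by (simp add: abs_mult power_mult_distrib power_abs power_inverse divide_inverse flip: power_mult) (simp add: mult_ac)
    qed (use nz in auto)
    show "negl ?N (\<lambda>k. lP ^ m k * sP ^ m k * s ^ n k)"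
    proof (rule exponential_negl[of "\<bar>lP * sP\<bar>" "\<bar>s\<bar>"])
      show "\<bar>lP * sP\<bar> powr \<kappa> * \<bar>s\<bar> < 1" using ev2(3) by (simp add: abs_mult)
    qed (use nz ev0 in \<open>auto simp: abs_mult power_mult_distrib power_abs\<close>)
    show "negl ?N (\<lambda>k. sP ^ m k * l ^ n k)"
    proof (rule exponential_negl[of "\<bar>sP\<bar>" "\<bar>l\<bar>"])
      have "\<bar>sP\<bar> powr \<kappa> * \<bar>l\<bar> < \<bar>zP\<bar> powr \<kappa> * \<bar>l\<bar>"
        using ev1 ev0 by (intro mult_strict_right_mono powr_less_mono2 \<kappa>0) auto
      then show "\<bar>sP\<bar> powr \<kappa> * \<bar>l\<bar> < 1" unfolding zk using ev0 by simp
    qed (use nz in \<open>auto simp: abs_mult power_abs\<close>)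
    show "negl ?N (\<lambda>k. l ^ n k / z ^ n k)"
      by (rule exponential_negl[of 1 "\<bar>l / z\<bar>"]) (use ev1 ev0 in \<open>auto simp: power_abs power_divide\<close>)
    show "negl ?N (\<lambda>k. z ^ n k)"
      by (rule exponential_negl[of 1 "\<bar>z\<bar>"]) (use ev1 in \<open>auto simp: power_abs\<close>)
    show "negl ?N (\<lambda>k. 1 / sP ^ m k)"
      by (rule exponential_negl[of "1 / \<bar>sP\<bar>" 1]) (use ev1 nz in \<open>auto simp: power_abs power_divide intro!: lt1\<close>)
    show "negl ?N (\<lambda>k. 1 / s ^ n k)"
      by (rule exponential_negl[of 1 "1 / \<bar>s\<bar>"]) (use ev1 nz in \<open>auto simp: power_abs power_divide\<close>)
    show "negl ?N (\<lambda>k. sP ^ m k / zP ^ m k)"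
      by (rule exponential_negl[of "\<bar>sP\<bar> / \<bar>zP\<bar>" 1]) (use ev1 nz in \<open>auto simp: power_abs power_divide intro!: lt1\<close>)
    show "negl ?N (\<lambda>k. lP ^ m k)"
      by (rule exponential_negl[of "\<bar>lP\<bar>" 1]) (use ev1 ev0 in \<open>auto simp: power_abs intro!: lt1\<close>)
    show "negl ?N (\<lambda>k. 1 / (zP ^ m k * z ^ n k))"
    proof (rule exponential_negl[of "1 / \<bar>zP\<bar>" "1 / \<bar>z\<bar>"])
      have "(1 / \<bar>zP\<bar>) powr \<kappa> = \<bar>l\<bar>" using zk nz ev0 by (simp add: powr_divide)
      then show "(1 / \<bar>zP\<bar>) powr \<kappa> * (1 / \<bar>z\<bar>) < 1" using ev1 ev0 by simp
    qed (use nz in \<open>auto simp: abs_mult power_abs power_divide\<close>)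
  qed (use c H_smooth H2_zz in auto)
qed

section \<open>The renormalization theorem\<close>

text \<open>Only the first order of a remainder is prescribed; it is smooth as the difference of two smooth maps.\<close>

lemma remainder_smooth:
  fixes H :: "R3 \<Rightarrow> real"
  assumes "Ck_at r g 0" "\<forall>\<^sub>F p in nhds 0. g p = L p + H p" "Ck_at r L 0" "vanishes_to_first_order H"
  shows "(\<exists>U. open U \<and> 0 \<in> U \<and> Ck_on r H U) \<and> H 0 = 0 \<and> (\<forall>j. frechet_derivative H (at 0) j = 0)"
proof -
  have "Ck_at r (\<lambda>p. g p - L p) 0" by (rule Ck_at_diff[OF assms(1,3)])
  then have "Ck_at r H 0" by (rule Ck_at_cong) (use assms(2) in \<open>eventually_elim, simp\<close>)
  moreover have "frechet_derivative H (at 0) = (\<lambda>_. 0)"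
    using assms(4) unfolding vanishes_to_first_order_def by (intro frechet_derivative_eqI) simp
  ultimately show ?thesis using assms(4) by (simp add: Ck_at_def vanishes_to_first_order_def)
qed

lemma Ck_at_linear_part: "Ck_at r (\<lambda>p :: R3. a + b * fst p + c * fst (snd p) + d * snd (snd p)) x"
  by (intro Ck_at_add Ck_at_mult Ck_at_const Ck_at_bounded_linear bounded_linear_fst
      bounded_linear_fst_comp bounded_linear_snd_comp bounded_linear_ident)

text \<open>Smoothness and non-degeneracy of a transition map, read off from its expansion.\<close>

lemma transition_map:
  fixes \<A> :: "'m::t2_space chart set" and g :: "'m \<Rightarrow> 'm" and T :: "R3 \<Rightarrow> R3"
  assumes M: "closed_3_manifold \<A>" and g: "g \<in> Diff r \<A>" and r: "r \<ge> 1"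
    and c: "Cr_chart r \<A> c" "x \<in> fst c" and d: "Cr_chart r \<A> d" "g x \<in> fst d"
    and T: "\<forall>\<^sub>F p in nhds 0. snd d (g (chart_inv c (snd c x + p))) = T p"
  shows "Ck_at r T 0" "(T has_derivative A) (at 0) \<Longrightarrow> inj A"
proof -
  let ?G = "\<lambda>u. snd d (g (chart_inv c u))"
  have "Ck_at r ?G (snd c x)"
    by (rule Cr_map_chart_expression[where f=g, OF M _ c(1) d(1) c(2) d(2)]) (use g in \<open>simp add: Diff_def\<close>)
  then have "Ck_at r (\<lambda>p. ?G (snd c x + p)) 0"
    by (intro Ck_at_compose[where f="\<lambda>p. snd c x + p" and g="?G"] Ck_at_add Ck_at_const Ck_at_ident) simp
  then show "Ck_at r T 0" by (rule Ck_at_cong[OF _ T])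
  assume D: "(T has_derivative A) (at 0)"
  obtain V where V: "open V" "0 \<in> V" "\<And>p. p \<in> V \<Longrightarrow> ?G (snd c x + p) = T p"
    using T unfolding eventually_nhds by blast
  have "((\<lambda>p. ?G (snd c x + p)) has_derivative A) (at 0)"
    by (rule has_derivative_transform_within_open[OF D V(1,2)]) (use V(3) in auto)
  moreover have "((\<lambda>u. u - snd c x) has_derivative (\<lambda>h. h)) (at (snd c x))"
    by (auto intro!: derivative_eq_intros)
  ultimately have "((\<lambda>u. ?G (snd c x + (u - snd c x))) has_derivative (\<lambda>h. A h)) (at (snd c x))"
    by (intro has_derivative_compose[where g="\<lambda>p. ?G (snd c x + p)" and f="\<lambda>u. u - snd c x"]) auto
  then have "(?G has_derivative A) (at (snd c x))" by simp
  then show "inj A" by (rule Diff_derivative_inj[OF M g r c d])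
qed

lemma has_derivative_first_order:
  assumes "vanishes_to_first_order H"
  shows "((\<lambda>p :: R3. a + b * fst p + c * fst (snd p) + d * snd (snd p) + H p) has_derivative
    (\<lambda>h. b * fst h + c * fst (snd h) + d * snd (snd h))) (at 0)"
proof -
  have H: "(H has_derivative (\<lambda>_. 0)) (at 0)" using assms by (simp add: vanishes_to_first_order_def)
  have "((\<lambda>p :: R3. a + b * fst p + c * fst (snd p) + d * snd (snd p)) has_derivative
    (\<lambda>h. b * fst h + c * fst (snd h) + d * snd (snd h))) (at 0)"
    by (auto intro!: derivative_eq_intros)
  from has_derivative_add[OF this H] show ?thesis by simp
qed

lemma Cr_converges_onI:
  assumes F: "Cr_tends r F \<Phi>" and eq: "\<forall>\<^sub>F k in sequentially. \<forall>x\<in>ball 0 \<rho>. F k x = G k x" and C: "C \<subseteq> ball 0 \<rho>"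
  shows "Cr_converges_on r G \<Phi> C"
  unfolding Cr_converges_on_def
proof (intro conjI allI impI)
  show "\<forall>\<^sub>F k in sequentially. \<exists>U. open U \<and> C \<subseteq> U \<and> Ck_on r (G k) U"
    using Cr_tends_imp_Ck_on[OF F, of \<rho>] eq
  proof eventually_elim
    case (elim k)
    have "Ck_on r (G k) (ball 0 \<rho>)" by (rule Ck_on_cong[OF open_ball _ elim(1)]) (use elim(2) in blast)
    then show ?case using C by blast
  qed
  fix vs :: "'a list" assume vs: "set vs \<subseteq> Basis \<and> length vs \<le> r"
  have "uniform_limit C (\<lambda>k. partials vs (F k)) (partials vs \<Phi>) sequentially"
    using Cr_tends_partials[OF F] vs C uniform_limit_on_subset by blast
  moreover have "\<forall>\<^sub>F k in sequentially. \<forall>x\<in>C. partials vs (F k) x = partials vs (G k) x"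
    using eq
  proof eventually_elim
    case (elim k)
    show ?case using partials_cong_open[OF open_ball, of 0 \<rho> "F k" "G k"] elim C by blast
  qed
  ultimately show "uniform_limit C (\<lambda>k. partials vs (G k)) (partials vs \<Phi>) sequentially"
    using uniform_limit_cong[of C "\<lambda>k. partials vs (F k)" "\<lambda>k. partials vs (G k)" sequentially "partials vs \<Phi>" "partials vs \<Phi>"]
    by auto
qed

lemma Cr_tends_eventually_dist:
  assumes "Cr_tends r F f" "\<epsilon> > 0"
  shows "\<forall>\<^sub>F k in sequentially. \<forall>x\<in>ball 0 \<rho>. dist (F k x) (f x) < \<epsilon>"
  by (rule uniform_limitD[OF loc_unif_limit[OF Cr_tends_loc_unif[OF assms(1)]] assms(2)])

lemma bounded_subset_ball: 
  fixes S :: "'a::real_normed_vector set" assumes "bounded S" obtains \<rho> where "\<rho> > 0" "S \<subseteq> ball 0 \<rho>"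
proof -
  obtain B where B: "B > 0" "\<And>x. x \<in> S \<Longrightarrow> norm x \<le> B" using assms by (auto simp: bounded_pos)
  have "norm x < B + 1" if "x \<in> S" for x using B(2)[OF that] by linarith
  then have "S \<subseteq> ball 0 (B + 1)" by auto
  then show ?thesis using that[of "B + 1"] B(1) by simp
qed

lemma norm_parameter_le:
  fixes a b c d e g :: real
  shows "norm ((a, b, c), (d, e, g)) \<le> \<bar>a\<bar> + \<bar>b\<bar> + \<bar>c\<bar> + \<bar>d\<bar> + \<bar>e\<bar> + \<bar>g\<bar>"
  using norm_Pair_le[of "(a, b, c)" "(d, e, g)"] norm_R3_le[of "(a, b, c)"] norm_R3_le[of "(d, e, g)"] by simp

lemma Cr_diffeo_id: "Cr_diffeo r (\<lambda>x. x)"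
proof -
  have "inv (\<lambda>x :: 'a. x) = (\<lambda>x. x)" using inv_id[where 'a='a] by (simp only: id_def)
  then show ?thesis unfolding Cr_diffeo_def using bij_id by (simp add: id_def)
qed

theorem theorem1p2:
  fixes \<A> :: "'m::t2_space chart set"
    and f :: "'m \<Rightarrow> 'm"
    and P Q X Y :: 'm
    and r N\<^sub>1 N\<^sub>2 :: nat
    and cP cQ :: "'m chart"
    and lP sP zP l s z :: real
    and \<alpha>\<^sub>1 \<alpha>\<^sub>2 \<alpha>\<^sub>3 \<beta>\<^sub>1 \<beta>\<^sub>2 \<beta>\<^sub>3 \<gamma>\<^sub>1 \<gamma>\<^sub>2 \<gamma>\<^sub>3 :: real
    and a\<^sub>1 a\<^sub>2 a\<^sub>3 b\<^sub>1 b\<^sub>2 b\<^sub>3 b\<^sub>4 c\<^sub>1 c\<^sub>2 c\<^sub>3 :: real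
    and Ht\<^sub>1 Ht\<^sub>2 Ht\<^sub>3 H\<^sub>1 H\<^sub>2 H\<^sub>3 :: "R3 \<Rightarrow> real"
  assumes manifold: "closed_3_manifold \<A>"
    and r: "r \<ge> 2"
    and f: "f \<in> Diff r \<A>"
    and cycle: "nontransverse_heterodimensional_cycle \<A> f P Q X Y"
    \<comment> \<open>eigenvalues\<close>
    and "real_eigenvalues (period_deriv \<A> f P) = {lP, sP, zP}"
    and "real_eigenvalues (period_deriv \<A> f Q) = {l, s, z}"
    \<comment> \<open>(Lin)\<close>
    and "linearizing_chart r \<A> f P cP lP sP zP"
    and "linearizing_chart r \<A> f Q cQ l s z"
    \<comment> \<open>(Eig)\<close>
    and "eigenvalue_conditions lP sP zP l s z"
    \<comment> \<open>(Tr)\<close>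
    and "N\<^sub>1 > 0" and "N\<^sub>2 > 0"
    and "X \<in> local_unstable_manifold f Q (fst cQ)" and "snd cQ X = (0, 1, 0)"
    and "(f ^^ N\<^sub>1) X \<in> local_stable_manifold f P (fst cP)" and "snd cP ((f ^^ N\<^sub>1) X) = (1, 0, 0)"
    and "Y \<in> local_unstable_manifold f P (fst cP)" and "snd cP Y = (0, 1, 1)"
    and "(f ^^ N\<^sub>2) Y \<in> local_stable_manifold f Q (fst cQ)" and "snd cQ ((f ^^ N\<^sub>2) Y) = (1, 0, 1)"
    and "\<forall>\<^sub>F (x, y, z) in nhds 0.
      snd cP ((f ^^ N\<^sub>1) (chart_inv cQ (x, 1 + y, z))) =
        (1 + \<alpha>\<^sub>1 * x + \<alpha>\<^sub>2 * y + \<alpha>\<^sub>3 * z + Ht\<^sub>1 (x, y, z),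
         \<beta>\<^sub>1 * x + \<beta>\<^sub>2 * y + \<beta>\<^sub>3 * z + Ht\<^sub>2 (x, y, z),
         \<gamma>\<^sub>1 * x + \<gamma>\<^sub>2 * y + \<gamma>\<^sub>3 * z + Ht\<^sub>3 (x, y, z))"
    and "\<forall>\<^sub>F (x, y, z) in nhds 0.
      snd cQ ((f ^^ N\<^sub>2) (chart_inv cP (x, 1 + y, 1 + z))) =
        (1 + a\<^sub>1 * x + a\<^sub>2 * y + a\<^sub>3 * z + H\<^sub>1 (x, y, z),
         b\<^sub>1 * x + b\<^sub>2 * y ^ 2 + b\<^sub>3 * z ^ 2 + b\<^sub>4 * y * z + H\<^sub>2 (x, y, z),
         1 + c\<^sub>1 * x + c\<^sub>2 * y + c\<^sub>3 * z + H\<^sub>3 (x, y, z))"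
    and "\<forall>H\<in>{Ht\<^sub>1, Ht\<^sub>2, Ht\<^sub>3, H\<^sub>1, H\<^sub>2, H\<^sub>3}. vanishes_to_first_order H"
    and "\<beta>\<^sub>3 = 0" and "\<gamma>\<^sub>2 = 0" and "\<gamma>\<^sub>3 = 0"
    and "partials [(0, 1, 0), (0, 1, 0)] H\<^sub>2 0 = 0"
    and "partials [(0, 0, 1), (0, 0, 1)] H\<^sub>2 0 = 0"
    and "partials [(0, 1, 0), (0, 0, 1)] H\<^sub>2 0 = 0"
    and "c\<^sub>3 = 0" and "b\<^sub>2 * b\<^sub>3 \<noteq> 0" and "\<gamma>\<^sub>1 * a\<^sub>3 > 0"
  shows "\<exists>\<kappa>\<^sub>1 \<kappa>\<^sub>2 :: real. \<exists>\<epsilon> > 0. \<exists>fam :: R3 \<times> R3 \<Rightarrow> 'm \<Rightarrow> 'm.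
    (let B = cbox (-\<epsilon>, -\<epsilon>, -\<epsilon>) (\<epsilon>, \<epsilon>, \<epsilon>) in
      (\<forall>p \<in> B \<times> B. fam p \<in> Diff r \<A>) \<and>
      (\<exists>W. open W \<and> B \<times> B \<subseteq> W \<and> Cr_family r \<A> W fam) \<and>
      fam (0, 0) = f \<and>
      (\<forall>\<xi> > 0.
        \<exists>(\<Psi> :: nat \<Rightarrow> R3 \<Rightarrow> 'm) (\<mu> :: nat \<Rightarrow> real \<Rightarrow> R3) (\<nu> :: nat \<Rightarrow> R3) (m :: nat \<Rightarrow> nat) (n :: nat \<Rightarrow> nat).
          filterlim m at_top sequentially \<and> filterlim n at_top sequentially \<and>
          (\<forall>K. compact K \<and> 0 \<in> interior K \<longrightarrow>
            (\<forall>\<^sub>F k in sequentially. \<exists>\<Omega>. K \<subseteq> \<Omega> \<and> Cr_parametrization r \<A> (\<Psi> k) \<Omega>)) \<and>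
          (\<forall>I. compact I \<and> 0 \<in> interior I \<longrightarrow>
            (\<forall>\<^sub>F k in sequentially.
               (\<exists>J. open J \<and> I \<subseteq> J \<and> Ck_on r (\<mu> k) J) \<and> \<mu> k ` I \<subseteq> B \<and> \<nu> k \<in> B)) \<and>
          \<comment> \<open>(1)\<close>
          (\<forall>I L. compact I \<and> compact L \<longrightarrow>
            uniform_limit I \<mu> (\<lambda>_. 0) sequentially \<and> \<nu> \<longlonglongrightarrow> 0 \<and>
            (\<forall>V. open V \<and> (f ^^ N\<^sub>2) Y \<in> V \<longrightarrow> (\<forall>\<^sub>F k in sequentially. \<Psi> k ` L \<subseteq> V))) \<and>
          \<comment> \<open>(2)\<close>
          (\<exists>\<Phi> :: real \<times> R3 \<Rightarrow> R3. conjugate_families r \<Phi> (G_family \<xi> \<kappa>\<^sub>1 \<kappa>\<^sub>2) \<and>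
            (\<forall>I L. compact I \<and> compact L \<longrightarrow>
              (\<exists>K\<^sub>0. compact K\<^sub>0 \<and> (\<forall>K. compact K \<and> K\<^sub>0 \<subseteq> K \<longrightarrow>
                (\<forall>\<^sub>F k in sequentially. \<exists>U. open U \<and> I \<times> L \<subseteq> U \<and>
                   (\<forall>(\<mu>', x) \<in> U. x \<in> K \<and>
                      (fam (\<mu> k \<mu>', \<nu> k) ^^ (N\<^sub>2 + m k + N\<^sub>1 + n k)) (\<Psi> k x) \<in> \<Psi> k ` K)) \<and>
                Cr_converges_on r
                  (\<lambda>k. renormalized fam K (\<Psi> k) (\<mu> k) (\<nu> k) (N\<^sub>2 + m k + N\<^sub>1 + n k))
                  \<Phi> (I \<times> L)))))))"
proof -
  let ?p1 = "(f ^^ N\<^sub>1) X" and ?p2 = "(f ^^ N\<^sub>2) Y"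
  note lin = assms(7,8) and eig = assms(9) and N = assms(10,11) and X = assms(12,13) and p1 = assms(14,15)
    and Y = assms(16,17) and p2 = assms(18,19) and T1 = assms(20) and T2 = assms(21) and van = assms(22)
    and zero = assms(23-25) and H2zz = assms(27) and c3 = assms(29) and bnz = assms(30) and gnz = assms(31)
  have per: "periodic_point f P" "periodic_point f Q"
    using cycle by (auto simp: nontransverse_heterodimensional_cycle_def)
  have ev: "\<bar>lP\<bar> < 1" "1 < \<bar>sP\<bar>" "\<bar>sP\<bar> < \<bar>zP\<bar>" "\<bar>l\<bar> < \<bar>z\<bar>" "\<bar>z\<bar> < 1" "1 < \<bar>s\<bar>"
    using eig unfolding eigenvalue_conditions_def Let_def by auto
  have ev': "1 < \<bar>zP\<bar>" "\<bar>l\<bar> < 1" using ev by linarith+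
  interpret saddle_cycle \<A> f P Q X Y r N\<^sub>1 N\<^sub>2 cP cQ lP sP zP l s z
    by unfold_locales (fact manifold r f per lin ev ev' N X p1 Y p2)+
  have r1: "r \<ge> 1" using r by simp
  obtain q where q: "r = Suc (Suc q)" using r by (metis add_2_eq_Suc le_Suc_ex)

  define T1f where "T1f = (\<lambda>p :: R3. (1 + \<alpha>\<^sub>1 * fst p + \<alpha>\<^sub>2 * fst (snd p) + \<alpha>\<^sub>3 * snd (snd p) + Ht\<^sub>1 p,
      0 + \<beta>\<^sub>1 * fst p + \<beta>\<^sub>2 * fst (snd p) + 0 * snd (snd p) + Ht\<^sub>2 p,
      0 + \<gamma>\<^sub>1 * fst p + 0 * fst (snd p) + 0 * snd (snd p) + Ht\<^sub>3 p))"
  define T2f where "T2f = (\<lambda>p :: R3. (1 + a\<^sub>1 * fst p + a\<^sub>2 * fst (snd p) + a\<^sub>3 * snd (snd p) + H\<^sub>1 p,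
      b\<^sub>1 * fst p + b\<^sub>2 * fst (snd p) ^ 2 + b\<^sub>3 * snd (snd p) ^ 2 + b\<^sub>4 * fst (snd p) * snd (snd p) + H\<^sub>2 p,
      1 + c\<^sub>1 * fst p + c\<^sub>2 * fst (snd p) + 0 * snd (snd p) + H\<^sub>3 p))"
  have sh: "(0, 1, 0) + p = (fst p, 1 + fst (snd p), snd (snd p))"
    "(0, 1, 1) + p = (fst p, 1 + fst (snd p), 1 + snd (snd p))" for p :: R3
    by (simp_all add: prod_eq_iff)
  have T1e: "\<forall>\<^sub>F p in nhds 0. snd cP ((f ^^ N\<^sub>1) (chart_inv cQ (snd cQ X + p))) = T1f p"
    using T1 by eventually_elim (simp add: T1f_def X(2) zero split_beta sh)
  have T2e: "\<forall>\<^sub>F p in nhds 0. snd cQ ((f ^^ N\<^sub>2) (chart_inv cP (snd cP Y + p))) = T2f p"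
    using T2 by eventually_elim (simp add: T2f_def Y(2) c3 split_beta sh)
  note tr1 = transition_map[OF manifold funpow_in_Diff[OF manifold f] r1 charts(2) in_charts(4) charts(1) in_charts(1) T1e]
  note tr2 = transition_map[OF manifold funpow_in_Diff[OF manifold f] r1 charts(1) in_charts(2) charts(2) in_charts(3) T2e]
  have v: "vanishes_to_first_order Ht\<^sub>1" "vanishes_to_first_order Ht\<^sub>2" "vanishes_to_first_order Ht\<^sub>3"
    "vanishes_to_first_order H\<^sub>1" "vanishes_to_first_order H\<^sub>2" "vanishes_to_first_order H\<^sub>3"
    using van by auto
  have quad: "((\<lambda>p :: R3. b\<^sub>1 * fst p + b\<^sub>2 * fst (snd p) ^ 2 + b\<^sub>3 * snd (snd p) ^ 2 + b\<^sub>4 * fst (snd p) * snd (snd p))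
      has_derivative (\<lambda>h. b\<^sub>1 * fst h)) (at 0)"
    by (auto intro!: derivative_eq_intros)
  have d1: "(T1f has_derivative (\<lambda>h. (\<alpha>\<^sub>1 * fst h + \<alpha>\<^sub>2 * fst (snd h) + \<alpha>\<^sub>3 * snd (snd h),
      \<beta>\<^sub>1 * fst h + \<beta>\<^sub>2 * fst (snd h) + 0 * snd (snd h), \<gamma>\<^sub>1 * fst h + 0 * fst (snd h) + 0 * snd (snd h)))) (at 0)"
    unfolding T1f_def by (rule has_derivative_Pair[OF has_derivative_first_order[OF v(1)]
          has_derivative_Pair[OF has_derivative_first_order[OF v(2)] has_derivative_first_order[OF v(3)]]])
  have q2: "((\<lambda>p. b\<^sub>1 * fst p + b\<^sub>2 * fst (snd p) ^ 2 + b\<^sub>3 * snd (snd p) ^ 2 + b\<^sub>4 * fst (snd p) * snd (snd p) + H\<^sub>2 p)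
      has_derivative (\<lambda>h. b\<^sub>1 * fst h)) (at 0)"
    using has_derivative_add[OF quad v(5)[unfolded vanishes_to_first_order_def, THEN conjunct2]] by simp
  have d2: "(T2f has_derivative (\<lambda>h. (a\<^sub>1 * fst h + a\<^sub>2 * fst (snd h) + a\<^sub>3 * snd (snd h),
      b\<^sub>1 * fst h, c\<^sub>1 * fst h + c\<^sub>2 * fst (snd h) + 0 * snd (snd h)))) (at 0)"
    unfolding T2f_def by (rule has_derivative_Pair[OF has_derivative_first_order[OF v(4)]
          has_derivative_Pair[OF q2 has_derivative_first_order[OF v(6)]]])
  have a3: "a\<^sub>3 \<noteq> 0" and b3: "b\<^sub>3 \<noteq> 0" using gnz bnz by auto
  \<comment> \<open>If \<open>c\<^sub>2\<close> or \<open>\<beta>\<^sub>2\<close> were zero, the derivative of the crossing would have a kernel.\<close>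
  have c2: "c\<^sub>2 \<noteq> 0"
  proof
    assume "c\<^sub>2 = 0"
    then have "(0, a\<^sub>3, - a\<^sub>2) = (0 :: R3)"
      by - (rule injD[OF tr2(2)[OF d2]], simp add: zero_prod_def)
    then show False using a3 by (simp add: zero_prod_def)
  qed
  have be2: "\<beta>\<^sub>2 \<noteq> 0"
  proof
    assume b: "\<beta>\<^sub>2 = 0"
    then have "(0, \<alpha>\<^sub>3, - \<alpha>\<^sub>2) = (0 :: R3)"
      by - (rule injD[OF tr1(2)[OF d1]], simp add: zero_prod_def)
    then have "\<alpha>\<^sub>2 = 0" by (simp add: zero_prod_def)
    then have "(0, 1, 0) = (0 :: R3)" using b
      by - (rule injD[OF tr1(2)[OF d1]], simp add: zero_prod_def)
    then show False by (simp add: zero_prod_def)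
  qed
  have smooth: "(\<exists>U. open U \<and> 0 \<in> U \<and> Ck_on (Suc (Suc q)) H U) \<and> H 0 = 0 \<and> (\<forall>j. frechet_derivative H (at 0) j = 0)"
    if "H \<in> {Ht\<^sub>1, Ht\<^sub>2, Ht\<^sub>3, H\<^sub>1, H\<^sub>2, H\<^sub>3}" for H
  proof -
    note t1 = tr1(1)[unfolded q] and t2 = tr2(1)[unfolded q]
    have quadC: "Ck_at k (\<lambda>p :: R3. b\<^sub>1 * fst p + b\<^sub>2 * fst (snd p) ^ 2 + b\<^sub>3 * snd (snd p) ^ 2 + b\<^sub>4 * fst (snd p) * snd (snd p)) 0" for k
      by (intro Ck_at_add Ck_at_mult Ck_at_const Ck_at_power Ck_at_bounded_linear bounded_linear_fst
          bounded_linear_fst_comp bounded_linear_snd_comp bounded_linear_ident)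
    have e: "\<forall>\<^sub>F p in nhds (0 :: R3). g p = g p" for g :: "R3 \<Rightarrow> real" by simp
    have s1: "(\<exists>U. open U \<and> 0 \<in> U \<and> Ck_on (Suc (Suc q)) H U) \<and> H 0 = 0 \<and> (\<forall>j. frechet_derivative H (at 0) j = 0)"
      if "Ck_at (Suc (Suc q)) (\<lambda>p. a + b * fst p + c * fst (snd p) + d * snd (snd p) + H p) 0" "vanishes_to_first_order H"
      for a b c d and H :: "R3 \<Rightarrow> real"
      by (rule remainder_smooth[OF that(1) e Ck_at_linear_part that(2)])
    have s2: "(\<exists>U. open U \<and> 0 \<in> U \<and> Ck_on (Suc (Suc q)) H\<^sub>2 U) \<and> H\<^sub>2 0 = 0 \<and> (\<forall>j. frechet_derivative H\<^sub>2 (at 0) j = 0)"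
      by (rule remainder_smooth[OF _ e quadC v(5)]) (use Ck_at_fst[OF Ck_at_snd[OF t2]] in \<open>simp add: T2f_def\<close>)
    have k: "Ck_at (Suc (Suc q)) (\<lambda>p. fst (T1f p)) 0" "Ck_at (Suc (Suc q)) (\<lambda>p. fst (snd (T1f p))) 0"
      "Ck_at (Suc (Suc q)) (\<lambda>p. snd (snd (T1f p))) 0" "Ck_at (Suc (Suc q)) (\<lambda>p. fst (T2f p)) 0"
      "Ck_at (Suc (Suc q)) (\<lambda>p. snd (snd (T2f p))) 0"
      by (rule Ck_at_fst[OF t1], rule Ck_at_fst[OF Ck_at_snd[OF t1]], rule Ck_at_snd[OF Ck_at_snd[OF t1]],
          rule Ck_at_fst[OF t2], rule Ck_at_snd[OF Ck_at_snd[OF t2]])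
    note k' = k[unfolded T1f_def T2f_def fst_conv snd_conv]
    from that consider "H = Ht\<^sub>1" | "H = Ht\<^sub>2" | "H = Ht\<^sub>3" | "H = H\<^sub>1" | "H = H\<^sub>2" | "H = H\<^sub>3" by blast
    then show ?thesis
      by cases (simp_all only: simp_thms s1[OF k'(1) v(1)] s1[OF k'(2) v(2)] s1[OF k'(3) v(3)] s1[OF k'(4) v(4)] s2 s1[OF k'(5) v(6)])
  qed
  have H2_zz: "frechet_derivative (\<lambda>w. frechet_derivative H\<^sub>2 (at w) (0, 0, 1)) (at 0) (0, 0, 1) = 0"
    using H2zz by simp
  have ev0: "lP \<noteq> 0" "l \<noteq> 0" "z \<noteq> 0"
    using eigenvalue_nonzero[OF linP perP] eigenvalue_nonzero[OF linQ perQ] by auto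

  define g1 where "g1 = (\<lambda>p :: R3. (\<alpha>\<^sub>1 * fst p + \<alpha>\<^sub>2 * fst (snd p) + \<alpha>\<^sub>3 * snd (snd p) + Ht\<^sub>1 p,
     \<beta>\<^sub>1 * fst p + \<beta>\<^sub>2 * fst (snd p) + Ht\<^sub>2 p, \<gamma>\<^sub>1 * fst p + Ht\<^sub>3 p))"
  define g2 where "g2 = (\<lambda>p :: R3. (a\<^sub>1 * fst p + a\<^sub>2 * fst (snd p) + a\<^sub>3 * snd (snd p) + H\<^sub>1 p,
     b\<^sub>1 * fst p + b\<^sub>2 * fst (snd p) ^ 2 + b\<^sub>3 * snd (snd p) ^ 2 + b\<^sub>4 * fst (snd p) * snd (snd p) + H\<^sub>2 p,
     c\<^sub>1 * fst p + c\<^sub>2 * fst (snd p) + H\<^sub>3 p))"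
  have T1g: "\<forall>\<^sub>F p in nhds 0. snd cP ((f ^^ N\<^sub>1) (chart_inv cQ ((0, 1, 0) + p))) = (1, 0, 0) + g1 p"
  proof -
    have "T1f p = (1, 0, 0) + g1 p" for p by (simp add: T1f_def g1_def)
    then show ?thesis using T1e unfolding X(2) by simp
  qed
  have T2g: "\<forall>\<^sub>F p in nhds 0. snd cQ ((f ^^ N\<^sub>2) (chart_inv cP ((0, 1, 1) + p))) = (1, 0, 1) + g2 p"
  proof -
    have "T2f p = (1, 0, 1) + g2 p" for p by (simp add: T2f_def g2_def)
    then show ?thesis using T2e unfolding Y(2) by simp
  qed
  obtain fam :: "R3 \<times> R3 \<Rightarrow> 'm \<Rightarrow> 'm" and \<delta> n0 where \<delta>: "\<delta> > 0"
    and famD: "\<And>p. p \<in> ball 0 \<delta> \<Longrightarrow> fam p \<in> Diff r \<A>"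
    and famS: "\<And>p x. p \<in> ball 0 \<delta> \<Longrightarrow> smooth_family_at r \<A> fam p x" and fam0: "fam 0 = f"
    and orb: "\<And>c mu nY nZ ng ne m n w v u. m \<ge> n0 \<Longrightarrow> n \<ge> n0 \<Longrightarrow> ((c, mu, nY), (nZ, ng, ne)) \<in> ball 0 \<delta> \<Longrightarrow>
       dist w (1, 0, 1) < \<delta> \<Longrightarrow> dist (diag3 l s z n w) (0, 1, 0) < \<delta> \<Longrightarrow>
       v = (1, 0, 0) + g1 (diag3 l s z n w - (0, 1, 0))
         + (0, nY, nZ + ng * (z ^ n * snd (snd w)) + ne * (s ^ n * fst (snd w) - 1)) \<Longrightarrow>
       dist v (1, 0, 0) < \<delta> \<Longrightarrow> dist (diag3 lP sP zP m v) (0, 1, 1) < \<delta> \<Longrightarrow>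
       u = (1, 0, 1) + g2 (diag3 lP sP zP m v - (0, 1, 1)) + (0, mu, c * (zP ^ m * snd (snd v) - 1)) \<Longrightarrow>
       (fam ((c, mu, nY), (nZ, ng, ne)) ^^ (N\<^sub>2 + pP * m + N\<^sub>1 + pQ * n)) (chart_inv cQ w) = chart_inv cQ u \<and>
       u \<in> snd cQ ` fst cQ"
    by (rule unfolding_family[OF T1g T2g]) (rule that; assumption)
  \<comment> \<open>A point of the cube has norm at most \<open>6 * \<epsilon>\<close>.\<close>
  define \<epsilon> where "\<epsilon> = \<delta> / 12"
  have \<epsilon>: "\<epsilon> > 0" using \<delta> by (simp add: \<epsilon>_def)
  define B where "B = cbox (-\<epsilon>, -\<epsilon>, -\<epsilon>) (\<epsilon>, \<epsilon>, \<epsilon> :: real)"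
  have inB: "(a, b, c) \<in> B \<longleftrightarrow> \<bar>a\<bar> \<le> \<epsilon> \<and> \<bar>b\<bar> \<le> \<epsilon> \<and> \<bar>c\<bar> \<le> \<epsilon>" for a b c
    by (auto simp: B_def cbox_Pair_eq)
  have BW: "B \<times> B \<subseteq> ball 0 \<delta>"
  proof
    fix p assume "p \<in> B \<times> B"
    then obtain a b c d e g where p: "p = ((a, b, c), (d, e, g))" "(a, b, c) \<in> B" "(d, e, g) \<in> B"
      by (metis mem_Times_iff prod.collapse)
    then have "norm p \<le> 6 * \<epsilon>" using norm_parameter_le[of a b c d e g] by (simp add: inB)
    then show "p \<in> ball 0 \<delta>" using \<delta> by (simp add: \<epsilon>_def)
  qed
  define K1 where "K1 = ln (inverse \<bar>l\<bar>) / ln \<bar>zP\<bar>"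
  have renorm: "\<exists>(\<Psi> :: nat \<Rightarrow> R3 \<Rightarrow> 'm) (\<mu> :: nat \<Rightarrow> real \<Rightarrow> R3) (\<nu> :: nat \<Rightarrow> R3) (m :: nat \<Rightarrow> nat) (n :: nat \<Rightarrow> nat).
          filterlim m at_top sequentially \<and> filterlim n at_top sequentially \<and>
          (\<forall>K. compact K \<and> 0 \<in> interior K \<longrightarrow>
            (\<forall>\<^sub>F k in sequentially. \<exists>\<Omega>. K \<subseteq> \<Omega> \<and> Cr_parametrization r \<A> (\<Psi> k) \<Omega>)) \<and>
          (\<forall>I. compact I \<and> 0 \<in> interior I \<longrightarrow>
            (\<forall>\<^sub>F k in sequentially.
               (\<exists>J. open J \<and> I \<subseteq> J \<and> Ck_on r (\<mu> k) J) \<and> \<mu> k ` I \<subseteq> B \<and> \<nu> k \<in> B)) \<and>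
          (\<forall>I L. compact I \<and> compact L \<longrightarrow>
            uniform_limit I \<mu> (\<lambda>_. 0) sequentially \<and> \<nu> \<longlonglongrightarrow> 0 \<and>
            (\<forall>V. open V \<and> ?p2 \<in> V \<longrightarrow> (\<forall>\<^sub>F k in sequentially. \<Psi> k ` L \<subseteq> V))) \<and>
          (\<exists>\<Phi> :: real \<times> R3 \<Rightarrow> R3. conjugate_families r \<Phi> (G_family \<xi> 0 0) \<and>
            (\<forall>I L. compact I \<and> compact L \<longrightarrow>
              (\<exists>K\<^sub>0. compact K\<^sub>0 \<and> (\<forall>K. compact K \<and> K\<^sub>0 \<subseteq> K \<longrightarrow>
                (\<forall>\<^sub>F k in sequentially. \<exists>U. open U \<and> I \<times> L \<subseteq> U \<and>
                   (\<forall>(\<mu>', x) \<in> U. x \<in> K \<and>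
                      (fam (\<mu> k \<mu>', \<nu> k) ^^ (N\<^sub>2 + m k + N\<^sub>1 + n k)) (\<Psi> k x) \<in> \<Psi> k ` K)) \<and>
                Cr_converges_on r
                  (\<lambda>k. renormalized fam K (\<Psi> k) (\<mu> k) (\<nu> k) (N\<^sub>2 + m k + N\<^sub>1 + n k))
                  \<Phi> (I \<times> L)))))"
    if \<xi>: "\<xi> > 0" for \<xi>
  proof -
    have lim_shift: "filterlim (\<lambda>k. k + j) at_top sequentially" for j :: nat
      by (rule filterlim_add_const_nat_at_top)
    \<comment> \<open>The unshifted sequences serve to find the index from which \<open>bb\<close> and \<open>d\<close> are nonzero.\<close>
    note inst = renormalization_exponents[OF eig ev0 _ lim_shift K1_def refl \<xi> be2 a3 b3 c2 smooth H2_zz]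
    interpret R0: renormalization q "\<lambda>k. real (k + 1)" "\<lambda>k. l ^ (k + 1)" "\<lambda>k. s ^ (k + 1)" "\<lambda>k. z ^ (k + 1)"
      "\<lambda>k. lP ^ nat \<lfloor>K1 * real (k + 1)\<rfloor>" "\<lambda>k. sP ^ nat \<lfloor>K1 * real (k + 1)\<rfloor>" "\<lambda>k. zP ^ nat \<lfloor>K1 * real (k + 1)\<rfloor>"
      \<xi> \<alpha>\<^sub>1 \<alpha>\<^sub>2 \<alpha>\<^sub>3 \<beta>\<^sub>1 \<beta>\<^sub>2 \<gamma>\<^sub>1 a\<^sub>1 a\<^sub>2 a\<^sub>3 b\<^sub>1 b\<^sub>2 b\<^sub>3 b\<^sub>4 c\<^sub>1 c\<^sub>2 Ht\<^sub>1 Ht\<^sub>2 Ht\<^sub>3 H\<^sub>1 H\<^sub>2 H\<^sub>3 2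
      by (rule inst(2)) auto
    obtain k0 where k0: "\<And>k. k \<ge> k0 \<Longrightarrow> R0.bb k \<noteq> 0 \<and> R0.d k \<noteq> 0"
      using R0.bb_d_eventually_nonzero by (auto simp: eventually_sequentially)
    define j where "j = k0 + 1"
    define n where "n = (\<lambda>k. k + j)"
    define m where "m = (\<lambda>k. nat \<lfloor>K1 * real (n k)\<rfloor>)"
    have base: "renormalization q (\<lambda>k. real (n k)) (\<lambda>k. l ^ n k) (\<lambda>k. s ^ n k) (\<lambda>k. z ^ n k)
      (\<lambda>k. lP ^ m k) (\<lambda>k. sP ^ m k) (\<lambda>k. zP ^ m k) \<xi> \<beta>\<^sub>2 a\<^sub>3 b\<^sub>3 c\<^sub>2 Ht\<^sub>1 Ht\<^sub>2 Ht\<^sub>3 H\<^sub>1 H\<^sub>2 H\<^sub>3 2"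
      unfolding m_def n_def by (rule inst(2)) (auto simp: j_def)
    have m_inf: "filterlim m at_top sequentially" unfolding m_def n_def by (rule inst(1)) (auto simp: j_def)
    have n_inf: "filterlim n at_top sequentially" unfolding n_def by (rule lim_shift)
    interpret R1: renormalization q "\<lambda>k. real (n k)" "\<lambda>k. l ^ n k" "\<lambda>k. s ^ n k" "\<lambda>k. z ^ n k"
      "\<lambda>k. lP ^ m k" "\<lambda>k. sP ^ m k" "\<lambda>k. zP ^ m k"
      \<xi> \<alpha>\<^sub>1 \<alpha>\<^sub>2 \<alpha>\<^sub>3 \<beta>\<^sub>1 \<beta>\<^sub>2 \<gamma>\<^sub>1 a\<^sub>1 a\<^sub>2 a\<^sub>3 b\<^sub>1 b\<^sub>2 b\<^sub>3 b\<^sub>4 c\<^sub>1 c\<^sub>2 Ht\<^sub>1 Ht\<^sub>2 Ht\<^sub>3 H\<^sub>1 H\<^sub>2 H\<^sub>3 2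
      by (rule base)
    have nk: "n k = (k + k0) + 1" for k by (simp add: n_def j_def)
    have bb: "R1.bb k = R0.bb (k + k0)" and dd: "R1.d k = R0.d (k + k0)" for k
      unfolding R1.bb_def R0.bb_def R1.e_def R0.e_def R1.C_def R0.C_def R1.d_def R0.d_def R1.c3_def R0.c3_def
      unfolding m_def nk by simp_all
    interpret R: renormalization_nondegenerate q "\<lambda>k. real (n k)" "\<lambda>k. l ^ n k" "\<lambda>k. s ^ n k" "\<lambda>k. z ^ n k"
      "\<lambda>k. lP ^ m k" "\<lambda>k. sP ^ m k" "\<lambda>k. zP ^ m k"
      \<xi> \<alpha>\<^sub>1 \<alpha>\<^sub>2 \<alpha>\<^sub>3 \<beta>\<^sub>1 \<beta>\<^sub>2 \<gamma>\<^sub>1 a\<^sub>1 a\<^sub>2 a\<^sub>3 b\<^sub>1 b\<^sub>2 b\<^sub>3 b\<^sub>4 c\<^sub>1 c\<^sub>2 Ht\<^sub>1 Ht\<^sub>2 Ht\<^sub>3 H\<^sub>1 H\<^sub>2 H\<^sub>3 2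
      by unfold_locales (use k0 bb dd in auto)
    have G12: "R.G1 = g1" "R.G2 = g2" by (auto simp: R.G1_def R.G2_def g1_def g2_def)
    define \<Psi> where "\<Psi> = (\<lambda>k v. chart_inv cQ (R.Psi k v))"
    define \<mu> where "\<mu> = (\<lambda>k t. (R1.c3 k, R.mu2 k t, R.nuY k))"
    define \<nu> where "\<nu> = (\<lambda>k. (R.nuZ k, R.nug k, R.nue k))"
    have Psi_lin: "Ck_on i (R.Psi k) UNIV" "Ck_on i (R.Psi_inv k) UNIV" for i k
      unfolding R.Psi_def[abs_def] R.Psi_inv_def[abs_def] divide_inverse
      by (intro Ck_on_Pair Ck_on_add Ck_on_diff Ck_on_mult Ck_on_const Ck_on_bounded_linear bounded_linear_fst
          bounded_linear_fst_comp bounded_linear_snd_comp bounded_linear_ident open_UNIV)+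
    have Psi_near: "\<forall>\<^sub>F k in sequentially. \<forall>v\<in>ball 0 \<rho>. dist (R.Psi k v) (1, 0, 1) < e" if "e > 0" for \<rho> e
    proof -
      have "\<forall>\<^sub>F k in sequentially. \<forall>x\<in>ball (0 :: real \<times> R3) \<rho>. dist (R.Psi k (snd x)) (1, 0, 1) < e"
        by (rule Cr_tends_eventually_dist[OF R.Psi_tends that])
      then show ?thesis
      proof eventually_elim
        case (elim k)
        show ?case
        proof
          fix v :: R3 assume "v \<in> ball 0 \<rho>"
          then have "(0 :: real, v) \<in> ball 0 \<rho>" by (simp add: norm_Pair)
          then show "dist (R.Psi k v) (1, 0, 1) < e" using elim by fastforce
        qed
      qed
    qed
    have p2im: "(1, 0, 1) \<in> snd cQ ` fst cQ" using in_charts(3) p2(2) by (metis imageI)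
    obtain e0 where e0: "e0 > 0" "ball (1, 0, 1) e0 \<subseteq> snd cQ ` fst cQ"
      using is_chartD(2)[OF charts(4)] p2im by (meson openE)
    have Psi_in: "\<forall>\<^sub>F k in sequentially. \<forall>v\<in>ball 0 \<rho>. R.Psi k v \<in> snd cQ ` fst cQ" for \<rho>
      using Psi_near[OF e0(1), of \<rho>] by eventually_elim (use e0(2) in \<open>auto simp: dist_commute subset_iff\<close>)
    have inj: "inj_on (\<Psi> k) S" if "\<forall>v\<in>S. R.Psi k v \<in> snd cQ ` fst cQ" for k S
    proof (rule inj_onI)
      fix v w assume "v \<in> S" "w \<in> S" "\<Psi> k v = \<Psi> k w"
      then have "R.Psi k v = R.Psi k w" using that is_chartD(4)[OF charts(4)] unfolding \<Psi>_def by metis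
      then show "v = w" using R.Psi_inverse(1) by metis
    qed
    have c3l: "R1.c3 \<longlonglongrightarrow> 0" by (rule R1.c3_lim)
    have \<mu>_lim: "uniform_limit I \<mu> (\<lambda>_. 0) sequentially" if I: "compact I" for I
    proof -
      obtain b where b: "b > 0" "\<And>t. t \<in> I \<Longrightarrow> \<bar>t\<bar> \<le> b"
        using compact_imp_bounded[OF I] by (auto simp: bounded_pos)
      define sm where "sm k = \<bar>R1.c3 k\<bar> + (\<bar>1 / s ^ n k - b\<^sub>1 * lP ^ m k * (1 + \<alpha>\<^sub>1 * l ^ n k + \<alpha>\<^sub>3 * z ^ n k)\<bar>
        + \<bar>R1.eta k ^ 2 * R1.bb k\<bar> * b) + \<bar>R.nuY k\<bar>" for k
      have "sm \<longlonglongrightarrow> \<bar>0\<bar> + (\<bar>0\<bar> + \<bar>0\<bar> * b) + \<bar>0\<bar>"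
        unfolding sm_def by (intro tendsto_intros c3l R.parameter_limits)
      then have sm: "sm \<longlonglongrightarrow> 0" by simp
      have le: "norm (\<mu> k t) \<le> sm k" if "t \<in> I" for k t
      proof -
        have "\<bar>R.mu2 k t\<bar> \<le> \<bar>1 / s ^ n k - b\<^sub>1 * lP ^ m k * (1 + \<alpha>\<^sub>1 * l ^ n k + \<alpha>\<^sub>3 * z ^ n k)\<bar>
          + \<bar>R1.eta k ^ 2 * R1.bb k\<bar> * \<bar>t\<bar>"
          unfolding R.mu2_def using abs_triangle_ineq by (simp add: abs_mult[symmetric])
        also have "\<dots> \<le> \<bar>1 / s ^ n k - b\<^sub>1 * lP ^ m k * (1 + \<alpha>\<^sub>1 * l ^ n k + \<alpha>\<^sub>3 * z ^ n k)\<bar>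
          + \<bar>R1.eta k ^ 2 * R1.bb k\<bar> * b" using b(2)[OF that] by (intro add_left_mono mult_left_mono) auto
        finally show ?thesis using norm_R3_le[of "\<mu> k t"] by (simp add: \<mu>_def sm_def)
      qed
      show ?thesis
      proof (rule uniform_limitI)
        fix e :: real assume "e > 0"
        then have "\<forall>\<^sub>F k in sequentially. sm k < e" using sm by (intro order_tendstoD) auto
        then show "\<forall>\<^sub>F k in sequentially. \<forall>t\<in>I. dist (\<mu> k t) 0 < e"
          by eventually_elim (use le in \<open>auto simp: dist_norm intro: le_less_trans\<close>)
      qed
    qed
    have \<nu>_lim: "\<nu> \<longlonglongrightarrow> 0"
      unfolding \<nu>_def zero_prod_def by (intro tendsto_Pair R.parameter_limits)
    have small: "\<forall>\<^sub>F k in sequentially. \<mu> k ` I \<subseteq> B \<and> \<nu> k \<in> B" if "compact I" for I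
    proof -
      have sB: "x \<in> B" if "dist x 0 < \<epsilon>" for x :: R3
        using that abs_component_le_norm[of x] inB[of "fst x" "fst (snd x)" "snd (snd x)"] by simp
      have "\<forall>\<^sub>F k in sequentially. \<forall>t\<in>I. dist (\<mu> k t) 0 < \<epsilon>" by (rule uniform_limitD[OF \<mu>_lim[OF that] \<epsilon>])
      moreover have "\<forall>\<^sub>F k in sequentially. dist (\<nu> k) 0 < \<epsilon>" by (rule tendstoD[OF \<nu>_lim \<epsilon>])
      ultimately show ?thesis by eventually_elim (use sB in \<open>blast\<close>)
    qed
    have return: "\<forall>\<^sub>F k in sequentially. \<forall>x\<in>ball 0 \<rho>.
        (fam (\<mu> k (fst x), \<nu> k) ^^ (N\<^sub>2 + pP * m k + N\<^sub>1 + pQ * n k)) (\<Psi> k (snd x)) = \<Psi> k (R.F k x)" for \<rho>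
    proof -
      have "\<forall>\<^sub>F k in sequentially. m k \<ge> n0" "\<forall>\<^sub>F k in sequentially. n k \<ge> n0"
        using m_inf n_inf by (auto simp: filterlim_at_top)
      moreover have "\<forall>\<^sub>F k in sequentially. \<mu> k ` cball 0 \<rho> \<subseteq> B \<and> \<nu> k \<in> B" by (rule small) simp
      moreover note Cr_tends_eventually_dist[OF R.Psi_tends \<delta>, of \<rho>] Cr_tends_eventually_dist[OF R.pp_tends \<delta>, of \<rho>]
        Cr_tends_eventually_dist[OF R.vv_tends \<delta>, of \<rho>] Cr_tends_eventually_dist[OF R.PP_tends \<delta>, of \<rho>]
      ultimately show ?thesis
      proof eventually_elim
        case (elim k)
        show ?case
        proof
          fix x :: "real \<times> R3" assume x: "x \<in> ball 0 \<rho>"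
          have "\<bar>fst x\<bar> \<le> norm x" using norm_fst_le[of "fst x" "snd x"] by simp
          then have "fst x \<in> cball 0 \<rho>" using x by simp
          then have par: "(\<mu> k (fst x), \<nu> k) \<in> ball 0 \<delta>" using elim(3) BW by blast
          let ?w = "R.Psi k (snd x)" and ?v = "R.vv k (snd x)"
          have dw: "diag3 l s z (n k) ?w = (0, 1, 0) + R.pp k (snd x)" by (simp add: diag3_def R.pp_def)
          have dv: "diag3 lP sP zP (m k) ?v = (0, 1, 1) + R.PP k (snd x)" by (simp add: diag3_def R.PP_def)
          have "(fam ((R1.c3 k, R.mu2 k (fst x), R.nuY k), (R.nuZ k, R.nug k, R.nue k)) ^^ (N\<^sub>2 + pP * m k + N\<^sub>1 + pQ * n k)) (chart_inv cQ ?w)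
              = chart_inv cQ (R.out k x) \<and> R.out k x \<in> snd cQ ` fst cQ"
          proof (rule orb[OF elim(1,2)])
            show "((R1.c3 k, R.mu2 k (fst x), R.nuY k), (R.nuZ k, R.nug k, R.nue k)) \<in> ball 0 \<delta>"
              using par by (simp add: \<mu>_def \<nu>_def)
            show "dist ?w (1, 0, 1) < \<delta>" using elim(4) x by blast
            show "dist (diag3 l s z (n k) ?w) (0, 1, 0) < \<delta>" using elim(5) x unfolding dw by (simp add: dist_norm)
            show "?v = (1, 0, 0) + g1 (diag3 l s z (n k) ?w - (0, 1, 0)) + (0, R.nuY k, R.nuZ k
                + R.nug k * (z ^ n k * snd (snd ?w)) + R.nue k * (s ^ n k * fst (snd ?w) - 1))"
              unfolding dw by (simp add: R.vv_def G12)
            show "dist ?v (1, 0, 0) < \<delta>" using elim(6) x by blast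
            show "dist (diag3 lP sP zP (m k) ?v) (0, 1, 1) < \<delta>" using elim(7) x unfolding dv by (simp add: dist_norm)
            show "R.out k x = (1, 0, 1) + g2 (diag3 lP sP zP (m k) ?v - (0, 1, 1))
                + (0, R.mu2 k (fst x), R1.c3 k * (zP ^ m k * snd (snd ?v) - 1))"
              unfolding dv by (simp add: R.out_def G12)
          qed
          then show "(fam (\<mu> k (fst x), \<nu> k) ^^ (N\<^sub>2 + pP * m k + N\<^sub>1 + pQ * n k)) (\<Psi> k (snd x)) = \<Psi> k (R.F k x)"
            by (simp add: \<Psi>_def \<mu>_def \<nu>_def R.Psi_F)
        qed
      qed
    qed
    have Ft: "Cr_tends r R.F R.limit_map" using R.F_tends by (simp add: q)
    show ?thesis
    proof (rule exI[of _ \<Psi>], rule exI[of _ \<mu>], rule exI[of _ \<nu>], rule exI[of _ "\<lambda>k. pP * m k"],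
        rule exI[of _ "\<lambda>k. pQ * n k"], intro conjI allI impI)
      have mult_inf: "filterlim (\<lambda>k. c * g k) at_top sequentially" if "c > 0" "filterlim g at_top sequentially" for c :: nat and g
        by (rule filterlim_at_top_mono[OF that(2)]) (use that(1) in auto)
      show "filterlim (\<lambda>k. pP * m k) at_top sequentially" by (rule mult_inf[OF pP(1) m_inf])
      show "filterlim (\<lambda>k. pQ * n k) at_top sequentially" by (rule mult_inf[OF pQ(1) n_inf])
    next
      fix K :: "R3 set" assume "compact K \<and> 0 \<in> interior K"
      then obtain \<rho> where \<rho>: "\<rho> > 0" "K \<subseteq> ball 0 \<rho>" using compact_imp_bounded bounded_subset_ball by metis
      show "\<forall>\<^sub>F k in sequentially. \<exists>\<Omega>. K \<subseteq> \<Omega> \<and> Cr_parametrization r \<A> (\<Psi> k) \<Omega>"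
        using Psi_in[of \<rho>]
      proof eventually_elim
        case (elim k)
        have "Cr_parametrization r \<A> (\<Psi> k) (ball 0 \<rho>)" unfolding \<Psi>_def
          by (rule chart_inv_parametrization[OF manifold charts(2) Psi_lin R.Psi_inverse open_ball])
            (use elim in blast)
        then show ?case using \<rho>(2) by blast
      qed
    next
      fix I :: "real set" assume I: "compact I \<and> 0 \<in> interior I"
      have "Ck_on r (\<mu> k) UNIV" for k
        unfolding \<mu>_def R.mu2_def by (intro Ck_on_Pair Ck_on_add Ck_on_mult Ck_on_const Ck_on_ident open_UNIV)
      then show "\<forall>\<^sub>F k in sequentially. (\<exists>J. open J \<and> I \<subseteq> J \<and> Ck_on r (\<mu> k) J) \<and> \<mu> k ` I \<subseteq> B \<and> \<nu> k \<in> B"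
        using small[OF conjunct1[OF I]] by (auto elim!: eventually_mono intro!: exI[of _ UNIV])
    next
      fix I :: "real set" and L :: "R3 set" assume IL: "compact I \<and> compact L"
      show "uniform_limit I \<mu> (\<lambda>_. 0) sequentially" using \<mu>_lim IL by blast
      show "\<nu> \<longlonglongrightarrow> 0" by (rule \<nu>_lim)
      fix V assume V: "open V \<and> ?p2 \<in> V"
      obtain \<rho> where \<rho>: "\<rho> > 0" "L \<subseteq> ball 0 \<rho>" using IL compact_imp_bounded bounded_subset_ball by metis
      have "chart_inv cQ (1, 0, 1) \<in> V" using V is_chartD(3)[OF charts(4) in_charts(3)] p2(2) by simp
      then have "\<forall>\<^sub>F u in nhds (1, 0, 1). chart_inv cQ u \<in> V"
        using V by (intro isCont_eventually_in[OF is_chart_isCont(2)[OF charts(4) p2im]]) auto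
      then obtain e where e: "e > 0" "\<And>u. dist u (1, 0, 1) < e \<Longrightarrow> chart_inv cQ u \<in> V"
        unfolding eventually_nhds_metric by blast
      show "\<forall>\<^sub>F k in sequentially. \<Psi> k ` L \<subseteq> V"
        using Psi_near[OF e(1), of \<rho>]
        by eventually_elim (unfold \<Psi>_def, use \<rho>(2) e(2) in blast)
    next
      have G: "R.limit_map (t, x) = G_family \<xi> 0 0 t x" for t x
        by (simp add: R.limit_map_def G_family_def split_beta)
      have conj: "conjugate_families r R.limit_map (G_family \<xi> 0 0)"
        unfolding conjugate_families_def
        by (rule exI[of _ "\<lambda>x. x"], rule exI[of _ "\<lambda>x. x"]) (simp add: Cr_diffeo_id G)
      show "\<exists>\<Phi> :: real \<times> R3 \<Rightarrow> R3. conjugate_families r \<Phi> (G_family \<xi> 0 0) \<and>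
            (\<forall>I L. compact I \<and> compact L \<longrightarrow>
              (\<exists>K\<^sub>0. compact K\<^sub>0 \<and> (\<forall>K. compact K \<and> K\<^sub>0 \<subseteq> K \<longrightarrow>
                (\<forall>\<^sub>F k in sequentially. \<exists>U. open U \<and> I \<times> L \<subseteq> U \<and>
                   (\<forall>(\<mu>', x) \<in> U. x \<in> K \<and>
                      (fam (\<mu> k \<mu>', \<nu> k) ^^ (N\<^sub>2 + pP * m k + N\<^sub>1 + pQ * n k)) (\<Psi> k x) \<in> \<Psi> k ` K)) \<and>
                Cr_converges_on r
                  (\<lambda>k. renormalized fam K (\<Psi> k) (\<mu> k) (\<nu> k) (N\<^sub>2 + pP * m k + N\<^sub>1 + pQ * n k))
                  \<Phi> (I \<times> L))))"
      proof (rule exI[of _ R.limit_map], intro conjI conj allI impI)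
        fix I :: "real set" and L :: "R3 set" assume IL: "compact I \<and> compact L"
        then have "bounded (I \<times> L)" by (intro compact_imp_bounded compact_Times) auto
        then obtain \<rho> where \<rho>: "\<rho> > 0" "I \<times> L \<subseteq> ball 0 \<rho>" by (rule bounded_subset_ball)
        have "bounded (R.limit_map ` ball 0 \<rho>)" by (rule loc_unif_bounded[OF Cr_tends_loc_unif[OF Ft]])
        then obtain b where b: "b > 0" "R.limit_map ` ball 0 \<rho> \<subseteq> ball 0 b" by (rule bounded_subset_ball)
        \<comment> \<open>A ball that contains the arguments and, up to an error \<open>1\<close>, the values of the limit.\<close>
        define K0 where "K0 = cball (0 :: R3) (\<rho> + b + 1)"
        have F_in: "\<forall>\<^sub>F k in sequentially. \<forall>x\<in>ball 0 \<rho>. snd x \<in> K0 \<and> R.F k x \<in> K0"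
          using Cr_tends_eventually_dist[OF Ft zero_less_one, of \<rho>]
        proof eventually_elim
          case (elim k)
          show ?case
          proof
            fix x :: "real \<times> R3" assume x: "x \<in> ball 0 \<rho>"
            have "norm (snd x) \<le> norm x" using norm_snd_le[of "snd x" "fst x"] by simp
            moreover have "norm (R.limit_map x) < b" using b(2) x by force
            moreover have "dist (R.F k x) (R.limit_map x) < 1" using elim x by blast
            ultimately show "snd x \<in> K0 \<and> R.F k x \<in> K0"
              using x \<rho>(1) b(1) norm_triangle_sub[of "R.F k x" "R.limit_map x"] by (simp add: K0_def dist_norm)
          qed
        qed
        show "\<exists>K\<^sub>0. compact K\<^sub>0 \<and> (\<forall>K. compact K \<and> K\<^sub>0 \<subseteq> K \<longrightarrow>
                (\<forall>\<^sub>F k in sequentially. \<exists>U. open U \<and> I \<times> L \<subseteq> U \<and>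
                   (\<forall>(\<mu>', x) \<in> U. x \<in> K \<and>
                      (fam (\<mu> k \<mu>', \<nu> k) ^^ (N\<^sub>2 + pP * m k + N\<^sub>1 + pQ * n k)) (\<Psi> k x) \<in> \<Psi> k ` K)) \<and>
                Cr_converges_on r
                  (\<lambda>k. renormalized fam K (\<Psi> k) (\<mu> k) (\<nu> k) (N\<^sub>2 + pP * m k + N\<^sub>1 + pQ * n k))
                  R.limit_map (I \<times> L))"
        proof (rule exI[of _ K0], intro conjI allI impI)
          show "compact K0" by (simp add: K0_def)
          fix K assume K: "compact K \<and> K0 \<subseteq> K"
          show "\<forall>\<^sub>F k in sequentially. \<exists>U. open U \<and> I \<times> L \<subseteq> U \<and>
                   (\<forall>(\<mu>', x) \<in> U. x \<in> K \<and>
                      (fam (\<mu> k \<mu>', \<nu> k) ^^ (N\<^sub>2 + pP * m k + N\<^sub>1 + pQ * n k)) (\<Psi> k x) \<in> \<Psi> k ` K)"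
            using F_in return[of \<rho>]
          proof eventually_elim
            case (elim k)
            have "x \<in> K \<and> (fam (\<mu> k \<mu>', \<nu> k) ^^ (N\<^sub>2 + pP * m k + N\<^sub>1 + pQ * n k)) (\<Psi> k x) \<in> \<Psi> k ` K"
              if "(\<mu>', x) \<in> ball 0 \<rho>" for \<mu>' x
              using elim(1)[rule_format, OF that] elim(2)[rule_format, OF that] K by auto
            then show ?case using \<rho>(2) by (intro exI[of _ "ball 0 \<rho>"]) auto
          qed
          obtain \<rho>' where \<rho>': "\<rho>' > 0" "K \<subseteq> ball 0 \<rho>'" using K compact_imp_bounded bounded_subset_ball by metis
          show "Cr_converges_on r
                  (\<lambda>k. renormalized fam K (\<Psi> k) (\<mu> k) (\<nu> k) (N\<^sub>2 + pP * m k + N\<^sub>1 + pQ * n k))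
                  R.limit_map (I \<times> L)"
          proof (rule Cr_converges_onI[OF Ft _ \<rho>(2)])
            show "\<forall>\<^sub>F k in sequentially. \<forall>x\<in>ball 0 \<rho>. R.F k x =
                renormalized fam K (\<Psi> k) (\<mu> k) (\<nu> k) (N\<^sub>2 + pP * m k + N\<^sub>1 + pQ * n k) x"
              using F_in return[of \<rho>] Psi_in[of \<rho>']
            proof eventually_elim
              case (elim k)
              have injK: "inj_on (\<Psi> k) K" by (rule inj) (use elim(3) \<rho>'(2) in blast)
              show ?case
              proof
                fix x :: "real \<times> R3" assume x: "x \<in> ball 0 \<rho>"
                have "R.F k x \<in> K" using elim(1) x K by blast
                from inv_into_f_f[OF injK this]
                show "R.F k x = renormalized fam K (\<Psi> k) (\<mu> k) (\<nu> k) (N\<^sub>2 + pP * m k + N\<^sub>1 + pQ * n k) x"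
                  using elim(2)[rule_format, OF x] by (simp add: renormalized_def split_beta)
              qed
            qed
          qed
        qed
      qed
    qed
  qed
  have famB: "\<forall>p \<in> B \<times> B. fam p \<in> Diff r \<A>" using famD BW by blast
  have famW: "\<exists>W. open W \<and> B \<times> B \<subseteq> W \<and> Cr_family r \<A> W fam"
  proof (rule exI[of _ "ball 0 \<delta>"], intro conjI open_ball BW)
    show "Cr_family r \<A> (ball 0 \<delta>) fam"
      by (rule smooth_family_imp_Cr_family[OF manifold open_ball]) (rule famS)
  qed
  have fam00: "fam (0, 0) = f" using fam0 by (simp add: zero_prod_def)
  show ?thesis
    unfolding Let_def
  proof (rule exI[of _ 0], rule exI[of _ 0], rule exI[of _ \<epsilon>], rule conjI[OF \<epsilon>], rule exI[of _ fam],
      fold B_def, intro conjI famB famW fam00 allI impI)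
  qed (erule renorm)
qed

end
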